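(* Let $q\ge 2$ be an integer, let $\mathcal{G}$ be a geometrically finite, asymptotically $(q+1)$-regular graph of groups with adjacency operator $A$, and let $\mu_0\in\mathbb{C}^\times$ be a resonance of $\mathcal{G}$. Put $z(\mu)=\frac{\mu+\mu^{-1}}{2}$. If $\mu_0\ne\pm1$, then $$\mathrm{grst}(\mathcal{G},\mu_0)=\Big\{u \text{ purely outgoing of parameter }\mu_0 \;:\; \exists\, J\in\mathbb{N}\text{ such that }\Big(\frac{A}{2\sqrt q}-z(\mu_0)\Big)^J u=0\Big\}.$$ If $\mu_0=\pm1$, then $$\mathrm{grst}(\mathcal{G},\mu_0)=\Big\{u \text{ purely outgoing of parameter }\mu_0\text{ of constant type} \;:\; \Big(\frac{A}{2\sqrt q}-z(\mu_0)\Big) u=0\Big\}.$$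
   Context: A graph of groups $\mathcal{G}$ consists of a connected, locally finite graph with countable vertex set $\mathcal{V}$ and edge set $\mathcal{E}$ (loops and multiple edges allowed), finite groups $G_v$ ($v\in\mathcal{V}$) and $G_e$ ($e\in\mathcal{E}$), and for each oriented edge $\vec e$ (every edge, including a loop, has two orientations; $\vec e$ has origin $o(\vec e)$ and terminus $t(\vec e)$) a monomorphism $G_e\hookrightarrow G_{t(\vec e)}$. Put $\mathcal{S}(v)=|G_v|$, $\mathcal{S}(e)=|G_e|$. The degree of $v$ is $\deg(v)=\sum_{\vec e: t(\vec e)=v}\mathcal{S}(v)/\mathcal{S}(e)$. A graph of groups with boundary may in addition have half-edges ("prongs") $h$ emanating from a vertex $v$, with a group $G_h$ and a monomorphism $G_h\hookrightarrow G_v$; prongs are counted in the degree. Cutting an edge replaces it by a prong at each of its two endpoints. An orbifold funnel is a graph of groups with boundary whose underlying graph is a locally finite rooted tree with root $o$, with one prong $h$ emanating from $o$, such that $G_o=G_h$ and $G_v=G_{\{v,w\}}\le G_w$ whenever $\{v,w\}$ is an edge with $w$ closer to $o$ than $v$. A cusp is a graph of groups with boundary whose underlying graph is a ray with vertices $0,1,2,\dots$, with one prong emanating from the root $0$, such that $G_i=G_{\{i,i+1\}}$ for all $i\ge 0$. $\mathcal{G}$ is geometrically finite and asymptotically $(q+1)$-regular if it can be cut along finitely many edges into finitely many pieces: one finite graph of groups with boundary (the compact core $\mathcal{L}$, not necessarily $(q+1)$-regular), and the rest either orbifold funnels or cusps all of whose vertices have degree $q+1$. Such a decomposition is fixed.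 $A$ acts on functions $f:\mathcal{V}\to\mathbb{C}$ by $Af(v)=\sum_{\vec e:t(\vec e)=v}\frac{\mathcal{S}(v)}{\mathcal{S}(e)}f(o(\vec e))$. $\ell^2(\mathcal{V})=\{f:\sum_v|f(v)|^2/\mathcal{S}(v)<\infty\}$ and, for $\rho:\mathcal{V}\to\mathbb{R}_+$, $\rho\,\ell^2(\mathcal{V})=\{f:\sum_v|f(v)|^2/(\rho(v)^2\mathcal{S}(v))<\infty\}$. $d$ is the path distance in the underlying graph; $o$ is a base point in $\mathcal{L}$. For $|\mu|$ large, $R_{\mathcal{G}}(\mu)=(\frac{A}{2\sqrt q}-z(\mu))^{-1}$ on $\ell^2(\mathcal{V})$. For every $N\ge0$ it continues, from large $|\mu|$, to a finitely meromorphic family (i.e. meromorphic with finite-rank coefficients at negative powers) of operators $q^{-Nd(o,\cdot)}\ell^2(\mathcal{V})\to q^{Nd(o,\cdot)}\ell^2(\mathcal{V})$ on $|\mu|>q^{1/2-N}$, and these are compatible for different $N$. A resonance is a pole $\mu_0\in\mathbb{C}^\times$ of this continuation. Writing $R_{\mathcal{G}}(\mu)=\sum_{j=1}^J\frac{A_{-j}}{(\mu-\mu_0)^j}+R_{\mathrm{hol}}(\mu)$ near $\mu_0$ with $R_{\mathrm{hol}}$ holomorphic, the space of generalized resonant states is $\mathrm{grst}(\mathcal{G},\mu_0)=\mathrm{span}(\mathrm{im}A_{-1}\cup\dots\cup\mathrm{im}A_{-J})$ (the images of finitely supported functions and of $q^{-Nd(o,\cdot)}\ell^2$ coincide). Let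 $\mathcal{H}$ be a finite connected subgraph of $\mathcal{G}$ containing $\mathcal{L}$, so that $\mathcal{G}\setminus\mathcal{H}$ is a disjoint union of finitely many cusps $\mathcal{C}_i$ and (orbifold) funnels $\mathcal{F}_j$. A function $f:\mathcal{V}\to\mathbb{C}$ is purely outgoing of parameter $\mu$ and exceptional locus $\mathcal{H}$ if on each $\mathcal{C}_i$ there is a one-variable polynomial $p_{\mathcal{C}_i}$ with $f(v)=p_{\mathcal{C}_i}(d(o,v))(\sqrt q/\mu)^{d(o,v)}$ for $v\in\mathcal{C}_i$, and on each $\mathcal{F}_j$ there is a polynomial $p_{\mathcal{F}_j}$ with $f(v)=p_{\mathcal{F}_j}(d(o,v))(\mu\sqrt q)^{-d(o,v)}$ for $v\in\mathcal{F}_j$ (the condition does not depend on the choice of $o\in\mathcal{L}$). It is purely outgoing of parameter $\mu$ if this holds for some $\mathcal{H}$, and of constant type if all these polynomials are constants. *)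

theory Defs
  imports
    "HOL-Analysis.Analysis"
    "HOL-Algebra.Coset"
    "HOL-Library.Function_Algebras"
    "Graph_Theory.Digraph_Component"
begin

section \<open>Graphs of groups with boundary\<close>

text \<open>
  The elements of \<open>arcs\<close> are the oriented edges, \<open>tail\<close> and \<open>head\<close> are origin and terminus, and
  \<open>opp\<close> reverses the orientation.  A prong is an oriented edge without a reverse: it is attached
  to its \<open>head\<close>, its \<open>tail\<close> has no meaning.  Hence cutting an edge just moves its two
  orientations from \<open>arcs\<close> to \<open>prongs\<close>.
\<close>

record ('v, 'e, 'g, 'h) gog =
  ugraph :: "('v, 'e) pre_digraph"
  opp :: "'e \<Rightarrow> 'e"
  prongs :: "'e set"
  vgrp :: "'v \<Rightarrow> 'g monoid"
  egrp :: "'e \<Rightarrow> 'h monoid"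
  emb :: "'e \<Rightarrow> 'h \<Rightarrow> 'g"

abbreviation gverts :: "('v, 'e, 'g, 'h) gog \<Rightarrow> 'v set" where
  "gverts G \<equiv> verts (ugraph G)"

abbreviation garcs :: "('v, 'e, 'g, 'h) gog \<Rightarrow> 'e set" where
  "garcs G \<equiv> arcs (ugraph G)"

abbreviation org :: "('v, 'e, 'g, 'h) gog \<Rightarrow> 'e \<Rightarrow> 'v" where
  "org G \<equiv> tail (ugraph G)"

abbreviation ter :: "('v, 'e, 'g, 'h) gog \<Rightarrow> 'e \<Rightarrow> 'v" where
  "ter G \<equiv> head (ugraph G)"

text \<open>
  Since \<open>arcs\<close> is closed under reversal, strong connectedness is connectedness of the underlying
  undirected graph.
\<close>

locale graph_of_groups_with_boundary =
  fixes G :: "('v, 'e, 'g, 'h) gog"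
  assumes wf_ugraph: "wf_digraph (ugraph G)"
    and connected_ugraph: "strongly_connected (ugraph G)"
    and countable_verts: "countable (gverts G)"
    and prongs_disjoint: "prongs G \<inter> garcs G = {}"
    and prongs_attached: "h \<in> prongs G \<Longrightarrow> ter G h \<in> gverts G"
    and locally_finite: "v \<in> gverts G \<Longrightarrow> finite {e \<in> garcs G \<union> prongs G. ter G e = v}"
    and opp_in_arcs: "e \<in> garcs G \<Longrightarrow> opp G e \<in> garcs G"
    and opp_opp: "e \<in> garcs G \<Longrightarrow> opp G (opp G e) = e"
    and opp_neq: "e \<in> garcs G \<Longrightarrow> opp G e \<noteq> e"
    and org_opp: "e \<in> garcs G \<Longrightarrow> org G (opp G e) = ter G e"
    and vgrp_group: "v \<in> gverts G \<Longrightarrow> group (vgrp G v)"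
    and vgrp_finite: "v \<in> gverts G \<Longrightarrow> finite (carrier (vgrp G v))"
    and egrp_group: "e \<in> garcs G \<union> prongs G \<Longrightarrow> group (egrp G e)"
    and egrp_finite: "e \<in> garcs G \<union> prongs G \<Longrightarrow> finite (carrier (egrp G e))"
    and egrp_opp: "e \<in> garcs G \<Longrightarrow> egrp G (opp G e) = egrp G e"
    and emb_mon: "e \<in> garcs G \<union> prongs G \<Longrightarrow> emb G e \<in> mon (egrp G e) (vgrp G (ter G e))"

locale graph_of_groups = graph_of_groups_with_boundary +
  assumes no_prongs: "prongs G = {}"

definition vsize :: "('v, 'e, 'g, 'h) gog \<Rightarrow> 'v \<Rightarrow> nat" where
  "vsize G v = card (carrier (vgrp G v))"

definition esize :: "('v, 'e, 'g, 'h) gog \<Rightarrow> 'e \<Rightarrow> nat" where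
  "esize G e = card (carrier (egrp G e))"

definition gog_degree :: "('v, 'e, 'g, 'h) gog \<Rightarrow> 'v \<Rightarrow> real" where
  "gog_degree G v =
     (\<Sum>e\<in>{e \<in> garcs G \<union> prongs G. ter G e = v}. real (vsize G v) / real (esize G e))"

definition gdist :: "('v, 'e, 'g, 'h) gog \<Rightarrow> 'v \<Rightarrow> 'v \<Rightarrow> nat" where
  "gdist G u v = (LEAST n. \<exists>p. pre_digraph.awalk (ugraph G) u p v \<and> length p = n)"


section \<open>Cutting, funnels and cusps\<close>

definition cut :: "('v, 'e, 'g, 'h) gog \<Rightarrow> 'e set \<Rightarrow> ('v, 'e, 'g, 'h) gog" where
  "cut G F = G\<lparr>ugraph := (ugraph G)\<lparr>arcs := garcs G - F\<rparr>, prongs := prongs G \<union> F\<rparr>"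

definition restrict_gog :: "('v, 'e, 'g, 'h) gog \<Rightarrow> 'v set \<Rightarrow> ('v, 'e, 'g, 'h) gog" where
  "restrict_gog G X =
     G\<lparr>ugraph := induce_subgraph (ugraph G) X, prongs := {h \<in> prongs G. ter G h \<in> X}\<rparr>"

text \<open>The pieces into which \<open>G\<close> falls when cut along the edges in \<open>F\<close>; \<open>F\<close> is meant to contain
  both orientations of each of its edges.\<close>

definition pieces :: "('v, 'e, 'g, 'h) gog \<Rightarrow> 'e set \<Rightarrow> ('v, 'e, 'g, 'h) gog set" where
  "pieces G F = restrict_gog (cut G F) ` pre_digraph.sccs_verts (ugraph (cut G F))"

text \<open>An undirected edge traversed back and forth is a \<open>cycle\<close> of the directed graph, and the only
  kind of cycle that a tree has.\<close>

definition tree_gog :: "('v, 'e, 'g, 'h) gog \<Rightarrow> bool" where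
  "tree_gog G \<longleftrightarrow> strongly_connected (ugraph G) \<and>
     (\<forall>p. pre_digraph.cycle (ugraph G) p \<longrightarrow> (\<exists>e. p = [e, opp G e]))"

text \<open>Equality of an edge or prong group with a vertex group means that the structural
  monomorphism between them is an isomorphism.\<close>

definition orbifold_funnel :: "('v, 'e, 'g, 'h) gog \<Rightarrow> bool" where
  "orbifold_funnel P \<longleftrightarrow> graph_of_groups_with_boundary P \<and> tree_gog P \<and>
     (\<exists>r h. r \<in> gverts P \<and> prongs P = {h} \<and> ter P h = r \<and>
        emb P h \<in> iso (egrp P h) (vgrp P r) \<and>
        (\<forall>e\<in>garcs P. gdist P r (org P e) < gdist P r (ter P e) \<longrightarrow>
           emb P e \<in> iso (egrp P e) (vgrp P (ter P e))))"

text \<open>\<open>r i\<close> is the \<open>i\<close>-th vertex of the ray and \<open>a i\<close> the edge from \<open>r i\<close> to \<open>r (i + 1)\<close>.\<close>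

definition cusp :: "('v, 'e, 'g, 'h) gog \<Rightarrow> bool" where
  "cusp P \<longleftrightarrow> graph_of_groups_with_boundary P \<and>
     (\<exists>(r :: nat \<Rightarrow> 'v) (a :: nat \<Rightarrow> 'e) h.
        bij_betw r UNIV (gverts P) \<and>
        garcs P = range a \<union> range (\<lambda>i. opp P (a i)) \<and>
        (\<forall>i. org P (a i) = r i \<and> ter P (a i) = r (Suc i)) \<and>
        prongs P = {h} \<and> ter P h = r 0 \<and>
        (\<forall>i. emb P (opp P (a i)) \<in> iso (egrp P (opp P (a i))) (vgrp P (r i))))"

text \<open>\<open>G\<close> is geometrically finite and asymptotically \<open>(q + 1)\<close>-regular, with compact core \<open>L\<close>, by
  cutting along \<open>F\<close>.\<close>

definition gf_decomposition ::
    "('v, 'e, 'g, 'h) gog \<Rightarrow> nat \<Rightarrow> 'e set \<Rightarrow> ('v, 'e, 'g, 'h) gog \<Rightarrow> bool" where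
  "gf_decomposition G q F L \<longleftrightarrow> graph_of_groups G \<and>
     F \<subseteq> garcs G \<and> finite F \<and> (\<forall>e\<in>F. opp G e \<in> F) \<and> finite (pieces G F) \<and>
     L \<in> pieces G F \<and> finite (gverts L) \<and>
     (\<forall>P\<in>pieces G F - {L}.
        (orbifold_funnel P \<or> cusp P) \<and> (\<forall>v\<in>gverts P. gog_degree P v = real q + 1))"


section \<open>The adjacency operator and weighted \<open>\<ell>\<^sup>2\<close> spaces\<close>

text \<open>A function on the vertex set is represented by a function on the whole type that vanishes
  off the vertex set.\<close>

definition vfuns :: "('v, 'e, 'g, 'h) gog \<Rightarrow> ('v \<Rightarrow> complex) set" where
  "vfuns G = {f. \<forall>v. v \<notin> gverts G \<longrightarrow> f v = 0}"

definition adjacency :: "('v, 'e, 'g, 'h) gog \<Rightarrow> ('v \<Rightarrow> complex) \<Rightarrow> 'v \<Rightarrow> complex" where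
  "adjacency G f v =
     (\<Sum>e\<in>{e \<in> garcs G. ter G e = v}. of_real (real (vsize G v) / real (esize G e)) * f (org G e))"

definition zpar :: "complex \<Rightarrow> complex" where
  "zpar \<mu> = (\<mu> + inverse \<mu>) / 2"

definition shifted_adjacency ::
    "('v, 'e, 'g, 'h) gog \<Rightarrow> nat \<Rightarrow> complex \<Rightarrow> ('v \<Rightarrow> complex) \<Rightarrow> 'v \<Rightarrow> complex" where
  "shifted_adjacency G q \<mu> f = (\<lambda>v. adjacency G f v / of_real (2 * sqrt (real q)) - zpar \<mu> * f v)"

text \<open>\<open>wl2 G \<rho>\<close> is \<open>\<rho> \<ell>\<^sup>2(\<V>)\<close>.\<close>

definition wl2 :: "('v, 'e, 'g, 'h) gog \<Rightarrow> ('v \<Rightarrow> real) \<Rightarrow> ('v \<Rightarrow> complex) set" where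
  "wl2 G \<rho> = {f \<in> vfuns G.
     (\<lambda>v. (cmod (f v))\<^sup>2 / ((\<rho> v)\<^sup>2 * real (vsize G v))) summable_on gverts G}"

definition wl2_norm ::
    "('v, 'e, 'g, 'h) gog \<Rightarrow> ('v \<Rightarrow> real) \<Rightarrow> ('v \<Rightarrow> complex) \<Rightarrow> real" where
  "wl2_norm G \<rho> f =
     sqrt (\<Sum>\<^sub>\<infinity>v\<in>gverts G. (cmod (f v))\<^sup>2 / ((\<rho> v)\<^sup>2 * real (vsize G v)))"

abbreviation l2 :: "('v, 'e, 'g, 'h) gog \<Rightarrow> ('v \<Rightarrow> complex) set" where
  "l2 G \<equiv> wl2 G (\<lambda>_. 1)"

definition dist_weight ::
    "('v, 'e, 'g, 'h) gog \<Rightarrow> nat \<Rightarrow> 'v \<Rightarrow> real \<Rightarrow> 'v \<Rightarrow> real" where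
  "dist_weight G q x0 N v = real q powr (N * real (gdist G x0 v))"

text \<open>The complex vector space of functions, for spans and finite rank.\<close>

interpretation cfun: vector_space "\<lambda>(c::complex) (f::'v \<Rightarrow> complex) v. c * f v"
  by unfold_locales (auto simp: fun_eq_iff algebra_simps)


section \<open>Finitely meromorphic families of operators\<close>

text \<open>Operators \<open>wl2 G \<rho> \<rightarrow> wl2 G \<sigma>\<close> are functions on all of \<open>'v \<Rightarrow> complex\<close> whose values
  outside \<open>wl2 G \<rho>\<close> are ignored.\<close>

definition bounded_op ::
    "('v, 'e, 'g, 'h) gog \<Rightarrow> ('v \<Rightarrow> real) \<Rightarrow> ('v \<Rightarrow> real) \<Rightarrow>
     (('v \<Rightarrow> complex) \<Rightarrow> 'v \<Rightarrow> complex) \<Rightarrow> bool" where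
  "bounded_op G \<rho> \<sigma> T \<longleftrightarrow>
     (\<forall>f\<in>wl2 G \<rho>. T f \<in> wl2 G \<sigma>) \<and>
     (\<forall>f\<in>wl2 G \<rho>. \<forall>g\<in>wl2 G \<rho>. T (\<lambda>v. f v + g v) = (\<lambda>v. T f v + T g v)) \<and>
     (\<forall>c. \<forall>f\<in>wl2 G \<rho>. T (\<lambda>v. c * f v) = (\<lambda>v. c * T f v)) \<and>
     (\<exists>C. \<forall>f\<in>wl2 G \<rho>. wl2_norm G \<sigma> (T f) \<le> C * wl2_norm G \<rho> f)"

definition finite_rank_op ::
    "('v, 'e, 'g, 'h) gog \<Rightarrow> ('v \<Rightarrow> real) \<Rightarrow> ('v \<Rightarrow> real) \<Rightarrow>
     (('v \<Rightarrow> complex) \<Rightarrow> 'v \<Rightarrow> complex) \<Rightarrow> bool" where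
  "finite_rank_op G \<rho> \<sigma> T \<longleftrightarrow>
     bounded_op G \<rho> \<sigma> T \<and> (\<exists>B. finite B \<and> T ` wl2 G \<rho> \<subseteq> cfun.span B)"

text \<open>Complex differentiability in operator norm, for open \<open>\<Omega>\<close>.\<close>

definition holomorphic_ops ::
    "('v, 'e, 'g, 'h) gog \<Rightarrow> ('v \<Rightarrow> real) \<Rightarrow> ('v \<Rightarrow> real) \<Rightarrow> complex set \<Rightarrow>
     (complex \<Rightarrow> ('v \<Rightarrow> complex) \<Rightarrow> 'v \<Rightarrow> complex) \<Rightarrow> bool" where
  "holomorphic_ops G \<rho> \<sigma> \<Omega> T \<longleftrightarrow>
     (\<forall>\<mu>\<in>\<Omega>. bounded_op G \<rho> \<sigma> (T \<mu>)) \<and>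
     (\<forall>\<mu>\<in>\<Omega>. \<exists>D. bounded_op G \<rho> \<sigma> D \<and>
        (\<forall>\<epsilon>>0. \<exists>\<delta>>0. \<forall>\<nu>\<in>\<Omega>. cmod (\<nu> - \<mu>) < \<delta> \<longrightarrow>
           (\<forall>f\<in>wl2 G \<rho>.
              wl2_norm G \<sigma> (\<lambda>v. T \<nu> f v - T \<mu> f v - (\<nu> - \<mu>) * D f v)
                \<le> \<epsilon> * cmod (\<nu> - \<mu>) * wl2_norm G \<rho> f)))"

text \<open>\<open>T \<mu> = \<Sum>j=1..J. C j / (\<mu> - \<mu>\<^sub>0)^j + R \<mu>\<close> near \<open>\<mu>\<^sub>0\<close>, with finite-rank \<open>C j\<close> and holomorphic
  \<open>R\<close>.  The value of \<open>T\<close> at \<open>\<mu>\<^sub>0\<close> itself plays no role.\<close>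

definition laurent_ops ::
    "('v, 'e, 'g, 'h) gog \<Rightarrow> ('v \<Rightarrow> real) \<Rightarrow> ('v \<Rightarrow> real) \<Rightarrow>
     (complex \<Rightarrow> ('v \<Rightarrow> complex) \<Rightarrow> 'v \<Rightarrow> complex) \<Rightarrow> complex \<Rightarrow>
     nat \<Rightarrow> (nat \<Rightarrow> ('v \<Rightarrow> complex) \<Rightarrow> 'v \<Rightarrow> complex) \<Rightarrow> bool" where
  "laurent_ops G \<rho> \<sigma> T \<mu>\<^sub>0 J C \<longleftrightarrow>
     (\<forall>j\<in>{1..J}. finite_rank_op G \<rho> \<sigma> (C j)) \<and>
     (\<exists>r>0. \<exists>R. holomorphic_ops G \<rho> \<sigma> (ball \<mu>\<^sub>0 r) R \<and>
        (\<forall>\<mu>\<in>ball \<mu>\<^sub>0 r - {\<mu>\<^sub>0}. \<forall>f\<in>wl2 G \<rho>.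
           T \<mu> f = (\<lambda>v. (\<Sum>j=1..J. C j f v / (\<mu> - \<mu>\<^sub>0) ^ j) + R \<mu> f v)))"

definition finitely_meromorphic ::
    "('v, 'e, 'g, 'h) gog \<Rightarrow> ('v \<Rightarrow> real) \<Rightarrow> ('v \<Rightarrow> real) \<Rightarrow> complex set \<Rightarrow>
     (complex \<Rightarrow> ('v \<Rightarrow> complex) \<Rightarrow> 'v \<Rightarrow> complex) \<Rightarrow> bool" where
  "finitely_meromorphic G \<rho> \<sigma> \<Omega> T \<longleftrightarrow> (\<forall>\<mu>\<in>\<Omega>. \<exists>J C. laurent_ops G \<rho> \<sigma> T \<mu> J C)"


section \<open>Resonances and generalized resonant states\<close>

definition cont_domain :: "nat \<Rightarrow> real \<Rightarrow> complex set" where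
  "cont_domain q N = {\<mu>. cmod \<mu> > real q powr (1/2 - N)}"

text \<open>\<open>T\<close> is the meromorphic continuation of the resolvent to \<open>cont_domain q N\<close>, which is
  connected, so that \<open>T\<close> is unique off its poles and removable singularities.\<close>

definition resolvent_continuation ::
    "('v, 'e, 'g, 'h) gog \<Rightarrow> nat \<Rightarrow> 'v \<Rightarrow> real \<Rightarrow>
     (complex \<Rightarrow> ('v \<Rightarrow> complex) \<Rightarrow> 'v \<Rightarrow> complex) \<Rightarrow> bool" where
  "resolvent_continuation G q x0 N T \<longleftrightarrow>
     finitely_meromorphic G (dist_weight G q x0 (- N)) (dist_weight G q x0 N) (cont_domain q N) T \<and>
     (\<exists>M. \<forall>\<mu>. cmod \<mu> > M \<longrightarrow>
        bij_betw (shifted_adjacency G q \<mu>) (l2 G) (l2 G) \<and>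
        (\<forall>f\<in>wl2 G (dist_weight G q x0 (- N)).
           T \<mu> f = inv_into (l2 G) (shifted_adjacency G q \<mu>) f))"

text \<open>The functions \<open>A\<^sub>-\<^sub>j\<close> of the Laurent expansion at \<open>\<mu>\<^sub>0\<close>, for any admissible \<open>N\<close>.\<close>

definition resolvent_laurent ::
    "('v, 'e, 'g, 'h) gog \<Rightarrow> nat \<Rightarrow> 'v \<Rightarrow> complex \<Rightarrow>
     real \<Rightarrow> nat \<Rightarrow> (nat \<Rightarrow> ('v \<Rightarrow> complex) \<Rightarrow> 'v \<Rightarrow> complex) \<Rightarrow> bool" where
  "resolvent_laurent G q x0 \<mu>\<^sub>0 N J C \<longleftrightarrow>
     0 \<le> N \<and> \<mu>\<^sub>0 \<in> cont_domain q N \<and>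
     (\<exists>T. resolvent_continuation G q x0 N T \<and>
        laurent_ops G (dist_weight G q x0 (- N)) (dist_weight G q x0 N) T \<mu>\<^sub>0 J C)"

definition resonance :: "('v, 'e, 'g, 'h) gog \<Rightarrow> nat \<Rightarrow> 'v \<Rightarrow> complex \<Rightarrow> bool" where
  "resonance G q x0 \<mu>\<^sub>0 \<longleftrightarrow> \<mu>\<^sub>0 \<noteq> 0 \<and>
     (\<exists>N J C. resolvent_laurent G q x0 \<mu>\<^sub>0 N J C \<and>
        (\<exists>j\<in>{1..J}. \<exists>f\<in>wl2 G (dist_weight G q x0 (- N)). C j f \<noteq> (\<lambda>_. 0)))"

text \<open>The continuation, hence its Laurent expansion, is unique for each \<open>N\<close>, and the images do not
  depend on \<open>N\<close> because finitely supported functions are dense; so the union over all choices is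
  the space given by any one of them.\<close>

definition grst :: "('v, 'e, 'g, 'h) gog \<Rightarrow> nat \<Rightarrow> 'v \<Rightarrow> complex \<Rightarrow> ('v \<Rightarrow> complex) set" where
  "grst G q x0 \<mu>\<^sub>0 = cfun.span
     {C j f | N J C j f. resolvent_laurent G q x0 \<mu>\<^sub>0 N J C \<and> j \<in> {1..J} \<and>
        f \<in> wl2 G (dist_weight G q x0 (- N))}"


section \<open>Purely outgoing functions\<close>

text \<open>Finite connected subgraphs \<open>H\<close> of \<open>G\<close> containing \<open>L\<close>.\<close>

definition exceptional_locus ::
    "('v, 'e, 'g, 'h) gog \<Rightarrow> ('v, 'e, 'g, 'h) gog \<Rightarrow> ('v, 'e) pre_digraph \<Rightarrow> bool" where
  "exceptional_locus G L H \<longleftrightarrow> subgraph H (ugraph G) \<and> (\<forall>e\<in>arcs H. opp G e \<in> arcs H) \<and>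
     fin_digraph H \<and> strongly_connected H \<and> gverts L \<subseteq> verts H \<and> garcs L \<subseteq> arcs H"

text \<open>The cusps and funnels making up \<open>G\<close> minus \<open>H\<close>, with the edges leading to \<open>H\<close> cut.\<close>

definition exterior_pieces ::
    "('v, 'e, 'g, 'h) gog \<Rightarrow> ('v, 'e) pre_digraph \<Rightarrow> ('v, 'e, 'g, 'h) gog set" where
  "exterior_pieces G H =
     {P \<in> pieces G {e \<in> garcs G. (org G e \<in> verts H) \<noteq> (ter G e \<in> verts H)}.
        gverts P \<inter> verts H = {}}"

definition outgoing_with ::
    "('v, 'e, 'g, 'h) gog \<Rightarrow> nat \<Rightarrow> 'v \<Rightarrow> complex \<Rightarrow> ('v, 'e) pre_digraph \<Rightarrow>
     (('v, 'e, 'g, 'h) gog \<Rightarrow> complex poly) \<Rightarrow> ('v \<Rightarrow> complex) \<Rightarrow> bool" where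
  "outgoing_with G q x0 \<mu> H p f \<longleftrightarrow> f \<in> vfuns G \<and>
     (\<forall>P\<in>exterior_pieces G H.
        (cusp P \<longrightarrow> (\<forall>v\<in>gverts P.
           f v = poly (p P) (of_nat (gdist G x0 v))
                 * (of_real (sqrt (real q)) / \<mu>) ^ gdist G x0 v)) \<and>
        (orbifold_funnel P \<longrightarrow> (\<forall>v\<in>gverts P.
           f v = poly (p P) (of_nat (gdist G x0 v))
                 * inverse ((\<mu> * of_real (sqrt (real q))) ^ gdist G x0 v))))"

definition purely_outgoing ::
    "('v, 'e, 'g, 'h) gog \<Rightarrow> nat \<Rightarrow> ('v, 'e, 'g, 'h) gog \<Rightarrow> 'v \<Rightarrow> complex \<Rightarrow>
     ('v \<Rightarrow> complex) \<Rightarrow> bool" where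
  "purely_outgoing G q L x0 \<mu> f \<longleftrightarrow>
     (\<exists>H p. exceptional_locus G L H \<and> outgoing_with G q x0 \<mu> H p f)"

definition purely_outgoing_constant_type ::
    "('v, 'e, 'g, 'h) gog \<Rightarrow> nat \<Rightarrow> ('v, 'e, 'g, 'h) gog \<Rightarrow> 'v \<Rightarrow> complex \<Rightarrow>
     ('v \<Rightarrow> complex) \<Rightarrow> bool" where
  "purely_outgoing_constant_type G q L x0 \<mu> f \<longleftrightarrow>
     (\<exists>H p. exceptional_locus G L H \<and> outgoing_with G q x0 \<mu> H p f \<and>
        (\<forall>P\<in>exterior_pieces G H. degree (p P) = 0))"

end

theory Submission
  imports Defs "HOL-Complex_Analysis.Complex_Analysis"
begin

text \<open>
  Write \<open>B\<close> for \<open>A / (2 \<surd>q) - z(\<mu>\<^sub>0)\<close> and \<open>t\<close> for \<open>\<mu> - \<mu>\<^sub>0\<close>.  The tool is the jet of order \<open>J\<close>: a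
  function \<open>W\<close> with values in the polynomials in \<open>t\<close> that satisfies, modulo \<open>t\<^sup>J\<close>, both
  \<open>(A / (2 \<surd>q) - z(\<mu>\<^sub>0 + t)) W = 0\<close> and, in every funnel and cusp, the first-order recursion along the
  parents that characterises outgoing functions of constant type and parameter \<open>\<mu>\<^sub>0 + t\<close>.
  Expanding the recursion in \<open>t\<close> shows that the coefficients of a jet below order \<open>J\<close> are purely
  outgoing of parameter \<open>\<mu>\<^sub>0\<close> and are killed by a power of \<open>B\<close>.

  For large \<open>|\<mu>|\<close> and finitely supported \<open>f\<close>, the \<open>\<ell>\<^sup>2\<close> function \<open>R(\<mu>) f\<close> satisfies the outgoing
  recursion off the support, and the identity theorem extends this to the continuation.  Hence
  \<open>t\<^sup>J\<close> times the principal part of \<open>R(\<mu>) f\<close> at \<open>\<mu>\<^sub>0\<close> is a jet.  At \<open>\<mu>\<^sub>0 = \<plusminus>1\<close>, Green's formula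
  bounds \<open>R(\<mu>) f\<close> as \<open>\<mu>\<close> tends to \<open>\<mu>\<^sub>0\<close> from outside the unit disc: the pole has order at
  most two, and \<open>A\<^sub>-\<^sub>2 f\<close> vanishes in the funnels and cusps, so that \<open>A\<^sub>-\<^sub>1 f\<close> satisfies the
  unperturbed recursion there; since \<open>z'(\<mu>\<^sub>0) = 0\<close>, both are killed by \<open>B\<close>.

  Conversely, for \<open>\<mu>\<^sub>0 \<noteq> \<plusminus>1\<close> an outgoing \<open>u\<close> with \<open>B\<^sup>J u = 0\<close> is completed to the jet given by the
  telescoping sum of \<open>(z(\<mu>) - z(\<mu>\<^sub>0))\<^sup>J\<^sup>-\<^sup>1\<^sup>-\<^sup>k B\<^sup>k u\<close> over \<open>k < J\<close>; for \<open>\<mu>\<^sub>0 = \<plusminus>1\<close> the constant jet \<open>u\<close>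
  of order one is used.  Continuing a jet from the core by the exact recursion gives outgoing functions
  \<open>w(\<mu>)\<close> for which \<open>g(\<mu>) = (A / (2 \<surd>q) - z(\<mu>)) w(\<mu>)\<close> is supported in a fixed finite set and is
  \<open>O(t\<^sup>J)\<close>.  Outgoing functions are in \<open>\<ell>\<^sup>2\<close> for large \<open>|\<mu>|\<close>, so \<open>w(\<mu>) = R(\<mu>) g(\<mu>)\<close>, and
  dividing by \<open>t\<^sup>J\<^sup>-\<^sup>1\<close> and letting \<open>t\<close> tend to \<open>0\<close> puts \<open>u\<close>, modulo \<open>B u, B\<^sup>2 u, \<dots>\<close>, into the span of
  finitely many values of the Laurent coefficients.
\<close>

text \<open>Funnels and cusps are treated at once. The parent arc of a vertex has weight 1 or
  \<open>q\<close>, and in both cases the children have total weight \<open>q\<close> divided by it.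
  On such an end the eigenvalue equation factors into two first-order recursions: if
  \<open>E v = u v - kap \<mu> v * u (par v)\<close> measures the failure of \<open>u\<close> to be
  outgoing of constant type, then the weighted sum of \<open>E\<close> over the children of
  \<open>v\<close> is \<open>sq * \<mu> * E v\<close>. Compared with outgoing growth, such a defect
  is multiplied by \<open>\<mu>\<^sup>2\<close> per generation. This excludes defects of square
  summable functions for large parameters, and polynomial defects as soon as
  \<open>\<mu>\<^sup>2 \<noteq> 1\<close>. At 1 and -1 the incoming and outgoing rates coincide and
  the second argument breaks down, hence Green's formula in one direction and constant type in the
  other. All limits are taken vertex by vertex. This is enough because a finite-dimensional space of
  functions is closed under pointwise limits, even where the scalars of the approximating
  combinations blow up.\<close>

section \<open>Finite-dimensional function spaces and polynomials\<close>

text \<open>Induction on the number of generators. Pointwise convergence suffices because a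
  generator \<open>b\<close> is eliminated by means of its value at a single point \<open>v\<close>
  with \<open>b v \<noteq> 0\<close>.\<close>

lemma cfun_span_pointwise_closed:
  fixes g :: "'x \<Rightarrow> 'v \<Rightarrow> complex"
  assumes "finite B" "F \<noteq> bot" "eventually (\<lambda>x. g x \<in> cfun.span B) F"
    and "\<And>v. ((\<lambda>x. g x v) \<longlongrightarrow> u v) F"
  shows "u \<in> cfun.span B"
  using assms
proof (induction "card B" arbitrary: B g u rule: less_induct)
  case less
  show ?case
  proof (cases "B = {}")
    case True
    with less(4) have ev: "eventually (\<lambda>x. g x = 0) F" by simp
    have "u v = 0" for v
    proof -
      have "((\<lambda>x. g x v) \<longlongrightarrow> 0) F"
        using ev by (intro tendsto_eventually) (auto elim: eventually_mono)
      then show ?thesis using less(3,5) tendsto_unique by blast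
    qed
    then have "u = 0" by auto
    then show ?thesis by (simp add: cfun.span_zero)
  next
    case False
    then obtain b B' where B: "B = insert b B'" "b \<notin> B'"
      by (meson Set.set_insert ex_in_conv)
    have finB': "finite B'" "card B' < card B" using B less(2) by auto
    show ?thesis
    proof (cases "b = 0")
      case True
      then have "cfun.span B = cfun.span B'" by (simp add: B cfun.span_insert_0)
      then show ?thesis using less(1)[of B' g u] finB' less(3,4,5) by simp
    next
      case False
      then obtain v where v: "b v \<noteq> 0" by (auto simp: fun_eq_iff)
      \<comment> \<open>The projection along \<open>b\<close> onto the functions vanishing at
        \<open>v\<close>. Its value at \<open>w\<close> involves only the values at \<open>v\<close>
        and \<open>w\<close>, so it passes to pointwise limits.\<close>
      define \<phi> where "\<phi> f = (\<lambda>w. f w - (f v / b v) * b w)" for f :: "'v \<Rightarrow> complex"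
      have \<phi>_span: "\<phi> f \<in> cfun.span (\<phi> ` B')" if "f \<in> cfun.span B" for f
        using that
      proof (induction rule: cfun.span_induct_alt)
        case base
        have "\<phi> 0 = 0" by (auto simp: \<phi>_def fun_eq_iff)
        then show ?case using cfun.span_zero[of "\<phi> ` B'"] by (simp add: zero_fun_def)
      next
        case (step c x y)
        have eq: "\<phi> ((\<lambda>w. c * x w) + y) = (\<lambda>w. c * \<phi> x w) + \<phi> y"
          using v by (auto simp: \<phi>_def fun_eq_iff field_simps)
        have "\<phi> x \<in> cfun.span (\<phi> ` B')"
        proof (cases "x = b")
          case True
          then have "\<phi> x = 0" using v by (auto simp: \<phi>_def fun_eq_iff)
          then show ?thesis by (simp add: cfun.span_zero)
        next
          case False
          then show ?thesis using step B by (intro cfun.span_base) auto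
        qed
        then show ?case unfolding eq using step by (intro cfun.span_add cfun.span_scale)
      qed
      have sub: "cfun.span (\<phi> ` B') \<subseteq> cfun.span B"
      proof (rule cfun.span_minimal[OF _ cfun.subspace_span], safe)
        fix x assume "x \<in> B'"
        then have "x - (\<lambda>w. (x v / b v) * b w) \<in> cfun.span B"
          using B by (intro cfun.span_diff cfun.span_scale) (auto intro: cfun.span_base)
        moreover have "x - (\<lambda>w. (x v / b v) * b w) = \<phi> x" by (auto simp: \<phi>_def)
        ultimately show "\<phi> x \<in> cfun.span B" by simp
      qed
      have "\<phi> u \<in> cfun.span (\<phi> ` B')"
      proof -
        have "card (\<phi> ` B') < card B" using finB' card_image_le le_less_trans by blast
        moreover have "((\<lambda>x. \<phi> (g x) w) \<longlongrightarrow> \<phi> u w) F" for w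
          unfolding \<phi>_def using v by (intro tendsto_intros less)
        moreover have "eventually (\<lambda>x. \<phi> (g x) \<in> cfun.span (\<phi> ` B')) F"
          using less(4) by eventually_elim (auto intro: \<phi>_span)
        ultimately show ?thesis using less(1)[of "\<phi> ` B'" "\<lambda>x. \<phi> (g x)" "\<phi> u"] less(3) finB' by simp
      qed
      then have "\<phi> u \<in> cfun.span B" using sub by blast
      then have "\<phi> u + (\<lambda>w. (u v / b v) * b w) \<in> cfun.span B"
        using B by (intro cfun.span_add cfun.span_scale) (auto intro: cfun.span_base)
      moreover have "\<phi> u + (\<lambda>w. (u v / b v) * b w) = u" by (auto simp: \<phi>_def)
      ultimately show ?thesis by simp
    qed
  qed
qed

text \<open>Factors \<open>t\<close> are split off one at a time. The filter may be finer than
  \<open>at 0\<close>, because the pole order at 1 and -1 is tested along a curve only.\<close>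

lemma coeff_eq_0_of_tendsto:
  fixes p :: "complex poly"
  assumes "F \<noteq> bot" "F \<le> at 0" "((\<lambda>t. poly p t / t ^ m) \<longlongrightarrow> 0) F" "i \<le> m"
  shows "coeff p i = 0"
  using assms(3,4)
proof (induction m arbitrary: p i)
  case 0
  have "((\<lambda>t. poly p t) \<longlongrightarrow> poly p 0) (at 0)"
    by (intro tendsto_intros)
  then have "((\<lambda>t. poly p t) \<longlongrightarrow> poly p 0) F"
    using assms(2) tendsto_mono by blast
  then have "poly p 0 = 0" using 0 assms(1) tendsto_unique by fastforce
  then show ?case using 0 by (simp add: poly_0_coeff_0)
next
  case (Suc m)
  have id: "((\<lambda>t. t) \<longlongrightarrow> 0) F" using assms(2) tendsto_ident_at tendsto_mono by blast
  have ne: "eventually (\<lambda>t. t \<noteq> 0) F"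
    using assms(2) by (auto simp: eventually_at_filter le_filter_def)
  have "((\<lambda>t. t ^ Suc m * (poly p t / t ^ Suc m)) \<longlongrightarrow> 0) F"
    using tendsto_mult[OF tendsto_power[OF id, of "Suc m"] Suc.prems(1)] by simp
  then have "((\<lambda>t. poly p t / t ^ 0) \<longlongrightarrow> 0) F"
    by (rule Lim_transform_eventually) (use ne in eventually_elim, simp)
  moreover have "((\<lambda>t. poly p t) \<longlongrightarrow> poly p 0) F"
    using assms(2) tendsto_mono by (intro tendsto_intros id)
  ultimately have "poly p 0 = 0" using assms(1) tendsto_unique by fastforce
  then obtain q where q: "p = pCons 0 q" by (metis pCons_cases poly_pCons add.right_neutral mult_zero_left)
  have "((\<lambda>t. poly q t / t ^ m) \<longlongrightarrow> 0) F"
    using Suc.prems(1) by (rule Lim_transform_eventually) (use ne in eventually_elim, simp add: q)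
  from Suc.IH[OF this] show ?case using Suc.prems(2) q by (cases i) auto
qed

lemma monom_dvd_tendsto:
  fixes p :: "complex poly"
  assumes "monom 1 (Suc m) dvd p"
  shows "((\<lambda>t. poly p t / t ^ m) \<longlongrightarrow> 0) (at 0)"
proof -
  from assms obtain r where r: "p = monom 1 (Suc m) * r" by (elim dvdE)
  have "((\<lambda>t. t * poly r t) \<longlongrightarrow> 0 * poly r 0) (at 0)" by (intro tendsto_intros)
  then show ?thesis unfolding mult_zero_left
    by (rule Lim_transform_eventually) (auto simp: eventually_at_filter r poly_monom)
qed

text \<open>The difference of \<open>c * x ^ (n + 1)\<close> has degree \<open>n\<close> and leading
  coefficient \<open>c * (n + 1)\<close>, so the leading term of \<open>p\<close> can be cancelled
  and the degree drops. Such a summation occurs where one coefficient of a jet drives the recursion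
  for the next.\<close>

lemma poly_antidifference:
  fixes p :: "'a::field_char_0 poly"
  shows "\<exists>P. \<forall>x. poly P (x + 1) - poly P x = poly p x"
proof (induction "degree p" arbitrary: p rule: less_induct)
  case less
  show ?case
  proof (cases "p = 0")
    case True
    then show ?thesis by (intro exI[of _ 0]) auto
  next
    case False
    define n c where "n = degree p" and "c = lead_coeff p / of_nat (Suc n)"
    define D where "D = pcompose (monom c (Suc n)) [:1, 1:] - monom c (Suc n)"
    have D: "poly D x = c * ((x + 1) ^ Suc n - x ^ Suc n)" for x
      by (simp add: D_def poly_pcompose poly_monom algebra_simps)
    have D': "D = (\<Sum>k\<le>n. monom (c * of_nat (Suc n choose k)) k)"
    proof (subst poly_eq_poly_eq_iff[symmetric], rule ext)
      fix x :: 'a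
      have "(x + 1) ^ Suc n = (\<Sum>k\<le>n. of_nat (Suc n choose k) * x ^ k) + x ^ Suc n"
        using binomial_ring[of x 1 "Suc n"] by (simp del: power_Suc)
      then show "poly D x = poly (\<Sum>k\<le>n. monom (c * of_nat (Suc n choose k)) k) x"
        unfolding D by (simp add: poly_sum poly_monom sum_distrib_left mult.assoc del: power_Suc)
    qed
    have "coeff D n = lead_coeff p"
      unfolding D' c_def by (simp add: coeff_sum coeff_monom sum.delta' field_simps del: of_nat_Suc)
    moreover have "degree D \<le> n"
      unfolding D' by (intro degree_sum_le) (auto intro: order_trans[OF degree_monom_le])
    ultimately have cf: "coeff (p - D) i = 0" if "i \<ge> n" for i
      using that by (cases "i = n") (auto simp: n_def coeff_eq_0)
    show ?thesis
    proof (cases "p - D = 0")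
      case True
      then show ?thesis using D by (intro exI[of _ "monom c (Suc n)"]) (auto simp: poly_monom algebra_simps)
    next
      case False
      then have "degree (p - D) < degree p"
        using cf n_def by (metis leading_coeff_0_iff not_le)
      from less[OF this] obtain P where "\<forall>x. poly P (x + 1) - poly P x = poly (p - D) x" by blast
      then show ?thesis using D
        by (intro exI[of _ "P + monom c (Suc n)"]) (auto simp: poly_monom algebra_simps)
    qed
  qed
qed

text \<open>A shift keeps the leading coefficient, so 1 is its only eigenvalue on nonzero
  polynomials. In the application \<open>c\<close> is the square of the parameter, which is how 1
  and -1 become exceptional.\<close>

lemma poly_shift_eigen_imp_0:
  fixes p :: "'a::field_char_0 poly"
  assumes "\<And>n::nat. n \<ge> m \<Longrightarrow> poly p (of_nat n + 1) = c * poly p (of_nat n)" "c \<noteq> 1"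
  shows "p = 0"
proof -
  have eq: "pcompose p [:1, 1:] = smult c p"
  proof (rule ccontr)
    assume "\<not> ?thesis"
    then have "pcompose p [:1, 1:] - smult c p \<noteq> 0" by simp
    then have "finite {x. poly (pcompose p [:1, 1:] - smult c p) x = 0}" by (rule poly_roots_finite)
    moreover have "of_nat ` {m..} \<subseteq> {x. poly (pcompose p [:1, 1:] - smult c p) x = 0}"
      using assms(1) by (auto simp: poly_pcompose add.commute)
    ultimately have "finite ((of_nat :: nat \<Rightarrow> 'a) ` {m..})" using finite_subset by blast
    then have "finite {m..}" by (rule finite_imageD) (auto intro: inj_onI)
    then show False by (simp add: infinite_Ici)
  qed
  have "lead_coeff (pcompose p [:1, 1:]) = lead_coeff p" by (subst lead_coeff_comp) auto
  then have "c * lead_coeff p = lead_coeff p" unfolding eq by (simp only: lead_coeff_smult)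
  then show ?thesis using assms(2) by simp
qed

section \<open>Identity theorem on the domain of continuation\<close>

text \<open>On a connected open set a meromorphic function is zero off a sparse set or avoids zero
  off a sparse set, and its behaviour near \<open>z1\<close> excludes the second case.\<close>

lemma meromorphic_eventually_0:
  assumes "f meromorphic_on A" "open A" "Topological_Spaces.connected A" "z0 \<in> A" "z1 \<in> A"
    and "eventually (\<lambda>z. f z = 0) (at z1)"
  shows "eventually (\<lambda>z. f z = 0) (at z0)"
proof -
  have "eventually (\<lambda>z. f z = 0) (cosparse A) \<or> eventually (\<lambda>z. f z \<noteq> 0) (cosparse A)"
    by (intro meromorphic_imp_constant_or_avoid assms)
  moreover have "\<not> eventually (\<lambda>z. f z \<noteq> 0) (cosparse A)"
  proof
    assume "eventually (\<lambda>z. f z \<noteq> 0) (cosparse A)"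
    then have "eventually (\<lambda>z. f z \<noteq> 0) (at z1)"
      using assms by (auto simp: eventually_cosparse_open_eq)
    then have "eventually (\<lambda>z. False) (at z1)" using assms(6) by eventually_elim auto
    then show False by simp
  qed
  ultimately show ?thesis using assms by (auto simp: eventually_cosparse_open_eq)
qed

lemma cont_domain_props:
  assumes "q > 0"
  shows "open (cont_domain q N)" "Topological_Spaces.connected (cont_domain q N)" "0 \<notin> cont_domain q N"
proof -
  have eq: "cont_domain q N = - cball 0 (real q powr (1/2 - N))"
    by (auto simp: cont_domain_def)
  show "open (cont_domain q N)" unfolding eq by (simp add: open_Compl)
  show "Topological_Spaces.connected (cont_domain q N)" unfolding eq
    by (rule connected_complement_bounded_convex) auto
  show "0 \<notin> cont_domain q N" using assms by (auto simp: cont_domain_def not_less)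
qed

section \<open>Rooted ends\<close>

text \<open>
  \<open>K0\<close> is the vertex set of the core and \<open>h v\<close> the arc from the parent of \<open>v\<close> into \<open>v\<close>.  Funnels are the
  ends with \<open>\<S>(v) / \<S>(h v) = 1\<close>, cusps those where this ratio is \<open>q\<close>.
\<close>

locale rooted_ends = graph_of_groups G for G :: "('v, 'e, 'g, 'h) gog" +
  fixes q :: nat and K0 :: "'v set" and x0 :: 'v and h :: "'v \<Rightarrow> 'e"
  assumes q_ge_2: "2 \<le> q"
    and finite_K0: "finite K0"
    and K0_subset: "K0 \<subseteq> gverts G"
    and x0_in: "x0 \<in> K0"
    and h_arc: "v \<in> gverts G - K0 \<Longrightarrow> h v \<in> garcs G"
    and ter_h: "v \<in> gverts G - K0 \<Longrightarrow> ter G (h v) = v"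
    and child_arc: "\<lbrakk>e \<in> garcs G; ter G e \<notin> K0; e \<noteq> h (ter G e)\<rbrakk> \<Longrightarrow>
          org G e \<notin> K0 \<and> h (org G e) = opp G e"
    and ratio_child: "\<lbrakk>e \<in> garcs G; ter G e \<notin> K0; e \<noteq> h (ter G e)\<rbrakk> \<Longrightarrow>
          real (vsize G (org G e)) / real (esize G (h (org G e))) =
          real (vsize G (ter G e)) / real (esize G (h (ter G e)))"
    and ratio_cases: "v \<in> gverts G - K0 \<Longrightarrow>
          real (vsize G v) / real (esize G (h v)) \<in> {1, real q}"
    and degree_eq: "v \<in> gverts G - K0 \<Longrightarrow> gog_degree G v = real q + 1"

section \<open>Walks, distances and parent-closed vertex sets\<close>

context graph_of_groups_with_boundary
begin

sublocale U: wf_digraph "ugraph G"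
  by (rule wf_ugraph)

lemma org_in: "e \<in> garcs G \<Longrightarrow> org G e \<in> gverts G"
  and ter_in: "e \<in> garcs G \<Longrightarrow> ter G e \<in> gverts G"
  by auto

lemma ter_opp: "e \<in> garcs G \<Longrightarrow> ter G (opp G e) = org G e"
  using org_opp[of "opp G e"] opp_opp opp_in_arcs by simp

lemma vsize_pos: "v \<in> gverts G \<Longrightarrow> vsize G v > 0"
  using vgrp_group vgrp_finite group.is_monoid monoid.one_closed
  by (fastforce simp: vsize_def card_gt_0_iff)

lemma esize_pos: "e \<in> garcs G \<union> prongs G \<Longrightarrow> esize G e > 0"
  using egrp_group egrp_finite group.is_monoid monoid.one_closed
  by (fastforce simp: esize_def card_gt_0_iff)

lemma esize_opp: "e \<in> garcs G \<Longrightarrow> esize G (opp G e) = esize G e"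
  by (simp add: esize_def egrp_opp)

lemma finite_in_arcs: "finite {e \<in> garcs G. ter G e = v}"
proof (cases "v \<in> gverts G")
  case True
  show ?thesis by (rule finite_subset[OF _ locally_finite[OF True]]) auto
next
  case False
  then have "{e \<in> garcs G. ter G e = v} = {}" using ter_in by auto
  then show ?thesis by (simp only: finite.emptyI)
qed

lemma awalk_exists:
  assumes "u \<in> gverts G" "v \<in> gverts G"
  obtains p where "U.awalk u p v"
  using connected_ugraph assms by (auto simp: U.reachable_awalk strongly_connected_def)

lemma gdist_le: "U.awalk u p v \<Longrightarrow> gdist G u v \<le> length p"
  unfolding gdist_def by (rule Least_le) auto

lemma gdist_awalk:
  assumes "u \<in> gverts G" "v \<in> gverts G"
  obtains p where "U.awalk u p v" "length p = gdist G u v"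
proof -
  obtain p where "U.awalk u p v" using awalk_exists assms .
  then have "\<exists>p. U.awalk u p v \<and> length p = gdist G u v"
    unfolding gdist_def by (intro LeastI_ex[where P = "\<lambda>n. \<exists>p. U.awalk u p v \<and> length p = n"]) auto
  then show ?thesis using that by blast
qed

lemma gdist_arc:
  assumes "e \<in> garcs G" "u \<in> gverts G"
  shows "gdist G u (ter G e) \<le> Suc (gdist G u (org G e))"
proof -
  obtain p where p: "U.awalk u p (org G e)" "length p = gdist G u (org G e)"
    using gdist_awalk assms org_in by metis
  have "U.awalk u (p @ [e]) (ter G e)"
    using p assms by (auto simp: U.awalk_simps intro: org_in ter_in)
  from gdist_le[OF this] p show ?thesis by simp
qed

text \<open>The walk is split at its first entrance into \<open>S\<close>; the part before it is
  kept because its length later bounds a distance.\<close>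

lemma cas_enter:
  assumes "U.cas u p v" "u \<notin> S" "v \<in> S"
  shows "\<exists>p1 e p2. p = p1 @ e # p2 \<and> U.cas u p1 (org G e) \<and> org G e \<notin> S \<and> ter G e \<in> S"
  using assms
proof (induction p arbitrary: u)
  case Nil
  then show ?case by auto
next
  case (Cons a p)
  show ?case
  proof (cases "ter G a \<in> S")
    case True
    then show ?thesis using Cons.prems
      by (intro exI[of _ "[]"] exI[of _ a] exI[of _ p]) auto
  next
    case False
    have "U.cas (ter G a) p v" using Cons.prems(1) by simp
    from Cons.IH[OF this False Cons.prems(3)] obtain p1 e p2
      where "p = p1 @ e # p2" "U.cas (ter G a) p1 (org G e)" "org G e \<notin> S" "ter G e \<in> S"
      by blast
    then show ?thesis using Cons.prems
      by (intro exI[of _ "a # p1"] exI[of _ e] exI[of _ p2]) auto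
  qed
qed

lemma awalk_enter:
  assumes "U.awalk u p v" "u \<notin> S" "v \<in> S"
  obtains p1 e p2 where "p = p1 @ e # p2" "U.awalk u p1 (org G e)" "e \<in> garcs G"
    "org G e \<notin> S" "ter G e \<in> S"
  using cas_enter[of u p v S] assms that unfolding U.awalk_def by auto

end

context rooted_ends
begin

definition ext :: "'v set" where "ext = gverts G - K0"

definition par :: "'v \<Rightarrow> 'v" where "par v = org G (h v)"

definition ratio :: "'v \<Rightarrow> real" where "ratio v = real (vsize G v) / real (esize G (h v))"

definition children :: "'v \<Rightarrow> 'e set" where "children v = {e \<in> garcs G. ter G e = v \<and> e \<noteq> h v}"

definition desc :: "'v \<Rightarrow> 'v set" where "desc v = {w. (w, v) \<in> {(c, par c) |c. c \<in> ext}\<^sup>*}"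

text \<open>These are the vertex sets of the exceptional loci: whatever lies outside such a set
  hangs below it in complete descendant sets.\<close>

definition good :: "'v set \<Rightarrow> bool" where
  "good K \<longleftrightarrow> finite K \<and> K0 \<subseteq> K \<and> K \<subseteq> gverts G \<and> (\<forall>v\<in>K - K0. par v \<in> K)"

abbreviation wt :: "'e \<Rightarrow> real" where "wt e \<equiv> real (vsize G (ter G e)) / real (esize G e)"

lemma q_pos: "q > 0" "real q > 0" "real q > 1" "sqrt (real q) > 0" "sqrt (real q) > 1"
  using q_ge_2 by auto

lemma ext_in: "v \<in> ext \<Longrightarrow> v \<in> gverts G" by (auto simp: ext_def)

lemma ext_h: "v \<in> ext \<Longrightarrow> h v \<in> garcs G" "v \<in> ext \<Longrightarrow> ter G (h v) = v"
  using h_arc ter_h by (auto simp: ext_def)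

lemma par_in: "v \<in> ext \<Longrightarrow> par v \<in> gverts G"
  by (simp add: par_def ext_h org_in)

lemma finite_children: "finite (children v)"
  by (rule finite_subset[OF _ finite_in_arcs[of v]]) (auto simp: children_def)

lemma child:
  assumes "v \<in> ext" "e \<in> children v"
  shows "e \<in> garcs G" "ter G e = v" "org G e \<in> ext" "par (org G e) = v" "h (org G e) = opp G e"
    "ratio (org G e) = ratio v" "esize G (h (org G e)) = esize G e"
proof -
  show e: "e \<in> garcs G" "ter G e = v" using assms by (auto simp: children_def)
  have *: "ter G e \<notin> K0" "e \<noteq> h (ter G e)" using assms e by (auto simp: children_def ext_def)
  show c: "org G e \<in> ext" using child_arc[OF e(1) *] e org_in by (auto simp: ext_def)
  show o: "h (org G e) = opp G e" using child_arc[OF e(1) *] by simp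
  show "par (org G e) = v" unfolding par_def o using org_opp e by simp
  show "ratio (org G e) = ratio v" using ratio_child[OF e(1) *] e by (simp add: ratio_def)
  show "esize G (h (org G e)) = esize G e" by (simp add: o esize_opp e)
qed

lemma ratio_pos: "v \<in> ext \<Longrightarrow> ratio v \<in> {1, real q}" "v \<in> ext \<Longrightarrow> ratio v > 0"
  using ratio_cases[of v] q_pos by (auto simp: ratio_def ext_def)

lemma in_arcs_ext:
  assumes "v \<in> ext"
  shows "{e \<in> garcs G. ter G e = v} = insert (h v) (children v)" "h v \<notin> children v"
  using ext_h assms by (auto simp: children_def)

lemma wt_h: "v \<in> ext \<Longrightarrow> wt (h v) = ratio v"
  by (simp add: ratio_def ext_h)

lemma sum_wt_children:
  assumes "v \<in> ext"
  shows "(\<Sum>e\<in>children v. wt e) = real q / ratio v"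
proof -
  have "gog_degree G v = (\<Sum>e\<in>{e \<in> garcs G. ter G e = v}. wt e)"
    unfolding gog_degree_def no_prongs by (rule sum.cong) auto
  also have "\<dots> = ratio v + (\<Sum>e\<in>children v. wt e)"
    unfolding in_arcs_ext[OF assms]
    using in_arcs_ext(2)[OF assms] wt_h[OF assms] finite_children by simp
  finally have "(\<Sum>e\<in>children v. wt e) = real q + 1 - ratio v"
    using degree_eq assms by (simp add: ext_def)
  then show ?thesis using ratio_pos(1)[OF assms] q_pos by auto
qed

lemma desc_refl [simp]: "v \<in> desc v" by (simp add: desc_def)

lemma desc_step: "w \<in> ext \<Longrightarrow> par w \<in> desc v \<Longrightarrow> w \<in> desc v"
  unfolding desc_def by (auto intro: converse_rtrancl_into_rtrancl)

lemma desc_cases: "w \<in> desc v \<Longrightarrow> w = v \<or> w \<in> ext \<and> par w \<in> desc v"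
  unfolding desc_def by (auto elim: converse_rtranclE)

lemma desc_subset: "v \<in> ext \<Longrightarrow> desc v \<subseteq> ext"
  using desc_cases by blast

lemma desc_induct [consumes 1, case_names root step]:
  assumes "w \<in> desc v" "P v" "\<And>w. w \<in> ext \<Longrightarrow> par w \<in> desc v \<Longrightarrow> P (par w) \<Longrightarrow> P w"
  shows "P w"
proof -
  have "(w, v) \<in> {(c, par c) |c. c \<in> ext}\<^sup>*" using assms(1) by (simp add: desc_def)
  then show ?thesis
  proof (induction rule: converse_rtrancl_induct)
    case base
    show ?case by fact
  next
    case (step y z)
    then show ?case using assms(3)[of y] by (auto simp: desc_def)
  qed
qed

lemma desc_trans: "w \<in> desc v \<Longrightarrow> v \<in> desc u \<Longrightarrow> w \<in> desc u"
  unfolding desc_def by auto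

text \<open>An arc into a descendant is its parent arc or comes from one of its children; in the
  second case it starts at a descendant again. So \<open>h v\<close> is the only gate to
  \<open>desc v\<close>, and no tree property has to be invoked.\<close>

lemma desc_enter:
  assumes "e \<in> garcs G" "v \<in> ext" "ter G e \<in> desc v" "org G e \<notin> desc v"
  shows "e = h v"
proof -
  let ?w = "ter G e"
  have w: "?w \<in> ext" using desc_subset assms by blast
  show ?thesis
  proof (cases "e = h ?w")
    case True
    then have "par ?w \<notin> desc v" using assms by (simp add: par_def)
    then have "?w = v" using desc_cases assms by blast
    then show ?thesis using True by simp
  next
    case False
    then have e: "e \<in> children ?w" using assms by (auto simp: children_def)
    have "org G e \<in> desc v" using child[OF w e] assms desc_step by auto
    then show ?thesis using assms by simp
  qed
qed

lemma x0_notin_desc: "v \<in> ext \<Longrightarrow> x0 \<notin> desc v"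
  using desc_subset x0_in by (auto simp: ext_def)

lemma awalk_through_h:
  assumes "U.awalk u p w" "u \<notin> desc v" "v \<in> ext" "w \<in> desc v"
  obtains p1 p2 where "p = p1 @ h v # p2" "U.awalk u p1 (par v)" "par v \<notin> desc v"
  using awalk_enter[OF assms(1,2,4)] desc_enter[OF _ assms(3)] that
  by (metis par_def)

abbreviation gd :: "'v \<Rightarrow> nat" where "gd \<equiv> gdist G x0"

lemma x0_V: "x0 \<in> gverts G" using x0_in K0_subset by auto

text \<open>The base point lies in the core, so every walk from it to \<open>v\<close> passes the
  gate \<open>h v\<close>. Hence the distance in the outgoing condition advances by exactly one with
  each generation.\<close>

lemma gd_par:
  assumes "v \<in> ext"
  shows "gd v = Suc (gd (par v))"
proof (rule antisym)
  show "gd v \<le> Suc (gd (par v))"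
    using gdist_arc[OF ext_h(1)[OF assms] x0_V] ext_h(2)[OF assms] by (simp add: par_def)
  obtain p where p: "U.awalk x0 p v" "length p = gd v"
    using gdist_awalk x0_V ext_in[OF assms] .
  obtain p1 p2 where "p = p1 @ h v # p2" "U.awalk x0 p1 (par v)"
    using awalk_through_h[OF p(1) x0_notin_desc[OF assms] assms desc_refl] by metis
  then show "Suc (gd (par v)) \<le> gd v"
    using p(2) gdist_le[of x0 p1 "par v"] by simp
qed

text \<open>The reverse of \<open>h v\<close> is a child arc of \<open>par v\<close>; otherwise
  \<open>v\<close> and \<open>par v\<close> would be parents of each other, against
  \<open>gd_par\<close>.\<close>

lemma ratio_par:
  assumes "v \<in> ext" "par v \<in> ext"
  shows "ratio v = ratio (par v)"
proof -
  let ?e = "opp G (h v)"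
  have e: "?e \<in> garcs G" "ter G ?e = par v" "org G ?e = v"
    using ext_h[OF assms(1)] opp_in_arcs ter_opp org_opp by (auto simp: par_def)
  have "?e \<noteq> h (par v)"
  proof
    assume "?e = h (par v)"
    then have "par (par v) = v" using e by (metis par_def)
    then show False using gd_par[OF assms(1)] gd_par[OF assms(2)] by simp
  qed
  then have "?e \<in> children (par v)" using e by (auto simp: children_def)
  from child(6)[OF assms(2) this] show ?thesis using e by simp
qed

lemma ratio_desc:
  assumes "w \<in> desc v" "v \<in> ext"
  shows "ratio w = ratio v"
  using assms
proof (induction rule: desc_induct)
  case (step w)
  then have "par w \<in> ext" using desc_subset by blast
  then show ?case using ratio_par step by simp
qed simp

lemma opp_h_children:
  assumes "v \<in> ext" "par v \<in> ext"
  shows "opp G (h v) \<in> children (par v)"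
proof -
  let ?e = "opp G (h v)"
  have e: "?e \<in> garcs G" "ter G ?e = par v" "org G ?e = v"
    using ext_h[OF assms(1)] opp_in_arcs ter_opp org_opp by (auto simp: par_def)
  have "?e \<noteq> h (par v)"
  proof
    assume "?e = h (par v)"
    then have "par (par v) = v" using e by (metis par_def)
    then show False using gd_par[OF assms(1)] gd_par[OF assms(2)] by simp
  qed
  then show ?thesis using e by (auto simp: children_def)
qed

lemma good_K0: "good K0"
  using finite_K0 K0_subset by (auto simp: good_def)

lemma good_Un: "good K \<Longrightarrow> good K' \<Longrightarrow> good (K \<union> K')"
  by (auto simp: good_def)

lemma good_insert: "good K \<Longrightarrow> v \<in> ext \<Longrightarrow> par v \<in> K \<Longrightarrow> good (insert v K)"
  by (auto simp: good_def ext_def)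

lemma good_notin: "good K \<Longrightarrow> v \<in> gverts G \<Longrightarrow> v \<notin> K \<Longrightarrow> v \<in> ext"
  by (auto simp: good_def ext_def)

lemma good_sub: "good K \<Longrightarrow> K \<subseteq> gverts G" by (auto simp: good_def)

lemma good_par: "good K \<Longrightarrow> v \<in> K \<Longrightarrow> v \<in> ext \<Longrightarrow> par v \<in> K"
  by (auto simp: good_def ext_def)

lemma good_containing_vertex:
  assumes "v \<in> gverts G"
  shows "\<exists>K. good K \<and> v \<in> K"
  using assms
proof (induction "gd v" arbitrary: v rule: less_induct)
  case less
  show ?case
  proof (cases "v \<in> K0")
    case True
    then show ?thesis using good_K0 by blast
  next
    case False
    then have v: "v \<in> ext" using less by (auto simp: ext_def)
    then obtain K where "good K" "par v \<in> K" using less(1)[of "par v"] gd_par par_in by auto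
    then show ?thesis using good_insert v by blast
  qed
qed

lemma good_containing:
  assumes "finite S" "S \<subseteq> gverts G"
  shows "\<exists>K. good K \<and> S \<subseteq> K"
  using assms
proof (induction rule: finite_induct)
  case empty
  then show ?case using good_K0 by blast
next
  case (insert v S)
  then obtain K K' where "good K" "S \<subseteq> K" "good K'" "v \<in> K'"
    using good_containing_vertex[of v] by auto
  then show ?case using good_Un by (intro exI[of _ "K \<union> K'"]) auto
qed

text \<open>One more generation is added because the adjacency operator and the recursion look one
  step up: outside \<open>layer K\<close> the parent still lies outside \<open>K\<close>.\<close>

definition layer :: "'v set \<Rightarrow> 'v set" where "layer K = K \<union> {v \<in> ext. par v \<in> K}"

lemma good_layer:
  assumes "good K"
  shows "good (layer K)" "K \<subseteq> layer K"
proof -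
  have "{v \<in> ext. par v \<in> K} \<subseteq> org G ` (\<Union>w\<in>K. {e \<in> garcs G. ter G e = w})"
  proof
    fix v assume "v \<in> {v \<in> ext. par v \<in> K}"
    then have "opp G (h v) \<in> garcs G" "ter G (opp G (h v)) \<in> K" "org G (opp G (h v)) = v"
      using ext_h opp_in_arcs ter_opp org_opp by (auto simp: par_def)
    then show "v \<in> org G ` (\<Union>w\<in>K. {e \<in> garcs G. ter G e = w})"
      by (intro image_eqI[of _ _ "opp G (h v)"]) simp_all
  qed
  moreover have "finite (org G ` (\<Union>w\<in>K. {e \<in> garcs G. ter G e = w}))"
    using assms finite_in_arcs by (auto simp: good_def)
  ultimately have "finite {v \<in> ext. par v \<in> K}" using finite_subset by blast
  then show "good (layer K)" "K \<subseteq> layer K"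
    using assms by (auto simp: good_def layer_def ext_def)
qed

lemma layer_notin:
  assumes "good K" "v \<in> gverts G" "v \<notin> layer K"
  shows "v \<in> ext" "par v \<notin> K" "v \<notin> K" "par v \<in> ext"
proof -
  show nv: "v \<notin> K" using assms(3) by (simp add: layer_def)
  show v: "v \<in> ext" using good_notin[OF assms(1,2) nv] .
  show np: "par v \<notin> K" using assms(3) v by (simp add: layer_def)
  show "par v \<in> ext" using good_notin[OF assms(1) par_in[OF v] np] .
qed

text \<open>The distance to the base point drops along parents, so each chain of parents ends in
  \<open>K\<close>.\<close>

lemma parent_induct [consumes 2, case_names core step]:
  assumes "good K" "v \<in> gverts G"
    and "\<And>v. v \<in> K \<Longrightarrow> P v"
    and "\<And>v. v \<in> ext \<Longrightarrow> v \<notin> K \<Longrightarrow> P (par v) \<Longrightarrow> P v"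
  shows "P v"
  using assms(2)
proof (induction "gd v" arbitrary: v rule: less_induct)
  case less
  show ?case
  proof (cases "v \<in> K")
    case False
    then have "v \<in> ext" using good_notin assms(1) less by blast
    then show ?thesis using less assms(4) False gd_par par_in by auto
  qed (use assms(3) in auto)
qed

text \<open>The top vertices of the components outside \<open>K\<close>; they index the polynomials
  of an outgoing function.\<close>

definition roots :: "'v set \<Rightarrow> 'v set" where "roots K = {v \<in> ext. v \<notin> K \<and> par v \<in> K}"

lemma rootsD: "\<rho> \<in> roots K \<Longrightarrow> \<rho> \<in> ext" "\<rho> \<in> roots K \<Longrightarrow> \<rho> \<notin> K" "\<rho> \<in> roots K \<Longrightarrow> par \<rho> \<in> K"
  by (auto simp: roots_def)

lemma desc_disjoint:
  assumes "good K" "v \<notin> K" "w \<in> desc v"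
  shows "w \<notin> K"
  using assms(3)
proof (induction rule: desc_induct)
  case (step w)
  then show ?case using good_par assms by blast
qed (use assms in auto)

lemma desc_of_root:
  assumes "good K" "v \<in> gverts G" "v \<notin> K"
  obtains \<rho> where "\<rho> \<in> roots K" "v \<in> desc \<rho>"
proof -
  have "v \<notin> K \<longrightarrow> (\<exists>\<rho>\<in>roots K. v \<in> desc \<rho>)"
    using assms(1,2)
  proof (induction rule: parent_induct)
    case (step v)
    then show ?case
      by (cases "par v \<in> K") (use desc_step in \<open>auto simp: roots_def\<close>)
  qed auto
  then show ?thesis using assms that by blast
qed

lemma gd_desc:
  assumes "w \<in> desc v" "v \<in> ext"
  shows "gd w \<ge> gd v"
  using assms(1)
proof (induction rule: desc_induct)
  case (step w)
  then show ?case using gd_par[of w] by simp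
qed simp

lemma child_desc: "v \<in> ext \<Longrightarrow> v \<in> desc u \<Longrightarrow> e \<in> children v \<Longrightarrow> org G e \<in> desc u"
  using child desc_step by metis

text \<open>The recursion is solved by iterating the one-step operator \<open>\<Phi>\<close>, which
  settles one further generation each time; the value at \<open>v\<close> is read off after as many
  steps as its depth requires.\<close>

lemma extend_from_core:
  fixes W :: "'v \<Rightarrow> complex" and \<kappa> :: "'v \<Rightarrow> complex"
  assumes "good K"
  obtains w where "\<And>v. v \<in> K \<Longrightarrow> w v = W v" "\<And>v. v \<in> ext \<Longrightarrow> v \<notin> K \<Longrightarrow> w v = \<kappa> v * w (par v)"
    "\<And>v. v \<notin> gverts G \<Longrightarrow> w v = 0"
proof -
  define \<Phi> where "\<Phi> f v = (if v \<in> K then W v else if v \<in> ext then \<kappa> v * f (par v) else 0)" for f v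
  have st: "(\<Phi> ^^ Suc n) f v = (\<Phi> ^^ Suc (gd v)) f v" if "v \<in> gverts G" "n \<ge> gd v" for n f v
    using assms that
  proof (induction arbitrary: n rule: parent_induct)
    case (core v)
    then show ?case by (simp add: \<Phi>_def)
  next
    case (step v)
    have gv: "gd v = Suc (gd (par v))" using gd_par step(1) .
    then obtain n' where n': "n = Suc n'" "n' \<ge> gd (par v)" using step(4) by (cases n) auto
    have *: "(\<Phi> ^^ Suc m) f v = \<kappa> v * (\<Phi> ^^ m) f (par v)" for m
      using step(1,2) by (simp add: \<Phi>_def)
    show ?case unfolding * gv n'(1) step(3)[OF n'(2)] ..
  qed
  \<comment> \<open>The number of iterations exceeds the depth by one. Passing from
    \<open>par v\<close> to \<open>v\<close> thus adds exactly the one application of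
    \<open>\<Phi>\<close> that the recursion asks for, and on \<open>K\<close> there is at least one
    application.\<close>
  define w where "w v = (\<Phi> ^^ Suc (gd v)) (\<lambda>_. 0) v" for v
  show thesis
  proof (rule that[of w])
    show "w v = W v" if "v \<in> K" for v using that by (simp add: w_def \<Phi>_def)
    show "w v = \<kappa> v * w (par v)" if "v \<in> ext" "v \<notin> K" for v
      unfolding w_def gd_par[OF that(1)] using that by (simp add: \<Phi>_def)
    show "w v = 0" if "v \<notin> gverts G" for v
    proof -
      have "v \<notin> K" "v \<notin> ext" using that good_sub[OF assms] ext_in by auto
      then show ?thesis by (simp add: w_def \<Phi>_def)
    qed
  qed
qed

end

section \<open>The adjacency operator on polynomial-valued functions; outgoing functions\<close>

lemma monom_1_dvd_coeff: "monom 1 J dvd p \<Longrightarrow> i < J \<Longrightarrow> coeff (p :: complex poly) i = 0"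
  by (simp add: monom_1_dvd_iff')

context graph_of_groups_with_boundary
begin

definition adjp :: "('v \<Rightarrow> complex poly) \<Rightarrow> 'v \<Rightarrow> complex poly" where
  "adjp W v = (\<Sum>e\<in>{e \<in> garcs G. ter G e = v}.
     smult (of_real (real (vsize G v) / real (esize G e))) (W (org G e)))"

lemma coeff_adjp: "coeff (adjp W v) i = adjacency G (\<lambda>v. coeff (W v) i) v"
  by (simp add: adjp_def adjacency_def coeff_sum)

lemma poly_adjp: "poly (adjp W v) t = adjacency G (\<lambda>v. poly (W v) t) v"
  by (simp add: adjp_def adjacency_def poly_sum)

lemma adjacency_off: "v \<notin> gverts G \<Longrightarrow> adjacency G f v = 0"
  unfolding adjacency_def using ter_in by (intro sum.neutral) auto

lemma adjacency_lin:
  "adjacency G (\<lambda>v. a * f v + b * g v) v = a * adjacency G f v + b * adjacency G g v"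
  by (simp add: adjacency_def sum.distrib sum_distrib_left algebra_simps)

lemma shifted_lin:
  "shifted_adjacency G q \<mu> (\<lambda>v. a * f v + b * g v) =
   (\<lambda>v. a * shifted_adjacency G q \<mu> f v + b * shifted_adjacency G q \<mu> g v)"
  by (simp add: shifted_adjacency_def adjacency_lin fun_eq_iff add_divide_distrib algebra_simps)

lemma shifted_pow_lin:
  "(shifted_adjacency G q \<mu> ^^ n) (\<lambda>v. a * f v + b * g v) =
   (\<lambda>v. a * (shifted_adjacency G q \<mu> ^^ n) f v + b * (shifted_adjacency G q \<mu> ^^ n) g v)"
  by (induction n) (simp_all add: shifted_lin)

lemma shifted_pow_0: "(shifted_adjacency G q \<mu> ^^ n) (\<lambda>_. 0) = (\<lambda>_. 0)"
  using shifted_pow_lin[where a = 0 and b = 0 and f = "\<lambda>_. 0" and g = "\<lambda>_. 0"] by simp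

lemma shifted_pow_mono:
  assumes "(shifted_adjacency G q \<mu> ^^ n) f = (\<lambda>_. 0)" "n \<le> m"
  shows "(shifted_adjacency G q \<mu> ^^ m) f = (\<lambda>_. 0)"
proof -
  obtain k where "m = k + n" using assms(2) by (metis le_add_diff_inverse2)
  then show ?thesis by (simp add: funpow_add assms(1) shifted_pow_0)
qed

lemma shifted_vfuns: "f \<in> vfuns G \<Longrightarrow> shifted_adjacency G q \<mu> f \<in> vfuns G"
  by (auto simp: vfuns_def shifted_adjacency_def adjacency_off)

lemma shifted_pow_vfuns: "f \<in> vfuns G \<Longrightarrow> (shifted_adjacency G q \<mu> ^^ n) f \<in> vfuns G"
  by (induction n) (simp_all add: shifted_vfuns)

end

context rooted_ends
begin

abbreviation sq :: complex where "sq \<equiv> complex_of_real (sqrt (real q))"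

lemma sq_sq: "sq * sq = of_nat q"
  using of_real_mult[of "sqrt (real q)" "sqrt (real q)", where 'a = complex] by simp

lemma sq_nz: "sq \<noteq> 0" using q_pos by simp

lemma adjacency_ext:
  assumes "v \<in> ext"
  shows "adjacency G f v = of_real (ratio v) * f (par v) + (\<Sum>e\<in>children v. of_real (wt e) * f (org G e))"
proof -
  have "adjacency G f v = (\<Sum>e\<in>insert (h v) (children v). of_real (wt e) * f (org G e))"
    unfolding adjacency_def in_arcs_ext(1)[OF assms, symmetric] by (rule sum.cong) auto
  then show ?thesis
    unfolding sum.insert[OF finite_children in_arcs_ext(2)[OF assms]] wt_h[OF assms] par_def .
qed

lemma adjp_ext:
  assumes "v \<in> ext"
  shows "adjp W v = smult (of_real (ratio v)) (W (par v)) + (\<Sum>e\<in>children v. smult (of_real (wt e)) (W (org G e)))"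
proof -
  have "adjp W v = (\<Sum>e\<in>insert (h v) (children v). smult (of_real (wt e)) (W (org G e)))"
    unfolding adjp_def in_arcs_ext(1)[OF assms, symmetric] by (rule sum.cong) auto
  then show ?thesis
    unfolding sum.insert[OF finite_children in_arcs_ext(2)[OF assms]] wt_h[OF assms] par_def .
qed

lemma csum_wt_children:
  assumes "v \<in> ext"
  shows "(\<Sum>e\<in>children v. complex_of_real (wt e)) = of_nat q / of_real (ratio v)"
  using arg_cong[OF sum_wt_children[OF assms], of complex_of_real] by simp

text \<open>
  The factor by which an outgoing function of constant type is multiplied on the way from the parent to \<open>v\<close>:
  \<open>1 / (\<mu> \<surd>q)\<close> in a funnel and \<open>\<surd>q / \<mu>\<close> in a cusp.
\<close>

definition kap :: "complex \<Rightarrow> 'v \<Rightarrow> complex" where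
  "kap \<mu> v = of_real (ratio v) / (sq * \<mu>)"

lemma kap_nz: "v \<in> ext \<Longrightarrow> \<mu> \<noteq> 0 \<Longrightarrow> kap \<mu> v \<noteq> 0"
  using ratio_pos(2)[of v] sq_nz by (simp add: kap_def)

lemma kap_ratio: "v \<in> ext \<Longrightarrow> \<mu> \<noteq> 0 \<Longrightarrow> kap \<mu> v * of_nat q / of_real (ratio v) = sq / \<mu>"
  using ratio_pos(2)[of v] sq_nz by (simp add: kap_def field_simps flip: sq_sq)

lemma kap_desc: "w \<in> desc v \<Longrightarrow> v \<in> ext \<Longrightarrow> kap \<mu> w = kap \<mu> v"
  by (simp add: kap_def ratio_desc)

text \<open>Purely outgoing functions, indexed by the top vertex of each component instead of by
  exterior pieces. As \<open>kap \<mu> \<rho>\<close> depends on \<open>\<rho>\<close> only through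
  its ratio, one formula covers funnels and cusps; \<open>purely_outgoing_iff\<close> makes the
  identification.\<close>

definition outg :: "'v set \<Rightarrow> complex \<Rightarrow> ('v \<Rightarrow> complex) \<Rightarrow> bool" where
  "outg K \<mu> f \<longleftrightarrow> f \<in> vfuns G \<and>
     (\<forall>\<rho>\<in>roots K. \<exists>p. \<forall>v\<in>desc \<rho>. f v = poly p (of_nat (gd v)) * kap \<mu> \<rho> ^ gd v)"

definition outg_const :: "'v set \<Rightarrow> complex \<Rightarrow> ('v \<Rightarrow> complex) \<Rightarrow> bool" where
  "outg_const K \<mu> f \<longleftrightarrow> f \<in> vfuns G \<and>
     (\<forall>\<rho>\<in>roots K. \<exists>c. \<forall>v\<in>desc \<rho>. f v = c * kap \<mu> \<rho> ^ gd v)"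

lemma roots_mono:
  assumes "good K" "good K'" "K \<subseteq> K'" "\<rho>' \<in> roots K'"
  obtains \<rho> where "\<rho> \<in> roots K" "\<rho>' \<in> desc \<rho>" "desc \<rho>' \<subseteq> desc \<rho>" "\<And>\<mu>. kap \<mu> \<rho>' = kap \<mu> \<rho>"
proof -
  have "\<rho>' \<in> gverts G" "\<rho>' \<notin> K" using assms(3) rootsD[OF assms(4)] ext_in by auto
  then obtain \<rho> where "\<rho> \<in> roots K" "\<rho>' \<in> desc \<rho>" using desc_of_root[OF assms(1)] by blast
  then show ?thesis using that desc_trans kap_desc rootsD by blast
qed

lemma outg_mono:
  assumes "good K" "good K'" "K \<subseteq> K'" "outg K \<mu> f"
  shows "outg K' \<mu> f"
  unfolding outg_def
proof (intro conjI ballI)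
  show "f \<in> vfuns G" using assms(4) by (simp add: outg_def)
  fix \<rho>' assume "\<rho>' \<in> roots K'"
  from roots_mono[OF assms(1-3) this] obtain \<rho> where r: "\<rho> \<in> roots K" "desc \<rho>' \<subseteq> desc \<rho>" "kap \<mu> \<rho>' = kap \<mu> \<rho>"
    by metis
  then obtain p where "\<forall>v\<in>desc \<rho>. f v = poly p (of_nat (gd v)) * kap \<mu> \<rho> ^ gd v"
    using assms(4) r(1) unfolding outg_def by blast
  then show "\<exists>p. \<forall>v\<in>desc \<rho>'. f v = poly p (of_nat (gd v)) * kap \<mu> \<rho>' ^ gd v"
    using r by (intro exI[of _ p]) auto
qed

lemma outg_const_mono:
  assumes "good K" "good K'" "K \<subseteq> K'" "outg_const K \<mu> f"
  shows "outg_const K' \<mu> f"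
  unfolding outg_const_def
proof (intro conjI ballI)
  show "f \<in> vfuns G" using assms(4) by (simp add: outg_const_def)
  fix \<rho>' assume "\<rho>' \<in> roots K'"
  from roots_mono[OF assms(1-3) this] obtain \<rho> where r: "\<rho> \<in> roots K" "desc \<rho>' \<subseteq> desc \<rho>" "kap \<mu> \<rho>' = kap \<mu> \<rho>"
    by metis
  then obtain p where "\<forall>v\<in>desc \<rho>. f v = p * kap \<mu> \<rho> ^ gd v"
    using assms(4) r(1) unfolding outg_const_def by blast
  then show "\<exists>p. \<forall>v\<in>desc \<rho>'. f v = p * kap \<mu> \<rho>' ^ gd v"
    using r by (intro exI[of _ p]) auto
qed

lemma outg_lin:
  assumes "outg K \<mu> f" "outg K \<mu> g"
  shows "outg K \<mu> (\<lambda>v. a * f v + b * g v)"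
  unfolding outg_def
proof (intro conjI ballI)
  show "(\<lambda>v. a * f v + b * g v) \<in> vfuns G" using assms by (auto simp: outg_def vfuns_def)
  fix \<rho> assume "\<rho> \<in> roots K"
  then obtain p p' where "\<forall>v\<in>desc \<rho>. f v = poly p (of_nat (gd v)) * kap \<mu> \<rho> ^ gd v"
    "\<forall>v\<in>desc \<rho>. g v = poly p' (of_nat (gd v)) * kap \<mu> \<rho> ^ gd v"
    using assms unfolding outg_def by blast
  then show "\<exists>p. \<forall>v\<in>desc \<rho>. a * f v + b * g v = poly p (of_nat (gd v)) * kap \<mu> \<rho> ^ gd v"
    by (intro exI[of _ "smult a p + smult b p'"]) (simp add: algebra_simps)
qed

lemma outg_const_lin:
  assumes "outg_const K \<mu> f" "outg_const K \<mu> g"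
  shows "outg_const K \<mu> (\<lambda>v. a * f v + b * g v)"
  unfolding outg_const_def
proof (intro conjI ballI)
  show "(\<lambda>v. a * f v + b * g v) \<in> vfuns G" using assms by (auto simp: outg_const_def vfuns_def)
  fix \<rho> assume "\<rho> \<in> roots K"
  then obtain p p' where "\<forall>v\<in>desc \<rho>. f v = p * kap \<mu> \<rho> ^ gd v"
    "\<forall>v\<in>desc \<rho>. g v = p' * kap \<mu> \<rho> ^ gd v"
    using assms unfolding outg_const_def by blast
  then show "\<exists>p. \<forall>v\<in>desc \<rho>. a * f v + b * g v = p * kap \<mu> \<rho> ^ gd v"
    by (intro exI[of _ "a * p + b * p'"]) (simp add: algebra_simps)
qed

lemma gd_child: "v \<in> ext \<Longrightarrow> e \<in> children v \<Longrightarrow> gd (org G e) = Suc (gd v)"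
  using child(3,4) gd_par by metis

text \<open>The parent and the children of \<open>v\<close> sit at distances \<open>gd v - 1\<close>
  and \<open>gd v + 1\<close>, so the polynomial is replaced by a combination of itself and its two
  shifts. A layer is lost because at the top of a component the parent lies in
  \<open>K\<close>.\<close>

lemma outg_shifted:
  assumes "good K" "outg K \<mu> f" "\<mu> \<noteq> 0"
  shows "outg (layer K) \<mu> (shifted_adjacency G q \<mu>' f)"
  unfolding outg_def
proof (intro conjI ballI)
  show "shifted_adjacency G q \<mu>' f \<in> vfuns G" using assms by (simp add: outg_def shifted_vfuns)
  fix \<rho>' assume r': "\<rho>' \<in> roots (layer K)"
  from roots_mono[OF assms(1) good_layer[OF assms(1)] this] obtain \<rho>
    where r: "\<rho> \<in> roots K" "\<rho>' \<in> desc \<rho>" "desc \<rho>' \<subseteq> desc \<rho>" "kap \<mu> \<rho>' = kap \<mu> \<rho>"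
    by metis
  then obtain p where p: "\<And>v. v \<in> desc \<rho> \<Longrightarrow> f v = poly p (of_nat (gd v)) * kap \<mu> \<rho> ^ gd v"
    using assms(2) unfolding outg_def by blast
  define k where "k = kap \<mu> \<rho>"
  have k: "k \<noteq> 0" using kap_nz rootsD(1)[OF r(1)] assms(3) by (simp add: k_def)
  \<comment> \<open>The shift by -1 comes from the parent, the shift by 1 from the children, whose
    total weight is \<open>q / ratio \<rho>\<close>.\<close>
  define P where "P = smult (1 / (2 * sq)) (smult (of_real (ratio \<rho>) / k) (pcompose p [:-1, 1:])
      + smult (of_nat q / of_real (ratio \<rho>) * k) (pcompose p [:1, 1:])) - smult (zpar \<mu>') p"
  have "shifted_adjacency G q \<mu>' f v = poly P (of_nat (gd v)) * k ^ gd v" if v: "v \<in> desc \<rho>'" for v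
  proof -
    have vr: "v \<in> desc \<rho>" using v r(3) by blast
    have ve: "v \<in> ext" using vr desc_subset rootsD(1)[OF r(1)] by blast
    have "\<rho>' \<notin> K" "par \<rho>' \<notin> K" using layer_notin[OF assms(1) _ rootsD(2)[OF r']] rootsD(1)[OF r'] ext_in by auto
    then have "par v \<notin> K" using desc_cases[OF v] desc_disjoint[OF assms(1), of \<rho>'] by blast
    then have pv: "par v \<in> desc \<rho>" using desc_cases[OF vr] rootsD(3)[OF r(1)] by auto
    have fp: "f (par v) = poly p (of_nat (gd v) - 1) * k ^ gd v / k"
      using p[OF pv] gd_par[OF ve] k by (simp add: k_def)
    have fc: "f (org G e) = poly p (of_nat (gd v) + 1) * k ^ gd v * k" if "e \<in> children v" for e
      using p[OF child_desc[OF ve vr that]] gd_child[OF ve that] by (simp add: k_def add.commute)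
    have "(\<Sum>e\<in>children v. of_real (wt e) * f (org G e))
        = (\<Sum>e\<in>children v. of_real (wt e)) * (poly p (of_nat (gd v) + 1) * k ^ gd v * k)"
      unfolding sum_distrib_right by (rule sum.cong) (auto simp: fc)
    then have "adjacency G f v = of_real (ratio \<rho>) * (poly p (of_nat (gd v) - 1) * k ^ gd v / k)
        + of_nat q / of_real (ratio \<rho>) * (poly p (of_nat (gd v) + 1) * k ^ gd v * k)"
      unfolding adjacency_ext[OF ve] csum_wt_children[OF ve] ratio_desc[OF vr rootsD(1)[OF r(1)]] fp by simp
    then show ?thesis
      unfolding shifted_adjacency_def P_def p[OF vr] k_def[symmetric]
      by (simp add: poly_pcompose field_simps)
  qed
  then show "\<exists>p. \<forall>v\<in>desc \<rho>'. shifted_adjacency G q \<mu>' f v = poly p (of_nat (gd v)) * kap \<mu> \<rho>' ^ gd v"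
    unfolding r(4) k_def by blast
qed

text \<open>Every application costs one layer. A single \<open>K'\<close> serves all powers because
  outgoing functions stay outgoing on larger good sets.\<close>

lemma outg_shifted_pow:
  assumes "good K" "outg K \<mu> f" "\<mu> \<noteq> 0"
  shows "\<exists>K'. good K' \<and> K \<subseteq> K' \<and> (\<forall>k\<le>n. outg K' \<mu> ((shifted_adjacency G q \<mu>' ^^ k) f))"
proof (induction n)
  case 0
  then show ?case using assms by auto
next
  case (Suc n)
  then obtain K' where K': "good K'" "K \<subseteq> K'" "\<And>k. k \<le> n \<Longrightarrow> outg K' \<mu> ((shifted_adjacency G q \<mu>' ^^ k) f)" by blast
  have "outg (layer K') \<mu> ((shifted_adjacency G q \<mu>' ^^ k) f)" if "k \<le> Suc n" for k
  proof (cases "k \<le> n")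
    case True
    then show ?thesis using outg_mono[OF K'(1) good_layer[OF K'(1)]] K'(3) by blast
  next
    case False
    then have "k = Suc n" using that by simp
    then show ?thesis using outg_shifted[OF K'(1) K'(3)[of n] assms(3)] by simp
  qed
  then show ?case using good_layer[OF K'(1)] K'(2) by blast
qed

section \<open>Jets\<close>

definition Mu :: "complex \<Rightarrow> complex poly" where "Mu \<mu> = [:\<mu>, 1:]"

text \<open>
  The eigenvalue equation and the outgoing recursion at \<open>\<mu> + t\<close>, multiplied by \<open>2 \<surd>q (\<mu> + t)\<close> and
  \<open>\<surd>q (\<mu> + t)\<close> to make them polynomial in \<open>t\<close>.
\<close>

definition jetD :: "complex \<Rightarrow> ('v \<Rightarrow> complex poly) \<Rightarrow> 'v \<Rightarrow> complex poly" where
  "jetD \<mu> W v = Mu \<mu> * adjp W v - smult sq ((Mu \<mu> ^ 2 + 1) * W v)"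

definition jetE :: "complex \<Rightarrow> ('v \<Rightarrow> complex poly) \<Rightarrow> 'v \<Rightarrow> complex poly" where
  "jetE \<mu> W v = smult sq (Mu \<mu> * W v) - smult (of_real (ratio v)) (W (par v))"

definition jet :: "'v set \<Rightarrow> complex \<Rightarrow> nat \<Rightarrow> ('v \<Rightarrow> complex poly) \<Rightarrow> bool" where
  "jet K \<mu> J W \<longleftrightarrow> (\<forall>v. v \<notin> gverts G \<longrightarrow> W v = 0) \<and>
     (\<forall>v\<in>gverts G. monom 1 J dvd jetD \<mu> W v) \<and>
     (\<forall>v\<in>ext - K. monom 1 J dvd jetE \<mu> W v)"

text \<open>The coefficient of order \<open>i\<close> of \<open>t ^ k * W v\<close>. The case
  distinction guards the truncated subtraction.\<close>

definition lower :: "nat \<Rightarrow> ('v \<Rightarrow> complex poly) \<Rightarrow> nat \<Rightarrow> 'v \<Rightarrow> complex" where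
  "lower k W i v = (if i < k then 0 else coeff (W v) (i - k))"

lemma coeff_Mu_mult: "coeff (Mu \<mu> * p) i = \<mu> * coeff p i + (if i < 1 then 0 else coeff p (i - 1))"
  by (cases i) (simp_all add: Mu_def coeff_pCons)

lemma coeff_Mu2_mult: "coeff ((Mu \<mu> ^ 2 + 1) * p) i = (\<mu>\<^sup>2 + 1) * coeff p i +
    2 * \<mu> * (if i < 1 then 0 else coeff p (i - 1)) + (if i < 2 then 0 else coeff p (i - 2))"
proof -
  have "(Mu \<mu> ^ 2 + 1) * p = Mu \<mu> * (Mu \<mu> * p) + p" by (simp add: algebra_simps power2_eq_square)
  then have "coeff ((Mu \<mu> ^ 2 + 1) * p) i = \<mu> * coeff (Mu \<mu> * p) i +
      (if i < 1 then 0 else coeff (Mu \<mu> * p) (i - 1)) + coeff p i"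
    by (simp only: coeff_add coeff_Mu_mult[of \<mu> "Mu \<mu> * p"])
  then show ?thesis unfolding coeff_Mu_mult[of \<mu> p]
    by (cases i; cases "i - 1") (auto simp: algebra_simps power2_eq_square numeral_2_eq_2)
qed

text \<open>The \<open>t\<close> in \<open>\<mu> + t\<close> brings in the coefficient one order
  lower, as an inhomogeneity of the recursion.\<close>

lemma jetE_coeff:
  assumes "jet K \<mu> J W" "i < J" "v \<in> ext" "v \<notin> K" "\<mu> \<noteq> 0"
  shows "coeff (W v) i = kap \<mu> v * coeff (W (par v)) i - lower 1 W i v / \<mu>"
proof -
  have "coeff (jetE \<mu> W v) i = 0"
    using assms(1-4) monom_1_dvd_coeff unfolding jet_def by blast
  then have "sq * (\<mu> * coeff (W v) i + lower 1 W i v) = of_real (ratio v) * coeff (W (par v)) i"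
    by (simp add: jetE_def coeff_Mu_mult lower_def del: One_nat_def)
  then show ?thesis using sq_nz assms(5) by (simp add: kap_def field_simps del: mult_cancel_left mult_cancel_right)
qed

text \<open>Coefficient comparison in \<open>jetD\<close>, divided by \<open>sq\<close>, with
  \<open>2 * \<mu> * zpar \<mu> = \<mu>\<^sup>2 + 1\<close>. The factor
  \<open>\<mu> - 1 / \<mu>\<close> is \<open>2 * \<mu>\<close> times the derivative of
  \<open>zpar\<close>, so it vanishes exactly at 1 and -1.\<close>

lemma jetD_coeff:
  assumes "jet K \<mu> J W" "i < J" "\<mu> \<noteq> 0"
  shows "2 * \<mu> * shifted_adjacency G q \<mu> (\<lambda>v. coeff (W v) i) v =
    - 2 * shifted_adjacency G q \<mu> (lower 1 W i) v + (\<mu> - 1 / \<mu>) * lower 1 W i v + lower 2 W i v"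
proof (cases "v \<in> gverts G")
  case True
  let ?A = "\<lambda>f. adjacency G f v"
  have low: "lower 1 (adjp W) i v = ?A (lower 1 W i)"
    by (auto simp: lower_def[abs_def] coeff_adjp) (simp add: adjacency_def)
  have "coeff (jetD \<mu> W v) i = 0"
    using assms(1,2) True monom_1_dvd_coeff unfolding jet_def by blast
  then have eq: "\<mu> * ?A (\<lambda>v. coeff (W v) i) + ?A (lower 1 W i) = sq * ((\<mu>\<^sup>2 + 1) * coeff (W v) i
     + 2 * \<mu> * lower 1 W i v + lower 2 W i v)"
    unfolding jetD_def coeff_diff coeff_smult coeff_Mu_mult[of _ "adjp W v"] coeff_Mu2_mult lower_def[symmetric] low
    unfolding coeff_adjp by simp
  have A1: "?A f = 2 * sq * (shifted_adjacency G q \<mu> f v + zpar \<mu> * f v)" for f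
    using sq_nz by (simp add: shifted_adjacency_def field_simps)
  have z: "2 * \<mu> * zpar \<mu> = \<mu>\<^sup>2 + 1" using assms(3) by (simp add: zpar_def field_simps power2_eq_square)
  have z2: "2 * zpar \<mu> = \<mu> + 1 / \<mu>" using assms(3) by (simp add: zpar_def field_simps)
  let ?B = "\<lambda>f. shifted_adjacency G q \<mu> f v" and ?c = "\<lambda>v. coeff (W v) i" and ?l = "lower 1 W i"
  have "sq * (2 * \<mu> * ?B ?c + (2 * \<mu> * zpar \<mu>) * ?c v + 2 * ?B ?l + (2 * zpar \<mu>) * ?l v) =
     sq * ((\<mu>\<^sup>2 + 1) * coeff (W v) i + 2 * \<mu> * ?l v + lower 2 W i v)"
    using eq unfolding A1 by (simp add: algebra_simps)
  then have "2 * \<mu> * ?B ?c + (2 * \<mu> * zpar \<mu>) * ?c v + 2 * ?B ?l + (2 * zpar \<mu>) * ?l v =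
     (\<mu>\<^sup>2 + 1) * coeff (W v) i + 2 * \<mu> * ?l v + lower 2 W i v" using sq_nz by simp
  then show ?thesis unfolding z z2 by (simp add: algebra_simps)
next
  case False
  then have "W v = 0" using assms(1) by (simp add: jet_def)
  then show ?thesis using False by (simp add: shifted_adjacency_def adjacency_off lower_def)
qed

text \<open>By \<open>jetD_coeff\<close> the shifted operator turns the coefficient of order
  \<open>i\<close> into a combination of those of orders \<open>i - 1\<close> and
  \<open>i - 2\<close> and the image of the former. Each order therefore costs one more
  power.\<close>

lemma jet_coeff_killed:
  assumes "jet K \<mu> J W" "i < J" "\<mu> \<noteq> 0"
  shows "(shifted_adjacency G q \<mu> ^^ Suc i) (\<lambda>v. coeff (W v) i) = (\<lambda>_. 0)"
  using assms(2)
proof (induction i rule: less_induct)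
  case (less i)
  let ?B = "shifted_adjacency G q \<mu>"
  have Bc: "?B (\<lambda>v. coeff (W v) i) = (\<lambda>v. 1 * ((- 1 / \<mu>) * ?B (lower 1 W i) v + ((\<mu> - 1 / \<mu>) / (2 * \<mu>)) * lower 1 W i v)
      + (1 / (2 * \<mu>)) * lower 2 W i v)"
  proof
    fix v
    have alg: "X = 1 * ((- 1 / \<mu>) * b + (c / (2 * \<mu>)) * l) + (1 / (2 * \<mu>)) * l2"
      if "2 * \<mu> * X = - 2 * b + c * l + l2" for X b c l l2
    proof -
      have "X = (2 * \<mu> * X) / (2 * \<mu>)" using assms(3) by simp
      also have "\<dots> = (- 2 * b + c * l + l2) / (2 * \<mu>)" unfolding that ..
      finally show ?thesis using assms(3) by (simp add: add_divide_distrib diff_divide_distrib)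
    qed
    show "?B (\<lambda>v. coeff (W v) i) v = 1 * ((- 1 / \<mu>) * ?B (lower 1 W i) v + ((\<mu> - 1 / \<mu>) / (2 * \<mu>)) * lower 1 W i v)
      + (1 / (2 * \<mu>)) * lower 2 W i v"
      by (rule alg, rule jetD_coeff[OF assms(1) less(2) assms(3)])
  qed
  have l1: "(?B ^^ i) (lower 1 W i) = (\<lambda>_. 0)"
  proof (cases i)
    case 0
    then show ?thesis by (simp add: lower_def[abs_def])
  next
    case (Suc j)
    then show ?thesis using less(1)[of j] less(2) by (simp add: lower_def[abs_def])
  qed
  have l2: "(?B ^^ i) (lower 2 W i) = (\<lambda>_. 0)"
  proof (cases "i < 2")
    case True
    then show ?thesis by (simp add: lower_def[abs_def] shifted_pow_0)
  next
    case False
    then have "(?B ^^ Suc (i - 2)) (lower 2 W i) = (\<lambda>_. 0)"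
      using less(1)[of "i - 2"] less(2) by (simp add: lower_def[abs_def])
    then show ?thesis by (rule shifted_pow_mono) (use False in linarith)
  qed
  have l3: "(?B ^^ i) (?B (lower 1 W i)) = (\<lambda>_. 0)"
    using shifted_pow_mono[OF l1, where m = "Suc i"] by (simp add: funpow_swap1)
  have "(?B ^^ i) (?B (\<lambda>v. coeff (W v) i)) = (\<lambda>_. 0)"
    unfolding Bc shifted_pow_lin l1 l2 l3 by simp
  then show ?case by (simp add: funpow_swap1)
qed

text \<open>After division by \<open>kap \<mu> \<rho> ^ gd v\<close>, the recursion of
  \<open>jetE_coeff\<close> prescribes the differences of consecutive generations as a polynomial in
  the distance. Summation gives a polynomial again, whose degree may rise with the order.\<close>

lemma jet_coeff_outg:
  assumes "good K" "jet K \<mu> J W" "i < J" "\<mu> \<noteq> 0"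
  shows "outg K \<mu> (\<lambda>v. coeff (W v) i)"
  using assms(3)
proof (induction i)
  have vf: "(\<lambda>v. coeff (W v) i) \<in> vfuns G" for i using assms(2) by (auto simp: jet_def vfuns_def)
  have main: "\<exists>p. \<forall>v\<in>desc \<rho>. coeff (W v) i = poly p (of_nat (gd v)) * kap \<mu> \<rho> ^ gd v"
    if r: "\<rho> \<in> roots K" and i: "i < J" and
      P': "\<And>v. v \<in> desc \<rho> \<Longrightarrow> lower 1 W i v = poly P' (of_nat (gd v)) * kap \<mu> \<rho> ^ gd v" for \<rho> P' i
  proof -
    \<comment> \<open>The inhomogeneity is evaluated at the child, one step further out than the
      parent, hence the argument \<open>x + 1\<close>.\<close>
    obtain P where P: "\<And>x. poly P (x + 1) - poly P x = - poly P' (x + 1) / \<mu>"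
      using poly_antidifference[of "smult (- 1 / \<mu>) (pcompose P' [:1, 1:])"]
      by (auto simp: poly_pcompose add.commute)
    have kn: "kap \<mu> \<rho> \<noteq> 0" using kap_nz rootsD(1)[OF r] assms(4) by blast
    \<comment> \<open>The constant of summation, fixed by the value at the top vertex.\<close>
    define c where "c = coeff (W \<rho>) i / kap \<mu> \<rho> ^ gd \<rho> - poly P (of_nat (gd \<rho>))"
    have "coeff (W v) i = poly (P + [:c:]) (of_nat (gd v)) * kap \<mu> \<rho> ^ gd v" if "v \<in> desc \<rho>" for v
      using that
    proof (induction rule: desc_induct)
      case root
      show ?case using kn by (simp add: c_def)
    next
      case (step w)
      have w: "w \<in> desc \<rho>" using step desc_step by blast
      have "w \<notin> K" using desc_disjoint[OF assms(1) rootsD(2)[OF r] w] .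
      from jetE_coeff[OF assms(2) i step(1) this assms(4)]
      have "coeff (W w) i = kap \<mu> \<rho> * (poly (P + [:c:]) (of_nat (gd (par w))) * kap \<mu> \<rho> ^ gd (par w))
        - poly P' (of_nat (gd (par w)) + 1) * kap \<mu> \<rho> ^ Suc (gd (par w)) / \<mu>"
        unfolding kap_desc[OF w rootsD(1)[OF r]] P'[OF w] step(3) gd_par[OF step(1)] by (simp add: add.commute)
      also have "\<dots> = kap \<mu> \<rho> ^ Suc (gd (par w)) * (c + (poly P (of_nat (gd (par w))) + (- poly P' (of_nat (gd (par w)) + 1) / \<mu>)))"
        by (simp add: algebra_simps)
      also have "\<dots> = kap \<mu> \<rho> ^ Suc (gd (par w)) * (c + poly P (of_nat (gd (par w)) + 1))"
        unfolding P[symmetric] by simp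
      finally show ?case unfolding gd_par[OF step(1)] by (simp add: algebra_simps)
    qed
    then show ?thesis by blast
  qed
  {
    case 0
    show ?case unfolding outg_def
    proof (intro conjI ballI vf)
      fix \<rho> assume r: "\<rho> \<in> roots K"
      show "\<exists>p. \<forall>v\<in>desc \<rho>. coeff (W v) 0 = poly p (of_nat (gd v)) * kap \<mu> \<rho> ^ gd v"
        by (rule main[OF r 0, of 0]) (simp add: lower_def)
    qed
  next
    case (Suc i)
    show ?case unfolding outg_def
    proof (intro conjI ballI vf)
      fix \<rho> assume r: "\<rho> \<in> roots K"
      have "outg K \<mu> (\<lambda>v. coeff (W v) i)" using Suc by simp
      then obtain P' where P': "\<forall>v\<in>desc \<rho>. coeff (W v) i = poly P' (of_nat (gd v)) * kap \<mu> \<rho> ^ gd v"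
        using r unfolding outg_def by blast
      show "\<exists>p. \<forall>v\<in>desc \<rho>. coeff (W v) (Suc i) = poly p (of_nat (gd v)) * kap \<mu> \<rho> ^ gd v"
      proof (rule main[OF r Suc(2)])
        show "lower 1 W (Suc i) v = poly P' (of_nat (gd v)) * kap \<mu> \<rho> ^ gd v" if "v \<in> desc \<rho>" for v
          using P' that by (simp add: lower_def)
      qed
    qed
  }
qed

end

section \<open>From outgoing functions to jets\<close>

lemma smult_sum2: "smult c (\<Sum>i\<in>A. f i) = (\<Sum>i\<in>A. smult c (f i))"
  by (induction A rule: infinite_finite_induct) (simp_all add: smult_add_right)

context rooted_ends
begin

definition Yp :: "complex \<Rightarrow> complex poly" where "Yp \<mu> = [:0, (\<mu> - 1 / \<mu>) / 2, 1 / 2:]"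

text \<open>
  By \<open>Mu2_Yp\<close> below, \<open>z(\<mu> + t) - z(\<mu>) = Yp / (\<mu> + t)\<close>, so up to the factor \<open>(\<mu> + t)\<^sup>J\<^sup>-\<^sup>1\<close> this is the
  telescoping sum whose image under \<open>B - (z(\<mu> + t) - z(\<mu>))\<close> is \<open>B\<^sup>J u - (z(\<mu> + t) - z(\<mu>))\<^sup>J u\<close>,
  where \<open>B\<close> is the shifted adjacency operator at \<open>\<mu>\<close>.
\<close>

definition jetW :: "complex \<Rightarrow> nat \<Rightarrow> ('v \<Rightarrow> complex) \<Rightarrow> 'v \<Rightarrow> complex poly" where
  "jetW \<mu> J u v = (\<Sum>k<J. smult ((shifted_adjacency G q \<mu> ^^ k) u v) (Mu \<mu> ^ k * Yp \<mu> ^ (J - 1 - k)))"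

lemma Mu2_Yp: "\<mu> \<noteq> 0 \<Longrightarrow> Mu \<mu> ^ 2 + 1 = smult (2 * zpar \<mu>) (Mu \<mu>) + smult 2 (Yp \<mu>)"
  by (simp add: Mu_def Yp_def zpar_def power2_eq_square field_simps one_pCons)

lemma monom_dvd_Yp_pow: "monom 1 J dvd Yp \<mu> ^ J"
proof -
  have "Yp \<mu> = monom 1 1 * [:(\<mu> - 1 / \<mu>) / 2, 1 / 2:]"
    by (simp add: Yp_def monom_altdef)
  then have "monom 1 1 dvd Yp \<mu>" by (rule dvdI)
  then have "monom 1 1 ^ J dvd Yp \<mu> ^ J" by (rule dvd_power_same)
  then show ?thesis by (simp add: monom_power)
qed

lemma adjacency_shifted: "adjacency G f v = 2 * sq * (shifted_adjacency G q \<mu> f v + zpar \<mu> * f v)"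
  using sq_nz by (simp add: shifted_adjacency_def field_simps)

lemma adjp_sum: "adjp (\<lambda>v. \<Sum>k\<in>A. smult (f k v) (N k)) v = (\<Sum>k\<in>A. smult (adjacency G (f k) v) (N k))"
proof -
  have "adjp (\<lambda>v. \<Sum>k\<in>A. smult (f k v) (N k)) v =
    (\<Sum>e\<in>{e \<in> garcs G. ter G e = v}. \<Sum>k\<in>A.
      smult (of_real (real (vsize G v) / real (esize G e)) * f k (org G e)) (N k))"
    by (simp add: adjp_def smult_sum2)
  also have "\<dots> = (\<Sum>k\<in>A. smult (adjacency G (f k) v) (N k))"
    by (subst sum.swap) (simp add: adjacency_def smult_sum)
  finally show ?thesis .
qed

text \<open>Both ends of the telescope are harmless: the upper one contains the power of the shifted
  operator that kills \<open>u\<close>, the lower one the factor \<open>Yp \<mu> ^ J\<close>, which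
  is divisible by \<open>t ^ J\<close>.\<close>

lemma jetD_jetW:
  assumes "(shifted_adjacency G q \<mu> ^^ J) u = (\<lambda>_. 0)" "\<mu> \<noteq> 0"
  shows "monom 1 J dvd jetD \<mu> (jetW \<mu> J u) v"
proof -
  let ?B = "shifted_adjacency G q \<mu>"
  define N where "N k = Mu \<mu> ^ k * Yp \<mu> ^ (J - 1 - k)" for k
  define T where "T k = smult ((?B ^^ k) u v) (Mu \<mu> ^ k * Yp \<mu> ^ (J - k))" for k
  have W: "jetW \<mu> J u = (\<lambda>v. \<Sum>k<J. smult ((?B ^^ k) u v) (N k))"
    by (simp add: jetW_def N_def fun_eq_iff)
  have "jetD \<mu> (jetW \<mu> J u) v = (\<Sum>k<J. smult (2 * sq) (T (Suc k) - T k))"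
    unfolding jetD_def W adjp_sum sum_distrib_left smult_sum2 sum_subtractf[symmetric]
  proof (rule sum.cong[OF refl])
    fix k assume "k \<in> {..<J}"
    then have k: "J - k = Suc (J - 1 - k)" "J - Suc k = J - 1 - k" by auto
    show "Mu \<mu> * smult (adjacency G ((?B ^^ k) u) v) (N k) -
         smult sq ((Mu \<mu> ^ 2 + 1) * smult ((?B ^^ k) u v) (N k)) = smult (2 * sq) (T (Suc k) - T k)"
      unfolding Mu2_Yp[OF assms(2)] adjacency_shifted[of _ _ \<mu>] T_def N_def k
      by (simp add: algebra_simps smult_add_left smult_add_right smult_diff_right)
  qed
  also have "\<dots> = smult (2 * sq) (T J - T 0)"
    unfolding smult_sum2[symmetric] sum_lessThan_telescope ..
  also have "\<dots> = smult (- 2 * sq * u v) (Yp \<mu> ^ J)"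
    using assms(1) by (simp add: T_def)
  finally show ?thesis using monom_dvd_Yp_pow by (metis dvd_smult)
qed

text \<open>The factorisation of the eigenvalue equation on an end. The parent terms of all children
  add up to \<open>sq * sq * W v\<close>, which accounts for the 1 in
  \<open>Mu \<mu> ^ 2 + 1\<close>; the square is absorbed by
  \<open>Mu \<mu> * jetE \<mu> W v\<close>.\<close>

lemma jetE_children:
  assumes "v \<in> ext"
  shows "(\<Sum>e\<in>children v. smult (of_real (wt e)) (jetE \<mu> W (org G e))) =
    smult sq (jetD \<mu> W v) + smult sq (Mu \<mu> * jetE \<mu> W v)"
proof -
  let ?r = "complex_of_real (ratio v)"
  have r: "?r \<noteq> 0" using ratio_pos(2)[OF assms] by simp
  define S where "S = (\<Sum>e\<in>children v. smult (of_real (wt e)) (W (org G e)))"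
  have "(\<Sum>e\<in>children v. smult (of_real (wt e)) (jetE \<mu> W (org G e))) =
    (\<Sum>e\<in>children v. smult sq (Mu \<mu> * smult (of_real (wt e)) (W (org G e))) - smult (of_real (wt e)) (smult ?r (W v)))"
  proof (rule sum.cong[OF refl])
    fix e assume "e \<in> children v"
    then show "smult (of_real (wt e)) (jetE \<mu> W (org G e)) =
      smult sq (Mu \<mu> * smult (of_real (wt e)) (W (org G e))) - smult (of_real (wt e)) (smult ?r (W v))"
      using child(4,6)[OF assms] by (simp add: jetE_def smult_diff_right mult.commute)
  qed
  also have "\<dots> = smult sq (Mu \<mu> * S) - smult (\<Sum>e\<in>children v. of_real (wt e)) (smult ?r (W v))"
    by (simp only: S_def sum_subtractf smult_sum2 sum_distrib_left smult_sum)
  also have "\<dots> = smult sq (Mu \<mu> * S) - smult (sq * sq) (W v)"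
    unfolding csum_wt_children[OF assms] using r by (simp add: sq_sq)
  also have "S = adjp W v - smult ?r (W (par v))"
    by (simp add: S_def adjp_ext[OF assms])
  finally have eq: "(\<Sum>e\<in>children v. smult (of_real (wt e)) (jetE \<mu> W (org G e))) =
    smult sq (Mu \<mu> * (adjp W v - smult ?r (W (par v)))) - smult (sq * sq) (W v)" .
  have D: "Mu \<mu> * adjp W v = jetD \<mu> W v + smult sq ((Mu \<mu> ^ 2 + 1) * W v)" by (simp add: jetD_def)
  show ?thesis unfolding eq right_diff_distrib D
    by (simp add: jetE_def algebra_simps smult_add_right smult_diff_right power2_eq_square)
qed

text \<open>The children of a vertex have positive total weight, so no end stops. Polynomial
  identities along an end are thus tested at infinitely many distances.\<close>

lemma desc_every_depth:
  assumes "\<rho> \<in> ext" "n \<ge> gd \<rho>"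
  obtains v where "v \<in> desc \<rho>" "gd v = n"
proof -
  have "\<exists>v\<in>desc \<rho>. gd v = gd \<rho> + k" for k
  proof (induction k)
    case 0
    then show ?case by (intro bexI[of _ \<rho>]) auto
  next
    case (Suc k)
    then obtain v where v: "v \<in> desc \<rho>" "gd v = gd \<rho> + k" by blast
    have ve: "v \<in> ext" using v desc_subset assms by blast
    have "(\<Sum>e\<in>children v. wt e) > 0"
      unfolding sum_wt_children[OF ve] using ratio_pos(2)[OF ve] q_pos by simp
    then have "children v \<noteq> {}" by auto
    then obtain e where "e \<in> children v" by blast
    then show ?case using child_desc[OF ve v(1)] gd_child[OF ve] v(2)
      by (intro bexI[of _ "org G e"]) auto
  qed
  from this[of "n - gd \<rho>"] show ?thesis using that assms(2) by auto
qed

lemma sum_wt_depth: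
  assumes "v \<in> ext" "\<And>e. e \<in> children v \<Longrightarrow> F (org G e) = c"
  shows "(\<Sum>e\<in>children v. of_real (wt e) * F (org G e)) = of_nat q / of_real (ratio v) * (c :: complex)"
proof -
  have "(\<Sum>e\<in>children v. of_real (wt e) * F (org G e)) = (\<Sum>e\<in>children v. of_real (wt e)) * c"
    unfolding sum_distrib_right using assms(2) by (intro sum.cong) auto
  then show ?thesis unfolding csum_wt_children[OF assms(1)] .
qed

text \<open>Only the eigenvalue part of a jet holds by construction. For the recursion, all powers
  of the shifted operator keep \<open>u\<close> outgoing, so each coefficient of the defect
  \<open>jetE\<close> is a polynomial in the distance times a power of
  \<open>kap \<mu> \<rho>\<close>. By \<open>jetE_children\<close> a shift by one multiplies this
  polynomial by \<open>\<mu>\<^sup>2\<close>, which forces it to be zero.\<close>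

lemma outgoing_imp_jet:
  assumes K: "good K" and u: "outg K \<mu> u" and killed: "(shifted_adjacency G q \<mu> ^^ J) u = (\<lambda>_. 0)"
    and mu: "\<mu> \<noteq> 0" "\<mu> \<noteq> 1" "\<mu> \<noteq> -1"
  shows "\<exists>K'. good K' \<and> jet K' \<mu> J (jetW \<mu> J u)"
proof -
  let ?B = "shifted_adjacency G q \<mu>" and ?W = "jetW \<mu> J u"
  obtain K1 where K1: "good K1" "\<And>k. k \<le> J \<Longrightarrow> outg K1 \<mu> ((?B ^^ k) u)"
    using outg_shifted_pow[OF K u mu(1)] by blast
  define N where "N k = Mu \<mu> ^ k * Yp \<mu> ^ (J - 1 - k)" for k
  have W: "?W v = (\<Sum>k<J. smult ((?B ^^ k) u v) (N k))" for v
    by (simp add: jetW_def N_def)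
  have E0: "coeff (jetE \<mu> ?W v) i = 0" if v: "v \<in> ext" "v \<notin> layer K1" and i: "i < J" for v i
  proof -
    obtain \<rho> where r: "\<rho> \<in> roots (layer K1)" "v \<in> desc \<rho>"
      using desc_of_root[OF good_layer(1)[OF K1(1)] ext_in[OF v(1)] v(2)] by blast
    note re = rootsD(1)[OF r(1)]
    obtain \<rho>' where r': "\<rho>' \<in> roots K1" "desc \<rho> \<subseteq> desc \<rho>'" "kap \<mu> \<rho> = kap \<mu> \<rho>'"
      using roots_mono[OF K1(1) good_layer[OF K1(1)] r(1)] by metis
    define k where "k = kap \<mu> \<rho>"
    have k: "k \<noteq> 0" using kap_nz re mu by (simp add: k_def)
    have "\<forall>j. \<exists>p. j < J \<longrightarrow> (\<forall>v\<in>desc \<rho>'. (?B ^^ j) u v = poly p (of_nat (gd v)) * k ^ gd v)"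
    proof
      fix j
      show "\<exists>p. j < J \<longrightarrow> (\<forall>v\<in>desc \<rho>'. (?B ^^ j) u v = poly p (of_nat (gd v)) * k ^ gd v)"
        using K1(2)[of j] r'(1) unfolding outg_def k_def r'(3) by (cases "j < J") auto
    qed
    then obtain P where P: "\<And>j v. j < J \<Longrightarrow> v \<in> desc \<rho>' \<Longrightarrow> (?B ^^ j) u v = poly (P j) (of_nat (gd v)) * k ^ gd v"
      by metis
    \<comment> \<open>The polynomial that describes the defect of order \<open>i\<close> on the
      component below \<open>\<rho>\<close>, once the power of \<open>k\<close> is split
      off.\<close>
    define ep where "ep i = (\<Sum>j<J. smult (sq * coeff (Mu \<mu> * N j) i) (P j)
      - smult (of_real (ratio \<rho>) / k * coeff (N j) i) (pcompose (P j) [:-1, 1:]))" for i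
    have ep: "coeff (jetE \<mu> ?W w) i = poly (ep i) (of_nat (gd w)) * k ^ gd w" if w: "w \<in> desc \<rho>" for w i
    proof -
      have we: "w \<in> ext" using w desc_subset re by blast
      have w': "w \<in> desc \<rho>'" using w r'(2) by blast
      have "\<rho> \<notin> K1" "par \<rho> \<notin> K1" using layer_notin[OF K1(1) ext_in[OF re] rootsD(2)[OF r(1)]] by auto
      then have "par w \<notin> K1" using desc_cases[OF w] desc_disjoint[OF K1(1), of \<rho>] by blast
      then have pw: "par w \<in> desc \<rho>'" using desc_cases[OF w'] rootsD(3)[OF r'(1)] by auto
      have 1: "coeff (Mu \<mu> * ?W w) i = (\<Sum>j<J. (?B ^^ j) u w * coeff (Mu \<mu> * N j) i)"
        unfolding W sum_distrib_left coeff_sum by (rule sum.cong) simp_all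
      have 2: "coeff (?W (par w)) i = (\<Sum>j<J. (?B ^^ j) u (par w) * coeff (N j) i)"
        unfolding W coeff_sum by (rule sum.cong) simp_all
      have "coeff (jetE \<mu> ?W w) i = (\<Sum>j<J. sq * ((?B ^^ j) u w * coeff (Mu \<mu> * N j) i)
          - of_real (ratio \<rho>) * ((?B ^^ j) u (par w) * coeff (N j) i))"
        unfolding jetE_def coeff_diff coeff_smult 1 2 sum_distrib_left sum_subtractf ratio_desc[OF w re] ..
      also have "\<dots> = (\<Sum>j<J. poly (smult (sq * coeff (Mu \<mu> * N j) i) (P j)
          - smult (of_real (ratio \<rho>) / k * coeff (N j) i) (pcompose (P j) [:-1, 1:])) (of_nat (gd w)) * k ^ gd w)"
      proof (rule sum.cong[OF refl])
        fix j assume "j \<in> {..<J}"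
        then have "(?B ^^ j) u w = poly (P j) (of_nat (gd w)) * k ^ gd w"
          "(?B ^^ j) u (par w) = poly (P j) (of_nat (gd w) - 1) * k ^ gd w / k"
          using P[OF _ w'] P[OF _ pw] k gd_par[OF we] by auto
        then show "sq * ((?B ^^ j) u w * coeff (Mu \<mu> * N j) i) - of_real (ratio \<rho>) * ((?B ^^ j) u (par w) * coeff (N j) i)
          = poly (smult (sq * coeff (Mu \<mu> * N j) i) (P j)
          - smult (of_real (ratio \<rho>) / k * coeff (N j) i) (pcompose (P j) [:-1, 1:])) (of_nat (gd w)) * k ^ gd w"
          by (simp add: poly_pcompose algebra_simps)
      qed
      also have "\<dots> = poly (ep i) (of_nat (gd w)) * k ^ gd w"
        by (simp add: ep_def poly_sum sum_distrib_right)
      finally show ?thesis .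
    qed
    have "ep i = 0" if "i < J" for i
      using that
    proof (induction i)
      \<comment> \<open>The factor \<open>\<mu> + t\<close> mixes in the defect of order
        \<open>i - 1\<close>, so the orders are treated upwards.\<close>
      have main: "ep i = 0" if i: "i < J" and prev: "i \<ge> 1 \<Longrightarrow> ep (i - 1) = 0" for i
      proof (rule poly_shift_eigen_imp_0)
        show "\<mu>\<^sup>2 \<noteq> 1" using mu by (simp add: power2_eq_1_iff)
        fix n assume "n \<ge> gd \<rho>"
        then obtain w where w: "w \<in> desc \<rho>" "gd w = n" using desc_every_depth re by blast
        have we: "w \<in> ext" using w desc_subset re by blast
        have ch: "coeff (jetE \<mu> ?W (org G e)) i = poly (ep i) (of_nat n + 1) * k ^ n * k" if "e \<in> children w" for e
          using ep[OF child_desc[OF we w(1) that]] gd_child[OF we that] w(2) by (simp add: add.commute)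
        have "(\<Sum>e\<in>children w. of_real (wt e) * coeff (jetE \<mu> ?W (org G e)) i) =
          coeff (\<Sum>e\<in>children w. smult (of_real (wt e)) (jetE \<mu> ?W (org G e))) i"
          by (simp add: coeff_sum)
        also have "\<dots> = sq * coeff (jetD \<mu> ?W w) i + sq * coeff (Mu \<mu> * jetE \<mu> ?W w) i"
          unfolding jetE_children[OF we] by simp
        also have "coeff (jetD \<mu> ?W w) i = 0"
          using jetD_jetW[OF killed mu(1)] i monom_1_dvd_coeff by blast
        also have "coeff (Mu \<mu> * jetE \<mu> ?W w) i = \<mu> * (poly (ep i) (of_nat n) * k ^ n)"
          unfolding coeff_Mu_mult ep[OF w(1)] w(2) using prev by auto
        also have "(\<Sum>e\<in>children w. of_real (wt e) * coeff (jetE \<mu> ?W (org G e)) i) =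
           of_nat q / of_real (ratio w) * (poly (ep i) (of_nat n + 1) * k ^ n * k)"
          by (rule sum_wt_depth[OF we]) (rule ch)
        finally have eq: "k ^ n * ((k * of_nat q / of_real (ratio w)) * poly (ep i) (of_nat n + 1)) =
          k ^ n * (sq * \<mu> * poly (ep i) (of_nat n))" by (simp add: field_simps)
        have "k ^ n \<noteq> 0" using k by simp
        from mult_left_cancel[OF this, THEN iffD1, OF eq]
        have "(k * of_nat q / of_real (ratio w)) * poly (ep i) (of_nat n + 1) = sq * \<mu> * poly (ep i) (of_nat n)" .
        \<comment> \<open>Passing to the children contributes \<open>sq / \<mu>\<close>, the other
          side is \<open>sq * \<mu>\<close>; their quotient is the eigenvalue
          \<open>\<mu>\<^sup>2\<close>.\<close>
        moreover have "k * of_nat q / of_real (ratio w) = sq / \<mu>"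
          using kap_ratio[OF re mu(1)] ratio_desc[OF w(1) re] by (simp add: k_def)
        ultimately show "poly (ep i) (of_nat n + 1) = \<mu>\<^sup>2 * poly (ep i) (of_nat n)"
          using sq_nz mu(1) by (simp add: field_simps power2_eq_square)
      qed
      {
        case 0
        then show ?case using main[of 0] by simp
      next
        case (Suc i)
        then show ?case using main[of "Suc i"] by simp
      }
    qed
    then show ?thesis using ep[OF r(2)] i by simp
  qed
  have "jet (layer K1) \<mu> J ?W"
    unfolding jet_def
  proof (intro conjI ballI allI impI)
    fix v assume "v \<notin> gverts G"
    moreover have "(?B ^^ k) u \<in> vfuns G" for k
      using u shifted_pow_vfuns by (auto simp: outg_def)
    ultimately show "?W v = 0" by (simp add: W vfuns_def)
  next
    fix v show "monom 1 J dvd jetD \<mu> ?W v" by (rule jetD_jetW[OF killed mu(1)])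
  next
    fix v assume "v \<in> ext - layer K1"
    then show "monom 1 J dvd jetE \<mu> ?W v" using E0 by (simp add: monom_1_dvd_iff')
  qed
  then show ?thesis using good_layer[OF K1(1)] by blast
qed

text \<open>Outside \<open>layer K\<close> a vertex and its parent lie in the same component and
  share its constant.\<close>

lemma outg_const_kap:
  assumes "good K" "outg_const K \<mu> u" "v \<in> ext" "v \<notin> layer K" "\<mu> \<noteq> 0"
  shows "u v = kap \<mu> v * u (par v)"
proof -
  note v = layer_notin[OF assms(1) ext_in[OF assms(3)] assms(4)]
  obtain \<rho> where r: "\<rho> \<in> roots K" "par v \<in> desc \<rho>"
    using desc_of_root[OF assms(1) par_in[OF assms(3)] v(2)] by blast
  then obtain c where "\<forall>w\<in>desc \<rho>. u w = c * kap \<mu> \<rho> ^ gd w"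
    using assms(2) unfolding outg_const_def by blast
  then show ?thesis
    using r(2) desc_step[OF assms(3) r(2)] gd_par[OF assms(3)] kap_desc[OF desc_step[OF assms(3) r(2)] rootsD(1)[OF r(1)]]
    by simp
qed

lemma outg_constI:
  assumes "good K" "u \<in> vfuns G" "\<And>v. v \<in> ext \<Longrightarrow> v \<notin> K \<Longrightarrow> u v = kap \<mu> v * u (par v)" "\<mu> \<noteq> 0"
  shows "outg_const K \<mu> u"
  unfolding outg_const_def
proof (intro conjI ballI)
  show "u \<in> vfuns G" by fact
  fix \<rho> assume r: "\<rho> \<in> roots K"
  note re = rootsD(1)[OF r]
  have k: "kap \<mu> \<rho> \<noteq> 0" using kap_nz re assms(4) by blast
  have "u v = (u \<rho> / kap \<mu> \<rho> ^ gd \<rho>) * kap \<mu> \<rho> ^ gd v" if "v \<in> desc \<rho>" for v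
    using that
  proof (induction rule: desc_induct)
    case root
    show ?case using k by simp
  next
    case (step w)
    have w: "w \<in> desc \<rho>" using step desc_step by blast
    have "w \<notin> K" using desc_disjoint[OF assms(1) rootsD(2)[OF r] w] .
    then show ?case using assms(3)[OF step(1)] step(3) gd_par[OF step(1)] kap_desc[OF w re] by simp
  qed
  then show "\<exists>c. \<forall>v\<in>desc \<rho>. u v = c * kap \<mu> \<rho> ^ gd v" by blast
qed

text \<open>At order one only the coefficient of \<open>t ^ 0\<close> is constrained, and for it
  constant type is the recursion itself. The argument therefore covers 1 and -1.\<close>

lemma eigen_const_imp_jet:
  assumes "good K" "outg_const K \<mu> u" "shifted_adjacency G q \<mu> u = (\<lambda>_. 0)" "\<mu> \<noteq> 0"
  shows "jet (layer K) \<mu> 1 (\<lambda>v. [:u v:])"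
proof -
  have "jetW \<mu> 1 u = (\<lambda>v. [:u v:])" by (auto simp: jetW_def)
  moreover have "coeff (jetE \<mu> (\<lambda>v. [:u v:]) v) 0 = 0" if "v \<in> ext" "v \<notin> layer K" for v
    using outg_const_kap[OF assms(1,2) that assms(4)] sq_nz assms(4)
    unfolding jetE_def coeff_diff coeff_smult coeff_Mu_mult by (simp add: kap_def)
  ultimately show ?thesis
    unfolding jet_def using assms(2) jetD_jetW[where J = 1 and u = u and \<mu> = \<mu>] assms(3,4)
    by (auto simp: outg_const_def vfuns_def monom_1_dvd_iff')
qed

end

section \<open>Outgoing functions and square summability\<close>

context graph_of_groups_with_boundary
begin

text \<open>One term of a sum of nonnegative terms is at most the sum. Evaluation at a vertex is
  thus bounded, which turns statements on norms into statements on single vertices.\<close>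

lemma wl2_bound:
  assumes "f \<in> wl2 G \<sigma>" "v \<in> gverts G" "\<sigma> v > 0"
  shows "cmod (f v) \<le> wl2_norm G \<sigma> f * (\<sigma> v * sqrt (real (vsize G v)))"
proof -
  let ?g = "\<lambda>v. (cmod (f v))\<^sup>2 / ((\<sigma> v)\<^sup>2 * real (vsize G v))"
  have "sum ?g {v} \<le> infsum ?g (gverts G)"
    using assms by (intro finite_sum_le_infsum) (auto simp: wl2_def)
  then have "sqrt (?g v) \<le> wl2_norm G \<sigma> f" unfolding wl2_norm_def by simp
  moreover have "sqrt (?g v) = cmod (f v) / (\<sigma> v * sqrt (real (vsize G v)))"
    using assms(3) by (simp add: real_sqrt_divide real_sqrt_mult)
  moreover have "\<sigma> v * sqrt (real (vsize G v)) > 0" using assms(3) vsize_pos[OF assms(2)] by simp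
  ultimately show ?thesis by (simp add: pos_divide_le_eq)
qed

lemma wl2_lin:
  assumes "f \<in> wl2 G \<sigma>" "g \<in> wl2 G \<sigma>"
  shows "(\<lambda>v. a * f v + b * g v) \<in> wl2 G \<sigma>"
proof -
  let ?w = "\<lambda>v. (\<sigma> v)\<^sup>2 * real (vsize G v)"
  have "(\<lambda>v. 2 * (cmod a)\<^sup>2 * ((cmod (f v))\<^sup>2 / ?w v) + 2 * (cmod b)\<^sup>2 * ((cmod (g v))\<^sup>2 / ?w v)) summable_on gverts G"
    using assms by (intro summable_on_add summable_on_cmult_right) (auto simp: wl2_def)
  moreover have "(cmod (a * f v + b * g v))\<^sup>2 / ?w v \<le>
      2 * (cmod a)\<^sup>2 * ((cmod (f v))\<^sup>2 / ?w v) + 2 * (cmod b)\<^sup>2 * ((cmod (g v))\<^sup>2 / ?w v)" for v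
  proof -
    have "(cmod (a * f v + b * g v))\<^sup>2 \<le> (cmod a * cmod (f v) + cmod b * cmod (g v))\<^sup>2"
      by (intro power_mono) (auto intro: order_trans[OF norm_triangle_ineq] simp: norm_mult)
    also have "\<dots> \<le> 2 * (cmod a * cmod (f v))\<^sup>2 + 2 * (cmod b * cmod (g v))\<^sup>2"
      using sum_squares_bound[of "cmod a * cmod (f v)" "cmod b * cmod (g v)"] by (simp add: power2_sum)
    finally have "(cmod (a * f v + b * g v))\<^sup>2 / ?w v \<le> (2 * (cmod a * cmod (f v))\<^sup>2 + 2 * (cmod b * cmod (g v))\<^sup>2) / ?w v"
      by (intro divide_right_mono) auto
    then show ?thesis by (simp add: add_divide_distrib power_mult_distrib)
  qed
  ultimately have "(\<lambda>v. (cmod (a * f v + b * g v))\<^sup>2 / ?w v) summable_on gverts G"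
    by (intro summable_on_comparison_test[where g = "\<lambda>v. (cmod (a * f v + b * g v))\<^sup>2 / ?w v"
       and f = "\<lambda>v. 2 * (cmod a)\<^sup>2 * ((cmod (f v))\<^sup>2 / ?w v) + 2 * (cmod b)\<^sup>2 * ((cmod (g v))\<^sup>2 / ?w v)"]) auto
  then show ?thesis using assms by (auto simp: wl2_def vfuns_def)
qed

lemma finsupp_wl2:
  assumes "f \<in> vfuns G" "finite K" "\<And>v. v \<notin> K \<Longrightarrow> f v = 0"
  shows "f \<in> wl2 G \<sigma>"
proof -
  have "finite {v \<in> gverts G. (cmod (f v))\<^sup>2 / ((\<sigma> v)\<^sup>2 * real (vsize G v)) \<noteq> 0}"
    using assms(3) by (intro finite_subset[OF _ assms(2)]) auto
  then have "(\<lambda>v. (cmod (f v))\<^sup>2 / ((\<sigma> v)\<^sup>2 * real (vsize G v))) summable_on gverts G"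
    by (rule finite_nonzero_values_imp_summable_on)
  then show ?thesis using assms(1) by (simp add: wl2_def)
qed

lemma esize_le_vsize:
  assumes "e \<in> garcs G \<union> prongs G" "ter G e \<in> gverts G"
  shows "esize G e \<le> vsize G (ter G e)"
  using emb_mon[OF assms(1)] vgrp_finite[OF assms(2)]
  unfolding esize_def vsize_def mon_def hom_def by (auto intro: card_inj_on_le)

end

context rooted_ends
begin

lemma vsize_ratio: "v \<in> ext \<Longrightarrow> real (vsize G v) = ratio v * real (esize G (h v))"
  using esize_pos[of "h v"] ext_h by (simp add: ratio_def)

lemma vsize_child:
  assumes "v \<in> ext" "e \<in> children v"
  shows "real (vsize G (org G e)) = ratio v * real (esize G e)"
  using vsize_ratio[OF child(3)[OF assms]] child(6,7)[OF assms] by simp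

lemma ratio_bounds: "v \<in> ext \<Longrightarrow> 1 \<le> ratio v" "v \<in> ext \<Longrightarrow> ratio v \<le> real q"
  using ratio_pos(1)[of v] q_pos by auto

lemma child_notin: "good K \<Longrightarrow> v \<in> ext \<Longrightarrow> v \<notin> K \<Longrightarrow> e \<in> children v \<Longrightarrow> org G e \<notin> K"
  using good_par child(3,4) by metis

text \<open>The group of a child is at most \<open>ratio v\<close> times as large as that of
  \<open>v\<close>. With total weight \<open>q / ratio v\<close> this leaves the factor
  \<open>q / sqrt (ratio v)\<close>, largest in funnels.\<close>

lemma sum_wt_sqrt:
  assumes "v \<in> ext"
  shows "(\<Sum>e\<in>children v. wt e * sqrt (real (vsize G (org G e)))) \<le> real q * sqrt (real (vsize G v))"
proof -
  let ?s = "sqrt (real (vsize G v))"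
  have r: "ratio v > 0" using ratio_pos(2)[OF assms] .
  have "(\<Sum>e\<in>children v. wt e * sqrt (real (vsize G (org G e)))) \<le> (\<Sum>e\<in>children v. wt e * (sqrt (ratio v) * ?s))"
  proof (intro sum_mono mult_left_mono)
    fix e assume e: "e \<in> children v"
    have "real (esize G e) \<le> real (vsize G v)"
      using esize_le_vsize[of e] child[OF assms e] ext_in[OF assms] by auto
    then have "real (vsize G (org G e)) \<le> ratio v * real (vsize G v)"
      unfolding vsize_child[OF assms e] using r by simp
    then show "sqrt (real (vsize G (org G e))) \<le> sqrt (ratio v) * ?s"
      by (metis real_sqrt_le_iff real_sqrt_mult)
  qed auto
  also have "\<dots> = real q / ratio v * (sqrt (ratio v) * ?s)"
    unfolding sum_distrib_right[symmetric] sum_wt_children[OF assms] ..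
  also have "\<dots> = real q / sqrt (ratio v) * ?s"
    using r by (simp add: field_simps)
  also have "\<dots> \<le> real q * ?s"
    using ratio_bounds(1)[OF assms] r divide_left_mono[of 1 "sqrt (ratio v)" "real q"]
    by (intro mult_right_mono) auto
  finally show ?thesis .
qed

text \<open>The factorisation of \<open>jetE_children\<close> at one value of the parameter, with
  the image under the shifted operator as a source.\<close>

lemma shifted_ext_children:
  assumes "v \<in> ext" "\<mu> \<noteq> 0"
  shows "(\<Sum>e\<in>children v. of_real (wt e) * (u (org G e) - kap \<mu> v * u v)) =
    sq * \<mu> * (u v - kap \<mu> v * u (par v)) + 2 * sq * shifted_adjacency G q \<mu> u v"
proof -
  have r: "complex_of_real (ratio v) \<noteq> 0" using ratio_pos(2)[OF assms(1)] by simp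
  have "(\<Sum>e\<in>children v. of_real (wt e) * (u (org G e) - kap \<mu> v * u v)) =
    (\<Sum>e\<in>children v. of_real (wt e) * u (org G e)) - of_nat q / of_real (ratio v) * (kap \<mu> v * u v)"
    unfolding csum_wt_children[OF assms(1), symmetric]
    by (simp only: right_diff_distrib sum_subtractf sum_distrib_right)
  also have "of_nat q / of_real (ratio v) * (kap \<mu> v * u v) = sq / \<mu> * u v"
    using kap_ratio[OF assms] by (simp add: mult.commute mult.left_commute)
  also have "(\<Sum>e\<in>children v. of_real (wt e) * u (org G e)) = adjacency G u v - of_real (ratio v) * u (par v)"
    using adjacency_ext[OF assms(1), of u] by simp
  also have "adjacency G u v = 2 * sq * (shifted_adjacency G q \<mu> u v + zpar \<mu> * u v)"
    by (rule adjacency_shifted)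
  finally have S: "(\<Sum>e\<in>children v. of_real (wt e) * (u (org G e) - kap \<mu> v * u v)) =
    2 * sq * (shifted_adjacency G q \<mu> u v + zpar \<mu> * u v) - of_real (ratio v) * u (par v) - sq / \<mu> * u v" .
  have k: "sq * \<mu> * kap \<mu> v = of_real (ratio v)" using assms(2) sq_nz by (simp add: kap_def)
  have 1: "sq * \<mu> * (u v - kap \<mu> v * u (par v)) = sq * \<mu> * u v - of_real (ratio v) * u (par v)"
    unfolding k[symmetric] by (simp add: algebra_simps)
  have "2 * sq * (shifted_adjacency G q \<mu> u v + zpar \<mu> * u v) =
    2 * sq * shifted_adjacency G q \<mu> u v + sq * (2 * zpar \<mu>) * u v" by (simp add: algebra_simps)
  also have "2 * zpar \<mu> = \<mu> + 1 / \<mu>" using assms(2) by (simp add: zpar_def field_simps)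
  finally show ?thesis unfolding S 1 by (simp add: algebra_simps)
qed

text \<open>By \<open>rel\<close> the defect \<open>E\<close> at a vertex is controlled by its
  values at the children. Measured against \<open>sqrt (real (vsize G w))\<close>, the size that
  square summability allows, every generation gains the factor \<open>\<theta> < 1\<close>.
  Iteration forces \<open>E\<close> to vanish.\<close>

lemma l2_outgoing:
  assumes K: "good K" and u: "u \<in> l2 G" and mu: "cmod \<mu> > sqrt (real q)"
    and eq: "\<And>v. v \<in> ext \<Longrightarrow> v \<notin> K \<Longrightarrow> shifted_adjacency G q \<mu> u v = 0"
    and v: "v \<in> ext" "v \<notin> K"
  shows "u v = kap \<mu> v * u (par v)"
proof -
  have mu0: "\<mu> \<noteq> 0" "cmod \<mu> > 0" using mu q_pos by auto
  define E where "E v = u v - kap \<mu> v * u (par v)" for v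
  define M where "M = wl2_norm G (\<lambda>_. 1) u"
  define \<theta> where "\<theta> = sqrt (real q) / cmod \<mu>"
  have \<theta>: "0 \<le> \<theta>" "\<theta> < 1" using mu mu0 by (auto simp: \<theta>_def)
  have ub: "cmod (u w) \<le> M * sqrt (real (vsize G w))" if "w \<in> gverts G" for w
    using wl2_bound[OF u that] by (simp add: M_def)
  have M0: "M \<ge> 0" by (auto simp: M_def wl2_norm_def infsum_nonneg)
  have Ec: "E (org G e) = u (org G e) - kap \<mu> w * u w" if "w \<in> ext" "e \<in> children w" for w e
    using child(4,6)[OF that] by (simp add: E_def kap_def)
  have rel: "sq * \<mu> * E w = (\<Sum>e\<in>children w. of_real (wt e) * E (org G e))" if w: "w \<in> ext" "w \<notin> K" for w
  proof -
    have "(\<Sum>e\<in>children w. of_real (wt e) * E (org G e)) =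
        (\<Sum>e\<in>children w. of_real (wt e) * (u (org G e) - kap \<mu> w * u w))"
      by (rule sum.cong) (simp_all only: Ec[OF w(1)])
    then show ?thesis
      unfolding shifted_ext_children[OF w(1) mu0(1)] eq[OF w] E_def[of w] by simp
  qed
  have step: "cmod (E w) \<le> \<theta> * C * sqrt (real (vsize G w))"
    if w: "w \<in> ext" "w \<notin> K" and C: "C \<ge> 0" "\<And>e. e \<in> children w \<Longrightarrow> cmod (E (org G e)) \<le> C * sqrt (real (vsize G (org G e)))"
    for w C
  proof -
    have "sqrt (real q) * cmod \<mu> * cmod (E w) = cmod (sq * \<mu> * E w)"
      by (simp add: norm_mult)
    also have "sq * \<mu> * E w = (\<Sum>e\<in>children w. of_real (wt e) * E (org G e))"
      by (rule rel[OF w])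
    finally have "sqrt (real q) * cmod \<mu> * cmod (E w) = cmod (\<Sum>e\<in>children w. of_real (wt e) * E (org G e))" .
    also have "\<dots> \<le> (\<Sum>e\<in>children w. wt e * (C * sqrt (real (vsize G (org G e)))))"
    proof (rule sum_norm_le)
      fix e assume "e \<in> children w"
      from mult_left_mono[OF C(2)[OF this], of "wt e"]
      show "cmod (of_real (wt e) * E (org G e)) \<le> wt e * (C * sqrt (real (vsize G (org G e))))"
        unfolding norm_mult norm_of_real by simp
    qed
    also have "\<dots> = C * (\<Sum>e\<in>children w. wt e * sqrt (real (vsize G (org G e))))"
      by (simp add: sum_distrib_left mult.left_commute)
    also have "\<dots> \<le> C * (real q * sqrt (real (vsize G w)))"
      using sum_wt_sqrt[OF w(1)] C(1) by (rule mult_left_mono)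
    also have "\<dots> = (sqrt (real q) * sqrt (real q)) * (C * sqrt (real (vsize G w)))" by simp
    finally have "sqrt (real q) * (cmod \<mu> * cmod (E w)) \<le> sqrt (real q) * (sqrt (real q) * C * sqrt (real (vsize G w)))"
      by (simp only: mult_ac)
    then have "cmod \<mu> * cmod (E w) \<le> sqrt (real q) * C * sqrt (real (vsize G w))"
      using q_pos by (simp only: mult_le_cancel_left_pos)
    then show ?thesis using mu0(2) by (simp add: \<theta>_def field_simps)
  qed
  \<comment> \<open>A child and its parent each contribute \<open>M\<close>, and
    \<open>1 + sqrt (real q)\<close> is at least 2.\<close>
  define C0 where "C0 = M * (1 + sqrt (real q))"
  have C0: "C0 \<ge> 0" using M0 by (simp add: C0_def)
  have kapb: "cmod (kap \<mu> w) \<le> 1 * sqrt (ratio w)" if w: "w \<in> ext" for w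
  proof -
    have "cmod (kap \<mu> w) = ratio w / (sqrt (real q) * cmod \<mu>)"
      using ratio_pos(2)[OF w] by (simp add: kap_def norm_divide norm_mult)
    also have "\<dots> \<le> ratio w / (sqrt (real q) * sqrt (real q))"
      using mu mu0 q_pos ratio_pos(2)[OF w] by (intro divide_left_mono mult_left_mono mult_pos_pos) auto
    also have "\<dots> \<le> 1" using ratio_bounds[OF w] q_pos by (simp add: field_simps)
    also have "1 \<le> sqrt (ratio w)" using ratio_bounds[OF w] by simp
    finally show ?thesis by simp
  qed
  have base: "cmod (E (org G e)) \<le> C0 * sqrt (real q) * sqrt (real (vsize G w))"
    if w: "w \<in> ext" "w \<notin> K" "e \<in> children w" for w e
  proof -
    note c = child[OF w(1,3)]
    have 1: "real (vsize G (org G e)) \<le> real q * real (vsize G w)"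
      unfolding vsize_child[OF w(1,3)]
      using esize_le_vsize[of e] c ratio_bounds[OF w(1)] ext_in[OF w(1)] by (intro mult_mono) auto
    then have "sqrt (real (vsize G (org G e))) \<le> sqrt (real q) * sqrt (real (vsize G w))"
      by (metis real_sqrt_le_iff real_sqrt_mult)
    then have a: "cmod (u (org G e)) \<le> M * (sqrt (real q) * sqrt (real (vsize G w)))"
      using ub[OF ext_in[OF c(3)]] M0 by (meson mult_left_mono order_trans)
    have "cmod (kap \<mu> w) \<le> sqrt (real q)"
      using kapb[OF w(1)] ratio_bounds(2)[OF w(1)] by (metis mult_1 order_trans real_sqrt_le_iff)
    then have b: "cmod (kap \<mu> w * u w) \<le> sqrt (real q) * (M * sqrt (real (vsize G w)))"
      unfolding norm_mult using ub[OF ext_in[OF w(1)]] by (intro mult_mono) auto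
    have "cmod (E (org G e)) \<le> M * (sqrt (real q) * sqrt (real (vsize G w))) + sqrt (real q) * (M * sqrt (real (vsize G w)))"
      unfolding Ec[OF w(1,3)] using a b norm_triangle_ineq4 order_trans add_mono by metis
    also have "\<dots> = (M * 2) * (sqrt (real q) * sqrt (real (vsize G w)))" by (simp add: algebra_simps)
    also have "\<dots> \<le> C0 * (sqrt (real q) * sqrt (real (vsize G w)))"
      unfolding C0_def using M0 q_pos by (intro mult_right_mono mult_left_mono) auto
    finally show ?thesis by (simp add: mult.assoc)
  qed
  \<comment> \<open>In a funnel the group of a child may be smaller than that of its parent, so
    \<open>base\<close> compares the defect at a child only with the size at the parent. One use of
    \<open>rel\<close> moves the bound to the right vertex.\<close>
  have bound0: "\<exists>C\<ge>0. \<forall>w. w \<in> ext \<longrightarrow> w \<notin> K \<longrightarrow> cmod (E w) \<le> C * sqrt (real (vsize G w))"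
  proof (intro exI[of _ "C0 * sqrt (real q) * sqrt (real q)"] conjI allI impI)
    show "0 \<le> C0 * sqrt (real q) * sqrt (real q)" using C0 by simp
    fix w assume w: "w \<in> ext" "w \<notin> K"
    have "cmod (sq * \<mu> * E w) = cmod (\<Sum>e\<in>children w. of_real (wt e) * E (org G e))"
      unfolding rel[OF w] ..
    also have "\<dots> \<le> (\<Sum>e\<in>children w. wt e * (C0 * sqrt (real q) * sqrt (real (vsize G w))))"
    proof (rule sum_norm_le)
      fix e assume "e \<in> children w"
      from mult_left_mono[OF base[OF w this], of "wt e"]
      show "cmod (of_real (wt e) * E (org G e)) \<le> wt e * (C0 * sqrt (real q) * sqrt (real (vsize G w)))"
        unfolding norm_mult norm_of_real by simp
    qed
    also have "\<dots> = real q / ratio w * (C0 * sqrt (real q) * sqrt (real (vsize G w)))"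
      unfolding sum_distrib_right[symmetric] sum_wt_children[OF w(1)] ..
    also have "\<dots> \<le> real q * (C0 * sqrt (real q) * sqrt (real (vsize G w)))"
      using ratio_bounds[OF w(1)] C0 q_pos by (intro mult_right_mono) (auto simp: field_simps)
    finally have 1: "sqrt (real q) * cmod \<mu> * cmod (E w) \<le> real q * (C0 * sqrt (real q) * sqrt (real (vsize G w)))"
      by (simp add: norm_mult)
    have "sqrt (real q) * sqrt (real q) * cmod (E w) \<le> sqrt (real q) * cmod \<mu> * cmod (E w)"
      using mu q_pos by (intro mult_right_mono mult_left_mono) auto
    with 1 have "real q * cmod (E w) \<le> real q * (C0 * sqrt (real q) * sqrt (real (vsize G w)))" by simp
    then have "cmod (E w) \<le> C0 * sqrt (real q) * sqrt (real (vsize G w))" using q_pos by simp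
    also have "\<dots> \<le> C0 * sqrt (real q) * sqrt (real (vsize G w)) * sqrt (real q)"
      using C0 q_pos mult_left_mono[of 1 "sqrt (real q)" "C0 * sqrt (real q) * sqrt (real (vsize G w))"] by simp
    finally show "cmod (E w) \<le> C0 * sqrt (real q) * sqrt (real q) * sqrt (real (vsize G w))"
      by (simp only: mult_ac)
  qed
  then obtain C where C: "C \<ge> 0" "\<And>w. w \<in> ext \<Longrightarrow> w \<notin> K \<Longrightarrow> cmod (E w) \<le> C * sqrt (real (vsize G w))" by blast
  have iter: "cmod (E w) \<le> \<theta> ^ n * C * sqrt (real (vsize G w))" if "w \<in> ext" "w \<notin> K" for w n
    using that
  proof (induction n arbitrary: w)
    case 0
    then show ?case using C(2) by simp
  next
    case (Suc n)
    have "cmod (E w) \<le> \<theta> * (\<theta> ^ n * C) * sqrt (real (vsize G w))"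
    proof (rule step[OF Suc(2,3)])
      show "0 \<le> \<theta> ^ n * C" using \<theta> C by simp
      fix e assume "e \<in> children w"
      then show "cmod (E (org G e)) \<le> \<theta> ^ n * C * sqrt (real (vsize G (org G e)))"
        using Suc.IH[of "org G e"] child(3)[OF Suc(2)] child_notin[OF K Suc(2,3)] by blast
    qed
    then show ?case by (simp add: mult_ac)
  qed
  have "(\<lambda>n. \<theta> ^ n * (C * sqrt (real (vsize G v)))) \<longlonglongrightarrow> 0 * (C * sqrt (real (vsize G v)))"
    using \<theta> by (intro tendsto_mult_right LIMSEQ_power_zero) auto
  then have "(\<lambda>n. \<theta> ^ n * C * sqrt (real (vsize G v))) \<longlonglongrightarrow> 0" by (simp add: mult.assoc)
  from LIMSEQ_le_const[OF this, of "cmod (E v)"] have "cmod (E v) \<le> 0" using iter[OF v] by blast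
  then show ?thesis by (simp add: E_def)
qed

text \<open>The recursion multiplies the weighted square mass by
  \<open>1 / (cmod \<mu>)\<^sup>2\<close> on the way from a vertex to all its children together, in
  funnels and cusps alike. Successive generations thus form a geometric series.\<close>

lemma outgoing_l2:
  assumes K: "good K" and w: "w \<in> vfuns G" and mu: "cmod \<mu> > 1"
    and eq: "\<And>v. v \<in> ext \<Longrightarrow> v \<notin> K \<Longrightarrow> w v = kap \<mu> v * w (par v)"
  shows "w \<in> l2 G"
proof -
  define g where "g v = (cmod (w v))\<^sup>2 / real (vsize G v)" for v
  define \<theta> where "\<theta> = 1 / (cmod \<mu>)\<^sup>2"
  have "1 < (cmod \<mu>)\<^sup>2" using mu by (simp add: one_less_power)
  moreover have "1 < x \<Longrightarrow> 0 < 1 / x \<and> 1 / x < 1" for x :: real by simp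
  ultimately have \<theta>: "0 < \<theta>" "\<theta> < 1" unfolding \<theta>_def by blast+
  have g0: "g v \<ge> 0" for v by (simp add: g_def)
  have child_sum: "(\<Sum>e\<in>children v. g (org G e)) = \<theta> * g v" if v: "v \<in> ext" "v \<notin> K" for v
  proof -
    have r: "ratio v > 0" using ratio_pos(2)[OF v(1)] .
    have "g (org G e) = wt e * (ratio v / (real q * (cmod \<mu>)\<^sup>2) * g v / 1)" if e: "e \<in> children v" for e
    proof -
      note c = child[OF v(1) e]
      have ez: "real (esize G e) > 0" "real (vsize G v) > 0" using esize_pos c vsize_pos[OF ext_in[OF v(1)]] by auto
      have "w (org G e) = kap \<mu> v * w v"
        using eq[OF c(3) child_notin[OF K v e]] c(4,6) by (simp add: kap_def)
      moreover have "(cmod (kap \<mu> v))\<^sup>2 = (ratio v)\<^sup>2 / (real q * (cmod \<mu>)\<^sup>2)"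
        using r by (simp add: kap_def norm_divide norm_mult power_divide power_mult_distrib)
      ultimately have "g (org G e) = (ratio v)\<^sup>2 / (real q * (cmod \<mu>)\<^sup>2) * (cmod (w v))\<^sup>2 / (ratio v * real (esize G e))"
        unfolding g_def vsize_child[OF v(1) e] by (simp add: norm_mult power_mult_distrib)
      also have "\<dots> = wt e * (ratio v / (real q * (cmod \<mu>)\<^sup>2) * g v / 1)"
        unfolding g_def c(2) using r ez by (simp add: field_simps power2_eq_square)
      finally show ?thesis .
    qed
    then have "(\<Sum>e\<in>children v. g (org G e)) = (\<Sum>e\<in>children v. wt e) * (ratio v / (real q * (cmod \<mu>)\<^sup>2) * g v / 1)"
      unfolding sum_distrib_right by (intro sum.cong) auto
    then show ?thesis unfolding sum_wt_children[OF v(1)] using r q_pos by (simp add: \<theta>_def)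
  qed
  define L where "L n = (layer ^^ n) K" for n
  have L: "good (L n)" "K \<subseteq> L n" "L n \<subseteq> L (Suc n)" for n
  proof -
    have "good (L n) \<and> K \<subseteq> L n" by (induction n) (use K good_layer in \<open>auto simp: L_def\<close>)
    then show "good (L n)" "K \<subseteq> L n" by auto
    then show "L n \<subseteq> L (Suc n)" using good_layer(2) by (simp add: L_def)
  qed
  have fin: "finite (L n)" for n using L(1) by (auto simp: good_def)
  have LS: "L (Suc n) = L n \<union> roots (L n)" "L n \<inter> roots (L n) = {}" for n
    by (auto simp: L_def layer_def roots_def)
  have finr: "finite (roots (L n))" for n using LS(1) fin by (metis finite_Un)
  have next_roots: "sum g (roots (L (Suc n))) = \<theta> * sum g (roots (L n))" for n
  proof -
    have "sum g (roots (L (Suc n))) = (\<Sum>(v, e)\<in>Sigma (roots (L n)) children. g (org G e))"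
    proof (rule sum.reindex_bij_witness[where j = "\<lambda>c. (par c, opp G (h c))" and i = "\<lambda>(v, e). org G e"])
      fix c assume c: "c \<in> roots (L (Suc n))"
      note ce = rootsD(1)[OF c]
      show "(case (par c, opp G (h c)) of (v, e) \<Rightarrow> org G e) = c"
        using org_opp ext_h[OF ce] by simp
      have "par c \<notin> L n" using rootsD[OF c] ce L(3) unfolding L_def by (auto simp: layer_def)
      moreover have pc: "par c \<in> roots (L n)" using rootsD(3)[OF c] calculation LS by blast
      ultimately show "(par c, opp G (h c)) \<in> Sigma (roots (L n)) children"
        using opp_h_children[OF ce rootsD(1)[OF pc]] by simp
      show "(case (par c, opp G (h c)) of (v, e) \<Rightarrow> g (org G e)) = g c"
        using org_opp ext_h[OF ce] by simp
    next
      fix p assume "p \<in> Sigma (roots (L n)) children"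
      then obtain v e where p: "p = (v, e)" "v \<in> roots (L n)" "e \<in> children v" by blast
      note c = child[OF rootsD(1)[OF p(2)] p(3)]
      show "(par (case p of (v, e) \<Rightarrow> org G e), opp G (h (case p of (v, e) \<Rightarrow> org G e))) = p"
        using p c opp_opp by simp
      have "org G e \<notin> L (Suc n)"
      proof
        assume "org G e \<in> L (Suc n)"
        then consider "org G e \<in> L n" | "org G e \<in> roots (L n)" using LS by blast
        then show False
        proof cases
          case 1
          then show ?thesis using good_par[OF L(1) 1 c(3)] c(4) rootsD(2)[OF p(2)] by simp
        next
          case 2
          then show ?thesis using rootsD(3)[OF 2] c(4) rootsD(2)[OF p(2)] by simp
        qed
      qed
      then show "(case p of (v, e) \<Rightarrow> org G e) \<in> roots (L (Suc n))"
        using p c LS(1) by (auto simp: roots_def)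
    qed
    also have "\<dots> = (\<Sum>v\<in>roots (L n). \<Sum>e\<in>children v. g (org G e))"
      using finr finite_children by (subst sum.Sigma) auto
    also have "\<dots> = (\<Sum>v\<in>roots (L n). \<theta> * g v)"
    proof (rule sum.cong[OF refl])
      fix v assume v: "v \<in> roots (L n)"
      show "(\<Sum>e\<in>children v. g (org G e)) = \<theta> * g v"
        using child_sum rootsD[OF v] L(2) by blast
    qed
    finally show ?thesis by (simp add: sum_distrib_left)
  qed
  \<comment> \<open>The mass collected so far plus the geometric series predicted from the next
    generation. It does not depend on \<open>n\<close> and so bounds all partial sums.\<close>
  define \<Psi> where "\<Psi> n = sum g (L n) + sum g (roots (L n)) / (1 - \<theta>)" for n
  have \<Psi>: "\<Psi> (Suc n) = \<Psi> n" for n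
  proof -
    have "sum g (L (Suc n)) = sum g (L n) + sum g (roots (L n))"
      unfolding LS(1) using fin finr LS(2) by (intro sum.union_disjoint)
    then show ?thesis unfolding \<Psi>_def next_roots using \<theta> by (simp add: field_simps)
  qed
  have \<Psi>c: "\<Psi> n = \<Psi> 0" for n by (induction n) (simp_all add: \<Psi>)
  have bound: "sum g (L n) \<le> \<Psi> 0" for n
  proof -
    have "sum g (L n) \<le> \<Psi> n" unfolding \<Psi>_def using \<theta> g0 by (simp add: sum_nonneg)
    then show ?thesis using \<Psi>c[of n] by simp
  qed
  have Lmono: "L m \<subseteq> L n" if "m \<le> n" for m n
    using that L(3) by (rule lift_Suc_mono_le[rotated])
  have cover: "\<exists>n. v \<in> L n" if "v \<in> gverts G" for v
    using K that
  proof (induction rule: parent_induct)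
    case (core v)
    then show ?case by (intro exI[of _ 0]) (simp add: L_def)
  next
    case (step v)
    then obtain n where "par v \<in> L n" by blast
    then have "v \<in> L (Suc n)" using step(1) by (simp add: L_def layer_def)
    then show ?case by blast
  qed
  have "g summable_on gverts G"
  proof (rule nonneg_bdd_above_summable_on)
    show "bdd_above (sum g ` {F. F \<subseteq> gverts G \<and> finite F})"
    proof (rule bdd_aboveI2)
      fix F assume "F \<in> {F. F \<subseteq> gverts G \<and> finite F}"
      then have F: "F \<subseteq> gverts G" "finite F" by auto
      have "\<forall>v\<in>F. \<exists>n. v \<in> L n" using F cover by blast
      then obtain n where n: "\<forall>v\<in>F. v \<in> L (n v)" by metis
      have "F \<subseteq> L (Max (n ` F))"
      proof
        fix v assume "v \<in> F"
        then show "v \<in> L (Max (n ` F))" using n F Lmono[of "n v" "Max (n ` F)"] by auto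
      qed
      then have "sum g F \<le> sum g (L (Max (n ` F)))" using fin g0 by (intro sum_mono2) auto
      then show "sum g F \<le> \<Psi> 0" using bound order_trans by blast
    qed
  qed (use g0 in auto)
  then show ?thesis using w by (simp add: wl2_def g_def[abs_def])
qed

text \<open>Green's formula on a good set: the bulk and the boundary terms have the same sign when
  \<open>cmod \<mu> \<ge> 1\<close>.\<close>

definition bd :: "'v set \<Rightarrow> 'e set" where "bd K = {e \<in> garcs G. ter G e \<in> K \<and> org G e \<notin> K}"

lemma finite_arcs_into: "finite K \<Longrightarrow> finite {e \<in> garcs G. ter G e \<in> K}"
proof -
  assume "finite K"
  then have "finite (\<Union>v\<in>K. {e \<in> garcs G. ter G e = v})" using finite_in_arcs by blast
  moreover have "{e \<in> garcs G. ter G e \<in> K} \<subseteq> (\<Union>v\<in>K. {e \<in> garcs G. ter G e = v})" by auto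
  ultimately show ?thesis using finite_subset by blast
qed

text \<open>If the reverse of the arc were not the parent arc of the outer vertex, the outer vertex
  would be the parent of the inner one, and \<open>K\<close> would not be closed under
  parents.\<close>

lemma bdD:
  assumes "good K" "e \<in> bd K"
  shows "org G e \<in> roots K" "par (org G e) = ter G e" "e \<in> garcs G" "ter G e \<in> K"
proof -
  show e: "e \<in> garcs G" "ter G e \<in> K" using assms by (auto simp: bd_def)
  have o: "org G e \<notin> K" using assms by (auto simp: bd_def)
  have oe: "org G e \<in> ext" using good_notin[OF assms(1) org_in[OF e(1)] o] .
  have "opp G e = h (org G e)"
  proof (rule ccontr)
    assume "\<not> ?thesis"
    then have "opp G e \<in> children (org G e)" using opp_in_arcs ter_opp e by (auto simp: children_def)
    from child(3,4)[OF oe this] have "ter G e \<in> ext" "par (ter G e) = org G e" using org_opp e by auto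
    then show False using good_par[OF assms(1) e(2)] o by simp
  qed
  then show "par (org G e) = ter G e" using org_opp e by (metis par_def)
  then show "org G e \<in> roots K" using oe o e by (simp add: roots_def)
qed

lemma green:
  assumes K: "good K" and mu: "\<mu> \<noteq> 0" "Im \<mu> \<ge> 0"
    and eq: "\<And>c. c \<in> roots K \<Longrightarrow> u c = kap \<mu> c * u (par c)"
  shows "Im (zpar \<mu>) * (\<Sum>v\<in>K. (cmod (u v))\<^sup>2 / real (vsize G v)) +
     Im \<mu> / (2 * real q * (cmod \<mu>)\<^sup>2) * (\<Sum>e\<in>bd K. (cmod (u (ter G e)))\<^sup>2 / real (esize G e))
   \<le> (\<Sum>v\<in>K. cmod (shifted_adjacency G q \<mu> u v) * cmod (u v) / real (vsize G v))"
proof -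
  let ?F = "shifted_adjacency G q \<mu> u"
  define I where "I = {e \<in> garcs G. ter G e \<in> K \<and> org G e \<in> K}"
  define t where "t e = u (org G e) * cnj (u (ter G e)) / of_nat (esize G e)" for e
  have finK: "finite K" using K by (simp add: good_def)
  have fin: "finite I" "finite (bd K)"
    unfolding I_def bd_def by (rule finite_subset[OF _ finite_arcs_into[OF finK]], blast)+
  have vz: "real (vsize G v) > 0" if "v \<in> K" for v using good_sub[OF K] that vsize_pos by auto
  have "(\<Sum>v\<in>K. adjacency G u v * cnj (u v) / of_nat (vsize G v)) =
     (\<Sum>v\<in>K. \<Sum>e\<in>{e \<in> garcs G. ter G e = v}. t e)"
  proof (rule sum.cong[OF refl])
    fix v assume "v \<in> K"
    then have "real (vsize G v) \<noteq> 0" using vz by auto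
    then show "adjacency G u v * cnj (u v) / of_nat (vsize G v) = (\<Sum>e\<in>{e \<in> garcs G. ter G e = v}. t e)"
      unfolding adjacency_def sum_distrib_right sum_divide_distrib
      by (intro sum.cong) (auto simp: t_def)
  qed
  also have "\<dots> = sum t {e \<in> garcs G. ter G e \<in> K}"
  proof -
    have "{e \<in> garcs G. ter G e \<in> K} = (\<Union>v\<in>K. {e \<in> garcs G. ter G e = v})" by auto
    then show ?thesis
      using finK finite_in_arcs by (simp only:, subst sum.UNION_disjoint) auto
  qed
  also have "\<dots> = sum t I + sum t (bd K)"
  proof -
    have "{e \<in> garcs G. ter G e \<in> K} = I \<union> bd K" "I \<inter> bd K = {}" by (auto simp: I_def bd_def)
    then show ?thesis using fin sum.union_disjoint by metis
  qed
  finally have A: "(\<Sum>v\<in>K. adjacency G u v * cnj (u v) / of_nat (vsize G v)) = sum t I + sum t (bd K)" .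
  \<comment> \<open>Reversal permutes the interior arcs and conjugates their terms. This is the
    symmetry of the adjacency operator; only the boundary contributes to the imaginary part.\<close>
  have "sum t I = (\<Sum>e\<in>I. cnj (t e))"
    by (rule sum.reindex_bij_witness[where i = "opp G" and j = "opp G"])
       (auto simp: I_def t_def opp_opp opp_in_arcs org_opp ter_opp esize_opp)
  then have "sum t I = cnj (sum t I)" by simp
  then have ImI: "Im (sum t I) = 0" by (metis cnj.simps(2) eq_neg_iff_add_eq_0 add_cancel_left_left Im_eq_0 complex_cnj_cnj mult_2 mult_eq_0_iff zero_neq_numeral)
  \<comment> \<open>The outgoing recursion makes a boundary term a nonnegative multiple of
    \<open>inverse \<mu>\<close>, whose imaginary part has the sign opposite to
    \<open>Im \<mu>\<close>.\<close>
  have Imb: "Im (t e) = - (ratio (org G e) / sqrt (real q) * Im \<mu> / (cmod \<mu>)\<^sup>2) * ((cmod (u (ter G e)))\<^sup>2 / real (esize G e))"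
    if e: "e \<in> bd K" for e
  proof -
    note b = bdD[OF K e]
    have "t e = kap \<mu> (org G e) * of_real ((cmod (u (ter G e)))\<^sup>2 / real (esize G e))"
      unfolding t_def eq[OF b(1)] b(2) by (simp add: complex_norm_square[symmetric] mult.assoc)
    moreover have "kap \<mu> (org G e) = of_real (ratio (org G e) / sqrt (real q)) * inverse \<mu>"
      by (simp add: kap_def field_simps)
    ultimately have "Im (t e) = ratio (org G e) / sqrt (real q) * Im (inverse \<mu>) * ((cmod (u (ter G e)))\<^sup>2 / real (esize G e))"
      by (simp only: Im_complex_of_real Re_complex_of_real times_complex.sel mult_zero_left mult_zero_right add_0_right)
    then show ?thesis by (simp add: cmod_power2)
  qed
  have Imt: "- Im (sum t (bd K)) \<ge> Im \<mu> / (sqrt (real q) * (cmod \<mu>)\<^sup>2) * (\<Sum>e\<in>bd K. (cmod (u (ter G e)))\<^sup>2 / real (esize G e))"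
    unfolding Im_sum sum_negf[symmetric] sum_distrib_left
  proof (rule sum_mono)
    fix e assume e: "e \<in> bd K"
    have "1 \<le> ratio (org G e)" using ratio_bounds rootsD(1)[OF bdD(1)[OF K e]] by blast
    then have "Im \<mu> / (sqrt (real q) * (cmod \<mu>)\<^sup>2) * 1 \<le> Im \<mu> / (sqrt (real q) * (cmod \<mu>)\<^sup>2) * ratio (org G e)"
      using mu(2) by (intro mult_left_mono) auto
    then have "Im \<mu> / (sqrt (real q) * (cmod \<mu>)\<^sup>2) * ((cmod (u (ter G e)))\<^sup>2 / real (esize G e))
      \<le> (ratio (org G e) / sqrt (real q) * Im \<mu> / (cmod \<mu>)\<^sup>2) * ((cmod (u (ter G e)))\<^sup>2 / real (esize G e))"
      by (intro mult_right_mono) (auto simp: field_simps)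
    then show "Im \<mu> / (sqrt (real q) * (cmod \<mu>)\<^sup>2) * ((cmod (u (ter G e)))\<^sup>2 / real (esize G e)) \<le> - Im (t e)"
      unfolding Imb[OF e] by simp
  qed
  define N where "N = (\<Sum>v\<in>K. (cmod (u v))\<^sup>2 / real (vsize G v))"
  have F: "?F v * cnj (u v) / of_nat (vsize G v) =
     (1 / (2 * sq)) * (adjacency G u v * cnj (u v) / of_nat (vsize G v)) - zpar \<mu> * of_real ((cmod (u v))\<^sup>2 / real (vsize G v))" for v
  proof -
    have nn: "u v * cnj (u v) = of_real ((cmod (u v))\<^sup>2)" by (metis complex_norm_square)
    have "?F v * cnj (u v) = (1 / (2 * sq)) * (adjacency G u v * cnj (u v)) - zpar \<mu> * (u v * cnj (u v))"
      by (simp add: shifted_adjacency_def algebra_simps)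
    then show ?thesis unfolding nn by (simp only: diff_divide_distrib of_real_divide of_real_of_nat_eq times_divide_eq_right)
  qed
  have "(\<Sum>v\<in>K. ?F v * cnj (u v) / of_nat (vsize G v)) = (1 / (2 * sq)) * (sum t I + sum t (bd K)) - zpar \<mu> * of_real N"
    unfolding F sum_subtractf A[symmetric] sum_distrib_left N_def of_real_sum ..
  then have "Im (\<Sum>v\<in>K. ?F v * cnj (u v) / of_nat (vsize G v)) = 1 / (2 * sqrt (real q)) * Im (sum t (bd K)) - Im (zpar \<mu>) * N"
    using ImI by simp
  then have "Im (zpar \<mu>) * N + 1 / (2 * sqrt (real q)) * (- Im (sum t (bd K))) \<le> cmod (\<Sum>v\<in>K. ?F v * cnj (u v) / of_nat (vsize G v))"
    using abs_Im_le_cmod[of "\<Sum>v\<in>K. ?F v * cnj (u v) / of_nat (vsize G v)"] by simp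
  also have "\<dots> \<le> (\<Sum>v\<in>K. cmod (?F v) * cmod (u v) / real (vsize G v))"
    by (rule sum_norm_le) (simp add: norm_mult norm_divide)
  finally have le: "Im (zpar \<mu>) * N + 1 / (2 * sqrt (real q)) * (- Im (sum t (bd K))) \<le> (\<Sum>v\<in>K. cmod (?F v) * cmod (u v) / real (vsize G v))" .
  have "Im \<mu> / (2 * real q * (cmod \<mu>)\<^sup>2) * (\<Sum>e\<in>bd K. (cmod (u (ter G e)))\<^sup>2 / real (esize G e)) =
     1 / (2 * sqrt (real q)) * (Im \<mu> / (sqrt (real q) * (cmod \<mu>)\<^sup>2) * (\<Sum>e\<in>bd K. (cmod (u (ter G e)))\<^sup>2 / real (esize G e)))"
    using q_pos by (simp add: field_simps)
  also have "\<dots> \<le> 1 / (2 * sqrt (real q)) * (- Im (sum t (bd K)))"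
    using Imt by (intro mult_left_mono) auto
  finally show ?thesis using le unfolding N_def by linarith
qed

end

section \<open>From operator families to scalar functions at a vertex\<close>

lemma coeff_eq_0_of_tendsto_at:
  fixes p :: "complex poly"
  assumes "F \<noteq> bot" "F \<le> at \<mu>\<^sub>0" "((\<lambda>\<mu>. poly p (\<mu> - \<mu>\<^sub>0) / (\<mu> - \<mu>\<^sub>0) ^ m) \<longlongrightarrow> 0) F" "i \<le> m"
  shows "coeff p i = 0"
proof (rule coeff_eq_0_of_tendsto)
  let ?F = "filtermap (\<lambda>\<mu>. \<mu> - \<mu>\<^sub>0) F"
  show "?F \<noteq> bot" using assms(1) by (simp add: filtermap_bot_iff)
  have "?F \<le> filtermap (\<lambda>\<mu>. \<mu> - \<mu>\<^sub>0) (at \<mu>\<^sub>0)" using assms(2) by (rule filtermap_mono)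
  also have "\<dots> = at 0" using filtermap_at_shift[of \<mu>\<^sub>0 \<mu>\<^sub>0] by simp
  finally show "?F \<le> at 0" .
  show "((\<lambda>t. poly p t / t ^ m) \<longlongrightarrow> 0) ?F" using assms(3) by (simp add: filterlim_filtermap)
qed (rule assms(4))

lemma monom_dvd_tendsto_at:
  fixes p :: "complex poly"
  assumes "monom 1 (Suc m) dvd p"
  shows "((\<lambda>\<mu>. poly p (\<mu> - \<mu>\<^sub>0) / (\<mu> - \<mu>\<^sub>0) ^ m) \<longlongrightarrow> 0) (at \<mu>\<^sub>0)"
proof -
  have "filtermap (\<lambda>\<mu>. \<mu> - \<mu>\<^sub>0) (at \<mu>\<^sub>0) = at 0" using filtermap_at_shift[of \<mu>\<^sub>0 \<mu>\<^sub>0] by simp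
  then have "filterlim (\<lambda>t. poly p t / t ^ m) (nhds 0) (filtermap (\<lambda>\<mu>. \<mu> - \<mu>\<^sub>0) (at \<mu>\<^sub>0))"
    using monom_dvd_tendsto[OF assms] by (simp only:)
  then show ?thesis by (simp only: filterlim_filtermap)
qed

context graph_of_groups_with_boundary
begin

lemma bounded_op_lin:
  assumes "bounded_op G \<rho> \<sigma> S" "f \<in> wl2 G \<rho>" "g \<in> wl2 G \<rho>"
  shows "S (\<lambda>v. a * f v + b * g v) = (\<lambda>v. a * S f v + b * S g v)"
proof -
  have "(\<lambda>v. a * f v) \<in> wl2 G \<rho>" "(\<lambda>v. b * g v) \<in> wl2 G \<rho>"
    using wl2_lin[OF assms(2,2), of a 0] wl2_lin[OF assms(3,3), of b 0] by auto
  then show ?thesis using assms unfolding bounded_op_def by simp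
qed

text \<open>Evaluation at \<open>v\<close> is bounded by \<open>wl2_bound\<close>, so
  differentiability in operator norm descends to the scalar function.\<close>

lemma holomorphic_ops_pointwise:
  assumes R: "holomorphic_ops G \<rho> \<sigma> \<Omega> R" and "open \<Omega>" "\<mu> \<in> \<Omega>" "f \<in> wl2 G \<rho>" "v \<in> gverts G" "\<sigma> v > 0"
  shows "\<exists>d. ((\<lambda>\<mu>. R \<mu> f v) has_field_derivative d) (at \<mu>)"
proof -
  from R assms(3) obtain D where D: "bounded_op G \<rho> \<sigma> D" and
    lim: "\<And>\<epsilon>. \<epsilon> > 0 \<Longrightarrow> \<exists>\<delta>>0. \<forall>\<nu>\<in>\<Omega>. cmod (\<nu> - \<mu>) < \<delta> \<longrightarrow>
           (\<forall>f\<in>wl2 G \<rho>. wl2_norm G \<sigma> (\<lambda>v. R \<nu> f v - R \<mu> f v - (\<nu> - \<mu>) * D f v)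
                \<le> \<epsilon> * cmod (\<nu> - \<mu>) * wl2_norm G \<rho> f)"
    unfolding holomorphic_ops_def by blast
  have Rw: "R \<nu> f \<in> wl2 G \<sigma>" if "\<nu> \<in> \<Omega>" for \<nu>
    using R that assms(4) unfolding holomorphic_ops_def bounded_op_def by blast
  have Dw: "D f \<in> wl2 G \<sigma>" using D assms(4) unfolding bounded_op_def by blast
  \<comment> \<open>The summand 1 keeps \<open>c\<close> positive when \<open>f\<close> has norm
    zero.\<close>
  define c where "c = wl2_norm G \<rho> f * (\<sigma> v * sqrt (real (vsize G v))) + 1"
  have nn: "wl2_norm G \<rho> f \<ge> 0" by (auto simp: wl2_norm_def infsum_nonneg)
  then have c: "c > 0" using assms(6) by (simp add: c_def add_nonneg_pos)
  have "((\<lambda>\<mu>. R \<mu> f v) has_derivative (\<lambda>h. D f v * h)) (at \<mu>)"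
    unfolding has_derivative_at_alt
  proof (intro conjI allI impI)
    show "bounded_linear ((*) (D f v))" by (rule bounded_linear_mult_right)
    fix e :: real assume e: "0 < e"
    obtain \<delta> where \<delta>: "\<delta> > 0" "\<And>\<nu>. \<nu> \<in> \<Omega> \<Longrightarrow> cmod (\<nu> - \<mu>) < \<delta> \<Longrightarrow>
         wl2_norm G \<sigma> (\<lambda>v. R \<nu> f v - R \<mu> f v - (\<nu> - \<mu>) * D f v) \<le> e / c * cmod (\<nu> - \<mu>) * wl2_norm G \<rho> f"
      using lim[of "e / c"] e c assms(4) by (meson divide_pos_pos)
    obtain \<delta>' where \<delta>': "\<delta>' > 0" "ball \<mu> \<delta>' \<subseteq> \<Omega>" using assms(2,3) openE by blast
    show "\<exists>d>0. \<forall>y. cmod (y - \<mu>) < d \<longrightarrow> cmod (R y f v - R \<mu> f v - D f v * (y - \<mu>)) \<le> e * cmod (y - \<mu>)"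
    proof (intro exI[of _ "min \<delta> \<delta>'"] conjI allI impI)
      show "0 < min \<delta> \<delta>'" using \<delta> \<delta>' by simp
      fix y assume y: "cmod (y - \<mu>) < min \<delta> \<delta>'"
      then have yO: "y \<in> \<Omega>" using \<delta>' by (auto simp: dist_norm norm_minus_commute subset_iff)
      let ?d = "\<lambda>v. R y f v - R \<mu> f v - (y - \<mu>) * D f v"
      have "?d = (\<lambda>v. 1 * (1 * R y f v + (- 1) * R \<mu> f v) + (- (y - \<mu>)) * D f v)" by (simp add: fun_eq_iff algebra_simps)
      moreover have "\<dots> \<in> wl2 G \<sigma>" using Rw[OF yO] Rw[OF assms(3)] Dw wl2_lin by blast
      ultimately have dw: "?d \<in> wl2 G \<sigma>" by simp
      have "cmod (?d v) \<le> wl2_norm G \<sigma> ?d * (\<sigma> v * sqrt (real (vsize G v)))"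
        by (rule wl2_bound[OF dw assms(5,6)])
      also have "\<dots> \<le> (e / c * cmod (y - \<mu>) * wl2_norm G \<rho> f) * (\<sigma> v * sqrt (real (vsize G v)))"
        using \<delta>(2)[OF yO] y assms(6) by (intro mult_right_mono) auto
      also have "\<dots> = e * cmod (y - \<mu>) * ((c - 1) / c)" by (simp add: c_def)
      also have "\<dots> \<le> e * cmod (y - \<mu>) * 1" using c e by (intro mult_left_mono) auto
      finally show "cmod (R y f v - R \<mu> f v - D f v * (y - \<mu>)) \<le> e * cmod (y - \<mu>)" by (simp add: mult.commute)
    qed
  qed
  then show ?thesis unfolding has_field_derivative_def by blast
qed

text \<open>The squared norm of the truncation error is the tail of a convergent sum.\<close>

lemma finsupp_dense:
  assumes "f \<in> wl2 G \<rho>"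
  shows "((\<lambda>Y. wl2_norm G \<rho> (\<lambda>v. f v - (if v \<in> Y then f v else 0))) \<longlongrightarrow> 0) (finite_subsets_at_top (gverts G))"
proof -
  let ?g = "\<lambda>v. (cmod (f v))\<^sup>2 / ((\<rho> v)\<^sup>2 * real (vsize G v))"
  have sg: "?g summable_on gverts G" using assms by (simp add: wl2_def)
  have "((\<lambda>Y. sqrt (infsum ?g (gverts G) - sum ?g Y)) \<longlongrightarrow> sqrt (infsum ?g (gverts G) - infsum ?g (gverts G))) (finite_subsets_at_top (gverts G))"
    by (intro tendsto_intros infsum_tendsto sg)
  then have "((\<lambda>Y. sqrt (infsum ?g (gverts G) - sum ?g Y)) \<longlongrightarrow> 0) (finite_subsets_at_top (gverts G))" by simp
  moreover have "eventually (\<lambda>Y. sqrt (infsum ?g (gverts G) - sum ?g Y) =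
      wl2_norm G \<rho> (\<lambda>v. f v - (if v \<in> Y then f v else 0))) (finite_subsets_at_top (gverts G))"
  proof (rule eventually_finite_subsets_at_top_weakI)
    fix Y assume Y: "finite Y" "Y \<subseteq> gverts G"
    have "infsum ?g (Y \<union> (gverts G - Y)) = infsum ?g Y + infsum ?g (gverts G - Y)"
      using Y by (intro infsum_Un_disjoint summable_on_finite summable_on_subset_banach[OF sg]) auto
    moreover have "Y \<union> (gverts G - Y) = gverts G" using Y by blast
    ultimately have "infsum ?g (gverts G) - sum ?g Y = infsum ?g (gverts G - Y)" using Y by simp
    also have "\<dots> = (\<Sum>\<^sub>\<infinity>v\<in>gverts G. (cmod (f v - (if v \<in> Y then f v else 0)))\<^sup>2 / ((\<rho> v)\<^sup>2 * real (vsize G v)))"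
      by (rule infsum_cong_neutral) auto
    finally show "sqrt (infsum ?g (gverts G) - sum ?g Y) = wl2_norm G \<rho> (\<lambda>v. f v - (if v \<in> Y then f v else 0))"
      by (simp add: wl2_norm_def)
  qed
  ultimately show ?thesis by (rule Lim_transform_eventually)
qed

text \<open>Finite rank gives the images of finitely supported functions a finite basis, whose span
  is closed under pointwise limits; density and boundedness then reach the image of every
  \<open>f\<close>. Jets need to be found for finitely supported sources only.\<close>

lemma finite_rank_finsupp:
  assumes S: "finite_rank_op G \<rho> \<sigma> S" and f: "f \<in> wl2 G \<rho>" and pos: "\<And>v. v \<in> gverts G \<Longrightarrow> \<sigma> v > 0"
  shows "S f \<in> cfun.span (S ` {g \<in> vfuns G. \<exists>K. finite K \<and> K \<subseteq> gverts G \<and> (\<forall>v. v \<notin> K \<longrightarrow> g v = 0)})"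
proof -
  define Z where "Z = {g \<in> vfuns G. \<exists>K. finite K \<and> K \<subseteq> gverts G \<and> (\<forall>v. v \<notin> K \<longrightarrow> g v = 0)}"
  have ZW: "Z \<subseteq> wl2 G \<rho>" unfolding Z_def using finsupp_wl2 by blast
  have b: "bounded_op G \<rho> \<sigma> S" using S by (simp add: finite_rank_op_def)
  obtain B where B: "finite B" "S ` wl2 G \<rho> \<subseteq> cfun.span B" using S by (auto simp: finite_rank_op_def)
  obtain B' where B': "B' \<subseteq> S ` Z" "cfun.independent B'" "S ` Z \<subseteq> cfun.span B'"
    using cfun.maximal_independent_subset .
  have "B' \<subseteq> cfun.span B" using B'(1) B(2) ZW by blast
  then have fin: "finite B'" using cfun.independent_span_bound[OF B(1) B'(2)] by blast
  obtain C where C: "\<And>g. g \<in> wl2 G \<rho> \<Longrightarrow> wl2_norm G \<sigma> (S g) \<le> C * wl2_norm G \<rho> g"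
    using b unfolding bounded_op_def by blast
  define fY where "fY Y v = (if v \<in> Y then f v else 0)" for Y v
  have fY: "fY Y \<in> Z" if "finite Y" "Y \<subseteq> gverts G" for Y
    using f that by (auto simp: Z_def fY_def[abs_def] wl2_def vfuns_def)
  let ?F = "finite_subsets_at_top (gverts G)"
  have "S f \<in> cfun.span B'"
  proof (rule cfun_span_pointwise_closed[OF fin, of ?F "\<lambda>Y. S (fY Y)"])
    show "eventually (\<lambda>Y. S (fY Y) \<in> cfun.span B') ?F"
      by (rule eventually_finite_subsets_at_top_weakI) (use fY B'(3) in blast)
    fix v
    show "((\<lambda>Y. S (fY Y) v) \<longlongrightarrow> S f v) ?F"
    proof (cases "v \<in> gverts G")
      case False
      have "eventually (\<lambda>Y. S f v = S (fY Y) v) ?F"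
      proof (rule eventually_finite_subsets_at_top_weakI)
        fix Y assume "finite Y" "Y \<subseteq> gverts G"
        then have "S (fY Y) \<in> wl2 G \<sigma>" "S f \<in> wl2 G \<sigma>" using b fY ZW f unfolding bounded_op_def by blast+
        then show "S f v = S (fY Y) v" using False by (auto simp: wl2_def vfuns_def)
      qed
      then show ?thesis using tendsto_const Lim_transform_eventually by fast
    next
      case True
      define c where "c = \<bar>C\<bar> * (\<sigma> v * sqrt (real (vsize G v)))"
      have lim: "((\<lambda>Y. wl2_norm G \<rho> (\<lambda>v. f v - fY Y v) * c) \<longlongrightarrow> 0) ?F"
        using tendsto_mult_right[OF finsupp_dense[OF f], of c] by (simp add: fY_def)
      have "((\<lambda>Y. S (fY Y) v - S f v) \<longlongrightarrow> 0) ?F"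
      proof (rule Lim_null_comparison[OF eventually_finite_subsets_at_top_weakI lim])
        fix Y assume Y: "finite Y" "Y \<subseteq> gverts G"
        have fw: "fY Y \<in> wl2 G \<rho>" using fY[OF Y] ZW by blast
        have eq: "S (\<lambda>v. f v - fY Y v) = (\<lambda>v. S f v - S (fY Y) v)"
          using bounded_op_lin[OF b f fw, of 1 "-1"] by simp
        have dw: "(\<lambda>v. f v - fY Y v) \<in> wl2 G \<rho>" using wl2_lin[OF f fw, of 1 "-1"] by simp
        have Sw: "S (\<lambda>v. f v - fY Y v) \<in> wl2 G \<sigma>" using b dw unfolding bounded_op_def by blast
        have "wl2_norm G \<rho> (\<lambda>v. f v - fY Y v) \<ge> 0" by (auto simp: wl2_norm_def infsum_nonneg)
        then have le: "wl2_norm G \<sigma> (S (\<lambda>v. f v - fY Y v)) \<le> \<bar>C\<bar> * wl2_norm G \<rho> (\<lambda>v. f v - fY Y v)"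
          using C[OF dw] by (meson abs_ge_self mult_right_mono order_trans)
        have "cmod (S (fY Y) v - S f v) = cmod (S (\<lambda>v. f v - fY Y v) v)"
          unfolding eq by (rule norm_minus_commute)
        also have "\<dots> \<le> wl2_norm G \<sigma> (S (\<lambda>v. f v - fY Y v)) * (\<sigma> v * sqrt (real (vsize G v)))"
          by (rule wl2_bound[OF Sw True pos[OF True]])
        also have "\<dots> \<le> (\<bar>C\<bar> * wl2_norm G \<rho> (\<lambda>v. f v - fY Y v)) * (\<sigma> v * sqrt (real (vsize G v)))"
          using le pos[OF True] by (intro mult_right_mono) auto
        also have "\<dots> = wl2_norm G \<rho> (\<lambda>v. f v - fY Y v) * c" by (simp add: c_def mult_ac)
        finally show "cmod (S (fY Y) v - S f v) \<le> wl2_norm G \<rho> (\<lambda>v. f v - fY Y v) * c" .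
      qed
      then show ?thesis by (rule LIM_zero_cancel)
    qed
  qed simp
  moreover have "cfun.span B' \<subseteq> cfun.span (S ` Z)" by (rule cfun.span_mono[OF B'(1)])
  ultimately show ?thesis unfolding Z_def by blast
qed

end

section \<open>Laurent coefficients of the resolvent\<close>

text \<open>One of the choices of weight, continuation and expansion over which \<open>grst\<close>
  takes its span.\<close>

locale resolvent_data = rooted_ends G q K0 x0 h
  for G :: "('v, 'e, 'g, 'h) gog" and q K0 x0 h +
  fixes N :: real and T :: "complex \<Rightarrow> ('v \<Rightarrow> complex) \<Rightarrow> 'v \<Rightarrow> complex"
    and \<mu>\<^sub>0 :: complex and J :: nat and C :: "nat \<Rightarrow> ('v \<Rightarrow> complex) \<Rightarrow> 'v \<Rightarrow> complex"
  assumes continuation: "resolvent_continuation G q x0 N T"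
    and mu0_in: "\<mu>\<^sub>0 \<in> cont_domain q N"
    and laurent: "laurent_ops G (dist_weight G q x0 (- N)) (dist_weight G q x0 N) T \<mu>\<^sub>0 J C"
begin

abbreviation \<Omega> :: "complex set" where "\<Omega> \<equiv> cont_domain q N"

abbreviation \<rho> :: "'v \<Rightarrow> real" where "\<rho> \<equiv> dist_weight G q x0 (- N)"

abbreviation \<sigma> :: "'v \<Rightarrow> real" where "\<sigma> \<equiv> dist_weight G q x0 N"

lemma \<sigma>_pos: "\<sigma> v > 0" using q_pos by (simp add: dist_weight_def)

lemma \<Omega>: "open \<Omega>" "Topological_Spaces.connected \<Omega>" "0 \<notin> \<Omega>"
  using cont_domain_props[of q N] q_ge_2 by auto

lemma mu0_nz: "\<mu>\<^sub>0 \<noteq> 0" using mu0_in \<Omega>(3) by blast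

lemma laurent_expansion_pointwise:
  assumes "laurent_ops G \<rho> \<sigma> T \<mu>\<^sub>1 J' C'" "f \<in> wl2 G \<rho>" "v \<in> gverts G"
  obtains r R where "r > 0"
    "(\<lambda>\<mu>. R \<mu> f v) holomorphic_on ball \<mu>\<^sub>1 r"
    "\<forall>\<mu>\<in>ball \<mu>\<^sub>1 r - {\<mu>\<^sub>1}. T \<mu> f v = (\<Sum>j=1..J'. C' j f v / (\<mu> - \<mu>\<^sub>1) ^ j) + R \<mu> f v"
proof -
  from assms(1) obtain r R where r: "r > 0" "holomorphic_ops G \<rho> \<sigma> (ball \<mu>\<^sub>1 r) R"
    "\<And>\<mu> f. \<mu> \<in> ball \<mu>\<^sub>1 r - {\<mu>\<^sub>1} \<Longrightarrow> f \<in> wl2 G \<rho> \<Longrightarrow>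
           T \<mu> f = (\<lambda>v. (\<Sum>j=1..J'. C' j f v / (\<mu> - \<mu>\<^sub>1) ^ j) + R \<mu> f v)"
    unfolding laurent_ops_def by blast
  have "(\<lambda>\<mu>. R \<mu> f v) holomorphic_on ball \<mu>\<^sub>1 r"
    unfolding holomorphic_on_def field_differentiable_def
    using holomorphic_ops_pointwise[OF r(2) open_ball _ assms(2,3) \<sigma>_pos] has_field_derivative_at_within by blast
  then show ?thesis using that[of r R] r(1) r(3)[OF _ assms(2)] by simp
qed

text \<open>The local expansions concern punctured neighbourhoods only, which is all that meromorphy
  asks for. The identity theorem then applies to each vertex separately.\<close>

lemma kernel_meromorphic:
  assumes "f \<in> wl2 G \<rho>" "v \<in> gverts G"
  shows "(\<lambda>\<mu>. T \<mu> f v) meromorphic_on \<Omega>"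
proof (subst meromorphic_on_meromorphic_at, rule ballI)
  fix \<mu>\<^sub>1 assume "\<mu>\<^sub>1 \<in> \<Omega>"
  then obtain J' C' where "laurent_ops G \<rho> \<sigma> T \<mu>\<^sub>1 J' C'"
    using continuation unfolding resolvent_continuation_def finitely_meromorphic_def by blast
  from laurent_expansion_pointwise[OF this assms] obtain r R where r: "r > 0"
    "(\<lambda>\<mu>. R \<mu> f v) holomorphic_on ball \<mu>\<^sub>1 r"
    "\<forall>\<mu>\<in>ball \<mu>\<^sub>1 r - {\<mu>\<^sub>1}. T \<mu> f v = (\<Sum>j=1..J'. C' j f v / (\<mu> - \<mu>\<^sub>1) ^ j) + R \<mu> f v" .
  have ev: "eventually (\<lambda>\<mu>. T \<mu> f v = (\<Sum>j=1..J'. C' j f v / (\<mu> - \<mu>\<^sub>1) ^ j) + R \<mu> f v) (at \<mu>\<^sub>1)"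
    unfolding eventually_at_topological
    using r(1,3) by (intro exI[of _ "ball \<mu>\<^sub>1 r"]) auto
  have "(\<lambda>\<mu>. R \<mu> f v) analytic_on ball \<mu>\<^sub>1 r" using r(2) by (simp add: analytic_on_open)
  then have "(\<lambda>\<mu>. R \<mu> f v) meromorphic_on ball \<mu>\<^sub>1 r" by (rule analytic_on_imp_meromorphic_on)
  then have "(\<lambda>\<mu>. R \<mu> f v) meromorphic_on {\<mu>\<^sub>1}" by (rule meromorphic_on_subset) (use r(1) in auto)
  then have "(\<lambda>\<mu>. (\<Sum>j=1..J'. C' j f v / (\<mu> - \<mu>\<^sub>1) ^ j) + R \<mu> f v) meromorphic_on {\<mu>\<^sub>1}"
    by (intro meromorphic_intros) auto
  then show "(\<lambda>\<mu>. T \<mu> f v) meromorphic_on {\<mu>\<^sub>1}"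
    using ev by (subst meromorphic_on_cong[OF _ refl]) auto
qed

definition finsupp :: "'v set \<Rightarrow> ('v \<Rightarrow> complex) \<Rightarrow> bool" where
  "finsupp K f \<longleftrightarrow> (\<forall>v. v \<notin> K \<longrightarrow> f v = 0)"

lemma finsupp_in:
  assumes "finsupp K f" "good K"
  shows "f \<in> vfuns G" "f \<in> wl2 G \<tau>"
proof -
  show "f \<in> vfuns G" using assms good_sub by (auto simp: finsupp_def vfuns_def)
  then show "f \<in> wl2 G \<tau>" using assms by (intro finsupp_wl2[of f K]) (auto simp: finsupp_def good_def)
qed

lemma large_mu:
  obtains M where "M \<ge> sqrt (real q)" "\<And>\<mu> K f. cmod \<mu> > M \<Longrightarrow> good K \<Longrightarrow> finsupp K f \<Longrightarrow>
      T \<mu> f \<in> l2 G \<and> shifted_adjacency G q \<mu> (T \<mu> f) = f"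
    "\<And>\<mu>. cmod \<mu> > M \<Longrightarrow> inj_on (shifted_adjacency G q \<mu>) (l2 G)"
proof -
  obtain M where M: "\<And>\<mu>. cmod \<mu> > M \<Longrightarrow> bij_betw (shifted_adjacency G q \<mu>) (l2 G) (l2 G)"
    "\<And>\<mu> f. cmod \<mu> > M \<Longrightarrow> f \<in> wl2 G \<rho> \<Longrightarrow> T \<mu> f = inv_into (l2 G) (shifted_adjacency G q \<mu>) f"
    using continuation unfolding resolvent_continuation_def by blast
  show ?thesis
  \<comment> \<open>The bound is raised to \<open>sqrt (real q)\<close> so that
    \<open>l2_outgoing\<close> applies beyond it.\<close>
  proof (rule that[of "max M (sqrt (real q))"])
    fix \<mu> K f assume a: "cmod \<mu> > max M (sqrt (real q))" "good K" "finsupp K f"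
    then have m: "cmod \<mu> > M" by simp
    have "f \<in> shifted_adjacency G q \<mu> ` l2 G"
      using M(1)[OF m] finsupp_in(2)[OF a(3,2)] by (simp add: bij_betw_def)
    then show "T \<mu> f \<in> l2 G \<and> shifted_adjacency G q \<mu> (T \<mu> f) = f"
      unfolding M(2)[OF m finsupp_in(2)[OF a(3,2)]] by (simp add: inv_into_into f_inv_into_f)
  qed (use M(1) in \<open>auto simp: bij_betw_def\<close>)
qed

lemma continuation_identity:
  assumes "\<phi> meromorphic_on \<Omega>" "\<And>\<mu>. cmod \<mu> > M \<Longrightarrow> \<phi> \<mu> = 0"
  shows "eventually (\<lambda>\<mu>. \<phi> \<mu> = 0) (at \<mu>\<^sub>0)"
proof -
  \<comment> \<open>A real point beyond both the inner radius of the domain and \<open>M\<close>;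
    the absolute value covers negative \<open>M\<close>.\<close>
  define x where "x = max (real q powr (1/2 - N)) \<bar>M\<bar> + 1"
  have x: "x > real q powr (1/2 - N)" "x > M" "x \<ge> 0" by (auto simp: x_def max_def)
  show ?thesis
  proof (rule meromorphic_eventually_0[OF assms(1) \<Omega>(1,2) mu0_in])
    show "complex_of_real x \<in> \<Omega>" using x by (simp add: cont_domain_def)
    have "open {\<mu>. cmod \<mu> > M}" by (intro open_Collect_less continuous_intros)
    moreover have "complex_of_real x \<in> {\<mu>. cmod \<mu> > M}" using x by simp
    ultimately have "eventually (\<lambda>\<mu>. \<mu> \<in> {\<mu>. cmod \<mu> > M}) (at (complex_of_real x))"
      by (rule eventually_at_in_open')
    then show "eventually (\<lambda>\<mu>. \<phi> \<mu> = 0) (at (complex_of_real x))"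
      by eventually_elim (use assms(2) in auto)
  qed
qed

lemma zpar_meromorphic: "zpar meromorphic_on \<Omega>"
  unfolding zpar_def[abs_def] by (intro meromorphic_intros)

lemma kap_meromorphic: "(\<lambda>\<mu>. kap \<mu> v) meromorphic_on \<Omega>"
  unfolding kap_def by (intro meromorphic_intros)

lemma shifted_meromorphic:
  assumes "\<And>w. w \<in> gverts G \<Longrightarrow> (\<lambda>\<mu>. u \<mu> w) meromorphic_on \<Omega>" "v \<in> gverts G"
  shows "(\<lambda>\<mu>. shifted_adjacency G q \<mu> (u \<mu>) v) meromorphic_on \<Omega>"
  unfolding shifted_adjacency_def adjacency_def
  by (intro meromorphic_intros zpar_meromorphic assms) (auto intro: org_in)

lemma resolvent_equation:
  assumes "good K" "finsupp K f" "v \<in> gverts G"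
  shows "eventually (\<lambda>\<mu>. shifted_adjacency G q \<mu> (T \<mu> f) v = f v) (at \<mu>\<^sub>0)"
proof -
  obtain M where M: "M \<ge> sqrt (real q)" "\<And>\<mu> K f. cmod \<mu> > M \<Longrightarrow> good K \<Longrightarrow> finsupp K f \<Longrightarrow>
      T \<mu> f \<in> l2 G \<and> shifted_adjacency G q \<mu> (T \<mu> f) = f"
    using large_mu by metis
  have "eventually (\<lambda>\<mu>. shifted_adjacency G q \<mu> (T \<mu> f) v - f v = 0) (at \<mu>\<^sub>0)"
  proof (rule continuation_identity)
    show "(\<lambda>\<mu>. shifted_adjacency G q \<mu> (T \<mu> f) v - f v) meromorphic_on \<Omega>"
      by (intro meromorphic_intros shifted_meromorphic kernel_meromorphic finsupp_in(2)[OF assms(2,1)] assms(3))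
    show "shifted_adjacency G q \<mu> (T \<mu> f) v - f v = 0" if "cmod \<mu> > M" for \<mu>
      using M(2)[OF that assms(1,2)] by simp
  qed
  then show ?thesis by simp
qed

lemma resolvent_outgoing:
  assumes "good K" "finsupp K f" "v \<in> ext" "v \<notin> K"
  shows "eventually (\<lambda>\<mu>. T \<mu> f v = kap \<mu> v * T \<mu> f (par v)) (at \<mu>\<^sub>0)"
proof -
  obtain M where M: "M \<ge> sqrt (real q)" "\<And>\<mu> K f. cmod \<mu> > M \<Longrightarrow> good K \<Longrightarrow> finsupp K f \<Longrightarrow>
      T \<mu> f \<in> l2 G \<and> shifted_adjacency G q \<mu> (T \<mu> f) = f"
    using large_mu by metis
  have "eventually (\<lambda>\<mu>. T \<mu> f v - kap \<mu> v * T \<mu> f (par v) = 0) (at \<mu>\<^sub>0)"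
  proof (rule continuation_identity)
    show "(\<lambda>\<mu>. T \<mu> f v - kap \<mu> v * T \<mu> f (par v)) meromorphic_on \<Omega>"
      by (intro meromorphic_intros kap_meromorphic kernel_meromorphic finsupp_in(2)[OF assms(2,1)] ext_in par_in assms(3))
    show "T \<mu> f v - kap \<mu> v * T \<mu> f (par v) = 0" if "cmod \<mu> > M" for \<mu>
    proof -
      have u: "T \<mu> f \<in> l2 G" "shifted_adjacency G q \<mu> (T \<mu> f) = f" using M(2)[OF that assms(1,2)] by auto
      have "cmod \<mu> > sqrt (real q)" using M(1) that by simp
      from l2_outgoing[OF assms(1) u(1) this _ assms(3,4)] u(2) assms(2)
      show ?thesis by (simp add: finsupp_def)
    qed
  qed
  then show ?thesis by simp
qed

text \<open>The principal part at \<open>\<mu>\<^sub>0\<close> multiplied by \<open>t\<^sup>J\<close>.\<close>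

definition principal_part :: "('v \<Rightarrow> complex) \<Rightarrow> 'v \<Rightarrow> complex poly" where
  "principal_part f v = (\<Sum>j=1..J. monom (C j f v) (J - j))"

lemma coeff_principal:
  assumes "i < J"
  shows "coeff (principal_part f v) i = C (J - i) f v"
proof -
  have "coeff (principal_part f v) i = (\<Sum>j=1..J. if j = J - i then C j f v else 0)"
    unfolding principal_part_def coeff_sum coeff_monom using assms by (intro sum.cong) auto
  then show ?thesis using assms by (simp add: sum.delta')
qed

lemma C_principal: "j \<in> {1..J} \<Longrightarrow> C j f = (\<lambda>v. coeff (principal_part f v) (J - j))"
  using coeff_principal[of "J - j" f] by (auto simp: fun_eq_iff)

lemma C_finite_rank: "j \<in> {1..J} \<Longrightarrow> finite_rank_op G \<rho> \<sigma> (C j)"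
  using laurent unfolding laurent_ops_def by blast

lemma C_vfuns: "j \<in> {1..J} \<Longrightarrow> f \<in> wl2 G \<rho> \<Longrightarrow> C j f \<in> vfuns G"
  using C_finite_rank[of j] unfolding finite_rank_op_def bounded_op_def wl2_def by blast

lemma nz_eventually: "eventually (\<lambda>\<mu>. \<mu> \<noteq> 0) (at \<mu>\<^sub>0)"
  using tendsto_imp_eventually_ne[OF tendsto_ident_at mu0_nz] .

lemma t_eventually: "eventually (\<lambda>\<mu>. \<mu> - \<mu>\<^sub>0 \<noteq> 0) (at \<mu>\<^sub>0)"
  by (simp add: eventually_at_filter)

lemma t_tendsto: "((\<lambda>\<mu>. \<mu> - \<mu>\<^sub>0) \<longlongrightarrow> 0) (at \<mu>\<^sub>0)"
  by (rule LIM_zero) (rule tendsto_ident_at)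

lemma laurent_remainder:
  assumes "f \<in> wl2 G \<rho>" "v \<in> gverts G"
  obtains R where "isCont R \<mu>\<^sub>0"
    "eventually (\<lambda>\<mu>. T \<mu> f v = (\<Sum>j=1..J. C j f v / (\<mu> - \<mu>\<^sub>0) ^ j) + R \<mu>) (at \<mu>\<^sub>0)"
proof -
  from laurent_expansion_pointwise[OF laurent assms] obtain r R where r: "r > 0"
    "(\<lambda>\<mu>. R \<mu> f v) holomorphic_on ball \<mu>\<^sub>0 r"
    "\<forall>\<mu>\<in>ball \<mu>\<^sub>0 r - {\<mu>\<^sub>0}. T \<mu> f v = (\<Sum>j=1..J. C j f v / (\<mu> - \<mu>\<^sub>0) ^ j) + R \<mu> f v" .
  show ?thesis
  proof (rule that[of "\<lambda>\<mu>. R \<mu> f v"])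
    show "isCont (\<lambda>\<mu>. R \<mu> f v) \<mu>\<^sub>0"
      using holomorphic_on_imp_continuous_on[OF r(2)] r(1) continuous_on_eq_continuous_at[OF open_ball] centre_in_ball by blast
    have "eventually (\<lambda>\<mu>. \<mu> \<in> ball \<mu>\<^sub>0 r - {\<mu>\<^sub>0}) (at \<mu>\<^sub>0)"
      using r(1) by (intro eventually_at_in_open) auto
    then show "eventually (\<lambda>\<mu>. T \<mu> f v = (\<Sum>j=1..J. C j f v / (\<mu> - \<mu>\<^sub>0) ^ j) + R \<mu> f v) (at \<mu>\<^sub>0)"
      by eventually_elim (use r(3) in blast)
  qed
qed

text \<open>Here \<open>g\<close> is the holomorphic remainder at \<open>v\<close>; only its
  continuity is kept, which makes its contribution \<open>t ^ J\<close> times something bounded near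
  \<open>\<mu>\<^sub>0\<close>.\<close>

lemma principal_eval:
  assumes "f \<in> wl2 G \<rho>" "v \<in> gverts G"
  obtains g where "isCont g \<mu>\<^sub>0"
    "eventually (\<lambda>\<mu>. poly (principal_part f v) (\<mu> - \<mu>\<^sub>0) = (\<mu> - \<mu>\<^sub>0) ^ J * (T \<mu> f v - g \<mu>)) (at \<mu>\<^sub>0)"
proof -
  from laurent_remainder[OF assms] obtain R where R: "isCont R \<mu>\<^sub>0"
    "eventually (\<lambda>\<mu>. T \<mu> f v = (\<Sum>j=1..J. C j f v / (\<mu> - \<mu>\<^sub>0) ^ j) + R \<mu>) (at \<mu>\<^sub>0)" .
  from R(2) t_eventually
  have "eventually (\<lambda>\<mu>. poly (principal_part f v) (\<mu> - \<mu>\<^sub>0) = (\<mu> - \<mu>\<^sub>0) ^ J * (T \<mu> f v - R \<mu>)) (at \<mu>\<^sub>0)"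
  proof eventually_elim
    case (elim \<mu>)
    show ?case
      unfolding elim(1) principal_part_def poly_sum poly_monom add_diff_cancel_right' sum_distrib_left
    proof (rule sum.cong[OF refl])
      fix j assume "j \<in> {1..J}"
      then have "(\<mu> - \<mu>\<^sub>0) ^ J = (\<mu> - \<mu>\<^sub>0) ^ (J - j) * (\<mu> - \<mu>\<^sub>0) ^ j" by (simp flip: power_add)
      then show "C j f v * (\<mu> - \<mu>\<^sub>0) ^ (J - j) = (\<mu> - \<mu>\<^sub>0) ^ J * (C j f v / (\<mu> - \<mu>\<^sub>0) ^ j)"
        using elim(2) by simp
    qed
  qed
  with R(1) show ?thesis by (rule that)
qed

text \<open>For \<open>J' = 0\<close> there is nothing to test; otherwise all coefficients below
  order \<open>J'\<close> vanish if division by \<open>t ^ (J' - 1)\<close> still leaves a null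
  function.\<close>

lemma monom_dvdI_tendsto:
  fixes p :: "complex poly"
  assumes "\<And>m. J' = Suc m \<Longrightarrow> ((\<lambda>\<mu>. poly p (\<mu> - \<mu>\<^sub>0) / (\<mu> - \<mu>\<^sub>0) ^ m) \<longlongrightarrow> 0) (at \<mu>\<^sub>0)"
  shows "monom 1 J' dvd p"
proof (cases J')
  case (Suc m)
  have "coeff p i = 0" if "i < J'" for i
    by (rule coeff_eq_0_of_tendsto_at[OF _ order_refl assms[OF Suc]]) (use that Suc in auto)
  then show ?thesis by (simp add: monom_1_dvd_iff')
qed simp

lemma poly_Mu: "poly (Mu \<mu>\<^sub>0) (\<mu> - \<mu>\<^sub>0) = \<mu>"
  by (simp add: Mu_def)

lemma poly_jetD: "poly (jetD \<mu>\<^sub>0 W v) (\<mu> - \<mu>\<^sub>0) =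
    \<mu> * adjacency G (\<lambda>w. poly (W w) (\<mu> - \<mu>\<^sub>0)) v - sq * ((\<mu>\<^sup>2 + 1) * poly (W v) (\<mu> - \<mu>\<^sub>0))"
  by (simp add: jetD_def poly_adjp poly_Mu)

lemma poly_jetE: "poly (jetE \<mu>\<^sub>0 W v) (\<mu> - \<mu>\<^sub>0) =
    sq * (\<mu> * poly (W v) (\<mu> - \<mu>\<^sub>0)) - of_real (ratio v) * poly (W (par v)) (\<mu> - \<mu>\<^sub>0)"
  by (simp add: jetE_def poly_Mu)

lemma shifted_as_jetD: "\<mu> \<noteq> 0 \<Longrightarrow> 2 * sq * \<mu> * shifted_adjacency G q \<mu> u v = \<mu> * adjacency G u v - sq * ((\<mu>\<^sup>2 + 1) * u v)"
  using sq_nz by (simp add: shifted_adjacency_def zpar_def field_simps power2_eq_square)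

text \<open>After multiplication by \<open>t ^ J\<close> the source of the resolvent equation is
  \<open>t ^ J * f v\<close>, and replacing the resolvent by its principal part changes both
  equations by \<open>t ^ J\<close> times a continuous function. Division by
  \<open>t ^ (J - 1)\<close> thus leaves \<open>t\<close> times a continuous function.\<close>

lemma principal_jet:
  assumes K: "good K" and f: "finsupp K f"
  shows "jet K \<mu>\<^sub>0 J (principal_part f)"
  unfolding jet_def
proof (intro conjI allI impI ballI)
  note fw = finsupp_in(2)[OF f K, of \<rho>]
  fix v assume "v \<notin> gverts G"
  then show "principal_part f v = 0" using C_vfuns[OF _ fw] by (auto simp: principal_part_def vfuns_def)
next
  note fw = finsupp_in(2)[OF f K, of \<rho>]
  fix v assume v: "v \<in> gverts G"
  have "\<exists>g. \<forall>w\<in>gverts G. isCont (g w) \<mu>\<^sub>0 \<and>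
     eventually (\<lambda>\<mu>. poly (principal_part f w) (\<mu> - \<mu>\<^sub>0) = (\<mu> - \<mu>\<^sub>0) ^ J * (T \<mu> f w - g w \<mu>)) (at \<mu>\<^sub>0)"
  proof (rule bchoice, rule ballI)
    fix w assume "w \<in> gverts G"
    from principal_eval[OF fw this] show "\<exists>g. isCont g \<mu>\<^sub>0 \<and>
       eventually (\<lambda>\<mu>. poly (principal_part f w) (\<mu> - \<mu>\<^sub>0) = (\<mu> - \<mu>\<^sub>0) ^ J * (T \<mu> f w - g \<mu>)) (at \<mu>\<^sub>0)"
      by blast
  qed
  then obtain g where g: "\<And>w. w \<in> gverts G \<Longrightarrow> isCont (g w) \<mu>\<^sub>0"
     "\<And>w. w \<in> gverts G \<Longrightarrow> eventually (\<lambda>\<mu>. poly (principal_part f w) (\<mu> - \<mu>\<^sub>0) = (\<mu> - \<mu>\<^sub>0) ^ J * (T \<mu> f w - g w \<mu>)) (at \<mu>\<^sub>0)"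
    by blast
  let ?A = "{e \<in> garcs G. ter G e = v}"
  show "monom 1 J dvd jetD \<mu>\<^sub>0 (principal_part f) v"
  proof (rule monom_dvdI_tendsto)
    fix m assume J: "J = Suc m"
    have "eventually (\<lambda>\<mu>. \<forall>e\<in>?A. poly (principal_part f (org G e)) (\<mu> - \<mu>\<^sub>0) = (\<mu> - \<mu>\<^sub>0) ^ J * (T \<mu> f (org G e) - g (org G e) \<mu>)) (at \<mu>\<^sub>0)"
      using finite_in_arcs g(2) org_in by (intro eventually_ball_finite) auto
    then have ev: "eventually (\<lambda>\<mu>. (\<mu> - \<mu>\<^sub>0) * (2 * sq * \<mu> * f v - (\<mu> * adjacency G (\<lambda>w. g w \<mu>) v - sq * ((\<mu>\<^sup>2 + 1) * g v \<mu>)))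
         = poly (jetD \<mu>\<^sub>0 (principal_part f) v) (\<mu> - \<mu>\<^sub>0) / (\<mu> - \<mu>\<^sub>0) ^ m) (at \<mu>\<^sub>0)"
      using g(2)[OF v] resolvent_equation[OF K f v] nz_eventually t_eventually
    proof eventually_elim
      case (elim \<mu>)
      have "adjacency G (\<lambda>w. poly (principal_part f w) (\<mu> - \<mu>\<^sub>0)) v = (\<mu> - \<mu>\<^sub>0) ^ J * adjacency G (\<lambda>w. T \<mu> f w - g w \<mu>) v"
        unfolding adjacency_def sum_distrib_left using elim(1) by (intro sum.cong) auto
      also have "adjacency G (\<lambda>w. T \<mu> f w - g w \<mu>) v = adjacency G (T \<mu> f) v - adjacency G (\<lambda>w. g w \<mu>) v"
        using adjacency_lin[of 1 "T \<mu> f" "-1" "\<lambda>w. g w \<mu>" v] by simp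
      finally have adj: "adjacency G (\<lambda>w. poly (principal_part f w) (\<mu> - \<mu>\<^sub>0)) v =
          (\<mu> - \<mu>\<^sub>0) ^ J * (adjacency G (T \<mu> f) v - adjacency G (\<lambda>w. g w \<mu>) v)" .
      have "poly (jetD \<mu>\<^sub>0 (principal_part f) v) (\<mu> - \<mu>\<^sub>0) = (\<mu> - \<mu>\<^sub>0) ^ J *
          ((\<mu> * adjacency G (T \<mu> f) v - sq * ((\<mu>\<^sup>2 + 1) * T \<mu> f v)) - (\<mu> * adjacency G (\<lambda>w. g w \<mu>) v - sq * ((\<mu>\<^sup>2 + 1) * g v \<mu>)))"
        unfolding poly_jetD elim(2) adj by (simp add: algebra_simps)
      also have "\<mu> * adjacency G (T \<mu> f) v - sq * ((\<mu>\<^sup>2 + 1) * T \<mu> f v) = 2 * sq * \<mu> * f v"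
        using shifted_as_jetD[OF elim(4), of "T \<mu> f" v] elim(3) by simp
      finally show ?case using elim(5) by (simp add: J)
    qed
    have "((\<lambda>\<mu>. (\<mu> - \<mu>\<^sub>0) * (2 * sq * \<mu> * f v - (\<mu> * adjacency G (\<lambda>w. g w \<mu>) v - sq * ((\<mu>\<^sup>2 + 1) * g v \<mu>))))
        \<longlongrightarrow> 0 * (2 * sq * \<mu>\<^sub>0 * f v - (\<mu>\<^sub>0 * adjacency G (\<lambda>w. g w \<mu>\<^sub>0) v - sq * ((\<mu>\<^sub>0\<^sup>2 + 1) * g v \<mu>\<^sub>0)))) (at \<mu>\<^sub>0)"
      unfolding adjacency_def
      by (intro tendsto_intros t_tendsto isContD[OF g(1)] v) (auto intro: org_in)
    then show "((\<lambda>\<mu>. poly (jetD \<mu>\<^sub>0 (principal_part f) v) (\<mu> - \<mu>\<^sub>0) / (\<mu> - \<mu>\<^sub>0) ^ m) \<longlongrightarrow> 0) (at \<mu>\<^sub>0)"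
      unfolding mult_zero_left using ev by (rule Lim_transform_eventually)
  qed
next
  note fw = finsupp_in(2)[OF f K, of \<rho>]
  fix v assume v: "v \<in> ext - K"
  then have ve: "v \<in> ext" "v \<notin> K" by auto
  obtain g where g: "isCont g \<mu>\<^sub>0"
    "eventually (\<lambda>\<mu>. poly (principal_part f v) (\<mu> - \<mu>\<^sub>0) = (\<mu> - \<mu>\<^sub>0) ^ J * (T \<mu> f v - g \<mu>)) (at \<mu>\<^sub>0)"
    using principal_eval[OF fw ext_in[OF ve(1)]] .
  obtain g' where g': "isCont g' \<mu>\<^sub>0"
    "eventually (\<lambda>\<mu>. poly (principal_part f (par v)) (\<mu> - \<mu>\<^sub>0) = (\<mu> - \<mu>\<^sub>0) ^ J * (T \<mu> f (par v) - g' \<mu>)) (at \<mu>\<^sub>0)"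
    using principal_eval[OF fw par_in[OF ve(1)]] .
  show "monom 1 J dvd jetE \<mu>\<^sub>0 (principal_part f) v"
  proof (rule monom_dvdI_tendsto)
    fix m assume J: "J = Suc m"
    have ev: "eventually (\<lambda>\<mu>. (\<mu> - \<mu>\<^sub>0) * (of_real (ratio v) * g' \<mu> - sq * (\<mu> * g \<mu>))
         = poly (jetE \<mu>\<^sub>0 (principal_part f) v) (\<mu> - \<mu>\<^sub>0) / (\<mu> - \<mu>\<^sub>0) ^ m) (at \<mu>\<^sub>0)"
      using g(2) g'(2) resolvent_outgoing[OF K f ve] nz_eventually t_eventually
    proof eventually_elim
      case (elim \<mu>)
      have "sq * \<mu> * T \<mu> f v = of_real (ratio v) * T \<mu> f (par v)"
        unfolding elim(3) using elim(4) sq_nz by (simp add: kap_def)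
      then have "poly (jetE \<mu>\<^sub>0 (principal_part f) v) (\<mu> - \<mu>\<^sub>0) = (\<mu> - \<mu>\<^sub>0) ^ J * (of_real (ratio v) * g' \<mu> - sq * (\<mu> * g \<mu>))"
        unfolding poly_jetE elim(1,2) by (simp add: algebra_simps)
      then show ?case using elim(5) by (simp add: J)
    qed
    have "((\<lambda>\<mu>. (\<mu> - \<mu>\<^sub>0) * (of_real (ratio v) * g' \<mu> - sq * (\<mu> * g \<mu>)))
        \<longlongrightarrow> 0 * (of_real (ratio v) * g' \<mu>\<^sub>0 - sq * (\<mu>\<^sub>0 * g \<mu>\<^sub>0))) (at \<mu>\<^sub>0)"
      by (intro tendsto_intros t_tendsto isContD[OF g(1)] isContD[OF g'(1)])
    then show "((\<lambda>\<mu>. poly (jetE \<mu>\<^sub>0 (principal_part f) v) (\<mu> - \<mu>\<^sub>0) / (\<mu> - \<mu>\<^sub>0) ^ m) \<longlongrightarrow> 0) (at \<mu>\<^sub>0)"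
      unfolding mult_zero_left using ev by (rule Lim_transform_eventually)
  qed
qed

lemma C_span_finsupp:
  assumes "j \<in> {1..J}" "f \<in> wl2 G \<rho>"
  shows "C j f \<in> cfun.span (C j ` {g. \<exists>K. good K \<and> finsupp K g})"
proof -
  have "C j f \<in> cfun.span (C j ` {g \<in> vfuns G. \<exists>K. finite K \<and> K \<subseteq> gverts G \<and> (\<forall>v. v \<notin> K \<longrightarrow> g v = 0)})"
    by (rule finite_rank_finsupp[OF C_finite_rank[OF assms(1)] assms(2) \<sigma>_pos])
  moreover have "{g \<in> vfuns G. \<exists>K. finite K \<and> K \<subseteq> gverts G \<and> (\<forall>v. v \<notin> K \<longrightarrow> g v = 0)} \<subseteq> {g. \<exists>K. good K \<and> finsupp K g}"
  proof clarify
    fix g K assume "finite K" "K \<subseteq> gverts G" "\<forall>v. v \<notin> K \<longrightarrow> g v = (0 :: complex)"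
    then show "\<exists>K. good K \<and> finsupp K g"
      using good_containing[of K] unfolding finsupp_def by (meson subsetD)
  qed
  ultimately show ?thesis using cfun.span_mono[OF image_mono] by blast
qed

lemma coefficient_outgoing:
  assumes "good K" "finsupp K f" "j \<in> {1..J}"
  shows "outg K \<mu>\<^sub>0 (C j f)" "\<exists>n. (shifted_adjacency G q \<mu>\<^sub>0 ^^ n) (C j f) = (\<lambda>_. 0)"
proof -
  have j: "J - j < J" using assms(3) by auto
  note jet = principal_jet[OF assms(1,2)]
  show "outg K \<mu>\<^sub>0 (C j f)"
    unfolding C_principal[OF assms(3)] by (rule jet_coeff_outg[OF assms(1) jet j mu0_nz])
  show "\<exists>n. (shifted_adjacency G q \<mu>\<^sub>0 ^^ n) (C j f) = (\<lambda>_. 0)"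
    unfolding C_principal[OF assms(3)] using jet_coeff_killed[OF jet j mu0_nz] by blast
qed

end

section \<open>The resonances \<open>\<plusminus>1\<close>\<close>

lemma zpar_Im: "Im (zpar \<mu>) = Im \<mu> * (1 - 1 / (cmod \<mu>)\<^sup>2) / 2"
  by (simp add: zpar_def cmod_power2 algebra_simps)

context resolvent_data
begin

text \<open>Points tending to \<open>\<plusminus>1\<close> from the region \<open>cmod \<mu> > 1\<close>, \<open>Im \<mu> > 0\<close>, where Green's formula
  controls the resolvent.\<close>

definition approach :: "real \<Rightarrow> complex" where
  "approach \<epsilon> = \<mu>\<^sub>0 * of_real (1 + \<epsilon>) + \<i> * of_real \<epsilon>"

text \<open>The point \<open>\<mu>\<^sub>0\<close> is critical for \<open>zpar\<close>, so along the
  curve its imaginary part is only quadratic in \<open>\<epsilon>\<close>. The 5 bounds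
  \<open>1 + 2 * \<epsilon> + 2 * \<epsilon>\<^sup>2\<close> for
  \<open>\<epsilon> \<le> 1\<close>.\<close>

lemma approach_props:
  assumes "\<mu>\<^sub>0 = 1 \<or> \<mu>\<^sub>0 = -1" "0 < \<epsilon>" "\<epsilon> \<le> 1"
  shows "Im (approach \<epsilon>) = \<epsilon>" "cmod (approach \<epsilon> - \<mu>\<^sub>0) = sqrt 2 * \<epsilon>" "(cmod (approach \<epsilon>))\<^sup>2 = 1 + 2 * \<epsilon> + 2 * \<epsilon>\<^sup>2"
    "Im (zpar (approach \<epsilon>)) \<ge> \<epsilon>\<^sup>2 / 5" "approach \<epsilon> \<noteq> 0"
proof -
  have re: "Re (approach \<epsilon>) = Re \<mu>\<^sub>0 * (1 + \<epsilon>)" "Im (approach \<epsilon>) = \<epsilon>" "(Re \<mu>\<^sub>0)\<^sup>2 = 1" "Im \<mu>\<^sub>0 = 0"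
    using assms(1) by (auto simp: approach_def)
  show "Im (approach \<epsilon>) = \<epsilon>" by (rule re)
  then show "approach \<epsilon> \<noteq> 0" using assms(2) by auto
  have "(Re (approach \<epsilon> - \<mu>\<^sub>0))\<^sup>2 = \<epsilon>\<^sup>2" using assms(1) by (auto simp: approach_def power2_eq_square)
  then have "cmod (approach \<epsilon> - \<mu>\<^sub>0) = sqrt (2 * \<epsilon>\<^sup>2)"
    using re by (simp add: cmod_def)
  then show "cmod (approach \<epsilon> - \<mu>\<^sub>0) = sqrt 2 * \<epsilon>" using assms(2) by (simp add: real_sqrt_mult)
  have "(cmod (approach \<epsilon>))\<^sup>2 = (1 + \<epsilon>)\<^sup>2 + \<epsilon>\<^sup>2"
    unfolding cmod_power2 re(1,2) power_mult_distrib re(3) by simp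
  then show n: "(cmod (approach \<epsilon>))\<^sup>2 = 1 + 2 * \<epsilon> + 2 * \<epsilon>\<^sup>2" by (simp add: power2_sum)
  have e2: "0 \<le> \<epsilon>\<^sup>2" "\<epsilon>\<^sup>2 \<le> 1" using assms(2,3) by (auto simp: power_le_one)
  have p: "1 + 2 * \<epsilon> + 2 * \<epsilon>\<^sup>2 > 0" "1 + 2 * \<epsilon> + 2 * \<epsilon>\<^sup>2 \<le> 5" using assms e2 by linarith+
  have "Im (zpar (approach \<epsilon>)) = \<epsilon> * (1 - 1 / (1 + 2 * \<epsilon> + 2 * \<epsilon>\<^sup>2)) / 2"
    unfolding zpar_Im n re(2) ..
  also have "\<dots> = \<epsilon> * (2 * \<epsilon> + 2 * \<epsilon>\<^sup>2) / (1 + 2 * \<epsilon> + 2 * \<epsilon>\<^sup>2) / 2"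
    using p(1) by (simp add: divide_simps)
  also have "\<dots> = \<epsilon>\<^sup>2 * (1 + \<epsilon>) / (1 + 2 * \<epsilon> + 2 * \<epsilon>\<^sup>2)"
    using p(1) by (simp add: field_simps power2_eq_square)
  also have "\<dots> \<ge> \<epsilon>\<^sup>2 * 1 / 5"
    using p assms(2) by (intro frac_le mult_left_mono mult_nonneg_nonneg) auto
  finally show "Im (zpar (approach \<epsilon>)) \<ge> \<epsilon>\<^sup>2 / 5" by simp
qed

definition approachF :: "complex filter" where "approachF = filtermap approach (at_right 0)"

lemma approachF_bot: "approachF \<noteq> bot"
  by (simp add: approachF_def filtermap_bot_iff)

lemma approachF_le:
  assumes "\<mu>\<^sub>0 = 1 \<or> \<mu>\<^sub>0 = -1"
  shows "approachF \<le> at \<mu>\<^sub>0"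
proof -
  have "filterlim approach (at \<mu>\<^sub>0) (at_right 0)"
    unfolding filterlim_at
  proof
    have ev: "eventually (\<lambda>\<epsilon>::real. \<epsilon> \<in> {0<..<1}) (at_right 0)"
      by (rule eventually_at_right_real) simp
    show "eventually (\<lambda>x. approach x \<in> UNIV \<and> approach x \<noteq> \<mu>\<^sub>0) (at_right 0)"
      using ev
    proof eventually_elim
      case (elim \<epsilon>)
      then have "cmod (approach \<epsilon> - \<mu>\<^sub>0) \<noteq> 0" using approach_props(2)[OF assms, of \<epsilon>] by simp
      then show ?case by auto
    qed
    have "((\<lambda>\<epsilon>::real. \<mu>\<^sub>0 * of_real (1 + \<epsilon>) + \<i> * of_real \<epsilon>) \<longlongrightarrow> \<mu>\<^sub>0 * of_real (1 + 0) + \<i> * of_real 0) (at_right 0)"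
      by (intro tendsto_intros)
    then show "(approach \<longlongrightarrow> \<mu>\<^sub>0) (at_right 0)" by (simp add: approach_def[abs_def])
  qed
  then show ?thesis by (simp add: approachF_def filterlim_def)
qed

text \<open>In \<open>green\<close> the bulk term carries \<open>Im (zpar \<mu>)\<close>, of order
  \<open>\<epsilon>\<^sup>2\<close>, but the boundary term carries
  \<open>Im \<mu> = \<epsilon>\<close>. The bulk norm is therefore of order at most
  \<open>1 / \<epsilon>\<^sup>2\<close>; inserting this bounds the squared boundary values by order
  \<open>1 / \<epsilon> ^ 3\<close> instead of \<open>1 / \<epsilon> ^ 4\<close>. The gain is what
  excludes a double pole at the boundary.\<close>

lemma resolvent_bounds:
  assumes pm: "\<mu>\<^sub>0 = 1 \<or> \<mu>\<^sub>0 = -1" and K: "good K" and f: "finsupp K f"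
  shows "\<exists>A\<ge>0. eventually (\<lambda>\<epsilon>. (\<forall>v\<in>K. cmod (T (approach \<epsilon>) f v) \<le> A / \<epsilon>\<^sup>2) \<and>
     (\<forall>e\<in>bd K. (cmod (T (approach \<epsilon>) f (ter G e)))\<^sup>2 \<le> A / \<epsilon> ^ 3)) (at_right 0)"
proof -
  have finK: "finite K" using K by (simp add: good_def)
  have finbd: "finite (bd K)"
    unfolding bd_def by (rule finite_subset[OF _ finite_arcs_into[OF finK]]) blast
  have finr: "finite (roots K)"
    using good_layer(1)[OF K] by (auto simp: good_def layer_def roots_def elim: rev_finite_subset)
  define c where "c = (\<Sum>v\<in>K. (cmod (f v))\<^sup>2 / real (vsize G v))"
  have c0: "c \<ge> 0" by (simp add: c_def sum_nonneg)
  \<comment> \<open>It dominates all group orders that occur, and being at least 1 it dominates its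
    own square root.\<close>
  define S where "S = (\<Sum>v\<in>K. real (vsize G v)) + (\<Sum>e\<in>bd K. real (esize G e)) + 1"
  have S0: "S \<ge> 1" by (simp add: S_def sum_nonneg)
  have Sv: "real (vsize G v) \<le> S" if "v \<in> K" for v
  proof -
    have "real (vsize G v) \<le> (\<Sum>v\<in>K. real (vsize G v))" using that finK by (intro member_le_sum) auto
    then show ?thesis by (simp add: S_def sum_nonneg add_increasing2)
  qed
  have Se: "real (esize G e) \<le> S" if "e \<in> bd K" for e
  proof -
    have "real (esize G e) \<le> (\<Sum>e\<in>bd K. real (esize G e))" using that finbd by (intro member_le_sum) auto
    moreover have "(\<Sum>v\<in>K. real (vsize G v)) \<ge> 0" by (simp add: sum_nonneg)
    ultimately show ?thesis by (simp add: S_def)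
  qed
  \<comment> \<open>One constant for both bounds: the first 5 is from the lower bound for
    \<open>Im (zpar \<mu>)\<close>, and \<open>50 * real q\<close> is this 5 times
    \<open>2 * real q * 5\<close>, with \<open>(cmod \<mu>)\<^sup>2 \<le> 5\<close>.\<close>
  define A where "A = S * (5 * sqrt c) + S * (50 * real q * c)"
  have A0: "A \<ge> 0" using S0 c0 by (simp add: A_def)
  have "eventually (\<lambda>\<mu>. (\<forall>v\<in>K. shifted_adjacency G q \<mu> (T \<mu> f) v = f v) \<and>
      (\<forall>v\<in>roots K. T \<mu> f v = kap \<mu> v * T \<mu> f (par v))) (at \<mu>\<^sub>0)"
    using finK finr resolvent_equation[OF K f] resolvent_outgoing[OF K f] good_sub[OF K] rootsD
    by (intro eventually_conj eventually_ball_finite) auto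
  then have "eventually (\<lambda>\<mu>. (\<forall>v\<in>K. shifted_adjacency G q \<mu> (T \<mu> f) v = f v) \<and>
      (\<forall>v\<in>roots K. T \<mu> f v = kap \<mu> v * T \<mu> f (par v))) approachF"
    using approachF_le[OF pm] filter_leD by blast
  then have ev: "eventually (\<lambda>\<epsilon>. (\<forall>v\<in>K. shifted_adjacency G q (approach \<epsilon>) (T (approach \<epsilon>) f) v = f v) \<and>
      (\<forall>v\<in>roots K. T (approach \<epsilon>) f v = kap (approach \<epsilon>) v * T (approach \<epsilon>) f (par v))) (at_right 0)"
    by (simp add: approachF_def eventually_filtermap)
  have ev1: "eventually (\<lambda>\<epsilon>::real. \<epsilon> \<in> {0<..<1}) (at_right 0)"
    by (rule eventually_at_right_real) simp
  have "eventually (\<lambda>\<epsilon>. (\<forall>v\<in>K. cmod (T (approach \<epsilon>) f v) \<le> A / \<epsilon>\<^sup>2) \<and>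
     (\<forall>e\<in>bd K. (cmod (T (approach \<epsilon>) f (ter G e)))\<^sup>2 \<le> A / \<epsilon> ^ 3)) (at_right 0)"
    using ev ev1
  proof eventually_elim
    case (elim \<epsilon>)
    define \<mu> u where "\<mu> = approach \<epsilon>" and "u = T \<mu> f"
    have \<epsilon>: "0 < \<epsilon>" "\<epsilon> < 1" "\<epsilon> \<le> 1" using elim by auto
    note ap = approach_props[OF pm \<epsilon>(1,3), folded \<mu>_def]
    define U where "U = (\<Sum>v\<in>K. (cmod (u v))\<^sup>2 / real (vsize G v))"
    define E where "E = (\<Sum>e\<in>bd K. (cmod (u (ter G e)))\<^sup>2 / real (esize G e))"
    have U0: "U \<ge> 0" "E \<ge> 0" by (auto simp: U_def E_def sum_nonneg)
    have "Im (zpar \<mu>) * U + Im \<mu> / (2 * real q * (cmod \<mu>)\<^sup>2) * E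
        \<le> (\<Sum>v\<in>K. cmod (shifted_adjacency G q \<mu> u v) * cmod (u v) / real (vsize G v))"
      unfolding U_def E_def using elim \<epsilon> ap by (intro green[OF K]) (auto simp: u_def \<mu>_def)
    also have "\<dots> = (\<Sum>v\<in>K. (cmod (f v) / sqrt (real (vsize G v))) * (cmod (u v) / sqrt (real (vsize G v))))"
      using elim by (intro sum.cong) (auto simp: u_def \<mu>_def)
    also have "\<dots> \<le> sqrt ((\<Sum>v\<in>K. (cmod (f v) / sqrt (real (vsize G v)))\<^sup>2) * (\<Sum>v\<in>K. (cmod (u v) / sqrt (real (vsize G v)))\<^sup>2))"
      by (intro real_le_rsqrt Cauchy_Schwarz_ineq_sum)
    also have "\<dots> = sqrt c * sqrt U"
      by (simp add: c_def U_def power_divide real_sqrt_mult)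
    finally have le: "Im (zpar \<mu>) * U + Im \<mu> / (2 * real q * (cmod \<mu>)\<^sup>2) * E \<le> sqrt c * sqrt U" .
    have "0 \<le> \<epsilon>\<^sup>2" "\<epsilon>\<^sup>2 \<le> 1" using \<epsilon> by (auto simp: power_le_one)
    then have n0: "(cmod \<mu>)\<^sup>2 > 0" "(cmod \<mu>)\<^sup>2 \<le> 5" unfolding ap(3) using \<epsilon> by linarith+
    have "\<epsilon>\<^sup>2 / 5 * U \<le> Im (zpar \<mu>) * U" using ap(4) U0 by (intro mult_right_mono) auto
    moreover have E1: "Im \<mu> / (2 * real q * (cmod \<mu>)\<^sup>2) * E \<ge> 0" using ap(1) \<epsilon> U0 by simp
    ultimately have "\<epsilon>\<^sup>2 / 5 * (sqrt U * sqrt U) \<le> sqrt c * sqrt U" using le U0 by simp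
    then have sU: "sqrt U \<le> 5 * sqrt c / \<epsilon>\<^sup>2"
    proof (cases "U = 0")
      case False
      then have "sqrt U > 0" using U0 by simp
      moreover assume "\<epsilon>\<^sup>2 / 5 * (sqrt U * sqrt U) \<le> sqrt c * sqrt U"
      ultimately have "\<epsilon>\<^sup>2 / 5 * sqrt U \<le> sqrt c" by (simp only: mult.assoc[symmetric] mult_le_cancel_right_pos)
      then show ?thesis using \<epsilon> by (simp add: field_simps)
    qed (use c0 in simp)
    have "Im (zpar \<mu>) * U \<ge> 0" using ap(4) \<epsilon> U0 by (intro mult_nonneg_nonneg) (auto intro: order_trans[OF _ ap(4)])
    then have "\<epsilon> / (2 * real q * (cmod \<mu>)\<^sup>2) * E \<le> sqrt c * (5 * sqrt c / \<epsilon>\<^sup>2)"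
      using le mult_left_mono[OF sU, of "sqrt c"] c0 unfolding ap(1) by simp
    also have "\<dots> = 5 * c / \<epsilon>\<^sup>2" using c0 by simp
    finally have "\<epsilon> / (2 * real q * (cmod \<mu>)\<^sup>2) * E \<le> 5 * c / \<epsilon>\<^sup>2" .
    moreover have "\<epsilon> / (2 * real q * 5) * E \<le> \<epsilon> / (2 * real q * (cmod \<mu>)\<^sup>2) * E"
      using n0 U0 \<epsilon> q_pos by (intro mult_right_mono divide_left_mono mult_left_mono mult_pos_pos) auto
    ultimately have "\<epsilon> / (2 * real q * 5) * E \<le> 5 * c / \<epsilon>\<^sup>2" by linarith
    then have E2: "E \<le> 50 * real q * c / \<epsilon> ^ 3"
      using \<epsilon> q_pos by (simp add: field_simps power2_eq_square power3_eq_cube)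
    show ?case unfolding \<mu>_def[symmetric] u_def[symmetric]
    proof (intro conjI ballI)
      fix v assume v: "v \<in> K"
      have vz: "real (vsize G v) > 0" using good_sub[OF K] v vsize_pos by auto
      have "(cmod (u v))\<^sup>2 / real (vsize G v) \<le> U"
        unfolding U_def using v finK by (intro member_le_sum) auto
      then have "(cmod (u v))\<^sup>2 \<le> real (vsize G v) * U" using vz by (simp add: field_simps)
      also have "\<dots> \<le> S * U" using Sv[OF v] U0 by (intro mult_right_mono)
      also have "\<dots> \<le> (S * S) * U" using S0 U0 by (intro mult_right_mono) auto
      finally have "cmod (u v) \<le> sqrt ((S * S) * U)" by (rule real_le_rsqrt)
      also have "\<dots> = S * sqrt U" using S0 by (simp add: real_sqrt_mult)
      also have "\<dots> \<le> S * (5 * sqrt c / \<epsilon>\<^sup>2)" using sU S0 by (intro mult_left_mono) auto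
      also have "\<dots> \<le> A / \<epsilon>\<^sup>2"
        using \<epsilon> S0 c0 by (simp add: A_def divide_right_mono)
      finally show "cmod (u v) \<le> A / \<epsilon>\<^sup>2" .
    next
      fix e assume e: "e \<in> bd K"
      have ez: "real (esize G e) > 0" using bdD(3)[OF K e] esize_pos by auto
      have "(cmod (u (ter G e)))\<^sup>2 / real (esize G e) \<le> E"
        unfolding E_def using e finbd by (intro member_le_sum[of e "bd K" "\<lambda>e. (cmod (u (ter G e)))\<^sup>2 / real (esize G e)"]) auto
      then have "(cmod (u (ter G e)))\<^sup>2 \<le> real (esize G e) * E" using ez by (simp add: field_simps)
      also have "\<dots> \<le> S * E" using Se[OF e] U0 by (intro mult_right_mono)
      also have "\<dots> \<le> S * (50 * real q * c / \<epsilon> ^ 3)" using E2 S0 by (intro mult_left_mono) auto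
      also have "\<dots> \<le> A / \<epsilon> ^ 3"
        using \<epsilon> S0 c0 by (simp add: A_def divide_right_mono)
      finally show "(cmod (u (ter G e)))\<^sup>2 \<le> A / \<epsilon> ^ 3" .
    qed
  qed
  then show ?thesis using A0 by blast
qed

text \<open>Coefficient \<open>i\<close> of the principal part belongs to the pole of order
  \<open>J - i\<close>, so the terms concerned are those of order greater than \<open>k\<close>. The
  factor \<open>sqrt 2 * \<epsilon>\<close> is the distance to \<open>\<mu>\<^sub>0\<close> along
  the approach.\<close>

lemma principal_part_vanish:
  assumes pm: "\<mu>\<^sub>0 = 1 \<or> \<mu>\<^sub>0 = -1" and f: "f \<in> wl2 G \<rho>" and v: "v \<in> gverts G"
    and k: "k < J"
    and bound: "((\<lambda>\<epsilon>. (sqrt 2 * \<epsilon>) ^ Suc k * cmod (T (approach \<epsilon>) f v)) \<longlongrightarrow> 0) (at_right 0)" "i \<le> J - Suc k"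
  shows "coeff (principal_part f v) i = 0"
proof (rule coeff_eq_0_of_tendsto_at[OF approachF_bot approachF_le[OF pm]])
  obtain g where g: "isCont g \<mu>\<^sub>0"
    "eventually (\<lambda>\<mu>. poly (principal_part f v) (\<mu> - \<mu>\<^sub>0) = (\<mu> - \<mu>\<^sub>0) ^ J * (T \<mu> f v - g \<mu>)) (at \<mu>\<^sub>0)"
    using principal_eval[OF f v] .
  have ev1: "eventually (\<lambda>\<epsilon>::real. \<epsilon> \<in> {0<..<1}) (at_right 0)"
    by (rule eventually_at_right_real) simp
  have 1: "((\<lambda>\<mu>. (\<mu> - \<mu>\<^sub>0) ^ Suc k * T \<mu> f v) \<longlongrightarrow> 0) approachF"
    unfolding approachF_def filterlim_filtermap
  proof (rule tendsto_norm_zero_cancel)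
    show "((\<lambda>\<epsilon>. cmod ((approach \<epsilon> - \<mu>\<^sub>0) ^ Suc k * T (approach \<epsilon>) f v)) \<longlongrightarrow> 0) (at_right 0)"
      using bound(1)
    proof (rule Lim_transform_eventually)
      show "eventually (\<lambda>\<epsilon>. (sqrt 2 * \<epsilon>) ^ Suc k * cmod (T (approach \<epsilon>) f v) =
          cmod ((approach \<epsilon> - \<mu>\<^sub>0) ^ Suc k * T (approach \<epsilon>) f v)) (at_right 0)"
        using ev1
      proof eventually_elim
        case (elim \<epsilon>)
        then have "0 < \<epsilon>" "\<epsilon> \<le> 1" by auto
        then show ?case unfolding norm_mult norm_power approach_props(2)[OF pm \<open>0 < \<epsilon>\<close> \<open>\<epsilon> \<le> 1\<close>] by simp
      qed
    qed
  qed
  have "((\<lambda>\<mu>. (\<mu> - \<mu>\<^sub>0) ^ Suc k * g \<mu>) \<longlongrightarrow> 0 ^ Suc k * g \<mu>\<^sub>0) (at \<mu>\<^sub>0)"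
    by (intro tendsto_mult tendsto_power t_tendsto isContD[OF g(1)])
  then have 2: "((\<lambda>\<mu>. (\<mu> - \<mu>\<^sub>0) ^ Suc k * g \<mu>) \<longlongrightarrow> 0) approachF"
    using tendsto_mono[OF approachF_le[OF pm]] by simp
  have lim: "((\<lambda>\<mu>. (\<mu> - \<mu>\<^sub>0) ^ Suc k * T \<mu> f v - (\<mu> - \<mu>\<^sub>0) ^ Suc k * g \<mu>) \<longlongrightarrow> 0) approachF"
    using tendsto_diff[OF 1 2] by simp
  have "eventually (\<lambda>\<mu>. (\<mu> - \<mu>\<^sub>0) ^ Suc k * T \<mu> f v - (\<mu> - \<mu>\<^sub>0) ^ Suc k * g \<mu> =
     poly (principal_part f v) (\<mu> - \<mu>\<^sub>0) / (\<mu> - \<mu>\<^sub>0) ^ (J - Suc k)) (at \<mu>\<^sub>0)"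
    using g(2) t_eventually
  proof eventually_elim
    case (elim \<mu>)
    have "(\<mu> - \<mu>\<^sub>0) ^ J = (\<mu> - \<mu>\<^sub>0) ^ Suc k * (\<mu> - \<mu>\<^sub>0) ^ (J - Suc k)"
      using k by (simp del: power_Suc flip: power_add)
    moreover have "(\<mu> - \<mu>\<^sub>0) ^ (J - Suc k) \<noteq> 0" using elim(2) by simp
    ultimately show ?case unfolding elim(1) by (simp add: right_diff_distrib mult_ac del: power_Suc)
  qed
  then have "eventually (\<lambda>\<mu>. (\<mu> - \<mu>\<^sub>0) ^ Suc k * T \<mu> f v - (\<mu> - \<mu>\<^sub>0) ^ Suc k * g \<mu> =
     poly (principal_part f v) (\<mu> - \<mu>\<^sub>0) / (\<mu> - \<mu>\<^sub>0) ^ (J - Suc k)) approachF"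
    using approachF_le[OF pm] filter_leD by blast
  with lim show "((\<lambda>\<mu>. poly (principal_part f v) (\<mu> - \<mu>\<^sub>0) / (\<mu> - \<mu>\<^sub>0) ^ (J - Suc k)) \<longlongrightarrow> 0) approachF"
    by (rule Lim_transform_eventually)
qed (rule bound(2))

text \<open>A function of order \<open>1 / \<epsilon>\<^sup>2\<close> has no pole of order three or
  more. The bound reaches any vertex, since the good set may be enlarged to contain it.\<close>

lemma principal_low_0:
  assumes pm: "\<mu>\<^sub>0 = 1 \<or> \<mu>\<^sub>0 = -1" and K: "good K" and f: "finsupp K f" and i: "i + 3 \<le> J"
  shows "coeff (principal_part f v) i = 0"
proof (cases "v \<in> gverts G")
  case False
  then show ?thesis using principal_jet[OF K f] by (simp add: jet_def)
next
  case True
  obtain K' where K': "good K'" "v \<in> K'" using good_containing_vertex[OF True] by blast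
  have KK: "good (K \<union> K')" using good_Un K K' by blast
  have f': "finsupp (K \<union> K') f" using f by (simp add: finsupp_def)
  obtain A where A: "A \<ge> 0" "eventually (\<lambda>\<epsilon>. (\<forall>v\<in>K \<union> K'. cmod (T (approach \<epsilon>) f v) \<le> A / \<epsilon>\<^sup>2) \<and>
      (\<forall>e\<in>bd (K \<union> K'). (cmod (T (approach \<epsilon>) f (ter G e)))\<^sup>2 \<le> A / \<epsilon> ^ 3)) (at_right 0)"
    using resolvent_bounds[OF pm KK f'] by blast
  have ev1: "eventually (\<lambda>\<epsilon>::real. \<epsilon> \<in> {0<..<1}) (at_right 0)"
    by (rule eventually_at_right_real) simp
  show ?thesis
  proof (rule principal_part_vanish[OF pm finsupp_in(2)[OF f K] True, where k = 2])
    show "2 < J" "i \<le> J - Suc 2" using i by auto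
    have "((\<lambda>\<epsilon>::real. (sqrt 2) ^ 3 * A * \<epsilon>) \<longlongrightarrow> (sqrt 2) ^ 3 * A * 0) (at_right 0)"
      by (intro tendsto_intros)
    then have lim: "((\<lambda>\<epsilon>::real. (sqrt 2) ^ 3 * A * \<epsilon>) \<longlongrightarrow> 0) (at_right 0)" by simp
    show "((\<lambda>\<epsilon>. (sqrt 2 * \<epsilon>) ^ Suc 2 * cmod (T (approach \<epsilon>) f v)) \<longlongrightarrow> 0) (at_right 0)"
    proof (rule Lim_null_comparison[OF _ lim])
      show "eventually (\<lambda>\<epsilon>. norm ((sqrt 2 * \<epsilon>) ^ Suc 2 * cmod (T (approach \<epsilon>) f v)) \<le> (sqrt 2) ^ 3 * A * \<epsilon>) (at_right 0)"
        using A(2) ev1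
      proof eventually_elim
        case (elim \<epsilon>)
        then have e: "0 < \<epsilon>" and b: "cmod (T (approach \<epsilon>) f v) \<le> A / \<epsilon>\<^sup>2" using K'(2) by auto
        have "norm ((sqrt 2 * \<epsilon>) ^ Suc 2 * cmod (T (approach \<epsilon>) f v)) = (sqrt 2 * \<epsilon>) ^ 3 * cmod (T (approach \<epsilon>) f v)"
          using e by (simp add: abs_mult power_abs numeral_3_eq_3 numeral_2_eq_2)
        also have "\<dots> \<le> (sqrt 2 * \<epsilon>) ^ 3 * (A / \<epsilon>\<^sup>2)" using b e by (intro mult_left_mono) auto
        also have "\<dots> = (sqrt 2) ^ 3 * A * \<epsilon>" using e by (simp add: power_mult_distrib power2_eq_square power3_eq_cube)
        finally show ?case .
      qed
    qed
  qed
qed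

text \<open>At the boundary vertices the resolvent is of order
  \<open>1 / (\<epsilon> * sqrt \<epsilon>)\<close>, too small for a double pole. As poles of order
  three are absent, the recursion for the double-pole coefficient is homogeneous, so the zero
  spreads from the boundary along each end.\<close>

lemma principal_second_0:
  assumes pm: "\<mu>\<^sub>0 = 1 \<or> \<mu>\<^sub>0 = -1" and K: "good K" and f: "finsupp K f" and J: "2 \<le> J"
    and v: "v \<in> gverts G" "v \<notin> K \<or> (\<exists>e\<in>bd K. v = ter G e)"
  shows "coeff (principal_part f v) (J - 2) = 0"
proof -
  have bdry: "coeff (principal_part f (ter G e)) (J - 2) = 0" if e: "e \<in> bd K" for e
  proof -
    have tv: "ter G e \<in> gverts G" using bdD(3)[OF K e] ter_in by blast
    obtain A where A: "A \<ge> 0" "eventually (\<lambda>\<epsilon>. (\<forall>v\<in>K. cmod (T (approach \<epsilon>) f v) \<le> A / \<epsilon>\<^sup>2) \<and>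
        (\<forall>e\<in>bd K. (cmod (T (approach \<epsilon>) f (ter G e)))\<^sup>2 \<le> A / \<epsilon> ^ 3)) (at_right 0)"
      using resolvent_bounds[OF pm K f] by blast
    have ev1: "eventually (\<lambda>\<epsilon>::real. \<epsilon> \<in> {0<..<1}) (at_right 0)"
      by (rule eventually_at_right_real) simp
    show ?thesis
    proof (rule principal_part_vanish[OF pm finsupp_in(2)[OF f K] tv, where k = 1])
      show "1 < J" "J - 2 \<le> J - Suc 1" using J by auto
      have "((\<lambda>\<epsilon>::real. 2 * sqrt A * sqrt \<epsilon>) \<longlongrightarrow> 2 * sqrt A * sqrt 0) (at_right 0)"
        by (intro tendsto_intros)
      then have lim: "((\<lambda>\<epsilon>::real. 2 * sqrt A * sqrt \<epsilon>) \<longlongrightarrow> 0) (at_right 0)" by simp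
      show "((\<lambda>\<epsilon>. (sqrt 2 * \<epsilon>) ^ Suc 1 * cmod (T (approach \<epsilon>) f (ter G e))) \<longlongrightarrow> 0) (at_right 0)"
      proof (rule Lim_null_comparison[OF _ lim])
        show "eventually (\<lambda>\<epsilon>. norm ((sqrt 2 * \<epsilon>) ^ Suc 1 * cmod (T (approach \<epsilon>) f (ter G e))) \<le> 2 * sqrt A * sqrt \<epsilon>) (at_right 0)"
          using A(2) ev1
        proof eventually_elim
          case (elim \<epsilon>)
          then have e0: "0 < \<epsilon>" and b: "(cmod (T (approach \<epsilon>) f (ter G e)))\<^sup>2 \<le> A / \<epsilon> ^ 3" using e by auto
          let ?x = "(sqrt 2 * \<epsilon>) ^ Suc 1 * cmod (T (approach \<epsilon>) f (ter G e))"
          have x: "?x = 2 * \<epsilon>\<^sup>2 * cmod (T (approach \<epsilon>) f (ter G e))"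
            by (simp add: power2_eq_square)
          have "?x\<^sup>2 = 4 * \<epsilon> ^ 4 * (cmod (T (approach \<epsilon>) f (ter G e)))\<^sup>2"
            unfolding x by (simp add: power_mult_distrib)
          also have "\<dots> \<le> 4 * \<epsilon> ^ 4 * (A / \<epsilon> ^ 3)" using b e0 by (intro mult_left_mono) auto
          also have "\<dots> = 4 * A * \<epsilon>" using e0 by (simp add: field_simps power_numeral_reduce)
          finally have "?x \<le> sqrt (4 * A * \<epsilon>)" by (rule real_le_rsqrt)
          also have "\<dots> = 2 * sqrt A * sqrt \<epsilon>" by (simp add: real_sqrt_mult)
          finally have "?x \<le> 2 * sqrt A * sqrt \<epsilon>" .
          moreover have "norm ?x = ?x" unfolding x using e0 by simp
          ultimately show ?case by simp
        qed
      qed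
    qed
  qed
  have low: "lower 1 (principal_part f) (J - 2) w = 0" for w
    using principal_low_0[OF pm K f, of "J - 2 - 1" w] by (auto simp: lower_def)
  have ext0: "w \<notin> K \<longrightarrow> coeff (principal_part f w) (J - 2) = 0" if "w \<in> gverts G" for w
    using K that
  proof (induction rule: parent_induct)
    case (step w)
    have "coeff (principal_part f (par w)) (J - 2) = 0"
    proof (cases "par w \<in> K")
      case True
      have "opp G (h w) \<in> bd K" "ter G (opp G (h w)) = par w"
        using True step(1,2) ext_h[OF step(1)] opp_in_arcs ter_opp org_opp by (auto simp: bd_def par_def)
      then show ?thesis using bdry by metis
    qed (use step in simp)
    then show ?case
      using jetE_coeff[OF principal_jet[OF K f] _ step(1,2) mu0_nz, of "J - 2"] J low by simp
  qed simp
  show ?thesis using v ext0 bdry by blast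
qed

text \<open>With \<open>\<mu>\<^sub>0 - 1 / \<mu>\<^sub>0 = 0\<close> the equation of
  \<open>jetD_coeff\<close> for the simple pole contains the double-pole coefficient only through
  its image under the shifted operator, which is zero.\<close>

lemma coefficient_constant_type:
  assumes pm: "\<mu>\<^sub>0 = 1 \<or> \<mu>\<^sub>0 = -1" and K: "good K" and f: "finsupp K f" and j: "j \<in> {1..J}"
  shows "outg_const K \<mu>\<^sub>0 (C j f)" "shifted_adjacency G q \<mu>\<^sub>0 (C j f) = (\<lambda>_. 0)"
proof -
  let ?P = "principal_part f"
  have vf: "C j f \<in> vfuns G" by (rule C_vfuns[OF j finsupp_in(2)[OF f K]])
  have m: "\<mu>\<^sub>0 - 1 / \<mu>\<^sub>0 = 0" using pm by auto
  have B0: "shifted_adjacency G q \<mu>\<^sub>0 (\<lambda>_. 0) = (\<lambda>_. 0)"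
    using shifted_pow_0[where n = 1] by simp
  have c3: "(\<lambda>v. coeff (?P v) i) = (\<lambda>_. 0)" if "i + 3 \<le> J" for i
    using principal_low_0[OF pm K f that] by auto
  have eqn: "2 * \<mu>\<^sub>0 * shifted_adjacency G q \<mu>\<^sub>0 (\<lambda>v. coeff (?P v) i) v =
      - 2 * shifted_adjacency G q \<mu>\<^sub>0 (lower 1 ?P i) v + lower 2 ?P i v" if "i < J" for i v
    using jetD_coeff[OF principal_jet[OF K f] that mu0_nz] m by simp
  have c2: "shifted_adjacency G q \<mu>\<^sub>0 (\<lambda>v. coeff (?P v) (J - 2)) = (\<lambda>_. 0)" if "2 \<le> J"
  proof -
    have l1: "lower 1 ?P (J - 2) = (\<lambda>_. 0)"
      using c3[of "J - 2 - 1"] by (auto simp: lower_def[abs_def] fun_eq_iff)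
    have l2: "lower 2 ?P (J - 2) = (\<lambda>_. 0)"
      using c3[of "J - 2 - 2"] by (auto simp: lower_def[abs_def] fun_eq_iff)
    have "J - 2 < J" using that by simp
    from eqn[OF this] show ?thesis unfolding l1 l2 B0 using mu0_nz by (simp add: fun_eq_iff)
  qed
  \<comment> \<open>Pole order \<open>j\<close> is jet coefficient \<open>J - j\<close>; the three
    cases have different reasons.\<close>
  consider "j \<ge> 3" | "j = 2" | "j = 1" using j by fastforce
  then have "outg_const K \<mu>\<^sub>0 (C j f) \<and> shifted_adjacency G q \<mu>\<^sub>0 (C j f) = (\<lambda>_. 0)"
  proof cases
    case 1
    then have Z: "C j f = (\<lambda>_. 0)" unfolding C_principal[OF j] using j by (intro c3) auto
    show ?thesis unfolding Z using B0 by (auto intro!: outg_constI[OF K _ _ mu0_nz] simp: vfuns_def)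
  next
    case 2
    then have J: "2 \<le> J" using j by simp
    have Cj: "C j f = (\<lambda>v. coeff (?P v) (J - 2))" using C_principal[OF j] 2 by simp
    have "outg_const K \<mu>\<^sub>0 (C j f)"
    proof (rule outg_constI[OF K vf _ mu0_nz])
      fix v assume v: "v \<in> ext" "v \<notin> K"
      have "coeff (?P v) (J - 2) = 0" using principal_second_0[OF pm K f J ext_in[OF v(1)]] v by blast
      moreover have "coeff (?P (par v)) (J - 2) = 0"
      proof (rule principal_second_0[OF pm K f J par_in[OF v(1)]])
        show "par v \<notin> K \<or> (\<exists>e\<in>bd K. par v = ter G e)"
        proof (cases "par v \<in> K")
          case True
          have "opp G (h v) \<in> bd K" "ter G (opp G (h v)) = par v"
            using True v ext_h[OF v(1)] opp_in_arcs ter_opp org_opp by (auto simp: bd_def par_def)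
          then show ?thesis by metis
        qed simp
      qed
      ultimately show "C j f v = kap \<mu>\<^sub>0 v * C j f (par v)" by (simp add: Cj)
    qed
    then show ?thesis using c2[OF J] by (simp add: Cj)
  next
    case 3
    have Cj: "C j f = (\<lambda>v. coeff (?P v) (J - 1))" using C_principal[OF j] 3 by simp
    have J: "J - 1 < J" using j by auto
    have "outg_const K \<mu>\<^sub>0 (C j f)"
    proof (rule outg_constI[OF K vf _ mu0_nz])
      fix v assume v: "v \<in> ext" "v \<notin> K"
      \<comment> \<open>For \<open>J = 1\<close> this is the default value of \<open>lower\<close>;
        otherwise it is the double-pole coefficient, absent outside \<open>K\<close>.\<close>
      have "lower 1 ?P (J - 1) v = 0"
        using principal_second_0[OF pm K f _ ext_in[OF v(1)]] v
        by (cases "2 \<le> J") (auto simp: lower_def numeral_2_eq_2)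
      then show "C j f v = kap \<mu>\<^sub>0 v * C j f (par v)"
        using jetE_coeff[OF principal_jet[OF K f] J v mu0_nz] by (simp add: Cj)
    qed
    moreover have "shifted_adjacency G q \<mu>\<^sub>0 (lower 1 ?P (J - 1)) = (\<lambda>_. 0)"
    proof (cases "2 \<le> J")
      case True
      then have "lower 1 ?P (J - 1) = (\<lambda>v. coeff (?P v) (J - 2))"
        by (auto simp: lower_def[abs_def] numeral_2_eq_2)
      then show ?thesis using c2[OF True] by simp
    next
      case False
      then have "lower 1 ?P (J - 1) = (\<lambda>_. 0)" using j by (auto simp: lower_def[abs_def])
      then show ?thesis using B0 by simp
    qed
    moreover have "lower 2 ?P (J - 1) = (\<lambda>_. 0)"
    proof (cases "J - 1 < 2")
      case False
      then have "lower 2 ?P (J - 1) = (\<lambda>v. coeff (?P v) (J - 1 - 2))" by (simp add: lower_def[abs_def])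
      then show ?thesis using c3[of "J - 1 - 2"] False by simp
    qed (simp add: lower_def[abs_def])
    ultimately show ?thesis using eqn[OF J] mu0_nz by (auto simp: Cj fun_eq_iff)
  qed
  then show "outg_const K \<mu>\<^sub>0 (C j f)" "shifted_adjacency G q \<mu>\<^sub>0 (C j f) = (\<lambda>_. 0)" by auto
qed

end

section \<open>Outgoing functions as resonant states\<close>

lemma sum_fun_apply: "(\<Sum>x\<in>A. f x) v = (\<Sum>x\<in>A. f x v)" for f :: "'x \<Rightarrow> 'v \<Rightarrow> complex"
  by (induction A rule: infinite_finite_induct) auto

context resolvent_data
begin

definition delta :: "'v \<Rightarrow> 'v \<Rightarrow> complex" where "delta x v = (if v = x then 1 else 0)"

definition states :: "('v \<Rightarrow> complex) set" where
  "states = {C j f | j f. j \<in> {1..J} \<and> f \<in> wl2 G \<rho>}"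

lemma delta_finsupp: "x \<in> K \<Longrightarrow> finsupp K (delta x)"
  by (auto simp: finsupp_def delta_def)

lemma delta_wl2: "x \<in> gverts G \<Longrightarrow> delta x \<in> wl2 G \<tau>"
  by (rule finsupp_wl2[where K = "{x}"]) (auto simp: vfuns_def delta_def)

text \<open>The scalars in \<open>c \<mu>\<close> contain negative powers of
  \<open>\<mu> - \<mu>\<^sub>0\<close> and need not converge. What counts is that
  \<open>c \<mu>\<close> stays in the span of one finite set and follows the scaled jet at every
  vertex.\<close>

lemma jet_limit:
  assumes K: "good K" and jet: "jet K \<mu>\<^sub>0 (Suc m) W"
  shows "\<exists>B c. finite B \<and> B \<subseteq> states \<and> (\<forall>\<mu>. c \<mu> \<in> cfun.span B) \<and>
    (\<forall>v. ((\<lambda>\<mu>. c \<mu> v - poly (W v) (\<mu> - \<mu>\<^sub>0) / (\<mu> - \<mu>\<^sub>0) ^ m) \<longlongrightarrow> 0) (at \<mu>\<^sub>0))"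
proof -
  have KV: "K \<subseteq> gverts G" and finK: "finite K" using K good_sub by (auto simp: good_def)
  define W\<mu> where "W\<mu> \<mu> v = poly (W v) (\<mu> - \<mu>\<^sub>0)" for \<mu> v
  have "\<forall>\<mu>. \<exists>w. (\<forall>v\<in>K. w v = W\<mu> \<mu> v) \<and> (\<forall>v. v \<in> ext \<longrightarrow> v \<notin> K \<longrightarrow> w v = kap \<mu> v * w (par v)) \<and>
      (\<forall>v. v \<notin> gverts G \<longrightarrow> w v = 0)"
  proof
    fix \<mu>
    obtain w where "\<And>v. v \<in> K \<Longrightarrow> w v = W\<mu> \<mu> v" "\<And>v. v \<in> ext \<Longrightarrow> v \<notin> K \<Longrightarrow> w v = kap \<mu> v * w (par v)"
      "\<And>v. v \<notin> gverts G \<Longrightarrow> w v = 0"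
      using extend_from_core[OF K, of "W\<mu> \<mu>" "kap \<mu>"] by blast
    then show "\<exists>w. (\<forall>v\<in>K. w v = W\<mu> \<mu> v) \<and> (\<forall>v. v \<in> ext \<longrightarrow> v \<notin> K \<longrightarrow> w v = kap \<mu> v * w (par v)) \<and>
      (\<forall>v. v \<notin> gverts G \<longrightarrow> w v = 0)" by blast
  qed
  from choice[OF this] obtain w where wK: "\<And>\<mu> v. v \<in> K \<Longrightarrow> w \<mu> v = W\<mu> \<mu> v"
    and wext: "\<And>\<mu> v. v \<in> ext \<Longrightarrow> v \<notin> K \<Longrightarrow> w \<mu> v = kap \<mu> v * w \<mu> (par v)"
    and woff: "\<And>\<mu> v. v \<notin> gverts G \<Longrightarrow> w \<mu> v = 0" by blast
  define g where "g \<mu> = shifted_adjacency G q \<mu> (w \<mu>)" for \<mu>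
  \<comment> \<open>On an end both defects in \<open>shifted_ext_children\<close> are zero by the
    exact recursion, which confines the source to \<open>K\<close>.\<close>
  have g_off: "g \<mu> v = 0" if mu: "\<mu> \<noteq> 0" and v: "v \<notin> K" for \<mu> v
  proof (cases "v \<in> gverts G")
    case False
    then show ?thesis by (simp add: g_def shifted_adjacency_def adjacency_off woff)
  next
    case True
    then have ve: "v \<in> ext" using good_notin[OF K] v by blast
    have "(\<Sum>e\<in>children v. of_real (wt e) * (w \<mu> (org G e) - kap \<mu> v * w \<mu> v)) = 0"
    proof (intro sum.neutral ballI)
      fix e assume e: "e \<in> children v"
      note c = child[OF ve e]
      have "w \<mu> (org G e) = kap \<mu> v * w \<mu> v"
        using wext[OF c(3) child_notin[OF K ve v e]] c(4,6) by (simp add: kap_def)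
      then show "of_real (wt e) * (w \<mu> (org G e) - kap \<mu> v * w \<mu> v) = 0" by simp
    qed
    moreover have "w \<mu> v - kap \<mu> v * w \<mu> (par v) = 0" using wext[OF ve v] by simp
    ultimately show ?thesis
      using shifted_ext_children[OF ve mu, of "w \<mu>"] sq_nz unfolding g_def by simp
  qed
  have W_mero: "(\<lambda>\<mu>. W\<mu> \<mu> v) meromorphic_on \<Omega>" for v
  proof -
    have "(\<lambda>\<mu>. W\<mu> \<mu> v) analytic_on UNIV" unfolding W\<mu>_def poly_altdef by (intro analytic_intros)
    then show ?thesis by (rule analytic_on_imp_meromorphic_on[OF analytic_on_subset]) auto
  qed
  have w_mero: "(\<lambda>\<mu>. w \<mu> v) meromorphic_on \<Omega>" if "v \<in> gverts G" for v
    using K that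
  proof (induction rule: parent_induct)
    case (core v)
    then show ?case using W_mero by (simp add: wK)
  next
    case (step v)
    have "(\<lambda>\<mu>. kap \<mu> v * w \<mu> (par v)) meromorphic_on \<Omega>"
      by (intro meromorphic_intros kap_meromorphic step(3))
    then show ?case using wext[OF step(1,2)] by simp
  qed
  have g_mero: "(\<lambda>\<mu>. g \<mu> v) meromorphic_on \<Omega>" if "v \<in> gverts G" for v
    unfolding g_def by (rule shifted_meromorphic[OF w_mero that])
  obtain M where M: "M \<ge> sqrt (real q)" "\<And>\<mu> K f. cmod \<mu> > M \<Longrightarrow> good K \<Longrightarrow> finsupp K f \<Longrightarrow>
      T \<mu> f \<in> l2 G \<and> shifted_adjacency G q \<mu> (T \<mu> f) = f"
    "\<And>\<mu>. cmod \<mu> > M \<Longrightarrow> inj_on (shifted_adjacency G q \<mu>) (l2 G)"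
    using large_mu by metis
  \<comment> \<open>Both sides are square summable with the same image, so injectivity of the
    shifted operator identifies them.\<close>
  have large: "(\<Sum>x\<in>K. g \<mu> x * T \<mu> (delta x) v) = w \<mu> v" if mu: "cmod \<mu> > M" for \<mu> v
  proof -
    have "cmod \<mu> > 1" using mu M(1) q_pos(5) by linarith
    then have mu1: "cmod \<mu> > 1" "\<mu> \<noteq> 0" by auto
    have wl: "w \<mu> \<in> l2 G"
      by (rule outgoing_l2[OF K _ mu1(1) wext]) (auto simp: vfuns_def woff)
    have T: "T \<mu> (delta x) \<in> l2 G" "shifted_adjacency G q \<mu> (T \<mu> (delta x)) = delta x" if "x \<in> K" for x
      using M(2)[OF mu K delta_finsupp[OF that]] by auto
    have "(\<lambda>v. \<Sum>x\<in>A. g \<mu> x * T \<mu> (delta x) v) \<in> l2 G \<and>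
       shifted_adjacency G q \<mu> (\<lambda>v. \<Sum>x\<in>A. g \<mu> x * T \<mu> (delta x) v) = (\<lambda>v. \<Sum>x\<in>A. g \<mu> x * delta x v)"
      if "A \<subseteq> K" for A
      using finite_subset[OF that finK] that
    proof (induction rule: finite_induct)
      case empty
      show ?case using shifted_pow_0[where n = 1] finsupp_wl2[where K = "{}" and f = "\<lambda>_. 0"] by (auto simp: vfuns_def)
    next
      case (insert x A)
      have eq: "(\<lambda>v. \<Sum>x\<in>insert x A. g \<mu> x * u x v) = (\<lambda>v. g \<mu> x * u x v + 1 * (\<Sum>x\<in>A. g \<mu> x * u x v))" for u :: "_ \<Rightarrow> _ \<Rightarrow> complex"
        using insert by simp
      have xK: "x \<in> K" using insert by simp
      have IH: "(\<lambda>v. \<Sum>x\<in>A. g \<mu> x * T \<mu> (delta x) v) \<in> l2 G"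
        "shifted_adjacency G q \<mu> (\<lambda>v. \<Sum>x\<in>A. g \<mu> x * T \<mu> (delta x) v) = (\<lambda>v. \<Sum>x\<in>A. g \<mu> x * delta x v)"
        using insert by auto
      show ?case unfolding eq shifted_lin T(2)[OF xK] IH(2) using wl2_lin[OF T(1)[OF xK] IH(1)] by blast
    qed
    from this[OF order_refl] have S: "(\<lambda>v. \<Sum>x\<in>K. g \<mu> x * T \<mu> (delta x) v) \<in> l2 G"
       "shifted_adjacency G q \<mu> (\<lambda>v. \<Sum>x\<in>K. g \<mu> x * T \<mu> (delta x) v) = (\<lambda>v. \<Sum>x\<in>K. g \<mu> x * delta x v)" by auto
    have "(\<Sum>x\<in>K. g \<mu> x * delta x v) = g \<mu> v" for v
    proof -
      have "(\<Sum>x\<in>K. g \<mu> x * delta x v) = (\<Sum>x\<in>K. if x = v then g \<mu> v else 0)"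
        by (rule sum.cong) (auto simp: delta_def)
      then show ?thesis using g_off[OF mu1(2)] finK by (simp add: sum.delta')
    qed
    then have "shifted_adjacency G q \<mu> (\<lambda>v. \<Sum>x\<in>K. g \<mu> x * T \<mu> (delta x) v) = shifted_adjacency G q \<mu> (w \<mu>)"
      unfolding S(2) by (simp add: g_def)
    from inj_onD[OF M(3)[OF mu] this S(1) wl] show ?thesis by (rule fun_cong)
  qed
  have ident: "eventually (\<lambda>\<mu>. (\<Sum>x\<in>K. g \<mu> x * T \<mu> (delta x) v) = w \<mu> v) (at \<mu>\<^sub>0)" if v: "v \<in> gverts G" for v
  proof -
    have "eventually (\<lambda>\<mu>. (\<Sum>x\<in>K. g \<mu> x * T \<mu> (delta x) v) - w \<mu> v = 0) (at \<mu>\<^sub>0)"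
    proof (rule continuation_identity)
      show "(\<lambda>\<mu>. (\<Sum>x\<in>K. g \<mu> x * T \<mu> (delta x) v) - w \<mu> v) meromorphic_on \<Omega>"
        using KV by (intro meromorphic_intros g_mero kernel_meromorphic delta_wl2 w_mero v) auto
      show "(\<Sum>x\<in>K. g \<mu> x * T \<mu> (delta x) v) - w \<mu> v = 0" if "cmod \<mu> > M" for \<mu>
        using large[OF that] by simp
    qed
    then show ?thesis by simp
  qed
  \<comment> \<open>The scaled difference between the exact extension and the truncated jet. It is
    zero on \<open>K\<close> and tends to zero generation by generation, because \<open>jetE\<close>
    is divisible by one power more than the denominator.\<close>
  define r where "r \<mu> v = (w \<mu> v - W\<mu> \<mu> v) / (\<mu> - \<mu>\<^sub>0) ^ m" for \<mu> v
  have kap_lim: "((\<lambda>\<mu>. kap \<mu> v) \<longlongrightarrow> kap \<mu>\<^sub>0 v) (at \<mu>\<^sub>0)" for v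
    unfolding kap_def using sq_nz mu0_nz by (intro tendsto_intros) auto
  have r0: "((\<lambda>\<mu>. r \<mu> v) \<longlongrightarrow> 0) (at \<mu>\<^sub>0)" if "v \<in> gverts G" for v
    using K that
  proof (induction rule: parent_induct)
    case (core v)
    then show ?case by (simp add: r_def wK)
  next
    case (step v)
    have "monom 1 (Suc m) dvd jetE \<mu>\<^sub>0 W v" using jet step(1,2) by (simp add: jet_def)
    note l1 = monom_dvd_tendsto_at[OF this, of \<mu>\<^sub>0]
    have "((\<lambda>\<mu>. kap \<mu> v * r \<mu> (par v) - (poly (jetE \<mu>\<^sub>0 W v) (\<mu> - \<mu>\<^sub>0) / (\<mu> - \<mu>\<^sub>0) ^ m) / (sq * \<mu>))
        \<longlongrightarrow> kap \<mu>\<^sub>0 v * 0 - 0 / (sq * \<mu>\<^sub>0)) (at \<mu>\<^sub>0)"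
      using sq_nz mu0_nz by (intro tendsto_intros kap_lim step(3) l1) auto
    then have "((\<lambda>\<mu>. kap \<mu> v * r \<mu> (par v) - (poly (jetE \<mu>\<^sub>0 W v) (\<mu> - \<mu>\<^sub>0) / (\<mu> - \<mu>\<^sub>0) ^ m) / (sq * \<mu>)) \<longlongrightarrow> 0) (at \<mu>\<^sub>0)"
      by simp
    moreover have "eventually (\<lambda>\<mu>. kap \<mu> v * r \<mu> (par v) - (poly (jetE \<mu>\<^sub>0 W v) (\<mu> - \<mu>\<^sub>0) / (\<mu> - \<mu>\<^sub>0) ^ m) / (sq * \<mu>) = r \<mu> v) (at \<mu>\<^sub>0)"
      using nz_eventually
    proof eventually_elim
      case (elim \<mu>)
      have "w \<mu> v - W\<mu> \<mu> v = kap \<mu> v * (w \<mu> (par v) - W\<mu> \<mu> (par v)) - poly (jetE \<mu>\<^sub>0 W v) (\<mu> - \<mu>\<^sub>0) / (sq * \<mu>)"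
        unfolding poly_jetE wext[OF step(1,2)] W\<mu>_def[symmetric] using elim sq_nz by (simp add: kap_def field_simps)
      then show ?case by (simp add: r_def diff_divide_distrib right_diff_distrib mult_ac)
    qed
    ultimately show ?case by (rule Lim_transform_eventually)
  qed
  \<comment> \<open>As \<open>w \<mu>\<close> is the jet plus
    \<open>(\<mu> - \<mu>\<^sub>0) ^ m\<close> times \<open>r \<mu>\<close>, the scaled source is a
    multiple of the scaled \<open>jetD\<close> plus the image of \<open>r \<mu>\<close>, both
    null.\<close>
  have g0: "((\<lambda>\<mu>. g \<mu> v / (\<mu> - \<mu>\<^sub>0) ^ m) \<longlongrightarrow> 0) (at \<mu>\<^sub>0)" if v: "v \<in> gverts G" for v
  proof -
    have "monom 1 (Suc m) dvd jetD \<mu>\<^sub>0 W v" using jet v by (simp add: jet_def)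
    note l1 = monom_dvd_tendsto_at[OF this, of \<mu>\<^sub>0]
    have "((\<lambda>\<mu>. (poly (jetD \<mu>\<^sub>0 W v) (\<mu> - \<mu>\<^sub>0) / (\<mu> - \<mu>\<^sub>0) ^ m) / (2 * sq * \<mu>) + shifted_adjacency G q \<mu> (r \<mu>) v)
        \<longlongrightarrow> 0 / (2 * sq * \<mu>\<^sub>0) + shifted_adjacency G q \<mu>\<^sub>0 (\<lambda>_. 0) v) (at \<mu>\<^sub>0)"
      unfolding shifted_adjacency_def adjacency_def zpar_def
      using sq_nz mu0_nz q_pos by (intro tendsto_intros l1 r0 v) (auto intro: org_in)
    then have "((\<lambda>\<mu>. (poly (jetD \<mu>\<^sub>0 W v) (\<mu> - \<mu>\<^sub>0) / (\<mu> - \<mu>\<^sub>0) ^ m) / (2 * sq * \<mu>) + shifted_adjacency G q \<mu> (r \<mu>) v) \<longlongrightarrow> 0) (at \<mu>\<^sub>0)"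
      using shifted_pow_0[where n = 1] by simp
    moreover have "eventually (\<lambda>\<mu>. (poly (jetD \<mu>\<^sub>0 W v) (\<mu> - \<mu>\<^sub>0) / (\<mu> - \<mu>\<^sub>0) ^ m) / (2 * sq * \<mu>) + shifted_adjacency G q \<mu> (r \<mu>) v
        = g \<mu> v / (\<mu> - \<mu>\<^sub>0) ^ m) (at \<mu>\<^sub>0)"
      using nz_eventually t_eventually
    proof eventually_elim
      case (elim \<mu>)
      let ?t = "(\<mu> - \<mu>\<^sub>0) ^ m"
      have tz: "?t \<noteq> 0" using elim by simp
      have wd: "w \<mu> = (\<lambda>v. 1 * W\<mu> \<mu> v + ?t * r \<mu> v)" using tz by (simp add: r_def fun_eq_iff)
      have "g \<mu> v = 1 * shifted_adjacency G q \<mu> (W\<mu> \<mu>) v + ?t * shifted_adjacency G q \<mu> (r \<mu>) v"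
        unfolding g_def by (subst wd) (simp only: shifted_lin)
      moreover have "2 * sq * \<mu> * shifted_adjacency G q \<mu> (W\<mu> \<mu>) v = poly (jetD \<mu>\<^sub>0 W v) (\<mu> - \<mu>\<^sub>0)"
        unfolding shifted_as_jetD[OF elim(1)] poly_jetD W\<mu>_def ..
      then have "shifted_adjacency G q \<mu> (W\<mu> \<mu>) v = poly (jetD \<mu>\<^sub>0 W v) (\<mu> - \<mu>\<^sub>0) / (2 * sq * \<mu>)"
        using elim(1) sq_nz by (simp add: field_simps)
      ultimately show ?case using tz by (simp add: add_divide_distrib)
    qed
    ultimately show ?thesis by (rule Lim_transform_eventually)
  qed
  define B where "B = (\<lambda>(j, x). C j (delta x)) ` ({1..J} \<times> K)"
  \<comment> \<open>The principal parts of the resolvent columns weighted by the scaled source. The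
    holomorphic parts carry weights that tend to zero and drop out.\<close>
  define c where "c \<mu> v = (\<Sum>x\<in>K. \<Sum>j=1..J. (g \<mu> x / (\<mu> - \<mu>\<^sub>0) ^ m / (\<mu> - \<mu>\<^sub>0) ^ j) * C j (delta x) v)" for \<mu> v
  show ?thesis
  proof (intro exI[of _ B] exI[of _ c] conjI allI)
    show "finite B" using finK by (simp add: B_def)
    show "B \<subseteq> states"
    proof
      fix y assume "y \<in> B"
      then obtain j x where "j \<in> {1..J}" "x \<in> K" "y = C j (delta x)" by (auto simp: B_def)
      then show "y \<in> states" unfolding states_def using delta_wl2[of x \<rho>] KV by blast
    qed
    fix \<mu>
    have "(\<Sum>x\<in>K. \<Sum>j=1..J. (\<lambda>v. (g \<mu> x / (\<mu> - \<mu>\<^sub>0) ^ m / (\<mu> - \<mu>\<^sub>0) ^ j) * C j (delta x) v)) \<in> cfun.span B"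
      by (intro cfun.span_sum cfun.span_scale cfun.span_base) (auto simp: B_def)
    moreover have "(\<Sum>x\<in>K. \<Sum>j=1..J. (\<lambda>v. (g \<mu> x / (\<mu> - \<mu>\<^sub>0) ^ m / (\<mu> - \<mu>\<^sub>0) ^ j) * C j (delta x) v)) = c \<mu>"
      by (simp add: fun_eq_iff c_def sum_fun_apply)
    ultimately show "c \<mu> \<in> cfun.span B" by simp
  next
    fix v
    show "((\<lambda>\<mu>. c \<mu> v - poly (W v) (\<mu> - \<mu>\<^sub>0) / (\<mu> - \<mu>\<^sub>0) ^ m) \<longlongrightarrow> 0) (at \<mu>\<^sub>0)"
    proof (cases "v \<in> gverts G")
      case False
      have "C j (delta x) v = 0" if "x \<in> K" "j \<in> {1..J}" for x j
        using C_vfuns[OF that(2) delta_wl2[of x]] KV that(1) False by (auto simp: vfuns_def)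
      then have "c \<mu> v = 0" for \<mu> by (simp add: c_def)
      moreover have "W v = 0" using jet False by (simp add: jet_def)
      ultimately show ?thesis by simp
    next
      case True
      have "\<forall>x\<in>K. \<exists>R. isCont R \<mu>\<^sub>0 \<and> eventually (\<lambda>\<mu>. T \<mu> (delta x) v = (\<Sum>j=1..J. C j (delta x) v / (\<mu> - \<mu>\<^sub>0) ^ j) + R \<mu>) (at \<mu>\<^sub>0)"
      proof
        fix x assume "x \<in> K"
        then have xw: "delta x \<in> wl2 G \<rho>" using KV delta_wl2 by blast
        from laurent_remainder[OF xw True]
        show "\<exists>R. isCont R \<mu>\<^sub>0 \<and> eventually (\<lambda>\<mu>. T \<mu> (delta x) v = (\<Sum>j=1..J. C j (delta x) v / (\<mu> - \<mu>\<^sub>0) ^ j) + R \<mu>) (at \<mu>\<^sub>0)"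
          by blast
      qed
      from bchoice[OF this] obtain R where R: "\<And>x. x \<in> K \<Longrightarrow> isCont (R x) \<mu>\<^sub>0"
        "\<And>x. x \<in> K \<Longrightarrow> eventually (\<lambda>\<mu>. T \<mu> (delta x) v = (\<Sum>j=1..J. C j (delta x) v / (\<mu> - \<mu>\<^sub>0) ^ j) + R x \<mu>) (at \<mu>\<^sub>0)"
        by blast
      have evR: "eventually (\<lambda>\<mu>. \<forall>x\<in>K. T \<mu> (delta x) v = (\<Sum>j=1..J. C j (delta x) v / (\<mu> - \<mu>\<^sub>0) ^ j) + R x \<mu>) (at \<mu>\<^sub>0)"
        using finK R(2) by (intro eventually_ball_finite) auto
      have "((\<lambda>\<mu>. r \<mu> v - (\<Sum>x\<in>K. (g \<mu> x / (\<mu> - \<mu>\<^sub>0) ^ m) * R x \<mu>)) \<longlongrightarrow> 0 - (\<Sum>x\<in>K. 0 * R x \<mu>\<^sub>0)) (at \<mu>\<^sub>0)"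
        using KV by (intro tendsto_intros r0 True g0 isContD[OF R(1)]) auto
      then have "((\<lambda>\<mu>. r \<mu> v - (\<Sum>x\<in>K. (g \<mu> x / (\<mu> - \<mu>\<^sub>0) ^ m) * R x \<mu>)) \<longlongrightarrow> 0) (at \<mu>\<^sub>0)" by simp
      moreover have "eventually (\<lambda>\<mu>. r \<mu> v - (\<Sum>x\<in>K. (g \<mu> x / (\<mu> - \<mu>\<^sub>0) ^ m) * R x \<mu>) =
          c \<mu> v - poly (W v) (\<mu> - \<mu>\<^sub>0) / (\<mu> - \<mu>\<^sub>0) ^ m) (at \<mu>\<^sub>0)"
        using evR ident[OF True]
      proof eventually_elim
        case (elim \<mu>)
        have "w \<mu> v / (\<mu> - \<mu>\<^sub>0) ^ m = (\<Sum>x\<in>K. (g \<mu> x / (\<mu> - \<mu>\<^sub>0) ^ m) * T \<mu> (delta x) v)"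
          unfolding elim(2)[symmetric] sum_divide_distrib by (intro sum.cong) auto
        also have "\<dots> = (\<Sum>x\<in>K. (\<Sum>j=1..J. (g \<mu> x / (\<mu> - \<mu>\<^sub>0) ^ m / (\<mu> - \<mu>\<^sub>0) ^ j) * C j (delta x) v) + (g \<mu> x / (\<mu> - \<mu>\<^sub>0) ^ m) * R x \<mu>)"
        proof (rule sum.cong[OF refl])
          fix x assume "x \<in> K"
          then have Tx: "T \<mu> (delta x) v = (\<Sum>j=1..J. C j (delta x) v / (\<mu> - \<mu>\<^sub>0) ^ j) + R x \<mu>" using elim(1) by blast
          show "(g \<mu> x / (\<mu> - \<mu>\<^sub>0) ^ m) * T \<mu> (delta x) v =
            (\<Sum>j=1..J. (g \<mu> x / (\<mu> - \<mu>\<^sub>0) ^ m / (\<mu> - \<mu>\<^sub>0) ^ j) * C j (delta x) v) + (g \<mu> x / (\<mu> - \<mu>\<^sub>0) ^ m) * R x \<mu>"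
            unfolding Tx distrib_left sum_distrib_left by (simp add: field_simps)
        qed
        also have "\<dots> = c \<mu> v + (\<Sum>x\<in>K. (g \<mu> x / (\<mu> - \<mu>\<^sub>0) ^ m) * R x \<mu>)"
          unfolding c_def sum.distrib ..
        finally show ?case by (simp add: r_def W\<mu>_def diff_divide_distrib)
      qed
      ultimately show ?thesis by (rule Lim_transform_eventually)
    qed
  qed
qed

lemma eigen_const_in_span:
  assumes "good K" "outg_const K \<mu>\<^sub>0 u" "shifted_adjacency G q \<mu>\<^sub>0 u = (\<lambda>_. 0)"
  shows "u \<in> cfun.span states"
proof -
  have "jet (layer K) \<mu>\<^sub>0 (Suc 0) (\<lambda>v. [:u v:])"
    using eigen_const_imp_jet[OF assms mu0_nz] by simp
  from jet_limit[OF good_layer(1)[OF assms(1)] this] obtain B c where B: "finite B" "B \<subseteq> states"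
    "\<And>\<mu>. c \<mu> \<in> cfun.span B" "\<And>v. ((\<lambda>\<mu>. c \<mu> v - u v) \<longlongrightarrow> 0) (at \<mu>\<^sub>0)"
    by auto
  have "u \<in> cfun.span B"
  proof (rule cfun_span_pointwise_closed[OF B(1), of "at \<mu>\<^sub>0" c])
    show "((\<lambda>\<mu>. c \<mu> v) \<longlongrightarrow> u v) (at \<mu>\<^sub>0)" for v by (rule LIM_zero_cancel[OF B(4)])
  qed (use B(3) in auto)
  then show ?thesis using cfun.span_mono[OF B(2)] by blast
qed

text \<open>In the scaled jet the factor of \<open>u\<close> converges to a nonzero number, while
  the factors of the iterates of \<open>u\<close> may blow up. Those iterates are killed by lower
  powers, so by induction they already lie in the span and can be subtracted.\<close>

lemma outgoing_in_span:
  assumes pm: "\<mu>\<^sub>0 \<noteq> 1" "\<mu>\<^sub>0 \<noteq> -1"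
  shows "good K \<Longrightarrow> outg K \<mu>\<^sub>0 u \<Longrightarrow> (shifted_adjacency G q \<mu>\<^sub>0 ^^ n) u = (\<lambda>_. 0) \<Longrightarrow> u \<in> cfun.span states"
proof (induction n arbitrary: K u rule: less_induct)
  case (less n)
  let ?B = "shifted_adjacency G q \<mu>\<^sub>0"
  show ?case
  proof (cases n)
    case 0
    then have "u = 0" using less.prems(3) by (auto simp: fun_eq_iff)
    then show ?thesis by (simp only: cfun.span_zero)
  next
    case (Suc m)
    obtain K1 where K1: "good K1" "jet K1 \<mu>\<^sub>0 (Suc m) (jetW \<mu>\<^sub>0 (Suc m) u)"
      using outgoing_imp_jet[OF less.prems(1,2) _ mu0_nz pm, of "Suc m"] less.prems(3) Suc by blast
    from jet_limit[OF this] obtain B c where B: "finite B" "B \<subseteq> states" "\<And>\<mu>. c \<mu> \<in> cfun.span B"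
      "\<And>v. ((\<lambda>\<mu>. c \<mu> v - poly (jetW \<mu>\<^sub>0 (Suc m) u v) (\<mu> - \<mu>\<^sub>0) / (\<mu> - \<mu>\<^sub>0) ^ m) \<longlongrightarrow> 0) (at \<mu>\<^sub>0)"
      by blast
    obtain K2 where K2: "good K2" "\<And>k. k \<le> n \<Longrightarrow> outg K2 \<mu>\<^sub>0 ((?B ^^ k) u)"
      using outg_shifted_pow[OF less.prems(1,2) mu0_nz] by blast
    have uk: "(?B ^^ k) u \<in> cfun.span states" if k: "1 \<le> k" "k \<le> m" for k
    proof (rule less.IH[of "n - k", OF _ K2])
      show "n - k < n" "k \<le> n" using k Suc by auto
      have "n - k + k = n" using k Suc by simp
      then show "(?B ^^ (n - k)) ((?B ^^ k) u) = (\<lambda>_. 0)"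
        using less.prems(3) by (metis funpow_add comp_apply)
    qed
    \<comment> \<open>This is \<open>\<mu>\<^sub>0\<close> times the derivative of
      \<open>zpar\<close> at \<open>\<mu>\<^sub>0\<close>, nonzero away from 1 and -1.\<close>
    define y where "y = (\<mu>\<^sub>0 - 1 / \<mu>\<^sub>0) / 2"
    have y: "y \<noteq> 0"
    proof
      assume "y = 0"
      then have "\<mu>\<^sub>0\<^sup>2 = 1" using mu0_nz by (simp add: y_def field_simps power2_eq_square)
      then show False using pm by (simp add: power2_eq_1_iff)
    qed
    define p where "p k \<mu> = poly (Mu \<mu>\<^sub>0 ^ k * Yp \<mu>\<^sub>0 ^ (m - k)) (\<mu> - \<mu>\<^sub>0) / (\<mu> - \<mu>\<^sub>0) ^ m" for k \<mu>
    have W: "poly (jetW \<mu>\<^sub>0 (Suc m) u v) (\<mu> - \<mu>\<^sub>0) / (\<mu> - \<mu>\<^sub>0) ^ m = p 0 \<mu> * u v + (\<Sum>k=1..m. p k \<mu> * (?B ^^ k) u v)" for \<mu> v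
    proof -
      have "poly (jetW \<mu>\<^sub>0 (Suc m) u v) (\<mu> - \<mu>\<^sub>0) / (\<mu> - \<mu>\<^sub>0) ^ m = (\<Sum>k<Suc m. p k \<mu> * (?B ^^ k) u v)"
        unfolding jetW_def poly_sum sum_divide_distrib by (rule sum.cong) (simp_all add: p_def)
      also have "{..<Suc m} = insert 0 {1..m}" by auto
      finally show ?thesis by simp
    qed
    have p0: "((\<lambda>\<mu>. p 0 \<mu>) \<longlongrightarrow> y ^ m) (at \<mu>\<^sub>0)"
    proof -
      have "((\<lambda>\<mu>. (y + (\<mu> - \<mu>\<^sub>0) / 2) ^ m) \<longlongrightarrow> (y + 0 / 2) ^ m) (at \<mu>\<^sub>0)"
        by (intro tendsto_intros t_tendsto) simp
      then have "((\<lambda>\<mu>. (y + (\<mu> - \<mu>\<^sub>0) / 2) ^ m) \<longlongrightarrow> y ^ m) (at \<mu>\<^sub>0)" by simp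
      moreover have "eventually (\<lambda>\<mu>. (y + (\<mu> - \<mu>\<^sub>0) / 2) ^ m = p 0 \<mu>) (at \<mu>\<^sub>0)"
        using t_eventually
      proof eventually_elim
        case (elim \<mu>)
        have "poly (Yp \<mu>\<^sub>0) (\<mu> - \<mu>\<^sub>0) = (\<mu> - \<mu>\<^sub>0) * (y + (\<mu> - \<mu>\<^sub>0) / 2)" by (simp add: Yp_def y_def)
        then show ?case using elim by (simp add: p_def power_mult_distrib)
      qed
      ultimately show ?thesis by (rule Lim_transform_eventually)
    qed
    \<comment> \<open>The iterates are added to the generators, since their unbounded factors rule
      out a limit of \<open>c \<mu>\<close> itself.\<close>
    define B' where "B' = B \<union> (\<lambda>k. (?B ^^ k) u) ` {1..m}"
    define c' where "c' \<mu> = c \<mu> - (\<Sum>k=1..m. (\<lambda>v. p k \<mu> * (?B ^^ k) u v))" for \<mu>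
    have "(\<lambda>v. y ^ m * u v) \<in> cfun.span B'"
    proof (rule cfun_span_pointwise_closed[of B' "at \<mu>\<^sub>0" c'])
      show "finite B'" using B(1) by (simp add: B'_def)
      have "cfun.span B \<subseteq> cfun.span B'" by (rule cfun.span_mono) (simp add: B'_def)
      then have cB: "c \<mu> \<in> cfun.span B'" for \<mu> using B(3) by blast
      have "c' \<mu> \<in> cfun.span B'" for \<mu>
        unfolding c'_def
      proof (intro cfun.span_diff cB cfun.span_sum cfun.span_scale)
        fix k assume "k \<in> {1..m}"
        then show "(?B ^^ k) u \<in> cfun.span B'" by (intro cfun.span_base) (simp add: B'_def)
      qed
      then show "eventually (\<lambda>\<mu>. c' \<mu> \<in> cfun.span B') (at \<mu>\<^sub>0)" by simp
      fix v
      have "c' \<mu> v = (c \<mu> v - poly (jetW \<mu>\<^sub>0 (Suc m) u v) (\<mu> - \<mu>\<^sub>0) / (\<mu> - \<mu>\<^sub>0) ^ m) + p 0 \<mu> * u v" for \<mu>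
        unfolding W by (simp add: c'_def sum_fun_apply)
      then show "((\<lambda>\<mu>. c' \<mu> v) \<longlongrightarrow> y ^ m * u v) (at \<mu>\<^sub>0)"
        using tendsto_add[OF B(4)[of v] tendsto_mult_right[OF p0, of "u v"]] by simp
    qed simp
    moreover have "cfun.span B' \<subseteq> cfun.span states"
    proof (rule cfun.span_minimal[OF _ cfun.subspace_span])
      show "B' \<subseteq> cfun.span states"
      proof
        fix x assume "x \<in> B'"
        then consider "x \<in> B" | k where "k \<in> {1..m}" "x = (?B ^^ k) u" unfolding B'_def by blast
        then show "x \<in> cfun.span states"
        proof cases
          case 1
          then show ?thesis using B(2) by (intro cfun.span_base) blast
        next
          case (2 k)
          then show ?thesis using uk[of k] by simp
        qed
      qed
    qed
    ultimately have "(\<lambda>v. y ^ m * u v) \<in> cfun.span states" by blast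
    from cfun.span_scale[OF this, of "1 / y ^ m"]
    have "(\<lambda>v. 1 / y ^ m * (y ^ m * u v)) \<in> cfun.span states" .
    moreover have "(\<lambda>v. 1 / y ^ m * (y ^ m * u v)) = u" using y by simp
    ultimately show ?thesis by (simp only:)
  qed
qed

end

section \<open>Parents in funnels and cusps\<close>

lemma cut_simps [simp]:
  "gverts (cut G F) = gverts G" "garcs (cut G F) = garcs G - F" "org (cut G F) = org G"
  "ter (cut G F) = ter G" "opp (cut G F) = opp G" "prongs (cut G F) = prongs G \<union> F"
  "vgrp (cut G F) = vgrp G" "egrp (cut G F) = egrp G" "emb (cut G F) = emb G"
  by (simp_all add: cut_def)

lemma restrict_gog_simps [simp]:
  "gverts (restrict_gog G X) = X"
  "garcs (restrict_gog G X) = {e \<in> garcs G. org G e \<in> X \<and> ter G e \<in> X}"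
  "org (restrict_gog G X) = org G" "ter (restrict_gog G X) = ter G" "opp (restrict_gog G X) = opp G"
  "prongs (restrict_gog G X) = {h \<in> prongs G. ter G h \<in> X}"
  "vgrp (restrict_gog G X) = vgrp G" "egrp (restrict_gog G X) = egrp G" "emb (restrict_gog G X) = emb G"
  by (simp_all add: restrict_gog_def)

lemma ugraph_restrict_gog: "ugraph (restrict_gog G X) = ugraph G \<restriction> X"
  by (simp add: restrict_gog_def)

lemma size_simps [simp]:
  "vsize (cut G F) = vsize G" "esize (cut G F) = esize G"
  "vsize (restrict_gog G X) = vsize G" "esize (restrict_gog G X) = esize G"
  by (simp_all add: vsize_def[abs_def] esize_def[abs_def])

context graph_of_groups_with_boundary
begin

lemma emb_iso_card:
  assumes "e \<in> garcs G \<union> prongs G" "emb G e \<in> iso (egrp G e) (vgrp G (ter G e))"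
  shows "esize G e = vsize G (ter G e)"
  using assms(2) unfolding esize_def vsize_def iso_def by (auto intro: bij_betw_same_card)

text \<open>An injection between finite sets of equal size is onto. Equality of groups thus becomes
  equality of orders, which the weights detect.\<close>

lemma card_emb_iso:
  assumes "e \<in> garcs G \<union> prongs G" "ter G e \<in> gverts G" "esize G e = vsize G (ter G e)"
  shows "emb G e \<in> iso (egrp G e) (vgrp G (ter G e))"
proof -
  have hom: "emb G e \<in> hom (egrp G e) (vgrp G (ter G e))" and inj: "inj_on (emb G e) (carrier (egrp G e))"
    using emb_mon[OF assms(1)] by (auto simp: mon_def)
  have sub: "emb G e ` carrier (egrp G e) \<subseteq> carrier (vgrp G (ter G e))"
    using hom by (auto simp: hom_def)
  have "card (emb G e ` carrier (egrp G e)) = card (carrier (vgrp G (ter G e)))"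
    using card_image[OF inj] assms(3) by (simp add: esize_def vsize_def)
  then have "emb G e ` carrier (egrp G e) = carrier (vgrp G (ter G e))"
    using card_subset_eq[OF vgrp_finite[OF assms(2)] sub] by simp
  then show ?thesis using hom inj by (simp add: iso_def bij_betw_def)
qed

lemma gdist_0: "u \<in> gverts G \<Longrightarrow> gdist G u u = 0"
  using gdist_le[of u "[]" u] by (simp add: U.awalk_Nil_iff)

lemma gdist_pos:
  assumes "u \<in> gverts G" "v \<in> gverts G" "u \<noteq> v"
  shows "gdist G u v > 0"
proof (rule ccontr)
  assume a: "\<not> ?thesis"
  obtain p where p: "U.awalk u p v" "length p = gdist G u v" using gdist_awalk assms by blast
  then have "p = []" using a by simp
  then show False using p(1) assms(3) by (simp add: U.awalk_Nil_iff)
qed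

lemma gdist_last_arc:
  assumes "u \<in> gverts G" "v \<in> gverts G" "u \<noteq> v"
  obtains e where "e \<in> garcs G" "ter G e = v" "gdist G u (org G e) < gdist G u v"
proof -
  obtain p where p: "U.awalk u p v" "length p = gdist G u v" using gdist_awalk assms(1,2) by blast
  have "p \<noteq> []" using p(1) assms(3) by (auto simp: U.awalk_Nil_iff)
  then obtain p' e where pe: "p = p' @ [e]" by (metis rev_exhaust)
  have w: "U.awalk u p' (org G e)" "e \<in> garcs G" "ter G e = v"
    using p(1) unfolding pe by (auto simp: U.awalk_simps)
  have "gdist G u (org G e) < gdist G u v"
    using gdist_le[OF w(1)] p(2) by (simp add: pe)
  then show ?thesis using that w by blast
qed

text \<open>In a tree, a second arc into \<open>v\<close> from a vertex at most as far from \<open>r\<close> as \<open>v\<close> would close a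
  cycle through \<open>v\<close>.\<close>

lemma tree_unique_parent:
  assumes tree: "tree_gog G" and r: "r \<in> gverts G"
    and e: "e \<in> garcs G" "ter G e = v" "gdist G r (org G e) \<le> gdist G r v"
    and e': "e' \<in> garcs G" "ter G e' = v" "gdist G r (org G e') \<le> gdist G r v"
  shows "e = e'"
proof -
  let ?X = "gverts G - {v}"
  interpret X: wf_digraph "ugraph G \<restriction> ?X" by (rule U.wellformed_induce_subgraph)
  have noloop: "org G x \<noteq> ter G x" if "x \<in> garcs G" for x
  proof
    assume "org G x = ter G x"
    then have "U.awalk (ter G x) [x] (ter G x)" "distinct (tl (U.awalk_verts (ter G x) [x]))"
      using that by (auto simp: U.awalk_simps)
    then have "U.cycle [x]" unfolding U.cycle_def by blast
    then show False using tree unfolding tree_gog_def by auto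
  qed
  \<comment> \<open>On a shortest way from \<open>r\<close> all earlier vertices are strictly closer
    to \<open>r\<close> than its end, hence different from \<open>v\<close>.\<close>
  have reach: "r \<rightarrow>\<^sup>*\<^bsub>ugraph G \<restriction> ?X\<^esub> w" if "w \<in> gverts G" "gdist G r w \<le> gdist G r v" "w \<noteq> v" for w
    using that
  proof (induction "gdist G r w" arbitrary: w rule: less_induct)
    case less
    show ?case
    proof (cases "w = r")
      case True
      show ?thesis unfolding True[symmetric] by (rule X.reachable_refl) (use less.prems in simp)
    next
      case False
      then obtain x where x: "x \<in> garcs G" "ter G x = w" "gdist G r (org G x) < gdist G r w"
        using gdist_last_arc[OF r less.prems(1)] by blast
      have "org G x \<noteq> v" using x less.prems by auto
      then have "r \<rightarrow>\<^sup>*\<^bsub>ugraph G \<restriction> ?X\<^esub> org G x"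
        using less.hyps[OF x(3) org_in[OF x(1)]] x(3) less.prems(2) by simp
      moreover have "org G x \<rightarrow>\<^bsub>ugraph G \<restriction> ?X\<^esub> w"
        using x less.prems \<open>org G x \<noteq> v\<close> org_in[OF x(1)]
        by (intro X.dominatesI[of x]) (auto simp: arc_to_ends_def)
      ultimately show ?thesis by (rule X.reachable_adj_trans)
    qed
  qed
  have sym: "symmetric (ugraph G \<restriction> ?X)"
    unfolding symmetric_def
  proof (rule symI)
    fix a b assume "a \<rightarrow>\<^bsub>ugraph G \<restriction> ?X\<^esub> b"
    then obtain x where x: "x \<in> garcs G" "org G x = a" "ter G x = b" "a \<in> ?X" "b \<in> ?X"
      by (elim reachableE) auto
    have "opp G x \<in> garcs G" "org G (opp G x) = b" "ter G (opp G x) = a"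
      using x opp_in_arcs org_opp ter_opp by auto
    then show "b \<rightarrow>\<^bsub>ugraph G \<restriction> ?X\<^esub> a"
      using x by (intro X.dominatesI[of "opp G x"]) (auto simp: arc_to_ends_def)
  qed
  have "r \<rightarrow>\<^sup>*\<^bsub>ugraph G \<restriction> ?X\<^esub> org G e'" "r \<rightarrow>\<^sup>*\<^bsub>ugraph G \<restriction> ?X\<^esub> org G e"
    using reach[OF org_in[OF e'(1)] e'(3)] reach[OF org_in[OF e(1)] e(3)] noloop[OF e(1)] noloop[OF e'(1)] e(2) e'(2)
    by simp_all
  then have "org G e' \<rightarrow>\<^sup>*\<^bsub>ugraph G \<restriction> ?X\<^esub> org G e"
    using symmetric_reachable[OF sym] X.reachable_trans by blast
  then obtain p where p: "X.apath (org G e') p (org G e)" using X.reachable_apath by blast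
  have sub: "subgraph (ugraph G \<restriction> ?X) (ugraph G)" by (rule U.subgraph_induce_subgraphI) blast
  have pG: "U.apath (org G e') p (org G e)" using U.subgraph_apath_imp_apath[OF p sub] .
  have "set (X.awalk_verts (org G e') p) \<subseteq> ?X"
  proof
    have "org G e' \<in> verts (ugraph G \<restriction> ?X)" "set p \<subseteq> arcs (ugraph G \<restriction> ?X)"
      using p unfolding X.apath_def X.awalk_def by blast+
    then show "x \<in> ?X" if "x \<in> set (X.awalk_verts (org G e') p)" for x
      using X.awalk_verts_in_verts[OF _ _ that] by simp
  qed
  then have vnot: "v \<notin> set (U.awalk_verts (org G e') p)"
    unfolding U.awalk_verts_induce by blast
  let ?p = "opp G e' # p @ [e]"
  have aw: "U.awalk (org G e') p (org G e)" using pG by (simp add: U.apath_def)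
  have oe': "opp G e' \<in> garcs G" "org G (opp G e') = v" "ter G (opp G e') = org G e'"
    using e' opp_in_arcs org_opp ter_opp by auto
  have "U.awalk v ?p v"
    using aw oe' e by (auto simp: U.awalk_simps)
  moreover have "distinct (tl (U.awalk_verts v ?p))"
  proof -
    have "U.awalk (org G e') (p @ [e]) v" using aw e by (auto simp: U.awalk_simps)
    then have "U.awalk_verts (org G e') (p @ [e]) = U.awalk_verts (org G e') p @ [v]"
      using U.awalk_verts_append[of "org G e'" p "[e]" v] e(2) by simp
    then show ?thesis using pG vnot oe' by (simp add: U.apath_def)
  qed
  ultimately have "U.cycle ?p" unfolding U.cycle_def by blast
  \<comment> \<open>A cycle in a tree has length two, so the connecting path is empty and
    \<open>e\<close> is the double reverse of \<open>e'\<close>.\<close>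
  then obtain x where "?p = [x, opp G x]" using tree unfolding tree_gog_def by blast
  then have "e = opp G (opp G e')" by (cases p) auto
  then show ?thesis using opp_opp e'(1) by simp
qed

end

text \<open>The common shape of funnels and cusps: one distinguished arc into each vertex, the prong
  playing this part at the top, and \<open>a\<close> the weight of these arcs.\<close>

definition piece_parents :: "('v, 'e, 'g, 'h) gog \<Rightarrow> real \<Rightarrow> ('v \<Rightarrow> 'e) \<Rightarrow> bool" where
  "piece_parents P a h \<longleftrightarrow> (\<forall>v\<in>gverts P. h v \<in> garcs P \<union> prongs P \<and> ter P (h v) = v \<and>
     (\<forall>e\<in>garcs P \<union> prongs P. ter P e = v \<and> e \<noteq> h v \<longrightarrow> e \<in> garcs P \<and> h (org P e) = opp P e) \<and>
     real (vsize P v) = a * real (esize P (h v)))"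

text \<open>The parent arc comes from a vertex closer to the root. Any other arc comes from a
  strictly farther vertex, by \<open>tree_unique_parent\<close>, or at the root because a loop would
  be a cycle of length one; so its reverse is a parent arc.\<close>

lemma funnel_parents:
  assumes "orbifold_funnel P"
  shows "\<exists>h. piece_parents P 1 h"
proof -
  interpret P: graph_of_groups_with_boundary P using assms by (simp add: orbifold_funnel_def)
  from assms obtain r hh where r: "tree_gog P" "r \<in> gverts P" "prongs P = {hh}" "ter P hh = r"
    "emb P hh \<in> iso (egrp P hh) (vgrp P r)"
    "\<And>e. e \<in> garcs P \<Longrightarrow> gdist P r (org P e) < gdist P r (ter P e) \<Longrightarrow> emb P e \<in> iso (egrp P e) (vgrp P (ter P e))"
    unfolding orbifold_funnel_def by blast
  have "\<forall>v. \<exists>e. v \<in> gverts P \<longrightarrow> v \<noteq> r \<longrightarrow> e \<in> garcs P \<and> ter P e = v \<and> gdist P r (org P e) < gdist P r v"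
    using P.gdist_last_arc[OF r(2)] by metis
  then obtain k where k: "\<And>v. v \<in> gverts P \<Longrightarrow> v \<noteq> r \<Longrightarrow>
      k v \<in> garcs P \<and> ter P (k v) = v \<and> gdist P r (org P (k v)) < gdist P r v" by metis
  define h where "h v = (if v = r then hh else k v)" for v
  have far: "gdist P r (org P e) > gdist P r (ter P e)" if e: "e \<in> garcs P" "e \<noteq> h (ter P e)" for e
  proof (rule ccontr)
    assume a: "\<not> ?thesis"
    show False
    proof (cases "ter P e = r")
      case True
      then have "gdist P r (org P e) = 0" using a P.gdist_0[OF r(2)] by simp
      then have o: "org P e = r" using P.gdist_pos[OF r(2) P.org_in[OF e(1)]] by auto
      have "P.U.awalk r [e] r" "distinct (tl (P.U.awalk_verts r [e]))"
        using e True o r(2) by (auto simp: P.U.awalk_simps)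
      then have "P.U.cycle [e]" unfolding P.U.cycle_def by blast
      then show False using r(1) unfolding tree_gog_def by auto
    next
      case False
      note kk = k[OF P.ter_in[OF e(1)] False]
      have "e = k (ter P e)"
        by (rule P.tree_unique_parent[OF r(1,2) e(1) refl]) (use a kk in auto)
      then show False using e False by (simp add: h_def)
    qed
  qed
  have "piece_parents P 1 h"
    unfolding piece_parents_def
  proof (intro ballI conjI impI)
    fix v assume v: "v \<in> gverts P"
    show hv: "h v \<in> garcs P \<union> prongs P" "ter P (h v) = v" using v k r by (auto simp: h_def)
    have "emb P (h v) \<in> iso (egrp P (h v)) (vgrp P (ter P (h v)))"
    proof (cases "v = r")
      case True
      then show ?thesis using r by (simp add: h_def)
    next
      case False
      then show ?thesis using r(6)[of "k v"] k[OF v] by (simp add: h_def)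
    qed
    then show "real (vsize P v) = 1 * real (esize P (h v))"
      using P.emb_iso_card[OF hv(1)] hv(2) by simp
    fix e assume "e \<in> garcs P \<union> prongs P" "ter P e = v \<and> e \<noteq> h v"
    moreover have "e \<notin> prongs P" using calculation r by (auto simp: h_def)
    ultimately show eP: "e \<in> garcs P" by blast
    have te: "ter P e = v" "e \<noteq> h v" using \<open>ter P e = v \<and> e \<noteq> h v\<close> by auto
    have fe: "gdist P r (org P e) > gdist P r v" using far[OF eP] te by simp
    have oe: "opp P e \<in> garcs P" "ter P (opp P e) = org P e" "org P (opp P e) = v"
      using P.opp_in_arcs P.ter_opp P.org_opp eP te by auto
    have "\<not> gdist P r (org P (opp P e)) > gdist P r (ter P (opp P e))" using fe oe by simp
    then show "h (org P e) = opp P e" using far[OF oe(1)] oe(2) by metis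
  qed
  then show ?thesis by blast
qed

text \<open>The arc from the next vertex of the ray has weight 1 because its group is the vertex
  group. Degree \<open>q + 1\<close> leaves weight \<open>q\<close> for the parent arc.\<close>

lemma cusp_parents:
  assumes "cusp P" and deg: "\<And>v. v \<in> gverts P \<Longrightarrow> gog_degree P v = real q + 1"
  shows "\<exists>h. piece_parents P (real q) h"
proof -
  interpret P: graph_of_groups_with_boundary P using assms by (simp add: cusp_def)
  from assms obtain r :: "nat \<Rightarrow> 'a" and a hh where bij: "bij_betw r UNIV (gverts P)" and
    c: "garcs P = range a \<union> range (\<lambda>i. opp P (a i))" "\<And>i. org P (a i) = r i" "\<And>i. ter P (a i) = r (Suc i)"
    "prongs P = {hh}" "ter P hh = r 0"
    "\<And>i. emb P (opp P (a i)) \<in> iso (egrp P (opp P (a i))) (vgrp P (r i))"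
    unfolding cusp_def by blast
  have inj: "r i = r j \<longleftrightarrow> i = j" for i j using bij by (auto simp: bij_betw_def inj_on_def)
  define n where "n = inv_into UNIV r"
  have n: "n (r i) = i" for i using bij by (simp add: n_def bij_betw_def inv_into_f_f)
  define h where "h v = (case n v of 0 \<Rightarrow> hh | Suc i \<Rightarrow> a i)" for v
  have h: "h (r 0) = hh" "h (r (Suc i)) = a i" for i by (simp_all add: h_def n)
  have aP: "a i \<in> garcs P" "opp P (a i) \<in> garcs P" "opp P (opp P (a i)) = a i"
    "org P (opp P (a i)) = r (Suc i)" "ter P (opp P (a i)) = r i" for i
    using c P.opp_opp P.org_opp P.ter_opp by auto
  have hP: "h (r i) \<in> garcs P \<union> prongs P" "ter P (h (r i)) = r i" for i
    by (cases i; use h c aP in auto)+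
  have into: "e = h (r i) \<or> e = opp P (a i)" if e: "e \<in> garcs P \<union> prongs P" "ter P e = r i" for e i
  proof -
    consider j where "e = a j" | j where "e = opp P (a j)" | "e = hh" using e(1) c(1,4) by blast
    then show ?thesis
    proof cases
      case (1 j)
      then have "i = Suc j" using e(2) c(3) inj by simp
      then show ?thesis using 1 h by simp
    next
      case (2 j)
      then show ?thesis using e(2) aP(5) inj by simp
    next
      case 3
      then have "i = 0" using e(2) c(5) inj by simp
      then show ?thesis using 3 h by simp
    qed
  qed
  have ne: "h (r i) \<noteq> opp P (a i)" for i
  proof (cases i)
    case 0
    then show ?thesis using h c(4) aP(2) P.prongs_disjoint by (metis IntI empty_iff insertI1)
  next
    case (Suc j)
    show ?thesis
    proof
      assume "h (r i) = opp P (a i)"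
      then have "org P (a j) = org P (opp P (a i))" using Suc h by simp
      then show False using c(2) aP(4) inj Suc by simp
    qed
  qed
  have "piece_parents P (real q) h"
    unfolding piece_parents_def
  proof (intro ballI conjI impI)
    fix v assume v: "v \<in> gverts P"
    then obtain i where i: "v = r i" using bij by (auto simp: bij_betw_def)
    show "h v \<in> garcs P \<union> prongs P" "ter P (h v) = v" using hP[of i] i by auto
    have S: "vsize P v > 0" "esize P (h v) > 0" using P.vsize_pos[OF v] P.esize_pos[OF hP(1)[of i]] i by auto
    have 1: "esize P (opp P (a i)) = vsize P v"
      using P.emb_iso_card[of "opp P (a i)"] aP(2,5)[of i] c(6)[of i] i by simp
    have "{e \<in> garcs P \<union> prongs P. ter P e = v} = {h v, opp P (a i)}"
    proof (intro subset_antisym subsetI)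
      fix x assume "x \<in> {e \<in> garcs P \<union> prongs P. ter P e = v}"
      then show "x \<in> {h v, opp P (a i)}" using into[of x i] unfolding i by blast
    next
      fix x assume "x \<in> {h v, opp P (a i)}"
      then show "x \<in> {e \<in> garcs P \<union> prongs P. ter P e = v}" using hP[of i] aP(2,5)[of i] unfolding i by blast
    qed
    then have "gog_degree P v = real (vsize P v) / real (esize P (h v)) + 1"
      unfolding gog_degree_def using ne[of i] S 1 i by simp
    then show "real (vsize P v) = real q * real (esize P (h v))"
      using deg[OF v] S by (simp add: field_simps)
    fix e assume e: "e \<in> garcs P \<union> prongs P" "ter P e = v \<and> e \<noteq> h v"
    then have "e = opp P (a i)" using into[of e i] unfolding i by blast
    then show "e \<in> garcs P" "h (org P e) = opp P e" using aP[of i] h(2)[of i] by auto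
  qed
  then show ?thesis by blast
qed

section \<open>Components after cutting\<close>

context graph_of_groups_with_boundary
begin

lemma wf_cut: "wf_digraph (ugraph (cut G F))"
  by unfold_locales (auto simp: org_in ter_in)

lemma cut_arc_reachable:
  assumes "e \<in> garcs G - F"
  shows "org G e \<rightarrow>\<^bsub>ugraph (cut G F)\<^esub> ter G e"
proof -
  interpret D: wf_digraph "ugraph (cut G F)" by (rule wf_cut)
  show ?thesis using assms by (intro D.dominatesI[of e]) (auto simp: arc_to_ends_def)
qed

lemma cut_opp:
  assumes "\<And>e. e \<in> F \<Longrightarrow> opp G e \<in> F" "e \<in> garcs G - F"
  shows "opp G e \<in> garcs G - F"
  using assms(1)[of "opp G e"] assms(2) opp_in_arcs opp_opp by auto

lemma scc_subset:
  assumes "X \<in> pre_digraph.sccs_verts (ugraph (cut G F))"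
  shows "X \<subseteq> gverts G"
proof
  fix v assume "v \<in> X"
  then have "v \<rightarrow>\<^sup>*\<^bsub>ugraph (cut G F)\<^esub> v" using assms unfolding pre_digraph.sccs_verts_def by blast
  then show "v \<in> gverts G" by (elim reachable_in_vertsE) simp
qed

text \<open>The cut set is closed under reversal, so an uncut arc can be travelled both ways and
  cannot leave its component.\<close>

lemma scc_closed:
  assumes F: "\<And>e. e \<in> F \<Longrightarrow> opp G e \<in> F" and X: "X \<in> pre_digraph.sccs_verts (ugraph (cut G F))"
    and e: "e \<in> garcs G - F" "org G e \<in> X"
  shows "ter G e \<in> X"
proof (rule ccontr)
  interpret D: wf_digraph "ugraph (cut G F)" by (rule wf_cut)
  assume n: "ter G e \<notin> X"
  have "org G e \<rightarrow>\<^sup>*\<^bsub>ugraph (cut G F)\<^esub> ter G e"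
    by (rule D.reachable_adjI[OF cut_arc_reachable[OF e(1)]])
  moreover have "ter G e \<rightarrow>\<^sup>*\<^bsub>ugraph (cut G F)\<^esub> org G e"
    using D.reachable_adjI[OF cut_arc_reachable[OF cut_opp[OF F e(1)]]] e(1) org_opp ter_opp by simp
  ultimately show False using X e(2) n unfolding pre_digraph.sccs_verts_def by blast
qed

lemma scc_closed':
  assumes F: "\<And>e. e \<in> F \<Longrightarrow> opp G e \<in> F" and X: "X \<in> pre_digraph.sccs_verts (ugraph (cut G F))"
    and e: "e \<in> garcs G - F" "ter G e \<in> X"
  shows "org G e \<in> X"
  using scc_closed[OF F X cut_opp[OF F e(1)]] e org_opp ter_opp by simp

lemma scc_strongly_connected:
  assumes F: "\<And>e. e \<in> F \<Longrightarrow> opp G e \<in> F" and X: "X \<in> pre_digraph.sccs_verts (ugraph (cut G F))"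
    and u: "u \<in> X" and v: "v \<in> X"
  shows "u \<rightarrow>\<^sup>*\<^bsub>ugraph (cut G F) \<restriction> X\<^esub> v"
proof -
  interpret D: wf_digraph "ugraph (cut G F)" by (rule wf_cut)
  interpret X: wf_digraph "ugraph (cut G F) \<restriction> X" by (rule D.wellformed_induce_subgraph)
  have "u \<rightarrow>\<^sup>*\<^bsub>ugraph (cut G F)\<^esub> v" using X u v unfolding pre_digraph.sccs_verts_def by blast
  then have "v \<in> X \<and> u \<rightarrow>\<^sup>*\<^bsub>ugraph (cut G F) \<restriction> X\<^esub> v"
  proof (induction rule: D.reachable_induct)
    case base
    show ?case using u X.reachable_refl[of u] by simp
  next
    case (step x y)
    from step(2) obtain e where e: "e \<in> garcs G - F" "org G e = x" "ter G e = y" by (elim reachableE) auto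
    have y: "y \<in> X" using scc_closed[OF F X e(1)] e step(3) by simp
    have "x \<rightarrow>\<^bsub>ugraph (cut G F) \<restriction> X\<^esub> y"
      using e y step(3) by (intro X.dominatesI[of e]) (auto simp: arc_to_ends_def)
    then show ?case using X.reachable_adj_trans step(3) y by blast
  qed
  then show ?thesis by blast
qed

end

text \<open>The parent arcs of a decomposition.  The last two clauses record that cut edges are parent
  arcs and that the pieces where the vertex group equals the parent edge group are trees.\<close>

lemma gf_decomposition_rooted:
  fixes G L :: "('v, 'e, 'g, 'h) gog"
  assumes q: "q \<ge> 2" and gf: "gf_decomposition G q F L" and x0: "x0 \<in> gverts L"
  shows "\<exists>h. rooted_ends G q (gverts L) x0 h \<and> (\<forall>e\<in>F. ter G e \<notin> gverts L \<longrightarrow> e = h (ter G e)) \<and>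
    (\<forall>v\<in>gverts G - gverts L. vsize G v = esize G (h v) \<longrightarrow>
       (\<exists>X\<in>pre_digraph.sccs_verts (ugraph (cut G F)). v \<in> X \<and> tree_gog (restrict_gog (cut G F) X)))"
proof -
  interpret G: graph_of_groups G using gf by (simp add: gf_decomposition_def)
  let ?D = "ugraph (cut G F)"
  interpret D: wf_digraph ?D by (rule G.wf_cut)
  let ?P = "restrict_gog (cut G F)"
  have F: "F \<subseteq> garcs G" "\<And>e. e \<in> F \<Longrightarrow> opp G e \<in> F" using gf by (auto simp: gf_decomposition_def)
  have finL: "finite (gverts L)" using gf by (simp add: gf_decomposition_def)
  obtain XL where XL: "XL \<in> D.sccs_verts" "L = ?P XL"
    using gf by (auto simp: gf_decomposition_def pieces_def)
  have gL: "gverts L = XL" using XL by simp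
  have "\<forall>X\<in>D.sccs_verts - {XL}. \<exists>ah. fst ah \<in> {1, real q} \<and> piece_parents (?P X) (fst ah) (snd ah) \<and>
      (fst ah = 1 \<longrightarrow> tree_gog (?P X)) \<and> (\<forall>v\<in>X. gog_degree (?P X) v = real q + 1)"
  proof
    fix X assume X: "X \<in> D.sccs_verts - {XL}"
    have "?P X \<noteq> L"
    proof
      assume "?P X = L"
      then have "gverts (?P X) = gverts L" by (rule arg_cong)
      then show False using X gL by simp
    qed
    then have "?P X \<in> pieces G F - {L}" using X by (simp add: pieces_def)
    then have P: "orbifold_funnel (?P X) \<or> cusp (?P X)" and deg: "\<And>v. v \<in> gverts (?P X) \<Longrightarrow> gog_degree (?P X) v = real q + 1"
      using gf unfolding gf_decomposition_def by blast+
    from P show "\<exists>ah. fst ah \<in> {1, real q} \<and> piece_parents (?P X) (fst ah) (snd ah) \<and> (fst ah = 1 \<longrightarrow> tree_gog (?P X)) \<and>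
       (\<forall>v\<in>X. gog_degree (?P X) v = real q + 1)"
    proof
      assume fu: "orbifold_funnel (?P X)"
      obtain h where "piece_parents (?P X) 1 h" using funnel_parents[OF fu] by blast
      moreover have "tree_gog (?P X)" using fu by (simp add: orbifold_funnel_def)
      ultimately show ?thesis using deg by (intro exI[of _ "(1, h)"]) simp
    next
      assume "cusp (?P X)"
      from cusp_parents[OF this deg] obtain h where "piece_parents (?P X) (real q) h" by blast
      then show ?thesis using deg q by (intro exI[of _ "(real q, h)"]) simp
    qed
  qed
  from bchoice[OF this] obtain ah where ah: "\<forall>X\<in>D.sccs_verts - {XL}. fst (ah X) \<in> {1, real q} \<and>
      piece_parents (?P X) (fst (ah X)) (snd (ah X)) \<and> (fst (ah X) = 1 \<longrightarrow> tree_gog (?P X)) \<and>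
      (\<forall>v\<in>X. gog_degree (?P X) v = real q + 1)" by blast
  define sc where "sc v = (SOME X. X \<in> D.sccs_verts \<and> v \<in> X)" for v
  define h where "h v = snd (ah (sc v)) v" for v
  have sc: "sc v = X" if "X \<in> D.sccs_verts" "v \<in> X" for v X
  proof -
    have "sc v \<in> D.sccs_verts \<and> v \<in> sc v" unfolding sc_def by (rule someI[of _ X]) (use that in blast)
    then show ?thesis using D.sccs_verts_disjoint[OF _ that(1)] that(2) by blast
  qed
  have scV: "sc v \<in> D.sccs_verts - {XL}" "v \<in> sc v" if v: "v \<in> gverts G" "v \<notin> XL" for v
  proof -
    have vD: "v \<in> verts ?D" using v by simp
    have X: "D.scc_of v \<in> D.sccs_verts" "v \<in> D.scc_of v"
      using D.scc_of_in_sccs_verts[OF vD] D.in_scc_of_self[OF vD] by auto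
    have "sc v = D.scc_of v" by (rule sc[OF X])
    then show "v \<in> sc v" "sc v \<in> D.sccs_verts - {XL}" using X v by auto
  qed
  have pp: "h v \<in> garcs G" "ter G (h v) = v" "fst (ah (sc v)) \<in> {1, real q}"
    "real (vsize G v) = fst (ah (sc v)) * real (esize G (h v))" "gog_degree G v = real q + 1"
    "\<And>e. e \<in> garcs G \<Longrightarrow> ter G e = v \<Longrightarrow> e \<noteq> h v \<Longrightarrow> e \<notin> F \<and> org G e \<in> sc v \<and> h (org G e) = opp G e"
    if v: "v \<in> gverts G" "v \<notin> XL" for v
  proof -
    note s = scV[OF v]
    have pr: "piece_parents (?P (sc v)) (fst (ah (sc v))) (snd (ah (sc v)))" and
      a1: "fst (ah (sc v)) \<in> {1, real q}" and dg: "gog_degree (?P (sc v)) v = real q + 1"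
      using ah s by blast+
    have vP: "v \<in> gverts (?P (sc v))" using s by simp
    from pr vP have *: "snd (ah (sc v)) v \<in> garcs (?P (sc v)) \<union> prongs (?P (sc v))"
      "ter (?P (sc v)) (snd (ah (sc v)) v) = v"
      "\<forall>e\<in>garcs (?P (sc v)) \<union> prongs (?P (sc v)). ter (?P (sc v)) e = v \<and> e \<noteq> snd (ah (sc v)) v \<longrightarrow>
          e \<in> garcs (?P (sc v)) \<and> snd (ah (sc v)) (org (?P (sc v)) e) = opp (?P (sc v)) e"
      "real (vsize (?P (sc v)) v) = fst (ah (sc v)) * real (esize (?P (sc v)) (snd (ah (sc v)) v))"
      unfolding piece_parents_def by blast+
    show "h v \<in> garcs G" "ter G (h v) = v" using *(1,2) F(1) G.no_prongs by (auto simp: h_def)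
    show "fst (ah (sc v)) \<in> {1, real q}" by (rule a1)
    show "real (vsize G v) = fst (ah (sc v)) * real (esize G (h v))" using *(4) by (simp add: h_def)
    have arcsP: "e \<in> garcs (?P (sc v)) \<union> prongs (?P (sc v))" if e: "e \<in> garcs G" "ter G e = v" for e
    proof (cases "e \<in> F")
      case True
      then show ?thesis using e s by simp
    next
      case False
      then have "org G e \<in> sc v" using G.scc_closed'[OF F(2), of "sc v" e] e s by blast
      then show ?thesis using e s False by simp
    qed
    \<comment> \<open>A cut arc stays attached as a prong, so degrees in a piece are degrees in
      \<open>G\<close>.\<close>
    have seteq: "{e \<in> garcs (?P (sc v)) \<union> prongs (?P (sc v)). ter (?P (sc v)) e = v} = {e \<in> garcs G \<union> prongs G. ter G e = v}"
    proof (intro subset_antisym subsetI)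
      fix e assume "e \<in> {e \<in> garcs (?P (sc v)) \<union> prongs (?P (sc v)). ter (?P (sc v)) e = v}"
      then show "e \<in> {e \<in> garcs G \<union> prongs G. ter G e = v}" using F(1) G.no_prongs by auto
    next
      fix e assume "e \<in> {e \<in> garcs G \<union> prongs G. ter G e = v}"
      then have "e \<in> garcs G" "ter G e = v" using G.no_prongs by auto
      then show "e \<in> {e \<in> garcs (?P (sc v)) \<union> prongs (?P (sc v)). ter (?P (sc v)) e = v}"
        using arcsP[of e] by simp
    qed
    show "gog_degree G v = real q + 1" using dg unfolding gog_degree_def seteq size_simps .
    fix e assume e: "e \<in> garcs G" "ter G e = v" "e \<noteq> h v"
    have "h v = snd (ah (sc v)) v" by (rule h_def)
    then have "ter (?P (sc v)) e = v \<and> e \<noteq> snd (ah (sc v)) v" using e(2,3) by simp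
    with bspec[OF *(3) arcsP[OF e(1,2)]]
    have "e \<in> garcs (?P (sc v))" "snd (ah (sc v)) (org (?P (sc v)) e) = opp (?P (sc v)) e" by blast+
    then have e1: "e \<notin> F" "org G e \<in> sc v" "snd (ah (sc v)) (org G e) = opp G e" by simp_all
    have "sc (org G e) = sc v" using sc[OF _ e1(2)] s(1) by blast
    then have "h (org G e) = opp G e" using e1(3) by (simp only: h_def)
    then show "e \<notin> F \<and> org G e \<in> sc v \<and> h (org G e) = opp G e" using e1(1,2) by blast
  qed
  have esz: "real (esize G (h v)) > 0" if v: "v \<in> gverts G" "v \<notin> XL" for v
    using G.esize_pos[of "h v"] pp(1)[OF v] by simp
  have notXL: "w \<notin> XL" if "w \<in> sc v" "v \<in> gverts G" "v \<notin> XL" for v w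
    using D.sccs_verts_disjoint[of "sc v" XL] scV[OF that(2,3)] XL(1) that(1) by blast
  have "rooted_ends G q (gverts L) x0 h"
  proof (unfold_locales, unfold gL)
    show "2 \<le> q" by (rule q)
    show "finite XL" using finL gL by simp
    show "XL \<subseteq> gverts G" by (rule G.scc_subset[OF XL(1)])
    show "x0 \<in> XL" using x0 gL by simp
    show "h v \<in> garcs G" "ter G (h v) = v" "gog_degree G v = real q + 1" if "v \<in> gverts G - XL" for v
      using pp that by blast+
    show "real (vsize G v) / real (esize G (h v)) \<in> {1, real q}" if "v \<in> gverts G - XL" for v
      using pp(3,4)[of v] esz[of v] that by auto
    fix e assume e: "e \<in> garcs G" "ter G e \<notin> XL" "e \<noteq> h (ter G e)"
    note t = G.ter_in[OF e(1)]
    have o: "org G e \<in> sc (ter G e)" "h (org G e) = opp G e" using pp(6)[OF t e(2) e(1) refl e(3)] by auto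
    have oX: "org G e \<notin> XL" by (rule notXL[OF o(1) t e(2)])
    then show "org G e \<notin> XL \<and> h (org G e) = opp G e" using o by simp
    have "sc (org G e) = sc (ter G e)" using sc[OF _ o(1)] scV(1)[OF t e(2)] by blast
    then show "real (vsize G (org G e)) / real (esize G (h (org G e))) = real (vsize G (ter G e)) / real (esize G (h (ter G e)))"
      using pp(4)[OF t e(2)] pp(4)[OF G.org_in[OF e(1)] oX] esz[OF t e(2)] esz[OF G.org_in[OF e(1)] oX] by simp
  qed
  moreover have "e = h (ter G e)" if "e \<in> F" "ter G e \<notin> gverts L" for e
    using pp(6)[OF G.ter_in _ _ refl, of e] F(1) that gL by blast
  moreover have "\<exists>X\<in>D.sccs_verts. v \<in> X \<and> tree_gog (?P X)" if v: "v \<in> gverts G - gverts L" "vsize G v = esize G (h v)" for v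
  proof -
    have v': "v \<in> gverts G" "v \<notin> XL" using v gL by auto
    have "fst (ah (sc v)) = 1" using pp(4)[OF v'] esz[OF v'] v(2) by simp
    then show ?thesis using ah scV[OF v'] by blast
  qed
  ultimately show ?thesis by blast
qed

section \<open>Exterior pieces\<close>

locale decomposed = rooted_ends G q "gverts L" x0 h
  for G L :: "('v, 'e, 'g, 'h) gog" and q x0 h +
  fixes F :: "'e set"
  assumes F_arcs: "F \<subseteq> garcs G" and F_opp: "e \<in> F \<Longrightarrow> opp G e \<in> F"
    and core_piece: "L \<in> pieces G F"
    and F_parent: "\<lbrakk>e \<in> F; ter G e \<notin> gverts L\<rbrakk> \<Longrightarrow> e = h (ter G e)"
    and tree_piece: "\<lbrakk>v \<in> gverts G - gverts L; vsize G v = esize G (h v)\<rbrakk> \<Longrightarrow>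
      \<exists>X\<in>pre_digraph.sccs_verts (ugraph (cut G F)). v \<in> X \<and> tree_gog (restrict_gog (cut G F) X)"
begin

definition crossing :: "'v set \<Rightarrow> 'e set" where
  "crossing K = {e \<in> garcs G. (org G e \<in> K) \<noteq> (ter G e \<in> K)}"

abbreviation ext_piece :: "'v set \<Rightarrow> 'v \<Rightarrow> ('v, 'e, 'g, 'h) gog" where
  "ext_piece K \<rho> \<equiv> restrict_gog (cut G (crossing K)) (desc \<rho>)"

lemma crossing_opp: "e \<in> crossing K \<Longrightarrow> opp G e \<in> crossing K"
  using opp_in_arcs org_opp ter_opp by (auto simp: crossing_def)

lemma parent_arc_uncut:
  assumes "good K" "\<rho> \<in> roots K" "w \<in> ext" "par w \<in> desc \<rho>"
  shows "h w \<in> garcs G - crossing K" "org G (h w) = par w" "ter G (h w) = w" "w \<in> desc \<rho>"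
proof -
  show w: "w \<in> desc \<rho>" using desc_step assms by blast
  show "org G (h w) = par w" "ter G (h w) = w" using ext_h[OF assms(3)] by (auto simp: par_def)
  then show "h w \<in> garcs G - crossing K"
    using ext_h[OF assms(3)] desc_disjoint[OF assms(1) rootsD(2)[OF assms(2)]] w assms(4) by (auto simp: crossing_def)
qed

text \<open>The only arc that leaves a descendant set is the reverse of its gate
  \<open>h \<rho>\<close>, and this one is cut.\<close>

lemma desc_out_arcs:
  assumes "good K" "\<rho> \<in> roots K" "e \<in> garcs G - crossing K" "org G e \<in> desc \<rho>"
  shows "ter G e \<in> desc \<rho>"
proof (rule ccontr)
  assume n: "ter G e \<notin> desc \<rho>"
  have e: "e \<in> garcs G" using assms(3) by simp
  have oe: "opp G e = h \<rho>"
    by (rule desc_enter) (use e n assms(4) rootsD(1)[OF assms(2)] opp_in_arcs org_opp ter_opp in auto)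
  have "ter G e = par \<rho>" using org_opp[OF e] unfolding oe par_def by simp
  moreover have "org G e = \<rho>" using ter_opp[OF e] ext_h(2)[OF rootsD(1)[OF assms(2)]] unfolding oe by simp
  ultimately show False using e assms(3) rootsD[OF assms(2)] by (auto simp: crossing_def)
qed

lemma desc_reach:
  assumes "good K" "\<rho> \<in> roots K" "w \<in> desc \<rho>"
  shows "\<rho> \<rightarrow>\<^sup>*\<^bsub>ugraph (cut G (crossing K)) \<restriction> desc \<rho>\<^esub> w"
    "w \<rightarrow>\<^sup>*\<^bsub>ugraph (cut G (crossing K)) \<restriction> desc \<rho>\<^esub> \<rho>"
proof -
  interpret D: wf_digraph "ugraph (cut G (crossing K))" by (rule wf_cut)
  interpret P: wf_digraph "ugraph (cut G (crossing K)) \<restriction> desc \<rho>" by (rule D.wellformed_induce_subgraph)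
  have "\<rho> \<rightarrow>\<^sup>*\<^bsub>ugraph (cut G (crossing K)) \<restriction> desc \<rho>\<^esub> w \<and> w \<rightarrow>\<^sup>*\<^bsub>ugraph (cut G (crossing K)) \<restriction> desc \<rho>\<^esub> \<rho>"
    using assms(3)
  proof (induction rule: desc_induct)
    case root
    show ?case using P.reachable_refl[of \<rho>] by simp
  next
    case (step w)
    note a = parent_arc_uncut[OF assms(1,2) step(1,2)]
    have o: "opp G (h w) \<in> garcs G - crossing K" "org G (opp G (h w)) = w" "ter G (opp G (h w)) = par w"
      using cut_opp[OF crossing_opp a(1)] a org_opp ter_opp by auto
    have "par w \<rightarrow>\<^bsub>ugraph (cut G (crossing K)) \<restriction> desc \<rho>\<^esub> w"
      using a step(2) by (intro P.dominatesI[of "h w"]) (auto simp: arc_to_ends_def)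
    moreover have "w \<rightarrow>\<^bsub>ugraph (cut G (crossing K)) \<restriction> desc \<rho>\<^esub> par w"
      using o a(4) step(2) by (intro P.dominatesI[of "opp G (h w)"]) (auto simp: arc_to_ends_def)
    ultimately show ?case using step(3) P.reachable_adj_trans P.adj_reachable_trans by blast
  qed
  then show "\<rho> \<rightarrow>\<^sup>*\<^bsub>ugraph (cut G (crossing K)) \<restriction> desc \<rho>\<^esub> w"
    "w \<rightarrow>\<^sup>*\<^bsub>ugraph (cut G (crossing K)) \<restriction> desc \<rho>\<^esub> \<rho>" by auto
qed

lemma desc_in_V: "\<rho> \<in> roots K \<Longrightarrow> desc \<rho> \<subseteq> gverts G"
  using desc_subset rootsD(1) ext_in by blast

lemma desc_scc:
  assumes "good K" "\<rho> \<in> roots K"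
  shows "desc \<rho> \<in> pre_digraph.sccs_verts (ugraph (cut G (crossing K)))"
proof -
  interpret D: wf_digraph "ugraph (cut G (crossing K))" by (rule wf_cut)
  interpret P: wf_digraph "ugraph (cut G (crossing K)) \<restriction> desc \<rho>" by (rule D.wellformed_induce_subgraph)
  have stay: "v \<in> desc \<rho>" if "u \<rightarrow>\<^sup>*\<^bsub>ugraph (cut G (crossing K))\<^esub> v" "u \<in> desc \<rho>" for u v
    using that(1)
  proof (induction rule: D.reachable_induct)
    case base
    show ?case by fact
  next
    case (step x y)
    from step(2) obtain e where "e \<in> garcs G - crossing K" "org G e = x" "ter G e = y" by (elim reachableE) auto
    then show ?case using desc_out_arcs[OF assms, of e] step(3) by simp
  qed
  have "u \<rightarrow>\<^sup>*\<^bsub>ugraph (cut G (crossing K))\<^esub> v" if "u \<in> desc \<rho>" "v \<in> desc \<rho>" for u v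
  proof (rule D.reachable_induce_subgraphD)
    show "u \<rightarrow>\<^sup>*\<^bsub>ugraph (cut G (crossing K)) \<restriction> desc \<rho>\<^esub> v"
      using desc_reach[OF assms that(1)] desc_reach[OF assms that(2)] P.reachable_trans by blast
    show "desc \<rho> \<subseteq> verts (ugraph (cut G (crossing K)))" using desc_in_V[OF assms(2)] by simp
  qed
  then show ?thesis unfolding D.in_sccs_verts_conv_reachable using stay desc_refl by blast
qed

text \<open>Every vertex outside \<open>K\<close> lies below some root, the sets
  \<open>desc \<rho>\<close> are components, and components are disjoint.\<close>

lemma exterior_pieces_eq:
  assumes K: "good K" and H: "verts H = K"
  shows "exterior_pieces G H = ext_piece K ` roots K"
proof -
  interpret D: wf_digraph "ugraph (cut G (crossing K))" by (rule wf_cut)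
  have ep: "exterior_pieces G H = {P \<in> restrict_gog (cut G (crossing K)) ` D.sccs_verts. gverts P \<inter> K = {}}"
    unfolding exterior_pieces_def pieces_def H crossing_def ..
  show ?thesis
    unfolding ep
  proof (intro subset_antisym subsetI)
    fix P assume "P \<in> {P \<in> restrict_gog (cut G (crossing K)) ` D.sccs_verts. gverts P \<inter> K = {}}"
    then obtain X where X: "X \<in> D.sccs_verts" "P = restrict_gog (cut G (crossing K)) X" "X \<inter> K = {}" by auto
    then obtain v where v: "v \<in> X" by (auto simp: D.in_sccs_verts_conv_reachable)
    then have "v \<in> gverts G" "v \<notin> K" using scc_subset[OF X(1)] X(3) by auto
    then obtain \<rho> where r: "\<rho> \<in> roots K" "v \<in> desc \<rho>" using desc_of_root[OF K] by blast
    have "X = desc \<rho>" using D.sccs_verts_disjoint[OF X(1) desc_scc[OF K r(1)]] v r(2) by blast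
    then show "P \<in> ext_piece K ` roots K" using X(2) r(1) by blast
  next
    fix P assume "P \<in> ext_piece K ` roots K"
    then obtain \<rho> where r: "\<rho> \<in> roots K" "P = ext_piece K \<rho>" by blast
    have "desc \<rho> \<inter> K = {}" using desc_disjoint[OF K rootsD(2)[OF r(1)]] by blast
    then show "P \<in> {P \<in> restrict_gog (cut G (crossing K)) ` D.sccs_verts. gverts P \<inter> K = {}}"
      using r desc_scc[OF K r(1)] by auto
  qed
qed

lemma prongs_ext_piece:
  assumes K: "good K" and r: "\<rho> \<in> roots K"
  shows "prongs (ext_piece K \<rho>) = {h \<rho>}"
proof -
  have "e = h \<rho>" if e: "e \<in> crossing K" "ter G e \<in> desc \<rho>" for e
  proof (rule desc_enter)
    show "e \<in> garcs G" "\<rho> \<in> ext" "ter G e \<in> desc \<rho>" using e rootsD(1)[OF r] by (auto simp: crossing_def)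
    have "ter G e \<notin> K" using desc_disjoint[OF K rootsD(2)[OF r] e(2)] .
    then have "org G e \<in> K" using e(1) by (auto simp: crossing_def)
    then show "org G e \<notin> desc \<rho>" using desc_disjoint[OF K rootsD(2)[OF r]] by blast
  qed
  moreover have "h \<rho> \<in> crossing K" "ter G (h \<rho>) \<in> desc \<rho>"
    using ext_h[OF rootsD(1)[OF r]] rootsD[OF r] by (auto simp: crossing_def par_def)
  ultimately have "{e \<in> crossing K. ter G e \<in> desc \<rho>} = {h \<rho>}" by blast
  then show ?thesis by (simp add: no_prongs)
qed

lemma ext_piece_gog:
  assumes K: "good K" and r: "\<rho> \<in> roots K"
  shows "graph_of_groups_with_boundary (ext_piece K \<rho>)"
proof -
  let ?P = "ext_piece K \<rho>"
  interpret D: wf_digraph "ugraph (cut G (crossing K))" by (rule wf_cut)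
  interpret P: wf_digraph "ugraph (cut G (crossing K)) \<restriction> desc \<rho>" by (rule D.wellformed_induce_subgraph)
  have hr: "h \<rho> \<in> garcs G" "ter G (h \<rho>) = \<rho>" "h \<rho> \<in> crossing K"
    using ext_h[OF rootsD(1)[OF r]] rootsD[OF r] by (auto simp: crossing_def par_def)
  have arcs: "e \<in> garcs G" if "e \<in> garcs ?P \<union> prongs ?P" for e
    using that hr unfolding prongs_ext_piece[OF K r] by auto
  show ?thesis
  proof (rule graph_of_groups_with_boundary.intro)
    show "wf_digraph (ugraph ?P)" unfolding ugraph_restrict_gog by (rule P.wf_digraph_axioms)
    show "strongly_connected (ugraph ?P)"
      unfolding ugraph_restrict_gog
    proof (rule strongly_connectedI)
      show "verts (ugraph (cut G (crossing K)) \<restriction> desc \<rho>) \<noteq> {}"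
        unfolding induce_subgraph_verts using desc_refl[of \<rho>] by (rule ex_in_conv[THEN iffD1, OF exI])
      fix u v assume "u \<in> verts (ugraph (cut G (crossing K)) \<restriction> desc \<rho>)" "v \<in> verts (ugraph (cut G (crossing K)) \<restriction> desc \<rho>)"
      then have uv: "u \<in> desc \<rho>" "v \<in> desc \<rho>" by (simp_all only: induce_subgraph_verts)
      show "u \<rightarrow>\<^sup>*\<^bsub>ugraph (cut G (crossing K)) \<restriction> desc \<rho>\<^esub> v"
        by (rule P.reachable_trans[OF desc_reach(2)[OF K r uv(1)] desc_reach(1)[OF K r uv(2)]])
    qed
    show "countable (gverts ?P)" using countable_subset[OF desc_in_V[OF r] countable_verts] by simp
    show "prongs ?P \<inter> garcs ?P = {}" unfolding prongs_ext_piece[OF K r] using hr by simp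
    show "ter ?P e \<in> gverts ?P" if "e \<in> prongs ?P" for e using that by simp
    show "finite {e \<in> garcs ?P \<union> prongs ?P. ter ?P e = v}" if "v \<in> gverts ?P" for v
      by (rule finite_subset[OF _ finite_in_arcs[of v]]) (use arcs in auto)
    show "opp ?P e \<in> garcs ?P" if "e \<in> garcs ?P" for e
      using that opp_in_arcs[of e] org_opp[of e] ter_opp[of e] cut_opp[of "crossing K" e, OF crossing_opp] by simp
    show "opp ?P (opp ?P e) = e" "opp ?P e \<noteq> e" "org ?P (opp ?P e) = ter ?P e" "egrp ?P (opp ?P e) = egrp ?P e"
      if "e \<in> garcs ?P" for e
      using that opp_opp opp_neq org_opp egrp_opp by auto
    show "group (vgrp ?P v)" "finite (carrier (vgrp ?P v))" if "v \<in> gverts ?P" for v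
      using that vgrp_group vgrp_finite desc_in_V[OF r] by auto
    show "group (egrp ?P e)" "finite (carrier (egrp ?P e))" "emb ?P e \<in> mon (egrp ?P e) (vgrp ?P (ter ?P e))"
      if "e \<in> garcs ?P \<union> prongs ?P" for e
      using arcs[OF that] egrp_group egrp_finite emb_mon by auto
  qed
qed

lemma iso_iff_size:
  assumes "e \<in> garcs G"
  shows "emb G e \<in> iso (egrp G e) (vgrp G (ter G e)) \<longleftrightarrow> esize G e = vsize G (ter G e)"
  using emb_iso_card[of e] card_emb_iso[of e] assms ter_in by blast

lemma children_in_piece:
  assumes K: "good K" and r: "\<rho> \<in> roots K" and v: "v \<in> desc \<rho>" and e: "e \<in> children v"
  shows "e \<in> garcs (ext_piece K \<rho>)" "org G e \<in> desc \<rho>" "ter G e = v" "e \<in> garcs G"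
proof -
  have ve: "v \<in> ext" using v desc_subset rootsD(1)[OF r] by blast
  note c = child[OF ve e]
  show c': "org G e \<in> desc \<rho>" by (rule child_desc[OF ve v e])
  show "ter G e = v" "e \<in> garcs G" by (rule c)+
  have "org G e \<notin> K" "ter G e \<notin> K" using desc_disjoint[OF K rootsD(2)[OF r]] v c c' by auto
  then show "e \<in> garcs (ext_piece K \<rho>)" using c c' v by (simp add: crossing_def)
qed

lemma piece_arc_cases:
  assumes K: "good K" and r: "\<rho> \<in> roots K" and e: "e \<in> garcs (ext_piece K \<rho>)"
  shows "e \<in> children (ter G e) \<or> (e = h (ter G e) \<and> ter G e \<noteq> \<rho>)"
proof -
  have e': "e \<in> garcs G" "e \<notin> crossing K" "org G e \<in> desc \<rho>" "ter G e \<in> desc \<rho>" using e by auto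
  show ?thesis
  proof (cases "e = h (ter G e)")
    case True
    have "ter G e \<noteq> \<rho>"
    proof
      assume "ter G e = \<rho>"
      then have "h \<rho> \<notin> crossing K" using True e'(2) by simp
      then show False using ext_h[OF rootsD(1)[OF r]] rootsD[OF r] by (auto simp: crossing_def par_def)
    qed
    then show ?thesis using True by blast
  qed (use e' in \<open>auto simp: children_def\<close>)
qed

text \<open>The piece sits inside one original funnel and inherits the absence of other cycles. It
  cannot cross an edge of \<open>F\<close>: both orientations would be parent arcs, making the two
  ends parents of each other.\<close>

lemma ext_piece_tree:
  assumes K: "good K" and r: "\<rho> \<in> roots K" and one: "ratio \<rho> = 1"
  shows "tree_gog (ext_piece K \<rho>)"
proof -
  let ?P = "ext_piece K \<rho>"
  note re = rootsD(1)[OF r]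
  interpret P: graph_of_groups_with_boundary ?P by (rule ext_piece_gog[OF K r])
  have "vsize G \<rho> = esize G (h \<rho>)" using vsize_ratio[OF re] one by simp
  then obtain X where X: "X \<in> pre_digraph.sccs_verts (ugraph (cut G F))" "\<rho> \<in> X" "tree_gog (restrict_gog (cut G F) X)"
    using tree_piece[of \<rho>] re by (auto simp: ext_def)
  let ?Q = "restrict_gog (cut G F) X"
  have noF: "e \<notin> F" if e: "e \<in> garcs G" "org G e \<in> desc \<rho>" "ter G e \<in> desc \<rho>" for e
  proof
    assume eF: "e \<in> F"
    have x: "org G e \<in> ext" "ter G e \<in> ext" using e desc_subset[OF re] by auto
    have "e = h (ter G e)" using F_parent[OF eF] x(2) by (simp add: ext_def)
    then have 1: "par (ter G e) = org G e" by (simp add: par_def)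
    have "opp G e = h (ter G (opp G e))"
      by (rule F_parent[OF F_opp[OF eF]]) (use x(1) ter_opp[OF e(1)] in \<open>simp add: ext_def\<close>)
    then have 2: "par (org G e) = ter G e" using ter_opp[OF e(1)] org_opp[OF e(1)] by (metis par_def)
    show False using gd_par[OF x(1)] gd_par[OF x(2)] 1 2 by simp
  qed
  have sub: "w \<in> X" if "w \<in> desc \<rho>" for w
    using that
  proof (induction rule: desc_induct)
    case root
    show ?case by (rule X(2))
  next
    case (step w)
    note a = parent_arc_uncut[OF K r step(1,2)]
    have "h w \<in> garcs G - F" using noF[of "h w"] a step(2) by simp
    then show ?case using scc_closed[OF F_opp X(1), of "h w"] a step(3) by simp
  qed
  interpret D: wf_digraph "ugraph (cut G F)" by (rule wf_cut)
  interpret Q: wf_digraph "ugraph ?Q" unfolding ugraph_restrict_gog by (rule D.wellformed_induce_subgraph)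
  have "subgraph (ugraph ?P) (ugraph ?Q)"
  proof (rule subgraphI)
    show "verts (ugraph ?P) \<subseteq> verts (ugraph ?Q)" using sub by auto
    show "arcs (ugraph ?P) \<subseteq> arcs (ugraph ?Q)" using sub noF by auto
    show "compatible (ugraph ?Q) (ugraph ?P)" by (simp add: compatible_def)
  qed (rule P.U.wf_digraph_axioms Q.wf_digraph_axioms)+
  then have "Q.cycle p" if "P.U.cycle p" for p using Q.subgraph_cycle that by blast
  then show ?thesis using X(3) P.connected_ugraph unfolding tree_gog_def by simp
qed

lemma funnel_ext_piece:
  assumes K: "good K" and r: "\<rho> \<in> roots K" and one: "ratio \<rho> = 1"
  shows "orbifold_funnel (ext_piece K \<rho>)"
proof -
  let ?P = "ext_piece K \<rho>"
  note re = rootsD(1)[OF r]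
  interpret P: graph_of_groups_with_boundary ?P by (rule ext_piece_gog[OF K r])
  have sizes: "vsize G v = esize G (h v)" if "v \<in> desc \<rho>" for v
  proof -
    have ve: "v \<in> ext" using that desc_subset re by blast
    show ?thesis using vsize_ratio[OF ve] ratio_desc[OF that re] one by simp
  qed
  have iso: "emb G (h v) \<in> iso (egrp G (h v)) (vgrp G v)" if "v \<in> desc \<rho>" for v
  proof -
    have ve: "v \<in> ext" using that desc_subset re by blast
    show ?thesis using iso_iff_size[OF ext_h(1)[OF ve]] sizes[OF that] ext_h(2)[OF ve] by simp
  qed
  \<comment> \<open>A walk from \<open>\<rho>\<close> to a child passes its parent first, so a child
    arc never comes from the closer vertex; the arc is a parent arc, where the orders agree.\<close>
  have down: "emb G e \<in> iso (egrp G e) (vgrp G (ter G e))"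
    if e: "e \<in> garcs ?P" and lt: "gdist ?P \<rho> (org G e) < gdist ?P \<rho> (ter G e)" for e
  proof -
    have e': "ter G e \<in> desc \<rho>" "org G e \<in> desc \<rho>" using e by auto
    have te: "ter G e \<in> ext" using e' desc_subset re by blast
    have "e \<notin> children (ter G e)"
    proof
      assume ch: "e \<in> children (ter G e)"
      note c = child[OF te ch]
      have "\<rho> \<notin> desc (org G e)"
      proof
        assume "\<rho> \<in> desc (org G e)"
        then have "gd \<rho> \<ge> gd (org G e)" by (rule gd_desc[OF _ c(3)])
        moreover have "gd (org G e) > gd (ter G e)" using gd_par[OF c(3)] c(4) by simp
        ultimately show False using gd_desc[OF e'(1) re] by simp
      qed
      moreover obtain p where p: "P.U.awalk \<rho> p (org G e)" "length p = gdist ?P \<rho> (org G e)"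
        using P.gdist_awalk[of \<rho> "org G e"] e' by auto
      have comp: "P.U.cas = U.cas" by (rule compatible_cas) (simp add: compatible_def)
      have pG: "U.awalk \<rho> p (org G e)"
        using p(1) ext_in[OF re] unfolding P.U.awalk_def U.awalk_def comp by auto
      ultimately obtain p1 p2 where pp: "p = p1 @ h (org G e) # p2" "U.awalk \<rho> p1 (par (org G e))"
        using awalk_through_h[OF pG _ c(3) desc_refl] by metis
      have "P.U.awalk \<rho> p1 (ter G e)"
        using pp(2) p(1) unfolding P.U.awalk_def U.awalk_def comp c(4) pp(1) by auto
      from P.gdist_le[OF this] show False using lt p(2) pp(1) by simp
    qed
    then show ?thesis using piece_arc_cases[OF K r e] iso[OF e'(1)] by metis
  qed
  show ?thesis
    unfolding orbifold_funnel_def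
  proof (intro conjI exI[of _ \<rho>] exI[of _ "h \<rho>"])
    show "graph_of_groups_with_boundary ?P" by (rule ext_piece_gog[OF K r])
    show "tree_gog ?P" by (rule ext_piece_tree[OF K r one])
    show "prongs ?P = {h \<rho>}" by (rule prongs_ext_piece[OF K r])
    show "\<rho> \<in> gverts ?P" "ter ?P (h \<rho>) = \<rho>" using ext_h(2)[OF re] by auto
    show "emb ?P (h \<rho>) \<in> iso (egrp ?P (h \<rho>)) (vgrp ?P \<rho>)" using iso[OF desc_refl] by simp
    show "\<forall>e\<in>garcs ?P. gdist ?P \<rho> (org ?P e) < gdist ?P \<rho> (ter ?P e) \<longrightarrow> emb ?P e \<in> iso (egrp ?P e) (vgrp ?P (ter ?P e))"
      using down by simp
  qed
qed

text \<open>Ratio \<open>q\<close> leaves total weight 1 for the children, while each child has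
  weight at least 1. So there is exactly one child, with equality of orders, and iterating it gives
  the ray.\<close>

lemma cusp_ext_piece:
  assumes K: "good K" and r: "\<rho> \<in> roots K" and rq: "ratio \<rho> = real q"
  shows "cusp (ext_piece K \<rho>)"
proof -
  let ?P = "ext_piece K \<rho>"
  note re = rootsD(1)[OF r]
  have one: "\<exists>e. children v = {e} \<and> esize G e = vsize G v" if v: "v \<in> desc \<rho>" for v
  proof -
    have ve: "v \<in> ext" using v desc_subset re by blast
    have s1: "(\<Sum>e\<in>children v. wt e) = 1"
      unfolding sum_wt_children[OF ve] ratio_desc[OF v re] rq using q_pos by simp
    have w1: "wt e \<ge> 1" if "e \<in> children v" for e
    proof -
      note c = child[OF ve that]
      have "real (esize G e) > 0" using esize_pos[of e] c by simp
      moreover have "real (esize G e) \<le> real (vsize G (ter G e))" using esize_le_vsize[of e] c(1,2) ext_in[OF ve] by simp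
      ultimately show ?thesis by simp
    qed
    have ne: "children v \<noteq> {}" using s1 by auto
    have "real (card (children v)) \<le> (\<Sum>e\<in>children v. wt e)"
      using sum_mono[of "children v" "\<lambda>_. 1" wt] w1 by simp
    then have "card (children v) \<le> 1" using s1 by simp
    moreover have "card (children v) > 0" using ne finite_children by (simp add: card_gt_0_iff)
    ultimately have "card (children v) = 1" by simp
    then obtain e where e: "children v = {e}" by (rule card_1_singletonE)
    have c: "ter G e = v" "e \<in> garcs G" using child(1,2)[OF ve, of e] e by auto
    have "wt e = 1" using s1 e by simp
    moreover have "real (esize G e) > 0" using esize_pos[of e] c by simp
    ultimately have "esize G e = vsize G v" using c(1) by (simp add: divide_eq_1_iff)
    then show ?thesis using e by blast
  qed
  then have "\<forall>v. \<exists>e. v \<in> desc \<rho> \<longrightarrow> children v = {e} \<and> esize G e = vsize G v" by blast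
  then obtain k where k: "\<And>v. v \<in> desc \<rho> \<Longrightarrow> children v = {k v} \<and> esize G (k v) = vsize G v" by metis
  define rr where "rr i = ((\<lambda>v. org G (k v)) ^^ i) \<rho>" for i
  have rr: "rr 0 = \<rho>" "rr (Suc i) = org G (k (rr i))" for i by (simp_all add: rr_def)
  have rd: "rr i \<in> desc \<rho>" for i
  proof (induction i)
    case 0
    then show ?case by (simp add: rr)
  next
    case (Suc i)
    then show ?case using children_in_piece(2)[OF K r Suc, of "k (rr i)"] k[OF Suc] by (simp add: rr)
  qed
  define a where "a i = opp G (k (rr i))" for i
  have kc: "k (rr i) \<in> children (rr i)" for i using k[OF rd] by blast
  have rde: "rr i \<in> ext" for i using rd desc_subset re by blast
  note kcp = children_in_piece[OF K r rd kc] child[OF rde kc]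
  have oa: "opp G (a i) = k (rr i)" for i using kcp(4) opp_opp by (simp add: a_def)
  have ends: "org G (a i) = rr i" "ter G (a i) = rr (Suc i)" for i
    using kcp(3,4) org_opp ter_opp by (simp_all add: a_def rr)
  have hrr: "h (rr (Suc i)) = a i" for i using kcp(9) by (simp add: a_def rr)
  have gdr: "gd (rr i) = gd \<rho> + i" for i
  proof (induction i)
    case (Suc i)
    have "par (rr (Suc i)) = rr i" using kcp(8) by (simp add: rr)
    then show ?case using gd_par[OF rde[of "Suc i"]] Suc by simp
  qed (simp add: rr)
  have surj: "w \<in> range rr" if "w \<in> desc \<rho>" for w
    using that
  proof (induction rule: desc_induct)
    case root
    show ?case using rr(1) by (metis rangeI)
  next
    case (step w)
    then obtain i where i: "par w = rr i" by blast
    have "par w \<in> ext" using rde i by simp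
    from opp_h_children[OF step(1) this] have "opp G (h w) = k (rr i)" using k[OF rd[of i]] i by auto
    then have "org G (opp G (h w)) = rr (Suc i)" by (simp add: rr)
    then have "w = rr (Suc i)" using org_opp ext_h[OF step(1)] by simp
    then show ?case by blast
  qed
  have arcs: "garcs ?P = range a \<union> range (\<lambda>i. opp G (a i))"
  proof (intro subset_antisym subsetI)
    fix e assume e: "e \<in> garcs ?P"
    then have "ter G e \<in> desc \<rho>" by simp
    then obtain i where i: "ter G e = rr i" using surj by blast
    from piece_arc_cases[OF K r e] show "e \<in> range a \<union> range (\<lambda>i. opp G (a i))"
    proof
      assume "e \<in> children (ter G e)"
      then have "e = opp G (a i)" using k[OF rd[of i]] i oa by auto
      then show ?thesis by blast
    next
      assume A: "e = h (ter G e) \<and> ter G e \<noteq> \<rho>"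
      then have "i \<noteq> 0" using i rr(1) by metis
      then obtain j where "i = Suc j" by (cases i) auto
      then have "e = a j" using A i hrr by metis
      then show ?thesis by blast
    qed
  next
    interpret P: graph_of_groups_with_boundary ?P by (rule ext_piece_gog[OF K r])
    fix e assume "e \<in> range a \<union> range (\<lambda>i. opp G (a i))"
    then obtain i where "e = a i \<or> e = k (rr i)" using oa by auto
    then show "e \<in> garcs ?P" using kcp(1) P.opp_in_arcs[of "k (rr i)"] by (auto simp: a_def)
  qed
  show ?thesis
    unfolding cusp_def
  proof (intro conjI exI[of _ rr] exI[of _ a] exI[of _ "h \<rho>"] allI)
    show "graph_of_groups_with_boundary ?P" by (rule ext_piece_gog[OF K r])
    have "inj rr" using gdr by (metis add_left_cancel injI)
    moreover have "range rr = desc \<rho>" using surj rd by blast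
    ultimately show "bij_betw rr UNIV (gverts ?P)" by (simp add: bij_betw_def)
    show "garcs ?P = range a \<union> range (\<lambda>i. opp ?P (a i))" using arcs by simp
    show "org ?P (a i) = rr i" "ter ?P (a i) = rr (Suc i)" for i using ends by simp_all
    show "prongs ?P = {h \<rho>}" by (rule prongs_ext_piece[OF K r])
    show "ter ?P (h \<rho>) = rr 0" using ext_h(2)[OF re] rr(1) by simp
    show "emb ?P (opp ?P (a i)) \<in> iso (egrp ?P (opp ?P (a i))) (vgrp ?P (rr i))" for i
      using iso_iff_size[OF kcp(4)[of i]] k[OF rd[of i]] kcp(3)[of i] oa by simp
  qed
qed

text \<open>In a cusp the top vertex has at most one child, of weight 1, so
  \<open>q / ratio \<rho> \<le> 1\<close>; since \<open>q \<ge> 2\<close> this excludes ratio 1.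
  With \<open>funnel_ratio\<close> it follows that no exterior piece is both a cusp and a
  funnel.\<close>

lemma cusp_ratio:
  assumes K: "good K" and r: "\<rho> \<in> roots K" and c: "cusp (ext_piece K \<rho>)"
  shows "ratio \<rho> = real q"
proof -
  let ?P = "ext_piece K \<rho>"
  note re = rootsD(1)[OF r]
  from c obtain rr :: "nat \<Rightarrow> 'v" and a hh where C: "bij_betw rr UNIV (gverts ?P)"
    "garcs ?P = range a \<union> range (\<lambda>i. opp ?P (a i))" "\<And>i. org ?P (a i) = rr i" "\<And>i. ter ?P (a i) = rr (Suc i)"
    "prongs ?P = {hh}" "ter ?P hh = rr 0"
    "\<And>i. emb ?P (opp ?P (a i)) \<in> iso (egrp ?P (opp ?P (a i))) (vgrp ?P (rr i))"
    unfolding cusp_def by blast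
  have inj: "rr i = rr j \<longleftrightarrow> i = j" for i j using C(1) by (auto simp: bij_betw_def inj_on_def)
  have "hh = h \<rho>" using C(5) prongs_ext_piece[OF K r] by simp
  then have r0: "rr 0 = \<rho>" using C(6) ext_h(2)[OF re] by simp
  have aP: "a i \<in> garcs ?P" for i using C(2) by blast
  then have aG: "a i \<in> garcs G" for i by simp
  have only: "e = opp G (a 0)" if e: "e \<in> children \<rho>" for e
  proof -
    note ce = children_in_piece[OF K r desc_refl e]
    have "e \<in> range a \<union> range (\<lambda>i. opp ?P (a i))" using ce(1) unfolding C(2) .
    then consider i where "e = a i" | i where "e = opp G (a i)" by auto
    then show ?thesis
    proof cases
      case (1 i)
      then have "rr (Suc i) = rr 0" using ce(3) C(4)[of i] r0 by simp
      then show ?thesis using inj by simp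
    next
      case (2 i)
      then have "rr i = rr 0" using ce(3) C(3)[of i] r0 ter_opp[OF aG[of i]] by simp
      then show ?thesis using inj 2 by simp
    qed
  qed
  have o: "opp G (a 0) \<in> garcs G" "ter G (opp G (a 0)) = \<rho>"
    using opp_in_arcs[OF aG] ter_opp[OF aG] C(3)[of 0] r0 by auto
  have "emb G (opp G (a 0)) \<in> iso (egrp G (opp G (a 0))) (vgrp G (ter G (opp G (a 0))))"
    using C(7)[of 0] o r0 by simp
  then have "esize G (opp G (a 0)) = vsize G \<rho>" using iso_iff_size[OF o(1)] o(2) by simp
  then have w1: "wt (opp G (a 0)) \<le> 1" using o(2) by simp
  have "children \<rho> \<subseteq> {opp G (a 0)}" using only by blast
  then have "(\<Sum>e\<in>children \<rho>. wt e) \<le> (\<Sum>e\<in>{opp G (a 0)}. wt e)" by (intro sum_mono2) auto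
  also have "\<dots> \<le> 1" using w1 by simp
  finally have "real q / ratio \<rho> \<le> 1" unfolding sum_wt_children[OF re] .
  then show ?thesis using ratio_pos[OF re] q_pos by auto
qed

lemma funnel_ratio:
  assumes K: "good K" and r: "\<rho> \<in> roots K" and c: "orbifold_funnel (ext_piece K \<rho>)"
  shows "ratio \<rho> = 1"
proof -
  let ?P = "ext_piece K \<rho>"
  note re = rootsD(1)[OF r]
  from c obtain r' hh where C: "prongs ?P = {hh}" "ter ?P hh = r'" "emb ?P hh \<in> iso (egrp ?P hh) (vgrp ?P r')"
    unfolding orbifold_funnel_def by blast
  have "hh = h \<rho>" using C(1) prongs_ext_piece[OF K r] by simp
  then have "emb G (h \<rho>) \<in> iso (egrp G (h \<rho>)) (vgrp G (ter G (h \<rho>)))" using C(2,3) by simp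
  then have "esize G (h \<rho>) = vsize G \<rho>" using iso_iff_size[OF ext_h(1)[OF re]] ext_h(2)[OF re] by simp
  moreover have "real (vsize G \<rho>) > 0" using vsize_pos[OF ext_in[OF re]] by simp
  ultimately show ?thesis by (simp add: ratio_def)
qed

section \<open>Exceptional loci and purely outgoing functions\<close>

text \<open>A walk inside \<open>H\<close> from the base point to \<open>v\<close> must use the
  parent arc of \<open>v\<close>, so \<open>H\<close> contains the parent.\<close>

lemma exceptional_locus_good:
  assumes "exceptional_locus G L H"
  shows "good (verts H)"
proof -
  have sub: "subgraph H (ugraph G)" and fin: "fin_digraph H" and sc: "strongly_connected H"
    and core: "gverts L \<subseteq> verts H"
    using assms by (auto simp: exceptional_locus_def)
  interpret H: fin_digraph H by (rule fin)
  have tails: "tail H = org G" "head H = ter G" using sub by (auto simp: subgraph_def compatible_def)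
  have parent: "par v \<in> verts H" if v: "v \<in> verts H - gverts L" for v
  proof -
    have vV: "v \<in> gverts G" using v sub by (auto simp: subgraph_def)
    have ve: "v \<in> ext" using v vV by (simp add: ext_def)
    have "x0 \<in> verts H" using x0_in core by blast
    then have "x0 \<rightarrow>\<^sup>*\<^bsub>H\<^esub> v" using sc v by (auto simp: strongly_connected_def)
    then obtain p where p: "H.awalk x0 p v" using H.reachable_awalk by blast
    have pG: "U.awalk x0 p v" using U.subgraph_awalk_imp_awalk[OF p sub] .
    obtain p1 p2 where pp: "p = p1 @ h v # p2"
      using awalk_through_h[OF pG x0_notin_desc[OF ve] ve desc_refl] by metis
    have "h v \<in> arcs H" using p pp by (auto simp: H.awalk_def)
    then have "tail H (h v) \<in> verts H" by (rule H.tail_in_verts)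
    then show ?thesis by (simp add: par_def tails)
  qed
  show ?thesis
    unfolding good_def using H.finite_verts core sub parent by (auto simp: subgraph_def)
qed

text \<open>The core is connected inside itself, being a component after cutting, and every other
  vertex of \<open>K\<close> is joined to it by parent arcs within \<open>K\<close>.\<close>

lemma good_exceptional_locus:
  assumes K: "good K"
  shows "exceptional_locus G L (ugraph G \<restriction> K)"
proof -
  let ?H = "ugraph G \<restriction> K"
  have KV: "K \<subseteq> gverts G" and LK: "gverts L \<subseteq> K" and finK: "finite K" using K by (auto simp: good_def)
  obtain X where X: "X \<in> pre_digraph.sccs_verts (ugraph (cut G F))" "L = restrict_gog (cut G F) X"
    using core_piece by (auto simp: pieces_def)
  have gL: "gverts L = X" using X(2) by simp
  interpret H: wf_digraph ?H by (rule U.wellformed_induce_subgraph)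
  have dom: "org G e \<rightarrow>\<^bsub>?H\<^esub> ter G e" if "e \<in> garcs G" "org G e \<in> K" "ter G e \<in> K" for e
    using that by (intro H.dominatesI[of e]) (auto simp: arc_to_ends_def)
  have core_reach: "x0 \<rightarrow>\<^sup>*\<^bsub>?H\<^esub> v" "v \<rightarrow>\<^sup>*\<^bsub>?H\<^esub> x0" if v: "v \<in> gverts L" for v
  proof -
    interpret D: wf_digraph "ugraph (cut G F)" by (rule wf_cut)
    interpret Q: wf_digraph "ugraph (cut G F) \<restriction> X" by (rule D.wellformed_induce_subgraph)
    have sub: "subgraph (ugraph (cut G F) \<restriction> X) ?H"
      using LK gL by (intro subgraphI Q.wf_digraph_axioms H.wf_digraph_axioms) (auto simp: compatible_def)
    have x: "x0 \<in> X" "v \<in> X" using x0_in v gL by auto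
    show "x0 \<rightarrow>\<^sup>*\<^bsub>?H\<^esub> v"
      by (rule H.reachable_mono[OF scc_strongly_connected[OF F_opp X(1) x] sub])
    show "v \<rightarrow>\<^sup>*\<^bsub>?H\<^esub> x0"
      by (rule H.reachable_mono[OF scc_strongly_connected[OF F_opp X(1) x(2) x(1)] sub])
  qed
  have reach: "v \<in> K \<longrightarrow> x0 \<rightarrow>\<^sup>*\<^bsub>?H\<^esub> v \<and> v \<rightarrow>\<^sup>*\<^bsub>?H\<^esub> x0" if "v \<in> gverts G" for v
    using good_K0 that
  proof (induction rule: parent_induct)
    case (core v)
    then show ?case using core_reach by (simp only: simp_thms)
  next
    case (step v)
    show ?case
    proof
      assume v: "v \<in> K"
      have p: "par v \<in> K" by (rule good_par[OF K v step(1)])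
      note hv = ext_h[OF step(1)]
      have "par v \<rightarrow>\<^bsub>?H\<^esub> v" using dom[of "h v"] hv p v by (simp add: par_def)
      moreover have "v \<rightarrow>\<^bsub>?H\<^esub> par v"
        using dom[of "opp G (h v)"] hv p v opp_in_arcs org_opp ter_opp by (simp add: par_def)
      ultimately show "x0 \<rightarrow>\<^sup>*\<^bsub>?H\<^esub> v \<and> v \<rightarrow>\<^sup>*\<^bsub>?H\<^esub> x0"
        using H.reachable_adj_trans[of x0 "par v" v] H.adj_reachable_trans[of v "par v" x0] step(3) p
        by (simp only: simp_thms)
    qed
  qed
  show ?thesis
    unfolding exceptional_locus_def
  proof (intro conjI)
    show "subgraph ?H (ugraph G)" by (rule U.subgraph_induce_subgraphI[OF KV])
    show "\<forall>e\<in>arcs ?H. opp G e \<in> arcs ?H" using opp_in_arcs org_opp ter_opp by simp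
    show "fin_digraph ?H"
    proof (intro fin_digraph.intro fin_digraph_axioms.intro H.wf_digraph_axioms)
      show "finite (verts ?H)" using finK by simp
      show "finite (arcs ?H)" by (rule finite_subset[OF _ finite_arcs_into[OF finK]]) auto
    qed
    show "strongly_connected ?H"
    proof (rule strongly_connectedI)
      show "verts ?H \<noteq> {}" unfolding induce_subgraph_verts using x0_in LK by blast
      fix u v assume "u \<in> verts ?H" "v \<in> verts ?H"
      then have "u \<in> K" "v \<in> K" by (simp_all only: induce_subgraph_verts)
      then have "u \<rightarrow>\<^sup>*\<^bsub>?H\<^esub> x0" "x0 \<rightarrow>\<^sup>*\<^bsub>?H\<^esub> v" using reach[of u] reach[of v] KV by blast+
      then show "u \<rightarrow>\<^sup>*\<^bsub>?H\<^esub> v" by (rule H.reachable_trans)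
    qed
    show "gverts L \<subseteq> verts ?H" using LK by simp
    show "garcs L \<subseteq> arcs ?H" using X(2) gL LK by auto
  qed
qed

lemma roots_eqI:
  assumes K: "good K" and r: "\<rho> \<in> roots K" "\<rho>' \<in> roots K" and eq: "desc \<rho> = desc \<rho>'"
  shows "\<rho> = \<rho>'"
proof -
  have "\<rho> \<in> desc \<rho>'" using eq desc_refl by blast
  moreover have "par \<rho> \<notin> desc \<rho>'"
    using desc_disjoint[OF K rootsD(2)[OF r(2)]] rootsD(3)[OF r(1)] by blast
  ultimately show ?thesis using desc_cases by blast
qed

lemma kap_cusp: "ratio \<rho> = real q \<Longrightarrow> (sq / \<mu>) ^ n = kap \<mu> \<rho> ^ n"
proof -
  assume r: "ratio \<rho> = real q"
  have "kap \<mu> \<rho> = sq * sq / (sq * \<mu>)" unfolding kap_def r sq_sq by simp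
  also have "\<dots> = sq / \<mu>" using sq_nz by simp
  finally show ?thesis by simp
qed

lemma kap_funnel: "ratio \<rho> = 1 \<Longrightarrow> inverse ((\<mu> * sq) ^ n) = kap \<mu> \<rho> ^ n"
  by (simp add: kap_def power_inverse power_mult_distrib mult.commute divide_inverse)

text \<open>The ratio decides which kind a piece is, and \<open>kap_funnel\<close> and
  \<open>kap_cusp\<close> show that both prescribed growth rates are powers of
  \<open>kap \<mu> \<rho>\<close>.\<close>

lemma outgoing_with_iff:
  assumes K: "good K" and H: "verts H = K"
  shows "outgoing_with G q x0 \<mu> H p f \<longleftrightarrow> f \<in> vfuns G \<and>
    (\<forall>\<rho>\<in>roots K. \<forall>v\<in>desc \<rho>. f v = poly (p (ext_piece K \<rho>)) (of_nat (gd v)) * kap \<mu> \<rho> ^ gd v)"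
proof -
  have piece: "((cusp (ext_piece K \<rho>) \<longrightarrow> (\<forall>v\<in>gverts (ext_piece K \<rho>).
           f v = poly (p (ext_piece K \<rho>)) (of_nat (gd v)) * (sq / \<mu>) ^ gd v)) \<and>
        (orbifold_funnel (ext_piece K \<rho>) \<longrightarrow> (\<forall>v\<in>gverts (ext_piece K \<rho>).
           f v = poly (p (ext_piece K \<rho>)) (of_nat (gd v)) * inverse ((\<mu> * sq) ^ gd v)))) \<longleftrightarrow>
     (\<forall>v\<in>desc \<rho>. f v = poly (p (ext_piece K \<rho>)) (of_nat (gd v)) * kap \<mu> \<rho> ^ gd v)"
    if r: "\<rho> \<in> roots K" for \<rho>
  proof -
    have "ratio \<rho> = 1 \<or> ratio \<rho> = real q" using ratio_pos(1)[OF rootsD(1)[OF r]] by simp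
    then show ?thesis
    proof
      assume one: "ratio \<rho> = 1"
      then have "orbifold_funnel (ext_piece K \<rho>)" "\<not> cusp (ext_piece K \<rho>)"
        using funnel_ext_piece[OF K r] cusp_ratio[OF K r] q_pos by auto
      then show ?thesis using kap_funnel[OF one, of \<mu>] by simp
    next
      assume rq: "ratio \<rho> = real q"
      then have "cusp (ext_piece K \<rho>)" "\<not> orbifold_funnel (ext_piece K \<rho>)"
        using cusp_ext_piece[OF K r] funnel_ratio[OF K r] q_pos by auto
      then show ?thesis using kap_cusp[OF rq, of \<mu>] by simp
    qed
  qed
  show ?thesis
    unfolding outgoing_with_def exterior_pieces_eq[OF K H] ball_simps(9)
    by (intro conj_cong ball_cong refl piece)
qed

lemma ext_piece_inj: "good K \<Longrightarrow> inj_on (ext_piece K) (roots K)"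
proof (rule inj_onI)
  fix \<rho> \<rho>' assume K: "good K" and r: "\<rho> \<in> roots K" "\<rho>' \<in> roots K" and eq: "ext_piece K \<rho> = ext_piece K \<rho>'"
  from arg_cong[OF eq, of "\<lambda>P. gverts P"] have "desc \<rho> = desc \<rho>'" by simp
  then show "\<rho> = \<rho>'" by (rule roots_eqI[OF K r])
qed

text \<open>From left to right an exceptional locus yields a good set, from right to left the
  induced subgraph is used. Polynomials indexed by roots become polynomials indexed by pieces by
  inverting \<open>ext_piece K\<close>.\<close>

lemma purely_outgoing_iff: "purely_outgoing G q L x0 \<mu> f \<longleftrightarrow> (\<exists>K. good K \<and> outg K \<mu> f)"
proof
  assume "purely_outgoing G q L x0 \<mu> f"
  then obtain H p where H: "exceptional_locus G L H" "outgoing_with G q x0 \<mu> H p f"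
    by (auto simp: purely_outgoing_def)
  note g = exceptional_locus_good[OF H(1)]
  have "outg (verts H) \<mu> f"
    using H(2) unfolding outgoing_with_iff[OF g refl] outg_def by blast
  then show "\<exists>K. good K \<and> outg K \<mu> f" using g by blast
next
  assume "\<exists>K. good K \<and> outg K \<mu> f"
  then obtain K where K: "good K" "outg K \<mu> f" by blast
  from K(2) have "\<forall>\<rho>\<in>roots K. \<exists>p. \<forall>v\<in>desc \<rho>. f v = poly p (of_nat (gd v)) * kap \<mu> \<rho> ^ gd v"
    by (simp add: outg_def)
  from bchoice[OF this] obtain p where
    p: "\<forall>\<rho>\<in>roots K. \<forall>v\<in>desc \<rho>. f v = poly (p \<rho>) (of_nat (gd v)) * kap \<mu> \<rho> ^ gd v" by blast
  have "outgoing_with G q x0 \<mu> (ugraph G \<restriction> K) (\<lambda>P. p (the_inv_into (roots K) (ext_piece K) P)) f"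
    unfolding outgoing_with_iff[OF K(1) induce_subgraph_verts]
    using K(2) p the_inv_into_f_f[OF ext_piece_inj[OF K(1)]] by (simp add: outg_def)
  then show "purely_outgoing G q L x0 \<mu> f"
    unfolding purely_outgoing_def using good_exceptional_locus[OF K(1)] by blast
qed

lemma purely_outgoing_constant_type_iff:
  "purely_outgoing_constant_type G q L x0 \<mu> f \<longleftrightarrow> (\<exists>K. good K \<and> outg_const K \<mu> f)"
proof
  assume "purely_outgoing_constant_type G q L x0 \<mu> f"
  then obtain H p where H: "exceptional_locus G L H" "outgoing_with G q x0 \<mu> H p f"
    "\<forall>P\<in>exterior_pieces G H. degree (p P) = 0"
    by (auto simp: purely_outgoing_constant_type_def)
  note g = exceptional_locus_good[OF H(1)]
  have f: "f \<in> vfuns G" and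
    o: "\<And>\<rho> v. \<rho> \<in> roots (verts H) \<Longrightarrow> v \<in> desc \<rho> \<Longrightarrow>
      f v = poly (p (ext_piece (verts H) \<rho>)) (of_nat (gd v)) * kap \<mu> \<rho> ^ gd v"
    using H(2) unfolding outgoing_with_iff[OF g refl] by blast+
  have "outg_const (verts H) \<mu> f"
    unfolding outg_const_def
  proof (intro conjI ballI f)
    fix \<rho> assume r: "\<rho> \<in> roots (verts H)"
    then have "degree (p (ext_piece (verts H) \<rho>)) = 0"
      using H(3) unfolding exterior_pieces_eq[OF g refl] by blast
    then obtain c where "p (ext_piece (verts H) \<rho>) = [:c:]" by (rule degree_eq_zeroE)
    then show "\<exists>c. \<forall>v\<in>desc \<rho>. f v = c * kap \<mu> \<rho> ^ gd v"
      using o[OF r] by (intro exI[of _ c]) simp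
  qed
  then show "\<exists>K. good K \<and> outg_const K \<mu> f" using g by blast
next
  assume "\<exists>K. good K \<and> outg_const K \<mu> f"
  then obtain K where K: "good K" "outg_const K \<mu> f" by blast
  from K(2) have "\<forall>\<rho>\<in>roots K. \<exists>c. \<forall>v\<in>desc \<rho>. f v = c * kap \<mu> \<rho> ^ gd v"
    by (simp add: outg_const_def)
  from bchoice[OF this] obtain c where
    c: "\<forall>\<rho>\<in>roots K. \<forall>v\<in>desc \<rho>. f v = c \<rho> * kap \<mu> \<rho> ^ gd v" by blast
  let ?p = "\<lambda>P. [:c (the_inv_into (roots K) (ext_piece K) P):]"
  have "outgoing_with G q x0 \<mu> (ugraph G \<restriction> K) ?p f"
    unfolding outgoing_with_iff[OF K(1) induce_subgraph_verts]
    using K(2) c the_inv_into_f_f[OF ext_piece_inj[OF K(1)]] by (simp add: outg_const_def)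
  then show "purely_outgoing_constant_type G q L x0 \<mu> f"
    unfolding purely_outgoing_constant_type_def
    using good_exceptional_locus[OF K(1)] by (intro exI[of _ "ugraph G \<restriction> K"] exI[of _ ?p]) simp
qed

section \<open>Subspaces of outgoing functions and the two inclusions\<close>

lemma shifted_0: "shifted_adjacency G q \<mu> (\<lambda>_. 0) = (\<lambda>_. 0)"
  using shifted_pow_0[where n = 1] by simp

lemma outg_0: "outg K \<mu> 0"
  by (auto simp: outg_def vfuns_def intro!: exI[of _ 0])

lemma outg_const_0: "outg_const K \<mu> 0"
  by (auto simp: outg_const_def vfuns_def intro!: exI[of _ 0])

text \<open>Two functions are compared on the union of their good sets and with the sum of their
  exponents.\<close>

lemma subspace_outgoing:
  "cfun.subspace {u. (\<exists>K. good K \<and> outg K \<mu> u) \<and> (\<exists>n. (shifted_adjacency G q \<mu>' ^^ n) u = (\<lambda>_. 0))}"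
    (is "cfun.subspace ?R")
proof -
  have lin: "(\<lambda>v. a * u v + b * w v) \<in> ?R" if uw: "u \<in> ?R" "w \<in> ?R" for a b u w
  proof -
    obtain K K' n m where K: "good K" "outg K \<mu> u" "good K'" "outg K' \<mu> w"
      and k: "(shifted_adjacency G q \<mu>' ^^ n) u = (\<lambda>_. 0)" "(shifted_adjacency G q \<mu>' ^^ m) w = (\<lambda>_. 0)"
      using uw by blast
    have g: "good (K \<union> K')" using good_Un K by blast
    have "outg (K \<union> K') \<mu> (\<lambda>v. a * u v + b * w v)"
      using outg_lin outg_mono[OF K(1) g _ K(2)] outg_mono[OF K(3) g _ K(4)] by blast
    moreover have "(shifted_adjacency G q \<mu>' ^^ (n + m)) (\<lambda>v. a * u v + b * w v) = (\<lambda>_. 0)"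
      unfolding shifted_pow_lin shifted_pow_mono[OF k(1) le_add1] shifted_pow_mono[OF k(2) le_add2] by simp
    ultimately show ?thesis using g by blast
  qed
  have "(shifted_adjacency G q \<mu>' ^^ 0) 0 = (\<lambda>_. 0)" by (simp add: zero_fun_def)
  then have z: "0 \<in> ?R" using outg_0 good_K0 by blast
  show ?thesis
  proof (rule cfun.subspaceI)
    show "0 \<in> ?R" by (rule z)
    show "x + y \<in> ?R" if "x \<in> ?R" "y \<in> ?R" for x y
      using lin[OF that, of 1 1] by (simp add: plus_fun_def)
    show "(\<lambda>v. c * x v) \<in> ?R" if "x \<in> ?R" for c x
      using lin[OF that z, of c 0] by simp
  qed
qed

lemma subspace_outgoing_const:
  "cfun.subspace {u. (\<exists>K. good K \<and> outg_const K \<mu> u) \<and> shifted_adjacency G q \<mu>' u = (\<lambda>_. 0)}"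
    (is "cfun.subspace ?R")
proof -
  have lin: "(\<lambda>v. a * u v + b * w v) \<in> ?R" if uw: "u \<in> ?R" "w \<in> ?R" for a b u w
  proof -
    obtain K K' where K: "good K" "outg_const K \<mu> u" "good K'" "outg_const K' \<mu> w"
      and k: "shifted_adjacency G q \<mu>' u = (\<lambda>_. 0)" "shifted_adjacency G q \<mu>' w = (\<lambda>_. 0)"
      using uw by blast
    have g: "good (K \<union> K')" using good_Un K by blast
    have "outg_const (K \<union> K') \<mu> (\<lambda>v. a * u v + b * w v)"
      using outg_const_lin outg_const_mono[OF K(1) g _ K(2)] outg_const_mono[OF K(3) g _ K(4)] by blast
    moreover have "shifted_adjacency G q \<mu>' (\<lambda>v. a * u v + b * w v) = (\<lambda>_. 0)"
      unfolding shifted_lin k by simp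
    ultimately show ?thesis using g by blast
  qed
  have "shifted_adjacency G q \<mu>' 0 = (\<lambda>_. 0)" using shifted_0 by (simp add: zero_fun_def)
  then have z: "0 \<in> ?R" using outg_const_0 good_K0 by blast
  show ?thesis
  proof (rule cfun.subspaceI)
    show "0 \<in> ?R" by (rule z)
    show "x + y \<in> ?R" if "x \<in> ?R" "y \<in> ?R" for x y
      using lin[OF that, of 1 1] by (simp add: plus_fun_def)
    show "(\<lambda>v. c * x v) \<in> ?R" if "x \<in> ?R" for c x
      using lin[OF that z, of c 0] by simp
  qed
qed

lemma resolvent_dataI:
  assumes "resolvent_laurent G q x0 \<mu>\<^sub>0 N J C"
  obtains T where "resolvent_data G q (gverts L) x0 h N T \<mu>\<^sub>0 J C"
proof -
  from assms obtain T where T: "resolvent_continuation G q x0 N T" "\<mu>\<^sub>0 \<in> cont_domain q N"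
    "laurent_ops G (dist_weight G q x0 (- N)) (dist_weight G q x0 N) T \<mu>\<^sub>0 J C"
    unfolding resolvent_laurent_def by blast
  have "resolvent_data G q (gverts L) x0 h N T \<mu>\<^sub>0 J C"
    using T by (intro resolvent_data.intro resolvent_data_axioms.intro) (rule rooted_ends_axioms)
  then show ?thesis by (rule that)
qed

text \<open>By \<open>C_span_finsupp\<close> only finitely supported sources have to be tested, but
  for every admissible expansion, since \<open>grst\<close> is spanned by all of them.\<close>

lemma grst_subset:
  assumes sub: "cfun.subspace R"
    and gen: "\<And>N T J C K f j. resolvent_data G q (gverts L) x0 h N T \<mu>\<^sub>0 J C \<Longrightarrow> good K \<Longrightarrow>
      resolvent_data.finsupp K f \<Longrightarrow> j \<in> {1..J} \<Longrightarrow> C j f \<in> R"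
  shows "grst G q x0 \<mu>\<^sub>0 \<subseteq> R"
  unfolding grst_def
proof (rule cfun.span_minimal[OF _ sub], rule subsetI)
  fix u assume "u \<in> {C j f |N J C j f. resolvent_laurent G q x0 \<mu>\<^sub>0 N J C \<and> j \<in> {1..J} \<and>
        f \<in> wl2 G (dist_weight G q x0 (- N))}"
  then obtain N J C j f where u: "u = C j f" "resolvent_laurent G q x0 \<mu>\<^sub>0 N J C" "j \<in> {1..J}"
    "f \<in> wl2 G (dist_weight G q x0 (- N))" by blast
  obtain T where T: "resolvent_data G q (gverts L) x0 h N T \<mu>\<^sub>0 J C" using resolvent_dataI[OF u(2)] .
  interpret resolvent_data G q "gverts L" x0 h N T \<mu>\<^sub>0 J C by (rule T)
  have "C j ` {g. \<exists>K. good K \<and> finsupp K g} \<subseteq> R" using gen[OF T _ _ u(3)] by blast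
  then have "cfun.span (C j ` {g. \<exists>K. good K \<and> finsupp K g}) \<subseteq> R" by (rule cfun.span_minimal[OF _ sub])
  then show "u \<in> R" using C_span_finsupp[OF u(3,4)] u(1) by blast
qed

lemma states_subset_grst:
  assumes r: "resolvent_laurent G q x0 \<mu>\<^sub>0 N J C" and T: "resolvent_data G q (gverts L) x0 h N T \<mu>\<^sub>0 J C"
  shows "cfun.span (resolvent_data.states G q x0 N J C) \<subseteq> grst G q x0 \<mu>\<^sub>0"
proof -
  interpret resolvent_data G q "gverts L" x0 h N T \<mu>\<^sub>0 J C by (rule T)
  show ?thesis
    unfolding grst_def states_def using r by (intro cfun.span_mono) blast
qed

end

theorem theorem1p2:
  fixes G L :: "('v, 'e, 'g, 'h) gog"
    and q :: nat and F :: "'e set" and x0 :: 'v and \<mu>\<^sub>0 :: complex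
  assumes "q \<ge> 2"
    and "gf_decomposition G q F L"
    and "x0 \<in> gverts L"
    and "resonance G q x0 \<mu>\<^sub>0"
  shows "(\<mu>\<^sub>0 \<noteq> 1 \<and> \<mu>\<^sub>0 \<noteq> -1 \<longrightarrow>
           grst G q x0 \<mu>\<^sub>0 = {u. purely_outgoing G q L x0 \<mu>\<^sub>0 u \<and>
             (\<exists>J. (shifted_adjacency G q \<mu>\<^sub>0 ^^ J) u = (\<lambda>_. 0))}) \<and>
         (\<mu>\<^sub>0 = 1 \<or> \<mu>\<^sub>0 = -1 \<longrightarrow>
           grst G q x0 \<mu>\<^sub>0 = {u. purely_outgoing_constant_type G q L x0 \<mu>\<^sub>0 u \<and>
             shifted_adjacency G q \<mu>\<^sub>0 u = (\<lambda>_. 0)})"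
proof -
  obtain h where h: "rooted_ends G q (gverts L) x0 h" "\<forall>e\<in>F. ter G e \<notin> gverts L \<longrightarrow> e = h (ter G e)"
    "\<forall>v\<in>gverts G - gverts L. vsize G v = esize G (h v) \<longrightarrow>
       (\<exists>X\<in>pre_digraph.sccs_verts (ugraph (cut G F)). v \<in> X \<and> tree_gog (restrict_gog (cut G F) X))"
    using gf_decomposition_rooted[OF assms(1-3)] by blast
  have "decomposed G L q x0 h F"
  proof (intro decomposed.intro decomposed_axioms.intro)
    show "rooted_ends G q (gverts L) x0 h" by (rule h(1))
    show "F \<subseteq> garcs G" "\<And>e. e \<in> F \<Longrightarrow> opp G e \<in> F" "L \<in> pieces G F"
      using assms(2) by (auto simp: gf_decomposition_def)
  qed (use h in blast)+
  then interpret decomposed G L q x0 h F .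
  \<comment> \<open>A single expansion suffices for placing outgoing functions in
    \<open>grst\<close>; the resonance supplies one.\<close>
  obtain N J C where r: "resolvent_laurent G q x0 \<mu>\<^sub>0 N J C"
    using assms(4) unfolding resonance_def by blast
  obtain T where T: "resolvent_data G q (gverts L) x0 h N T \<mu>\<^sub>0 J C" using resolvent_dataI[OF r] .
  show ?thesis
    unfolding purely_outgoing_iff purely_outgoing_constant_type_iff
  proof (intro conjI impI subset_antisym)
    show "grst G q x0 \<mu>\<^sub>0 \<subseteq> {u. (\<exists>K. good K \<and> outg K \<mu>\<^sub>0 u) \<and> (\<exists>J. (shifted_adjacency G q \<mu>\<^sub>0 ^^ J) u = (\<lambda>_. 0))}"
    proof (rule grst_subset[OF subspace_outgoing])
      fix N T J C K f j
      assume "resolvent_data G q (gverts L) x0 h N T \<mu>\<^sub>0 J C" "good K" "resolvent_data.finsupp K f" "j \<in> {1..J}"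
      note c = resolvent_data.coefficient_outgoing[OF this]
      show "C j f \<in> {u. (\<exists>K. good K \<and> outg K \<mu>\<^sub>0 u) \<and> (\<exists>J. (shifted_adjacency G q \<mu>\<^sub>0 ^^ J) u = (\<lambda>_. 0))}"
        using c \<open>good K\<close> by (intro CollectI conjI exI[of _ K])
    qed
    assume pm: "\<mu>\<^sub>0 \<noteq> 1 \<and> \<mu>\<^sub>0 \<noteq> -1"
    show "{u. (\<exists>K. good K \<and> outg K \<mu>\<^sub>0 u) \<and> (\<exists>J. (shifted_adjacency G q \<mu>\<^sub>0 ^^ J) u = (\<lambda>_. 0))} \<subseteq> grst G q x0 \<mu>\<^sub>0"
    proof (intro subsetI)
      fix u assume "u \<in> {u. (\<exists>K. good K \<and> outg K \<mu>\<^sub>0 u) \<and> (\<exists>J. (shifted_adjacency G q \<mu>\<^sub>0 ^^ J) u = (\<lambda>_. 0))}"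
      then obtain K n where u: "good K" "outg K \<mu>\<^sub>0 u" "(shifted_adjacency G q \<mu>\<^sub>0 ^^ n) u = (\<lambda>_. 0)" by blast
      show "u \<in> grst G q x0 \<mu>\<^sub>0"
        by (rule subsetD[OF states_subset_grst[OF r T] resolvent_data.outgoing_in_span[OF T _ _ u]]) (use pm in blast)+
    qed
  next
    assume pm: "\<mu>\<^sub>0 = 1 \<or> \<mu>\<^sub>0 = -1"
    show "grst G q x0 \<mu>\<^sub>0 \<subseteq> {u. (\<exists>K. good K \<and> outg_const K \<mu>\<^sub>0 u) \<and> shifted_adjacency G q \<mu>\<^sub>0 u = (\<lambda>_. 0)}"
    proof (rule grst_subset[OF subspace_outgoing_const])
      fix N T J C K f j
      assume a: "resolvent_data G q (gverts L) x0 h N T \<mu>\<^sub>0 J C" "good K" "resolvent_data.finsupp K f" "j \<in> {1..J}"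
      note c = resolvent_data.coefficient_constant_type[OF a(1) pm a(2-4)]
      show "C j f \<in> {u. (\<exists>K. good K \<and> outg_const K \<mu>\<^sub>0 u) \<and> shifted_adjacency G q \<mu>\<^sub>0 u = (\<lambda>_. 0)}"
        using c a(2) by (intro CollectI conjI exI[of _ K])
    qed
    show "{u. (\<exists>K. good K \<and> outg_const K \<mu>\<^sub>0 u) \<and> shifted_adjacency G q \<mu>\<^sub>0 u = (\<lambda>_. 0)} \<subseteq> grst G q x0 \<mu>\<^sub>0"
    proof (intro subsetI)
      fix u assume "u \<in> {u. (\<exists>K. good K \<and> outg_const K \<mu>\<^sub>0 u) \<and> shifted_adjacency G q \<mu>\<^sub>0 u = (\<lambda>_. 0)}"
      then obtain K where u: "good K" "outg_const K \<mu>\<^sub>0 u" "shifted_adjacency G q \<mu>\<^sub>0 u = (\<lambda>_. 0)" by blast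
      show "u \<in> grst G q x0 \<mu>\<^sub>0"
        by (rule subsetD[OF states_subset_grst[OF r T] resolvent_data.eigen_const_in_span[OF T u]])
    qed
  qed
qed

end
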